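(* Let $X=(X^1,\dots,X^d)$, $d\in\{2,3\}$, be the Itô semimartingale described in the context, observed at times $i\Delta_n$, $i=0,\dots,n$, with $n\Delta_n=T$ fixed. Assume (Assumption 1) that for some constant $c_{\min}>0$ one has $\inf_{t\in[0,T]}\min(\sigma_t,\overline\sigma_t)\ge c_{\min}$, and that for some $s>1/2$ one has $\sup_{t\in(0,T]}t^{-s}\omega(b^j)_t<\infty$ for every $j=1,\dots,d$. (1) For $d=2$, $$\Delta_n^{-1/2}(\widehat\vartheta_{2,n}-\vartheta)\to\mathcal N\big(0,V_\vartheta(\sigma,\overline\sigma)\big)$$ in distribution as $n\to\infty$, where $\mathcal N(0,V_\vartheta(\sigma,\overline\sigma))$ is a random variable which, conditionally on $\mathcal F_T$, is centred Gaussian with variance $$V_\vartheta(\sigma,\overline\sigma)=\frac{1}{(T_2-T_1)^2}\,(e^{\vartheta T_2}-e^{\vartheta T_1})^2\,\frac{\int_0^Te^{2\vartheta t}\sigma_t^2\overline\sigma_t^2\,dt}{\big(\int_0^Te^{2\vartheta t}\sigma_t^2\,dt\big)^2}.$$ (2) For $d=3$, assume moreover that $b^j=0$ for $j=1,2,3$. Then $$\Delta_n^{-1}(\widehat\vartheta_{3,n}-\vartheta)\to\frac{\widetilde b_T+\int_0^T\overline b_t\,e^{\vartheta t}\sigma_t\,dB_t}{2(e^{-\vartheta T_2}-e^{-\vartheta T_1})\,D_3\int_0^Te^{2\vartheta t}\sigma_t^2\,dt}$$ in probability as $n\to\infty$, where $$\overline b_t=2(e^{-\vartheta T_2}-e^{-\vartheta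 T_1})(e^{-\vartheta T_3}-e^{-\vartheta T_2})\big((e^{-\vartheta T_2}-e^{-\vartheta T_1})(b^3_t-b^2_t)-(e^{-\vartheta T_3}-e^{-\vartheta T_2})(b^2_t-b^1_t)\big),$$ $$\widetilde b_T=(e^{-\vartheta T_2}-e^{-\vartheta T_1})^2\int_0^T(b^3_t-b^2_t)^2dt-(e^{-\vartheta T_3}-e^{-\vartheta T_2})^2\int_0^T(b^2_t-b^1_t)^2dt,$$ $$D_3=(e^{-\vartheta T_3}-e^{-\vartheta T_2})\big((e^{-\vartheta T_3}-e^{-\vartheta T_2})(T_2e^{-\vartheta T_2}-T_1e^{-\vartheta T_1})-(e^{-\vartheta T_2}-e^{-\vartheta T_1})(T_3e^{-\vartheta T_3}-T_2e^{-\vartheta T_2})\big).$$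
   Context: Model. On a filtered probability space $(\Omega,\mathcal F,(\mathcal F_t)_{t\ge0},\mathbb P)$, $X=(X_t)_{t\ge 0}$ is $d$-dimensional with components $$X^j_t=X^j_0+\int_0^tb^j_s\,ds+\int_0^te^{-\vartheta(T_j-s)}\sigma_s\,dB_s+\int_0^t\overline\sigma_s\,d\overline B_s,\qquad j=1,\dots,d,$$ where $X_0^j\in\mathbb R$, $B$ and $\overline B$ are independent Brownian motions, $\vartheta>0$ is unknown, $\sigma,\overline\sigma,b^j$ are càdlàg adapted processes, and $0<T\le T_1<\dots<T_d$ are known. One observes $X$ at times $0,\Delta_n,2\Delta_n,\dots,n\Delta_n=T$, with $T$ fixed and $n\to\infty$. Write $\Delta_i^nX^j=X^j_{i\Delta_n}-X^j_{(i-1)\Delta_n}$. Modulus of continuity. For a process $Y=(Y_t)_{0\le t\le T}$, $\omega(Y)_t=\sup_{|h|\le t}\big(\int_0^T\mathbb E[(Y_{s+h}-Y_s)^2]\,ds\big)^{1/2}$, the integral being restricted to those $s$ with $s+h\in[0,T]$. Estimator for $d=2$. Let $$\Psi^n_{T_1,T_2}=\frac{\sum_{i=1}^n(\Delta_i^nX^2-\Delta_i^nX^1)^2}{\sum_{i=1}^n\big((\Delta_i^nX^2)^2-(\Delta_i^nX^1)^2\big)},\qquad \psi_{T_1,T_2}(\vartheta)=\frac{(e^{-\vartheta T_2}-e^{-\vartheta T_1})^2}{e^{-2\vartheta T_2}-e^{-2\vartheta T_1}};$$ $\psi_{T_1,T_2}$ is a bijection from $(0,\infty)$ onto $(-1,0)$.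 Set $\widehat\vartheta_{2,n}=\psi_{T_1,T_2}^{-1}(\Psi^n_{T_1,T_2})$ if $\Psi^n_{T_1,T_2}\in(-1,0)$ and $\widehat\vartheta_{2,n}=0$ otherwise. Estimator for $d=3$. Let $$\Psi^n_{T_1,T_2,T_3}=\frac{\sum_{i=1}^n(\Delta_i^nX^3-\Delta_i^nX^2)^2}{\sum_{i=1}^n(\Delta_i^nX^2-\Delta_i^nX^1)^2},\qquad \psi_{T_1,T_2,T_3}(\vartheta)=\Big(\frac{e^{-\vartheta T_3}-e^{-\vartheta T_2}}{e^{-\vartheta T_2}-e^{-\vartheta T_1}}\Big)^2;$$ $\psi_{T_1,T_2,T_3}$ is a bijection from $(0,\infty)$ onto $\big(0,(\frac{T_3-T_2}{T_2-T_1})^2\big)$. Set $\widehat\vartheta_{3,n}=\psi_{T_1,T_2,T_3}^{-1}(\Psi^n_{T_1,T_2,T_3})$ if $\Psi^n_{T_1,T_2,T_3}$ lies in that interval and $\widehat\vartheta_{3,n}=0$ otherwise. The limit variable in (1) may be defined on an extension of the original probability space. *)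

theory Defs
  imports "HOL-Probability.Probability"
begin

text \<open>Processes are functions \<open>real \<Rightarrow> 'a \<Rightarrow> real\<close>, of which only the times \<open>t \<ge> 0\<close> matter.
  Filtrations are those of the library, here with index type \<open>real\<close>: a filtration
  \<open>(F t)\<close> indexed by \<open>t \<ge> 0\<close> is extended by \<open>F t = F 0\<close> for \<open>t < 0\<close>.\<close>

definition filtered_prob_space :: "'a measure \<Rightarrow> (real \<Rightarrow> 'a measure) \<Rightarrow> bool" where
  "filtered_prob_space M F \<longleftrightarrow>
     prob_space M \<and> filtration (space M) F \<and> (\<forall>t. subalgebra M (F t))"

definition adapted_process :: "(real \<Rightarrow> 'a measure) \<Rightarrow> (real \<Rightarrow> 'a \<Rightarrow> real) \<Rightarrow> bool" where
  "adapted_process F Y \<longleftrightarrow> (\<forall>t\<ge>0. Y t \<in> borel_measurable (F t))"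

definition cadlag :: "(real \<Rightarrow> real) \<Rightarrow> bool" where
  "cadlag f \<longleftrightarrow> (\<forall>t\<ge>0. continuous (at_right t) f) \<and> (\<forall>t>0. \<exists>l. (f \<longlongrightarrow> l) (at_left t))"

definition cadlag_adapted ::
  "'a measure \<Rightarrow> (real \<Rightarrow> 'a measure) \<Rightarrow> (real \<Rightarrow> 'a \<Rightarrow> real) \<Rightarrow> bool" where
  "cadlag_adapted M F Y \<longleftrightarrow> adapted_process F Y \<and> (\<forall>\<omega>\<in>space M. cadlag (\<lambda>t. Y t \<omega>))"

definition progressively_measurable ::
  "(real \<Rightarrow> 'a measure) \<Rightarrow> (real \<Rightarrow> 'a \<Rightarrow> real) \<Rightarrow> bool" where
  "progressively_measurable F Y \<longleftrightarrow>
     (\<forall>t\<ge>0. (\<lambda>(s, \<omega>). Y s \<omega>) \<in> borel_measurable (restrict_space borel {0..t} \<Otimes>\<^sub>M F t))"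

definition tendsto_in_prob ::
  "'a measure \<Rightarrow> (nat \<Rightarrow> 'a \<Rightarrow> real) \<Rightarrow> ('a \<Rightarrow> real) \<Rightarrow> bool" where
  "tendsto_in_prob M Y Z \<longleftrightarrow>
     (\<forall>n. Y n \<in> borel_measurable M) \<and> Z \<in> borel_measurable M \<and>
     (\<forall>\<epsilon>>0. (\<lambda>n. measure M {\<omega> \<in> space M. \<bar>Y n \<omega> - Z \<omega>\<bar> > \<epsilon>}) \<longlonglongrightarrow> 0)"

definition brownian_motion ::
  "'a measure \<Rightarrow> (real \<Rightarrow> 'a measure) \<Rightarrow> (real \<Rightarrow> 'a \<Rightarrow> real) \<Rightarrow> bool" where
  "brownian_motion M F B \<longleftrightarrow>
     adapted_process F B \<and>
     (AE \<omega> in M. B 0 \<omega> = 0) \<and>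
     (AE \<omega> in M. continuous_on {0..} (\<lambda>t. B t \<omega>)) \<and>
     (\<forall>s t. 0 \<le> s \<and> s < t \<longrightarrow>
        distributed M lborel (\<lambda>\<omega>. B t \<omega> - B s \<omega>) (normal_density 0 (sqrt (t - s))) \<and>
        prob_space.indep_set M
          (sets (vimage_algebra (space M) (\<lambda>\<omega>. B t \<omega> - B s \<omega>) borel)) (sets (F s)))"

definition independent_processes ::
  "'a measure \<Rightarrow> (real \<Rightarrow> 'a \<Rightarrow> real) \<Rightarrow> (real \<Rightarrow> 'a \<Rightarrow> real) \<Rightarrow> bool" where
  "independent_processes M Y Z \<longleftrightarrow>
     prob_space.indep_var M
       (Pi\<^sub>M {0..} (\<lambda>_. borel)) (\<lambda>\<omega>. \<lambda>t\<in>{0..}. Y t \<omega>)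
       (Pi\<^sub>M {0..} (\<lambda>_. borel)) (\<lambda>\<omega>. \<lambda>t\<in>{0..}. Z t \<omega>)"

text \<open>The data \<open>m, \<tau>, \<xi>\<close> encode the simple process
  \<open>\<Sum>i<m. \<xi>\<^sub>i 1_(\<tau>\<^sub>i, \<tau>\<^sub>i\<^sub>+\<^sub>1]\<close>.\<close>

definition simple_process_data ::
  "'a measure \<Rightarrow> (real \<Rightarrow> 'a measure) \<Rightarrow> nat \<Rightarrow> (nat \<Rightarrow> real) \<Rightarrow> (nat \<Rightarrow> 'a \<Rightarrow> real) \<Rightarrow> bool" where
  "simple_process_data M F m \<tau> \<xi> \<longleftrightarrow>
     0 \<le> \<tau> 0 \<and> (\<forall>i<m. \<tau> i \<le> \<tau> (Suc i)) \<and>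
     (\<forall>i<m. \<xi> i \<in> borel_measurable (F (\<tau> i)) \<and> (\<exists>C. \<forall>\<omega>\<in>space M. \<bar>\<xi> i \<omega>\<bar> \<le> C))"

definition simple_process_val ::
  "nat \<Rightarrow> (nat \<Rightarrow> real) \<Rightarrow> (nat \<Rightarrow> 'a \<Rightarrow> real) \<Rightarrow> real \<Rightarrow> 'a \<Rightarrow> real" where
  "simple_process_val m \<tau> \<xi> s \<omega> = (\<Sum>i<m. \<xi> i \<omega> * indicator {\<tau> i<..\<tau> (Suc i)} s)"

definition simple_integral_process ::
  "nat \<Rightarrow> (nat \<Rightarrow> real) \<Rightarrow> (nat \<Rightarrow> 'a \<Rightarrow> real) \<Rightarrow> (real \<Rightarrow> 'a \<Rightarrow> real) \<Rightarrow> real \<Rightarrow> 'a \<Rightarrow> real" where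
  "simple_integral_process m \<tau> \<xi> B t \<omega> =
     (\<Sum>i<m. \<xi> i \<omega> * (B (min t (\<tau> (Suc i))) \<omega> - B (min t (\<tau> i)) \<omega>))"

text \<open>\<open>has_ito_integral M F B H I\<close>: the process \<open>I\<close> is a version with continuous paths of
  \<open>\<integral>\<^sub>0\<^sup>t H\<^sub>s dB\<^sub>s\<close>, \<open>t \<ge> 0\<close>. The integral is the limit in probability of the integrals of simple
  processes approximating \<open>H\<close> in \<open>L\<^sup>2([0,t])\<close> in probability, for every \<open>t\<close>. Adaptedness of \<open>I\<close>
  is not demanded because the filtration need not contain the null sets.\<close>

definition has_ito_integral ::
  "'a measure \<Rightarrow> (real \<Rightarrow> 'a measure) \<Rightarrow> (real \<Rightarrow> 'a \<Rightarrow> real) \<Rightarrow> (real \<Rightarrow> 'a \<Rightarrow> real) \<Rightarrow>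
   (real \<Rightarrow> 'a \<Rightarrow> real) \<Rightarrow> bool" where
  "has_ito_integral M F B H I \<longleftrightarrow>
     progressively_measurable F H \<and>
     (AE \<omega> in M. \<forall>t\<ge>0. (\<integral>\<^sup>+ s\<in>{0..t}. ennreal ((H s \<omega>)\<^sup>2) \<partial>lborel) < \<top>) \<and>
     (AE \<omega> in M. continuous_on {0..} (\<lambda>t. I t \<omega>)) \<and>
     (\<exists>m \<tau> \<xi>.
        (\<forall>k. simple_process_data M F (m k) (\<tau> k) (\<xi> k)) \<and>
        (\<forall>t\<ge>0. \<forall>\<epsilon>>0. (\<lambda>k::nat. measure M {\<omega> \<in> space M.
            (\<integral>\<^sup>+ s\<in>{0..t}. ennreal ((simple_process_val (m k) (\<tau> k) (\<xi> k) s \<omega> - H s \<omega>)\<^sup>2) \<partial>lborel)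
              > ennreal \<epsilon>}) \<longlonglongrightarrow> 0) \<and>
        (\<forall>t\<ge>0. tendsto_in_prob M (\<lambda>k. simple_integral_process (m k) (\<tau> k) (\<xi> k) B t) (I t)))"

definition ennsqrt :: "ennreal \<Rightarrow> ennreal" where
  "ennsqrt x = (if x = \<top> then \<top> else ennreal (sqrt (enn2real x)))"

definition mod_cont :: "'a measure \<Rightarrow> real \<Rightarrow> (real \<Rightarrow> 'a \<Rightarrow> real) \<Rightarrow> real \<Rightarrow> ennreal" where
  "mod_cont M T Y t =
     (SUP h\<in>{-t..t}. ennsqrt (\<integral>\<^sup>+ s\<in>{s. s \<in> {0..T} \<and> s + h \<in> {0..T}}.
        (\<integral>\<^sup>+ \<omega>. ennreal ((Y (s + h) \<omega> - Y s \<omega>)\<^sup>2) \<partial>M) \<partial>lborel))"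

text \<open>In the estimators below, \<open>Tm j\<close> is the \<open>j\<close>-th maturity. When a denominator vanishes, division by zero gives \<open>\<Psi> = 0\<close>, hence the value 0 of the estimator.\<close>

definition mesh :: "real \<Rightarrow> nat \<Rightarrow> real" where
  "mesh T n = T / real n"

definition incr ::
  "(nat \<Rightarrow> real \<Rightarrow> 'a \<Rightarrow> real) \<Rightarrow> real \<Rightarrow> nat \<Rightarrow> nat \<Rightarrow> nat \<Rightarrow> 'a \<Rightarrow> real" where
  "incr X T n i j \<omega> = X j (real i * mesh T n) \<omega> - X j ((real i - 1) * mesh T n) \<omega>"

definition \<Psi>2 :: "(nat \<Rightarrow> real \<Rightarrow> 'a \<Rightarrow> real) \<Rightarrow> real \<Rightarrow> nat \<Rightarrow> 'a \<Rightarrow> real" where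
  "\<Psi>2 X T n \<omega> =
     (\<Sum>i=1..n. (incr X T n i 2 \<omega> - incr X T n i 1 \<omega>)\<^sup>2) /
     (\<Sum>i=1..n. (incr X T n i 2 \<omega>)\<^sup>2 - (incr X T n i 1 \<omega>)\<^sup>2)"

definition \<psi>2 :: "(nat \<Rightarrow> real) \<Rightarrow> real \<Rightarrow> real" where
  "\<psi>2 Tm \<theta> = (exp (- \<theta> * Tm 2) - exp (- \<theta> * Tm 1))\<^sup>2 /
               (exp (- 2 * \<theta> * Tm 2) - exp (- 2 * \<theta> * Tm 1))"

definition estimator2 ::
  "(nat \<Rightarrow> real) \<Rightarrow> (nat \<Rightarrow> real \<Rightarrow> 'a \<Rightarrow> real) \<Rightarrow> real \<Rightarrow> nat \<Rightarrow> 'a \<Rightarrow> real" where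
  "estimator2 Tm X T n \<omega> =
     (if \<Psi>2 X T n \<omega> \<in> {-1<..<0} then inv_into {0<..} (\<psi>2 Tm) (\<Psi>2 X T n \<omega>) else 0)"

definition \<Psi>3 :: "(nat \<Rightarrow> real \<Rightarrow> 'a \<Rightarrow> real) \<Rightarrow> real \<Rightarrow> nat \<Rightarrow> 'a \<Rightarrow> real" where
  "\<Psi>3 X T n \<omega> =
     (\<Sum>i=1..n. (incr X T n i 3 \<omega> - incr X T n i 2 \<omega>)\<^sup>2) /
     (\<Sum>i=1..n. (incr X T n i 2 \<omega> - incr X T n i 1 \<omega>)\<^sup>2)"

definition \<psi>3 :: "(nat \<Rightarrow> real) \<Rightarrow> real \<Rightarrow> real" where
  "\<psi>3 Tm \<theta> = ((exp (- \<theta> * Tm 3) - exp (- \<theta> * Tm 2)) /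
                (exp (- \<theta> * Tm 2) - exp (- \<theta> * Tm 1)))\<^sup>2"

definition estimator3 ::
  "(nat \<Rightarrow> real) \<Rightarrow> (nat \<Rightarrow> real \<Rightarrow> 'a \<Rightarrow> real) \<Rightarrow> real \<Rightarrow> nat \<Rightarrow> 'a \<Rightarrow> real" where
  "estimator3 Tm X T n \<omega> =
     (if \<Psi>3 X T n \<omega> \<in> {0<..<((Tm 3 - Tm 2) / (Tm 2 - Tm 1))\<^sup>2}
      then inv_into {0<..} (\<psi>3 Tm) (\<Psi>3 X T n \<omega>) else 0)"

definition limit_variance ::
  "real \<Rightarrow> (nat \<Rightarrow> real) \<Rightarrow> real \<Rightarrow> (real \<Rightarrow> 'a \<Rightarrow> real) \<Rightarrow> (real \<Rightarrow> 'a \<Rightarrow> real) \<Rightarrow> 'a \<Rightarrow> real" where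
  "limit_variance \<theta> Tm T \<sigma> \<sigma>' \<omega> =
     1 / (Tm 2 - Tm 1)\<^sup>2 * (exp (\<theta> * Tm 2) - exp (\<theta> * Tm 1))\<^sup>2 *
     ((LINT t:{0..T}|lborel. exp (2 * \<theta> * t) * (\<sigma> t \<omega>)\<^sup>2 * (\<sigma>' t \<omega>)\<^sup>2) /
      (LINT t:{0..T}|lborel. exp (2 * \<theta> * t) * (\<sigma> t \<omega>)\<^sup>2)\<^sup>2)"

definition b_bar ::
  "real \<Rightarrow> (nat \<Rightarrow> real) \<Rightarrow> (nat \<Rightarrow> real \<Rightarrow> 'a \<Rightarrow> real) \<Rightarrow> real \<Rightarrow> 'a \<Rightarrow> real" where
  "b_bar \<theta> Tm b t \<omega> =
     2 * (exp (- \<theta> * Tm 2) - exp (- \<theta> * Tm 1)) * (exp (- \<theta> * Tm 3) - exp (- \<theta> * Tm 2)) *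
     ((exp (- \<theta> * Tm 2) - exp (- \<theta> * Tm 1)) * (b 3 t \<omega> - b 2 t \<omega>) -
      (exp (- \<theta> * Tm 3) - exp (- \<theta> * Tm 2)) * (b 2 t \<omega> - b 1 t \<omega>))"

definition b_tilde ::
  "real \<Rightarrow> (nat \<Rightarrow> real) \<Rightarrow> (nat \<Rightarrow> real \<Rightarrow> 'a \<Rightarrow> real) \<Rightarrow> real \<Rightarrow> 'a \<Rightarrow> real" where
  "b_tilde \<theta> Tm b T \<omega> =
     (exp (- \<theta> * Tm 2) - exp (- \<theta> * Tm 1))\<^sup>2 * (LINT t:{0..T}|lborel. (b 3 t \<omega> - b 2 t \<omega>)\<^sup>2) -
     (exp (- \<theta> * Tm 3) - exp (- \<theta> * Tm 2))\<^sup>2 * (LINT t:{0..T}|lborel. (b 2 t \<omega> - b 1 t \<omega>)\<^sup>2)"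

definition D3 :: "real \<Rightarrow> (nat \<Rightarrow> real) \<Rightarrow> real" where
  "D3 \<theta> Tm =
     (exp (- \<theta> * Tm 3) - exp (- \<theta> * Tm 2)) *
     ((exp (- \<theta> * Tm 3) - exp (- \<theta> * Tm 2)) * (Tm 2 * exp (- \<theta> * Tm 2) - Tm 1 * exp (- \<theta> * Tm 1)) -
      (exp (- \<theta> * Tm 2) - exp (- \<theta> * Tm 1)) * (Tm 3 * exp (- \<theta> * Tm 3) - Tm 2 * exp (- \<theta> * Tm 2)))"

definition prob_extension :: "'a measure \<Rightarrow> 'b measure \<Rightarrow> ('b \<Rightarrow> 'a) \<Rightarrow> bool" where
  "prob_extension M N \<pi> \<longleftrightarrow> prob_space N \<and> \<pi> \<in> measurable N M \<and> distr N M \<pi> = M"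

text \<open>Written as an image measure so that \<open>v = 0\<close> gives the Dirac measure at 0.\<close>

definition centred_gaussian :: "real \<Rightarrow> real measure" where
  "centred_gaussian v = distr std_normal_distribution borel (\<lambda>x. sqrt v * x)"

text \<open>On the extension \<open>N\<close> of the original space, with projection \<open>\<pi>\<close>, the conditional law of
  \<open>Z\<close> given (the copy on \<open>N\<close> of) the sub-\<open>\<sigma>\<close>-algebra \<open>G\<close> is \<open>\<N>(0, V)\<close>.\<close>

definition conditionally_gaussian ::
  "'b measure \<Rightarrow> ('b \<Rightarrow> 'a) \<Rightarrow> 'a measure \<Rightarrow> ('a \<Rightarrow> real) \<Rightarrow> ('b \<Rightarrow> real) \<Rightarrow> bool" where
  "conditionally_gaussian N \<pi> G V Z \<longleftrightarrow>
     Z \<in> borel_measurable N \<and>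
     (\<forall>C\<in>sets borel. AE x in N.
        real_cond_exp N (vimage_algebra (space N) \<pi> G) (\<lambda>y. indicator C (Z y)) x =
        measure (centred_gaussian (V (\<pi> x))) C)"

definition tendsto_in_distribution ::
  "'a measure \<Rightarrow> (nat \<Rightarrow> 'a \<Rightarrow> real) \<Rightarrow> 'b measure \<Rightarrow> ('b \<Rightarrow> real) \<Rightarrow> bool" where
  "tendsto_in_distribution M Y N Z \<longleftrightarrow>
     (\<forall>n. Y n \<in> borel_measurable M) \<and> Z \<in> borel_measurable N \<and>
     weak_conv_m (\<lambda>n. distr M borel (Y n)) (distr N borel Z)"

end

theory Submission
 imports Defs
begin

text \<open>With \<open>M\<^sub>t = \<integral> exp(\<theta>u) \<sigma>\<^sub>u dB\<^sub>u\<close> and \<open>J\<close> the integral against \<open>B'\<close>, the martingale part of \<open>X\<^sup>j\<close> is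
 \<open>exp(-\<theta>T\<^sub>j) M + J\<close>. Hence \<open>\<Psi>\<^sub>2 - \<psi>\<^sub>2(\<theta>)\<close> is, up to terms of smaller order, a constant times \<open>\<Sum> \<Delta>M \<Delta>J\<close> over
 the quadratic variation of \<open>M\<close>; on coarse blocks the drift is nearly constant and the increments
 of \<open>M\<close> telescope, so the drift is negligible. For \<open>\<Sum> \<Delta>M \<Delta>J\<close> the integrands are frozen on a coarse grid. With
 deterministic weights the sum of \<open>\<Delta>B \<Delta>B'\<close> is Gaussian given \<open>B\<close>, with nearly constant variance, and sums over
 a fine and a fixed grid are nearly independent; by Renyi's argument the convergence is mixing, so
 the frozen weights may be random. The delta method and Levy's theorem conclude.\<close>

text \<open>Bounded by Cauchy-Schwarz, the products of increments of M with drift increments sum up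
  to the order of the square root of the mesh, exactly the order of the fluctuations; hence
  telescoping on blocks instead of a size estimate. The limiting variance is random, so convergence
  in law for deterministic weights does not carry over; the limit is proved against every bounded
  random factor. An Ito integral is accessible as a limit in probability of Riemann sums. The
  estimates are therefore moment bounds on a grid refined by a factor \<open>r\<close>, uniform in
  \<open>r\<close>, and they reach the integrals as bounds on tail probabilities. In these moment
  bounds the integrands are localised by clipping at \<open>K\<close>, not by stopping: on
  \<open>good K\<close>, whose probability is near 1, clipping is invisible at all grid points. That
  \<open>B\<close> and \<open>B'\<close> are Brownian motions of one filtration and independent as
  processes does not say at once that their increments are uncorrelated given the past. This is
  established separately, and it is the only joint conditional moment in the bounds.\<close>

section \<open>Sums of predictable weights against Gaussian increments\<close>

lemma (in prob_space) integrable_mult_sq: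
 fixes f g :: "'a => real"
 assumes [measurable]: "f \<in> borel_measurable M" "g \<in> borel_measurable M"
  and "integrable M (%w. (f w)^2)" "integrable M (%w. (g w)^2)"
 shows "integrable M (%w. f w * g w)"
proof (rule Bochner_Integration.integrable_bound)
 show "integrable M (%w. (f w)^2 + (g w)^2)" using assms by auto
 show "AE x in M. norm (f x * g x) <= norm ((f x)^2 + (g x)^2)"
 proof (rule AE_I2)
  fix x
  have "2 * \<bar>f x\<bar> * \<bar>g x\<bar> <= \<bar>f x\<bar>\<^sup>2 + \<bar>g x\<bar>\<^sup>2" by (rule sum_squares_bound)
  moreover have "0 <= \<bar>f x\<bar> * \<bar>g x\<bar>" by simp
  ultimately have "\<bar>f x\<bar> * \<bar>g x\<bar> <= \<bar>f x\<bar>\<^sup>2 + \<bar>g x\<bar>\<^sup>2" by linarith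
  then show "norm (f x * g x) <= norm ((f x)^2 + (g x)^2)" by (simp add: abs_mult)
 qed
qed auto

lemma (in prob_space) integrable_lower_power:
 fixes f :: "'a => real"
 assumes [measurable]: "f \<in> borel_measurable M"
  and i: "integrable M (%w. (f w) ^ 4)" and k: "k <= 4"
 shows "integrable M (%w. (f w) ^ k)"
proof (rule Bochner_Integration.integrable_bound)
 show "integrable M (%w. 1 + (f w) ^ 4)" using i by auto
 show "AE x in M. norm (f x ^ k) <= norm (1 + f x ^ 4)"
 proof (rule AE_I2)
  fix x
  have "\<bar>f x\<bar> ^ k <= 1 + \<bar>f x\<bar> ^ 4"
  proof (cases "\<bar>f x\<bar> <= 1")
   case True
   then have "\<bar>f x\<bar> ^ k <= 1" by (simp add: power_le_one)
   then show ?thesis by (simp add: add_increasing2)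
  next
   case False
   then show ?thesis using power_increasing[OF k, of "\<bar>f x\<bar>"] by simp
  qed
  then show "norm (f x ^ k) <= norm (1 + f x ^ 4)" by (simp add: power_abs)
 qed
qed auto

text \<open>Conditional moments given the past are expressed through test functions
  \<open>g\<close>, so no conditional expectation occurs. \<open>g\<close> is integrable but not
  bounded, because in the inductions below it contains the sum built so far. The values 0, \<delta>,
  0 and 3 \<delta>^2 are the moments of a centred normal law.\<close>

locale gauss_steps = prob_space M for M :: "'a measure" +
 fixes G :: "nat => 'a measure" and d :: "nat => 'a => real" and \<delta> :: "nat => real"
 assumes sub: "subalgebra M (G j)"
  and G_mono: "i <= j ==> sets (G i) \<subseteq> sets (G j)"
  and d_meas: "d j \<in> borel_measurable (G (Suc j))"
  and \<delta>_pos: "0 < \<delta> j"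
  and d_int: "g \<in> borel_measurable (G j) ==> integrable M g ==> k <= 4 ==>
    integrable M (%w. g w * d j w ^ k)"
  and m1: "g \<in> borel_measurable (G j) ==> integrable M g ==> expectation (%w. g w * d j w) = 0"
  and m2: "g \<in> borel_measurable (G j) ==> integrable M g ==>
    expectation (%w. g w * d j w ^ 2) = \<delta> j * expectation g"
  and m3: "g \<in> borel_measurable (G j) ==> integrable M g ==> expectation (%w. g w * d j w ^ 3) = 0"
  and m4: "g \<in> borel_measurable (G j) ==> integrable M g ==>
    expectation (%w. g w * d j w ^ 4) = 3 * (\<delta> j)^2 * expectation g"
begin

lemma meas_M: "f \<in> borel_measurable (G j) ==> f \<in> borel_measurable M"
 by (rule measurable_from_subalg[OF sub])

lemma meas_up: "f \<in> borel_measurable (G i) ==> i <= j ==> f \<in> borel_measurable (G j)"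
proof -
 assume f: "f \<in> borel_measurable (G i)" and "i <= j"
 then have "subalgebra (G j) (G i)"
  using G_mono[of i j] sub[of i] sub[of j] by (simp add: subalgebra_def)
 then show ?thesis using f by (rule measurable_from_subalg)
qed

lemma sum_meas:
 assumes "!!j. j < L ==> a j \<in> borel_measurable (G j)"
 shows "(%w. \<Sum>j<L. a j w * d j w) \<in> borel_measurable (G L)"
proof (intro borel_measurable_sum borel_measurable_times)
 fix j assume "j \<in> {..<L}"
 then have j: "j < L" by simp
 show "a j \<in> borel_measurable (G L)" by (rule meas_up[OF assms[OF j]]) (use j in simp)
 show "d j \<in> borel_measurable (G L)" by (rule meas_up[OF d_meas]) (use j in simp)
qed

lemma int_sq:
 assumes a: "a \<in> borel_measurable (G j)" "integrable M (%w. (a w)^2)"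
 shows "integrable M (%w. (a w * d j w)^2)"
  and "expectation (%w. (a w * d j w)^2) = \<delta> j * expectation (%w. (a w)^2)"
proof -
 have m: "(%w. (a w)^2) \<in> borel_measurable (G j)" using a by measurable
 show "integrable M (%w. (a w * d j w)^2)"
  using d_int[OF m a(2), of 2] by (simp add: power_mult_distrib)
 show "expectation (%w. (a w * d j w)^2) = \<delta> j * expectation (%w. (a w)^2)"
  using m2[OF m a(2)] by (simp add: power_mult_distrib)
qed

text \<open>Discrete Ito isometry. In the induction the mixed term vanishes by \<open>m1\<close>,
  with the earlier sum times \<open>a L\<close> as test function.\<close>

lemma isometry:
 assumes "!!j. j < L ==> a j \<in> borel_measurable (G j)"
  and "!!j. j < L ==> integrable M (%w. (a j w)^2)"
 shows "integrable M (%w. (\<Sum>j<L. a j w * d j w)^2) \<and>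
  expectation (%w. (\<Sum>j<L. a j w * d j w)^2) = (\<Sum>j<L. \<delta> j * expectation (%w. (a j w)^2))"
 using assms
proof (induction L)
 case 0
 then show ?case by simp
next
 case (Suc L)
 let ?S = "%w. \<Sum>j<L. a j w * d j w"
 have IH: "integrable M (%w. (?S w)^2)"
  "expectation (%w. (?S w)^2) = (\<Sum>j<L. \<delta> j * expectation (%w. (a j w)^2))"
  using Suc by auto
 have S: "?S \<in> borel_measurable (G L)" using Suc by (intro sum_meas) auto
 have aL: "a L \<in> borel_measurable (G L)" "integrable M (%w. (a L w)^2)" using Suc by auto
 have g: "integrable M (%w. ?S w * a L w)"
  using IH aL meas_M[OF S] meas_M[OF aL(1)] by (intro integrable_mult_sq) auto
 have gm: "(%w. ?S w * a L w) \<in> borel_measurable (G L)" using S aL by measurable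
 have c: "integrable M (%w. ?S w * a L w * d L w)" using d_int[OF gm g, of 1] by simp
 have eq: "(\<Sum>j<Suc L. a j w * d j w)^2 = (?S w)^2 + 2 * (?S w * a L w * d L w) + (a L w * d L w)^2" for w
  by (simp add: power2_sum algebra_simps)
 show ?case unfolding eq
  using IH c m1[OF gm g] int_sq[OF aL] by simp
qed

text \<open>In the expansion of the fourth power the odd powers of \<open>d L\<close> have mean zero
  by \<open>m1\<close> and \<open>m3\<close>. The surviving terms, with the second moment of the
  earlier sum bounded by \<open>s\<close>, complete the square
  \<open>3 * (s + \<kappa>^2 * \<delta>)^2\<close>; the 3 is the Gaussian fourth moment.\<close>

lemma fourth_moment:
 assumes "!!j. j < L ==> a j \<in> borel_measurable (G j)"
  and "!!j w. j < L ==> w \<in> space M ==> \<bar>a j w\<bar> <= \<kappa> j"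
 shows "integrable M (%w. (\<Sum>j<L. a j w * d j w) ^ 4) \<and>
  expectation (%w. (\<Sum>j<L. a j w * d j w) ^ 4) <= 3 * (\<Sum>j<L. (\<kappa> j)^2 * \<delta> j)^2"
 using assms
proof (induction L)
 case 0
 then show ?case by simp
next
 case (Suc L)
 let ?S = "%w. \<Sum>j<L. a j w * d j w"
 let ?s = "\<Sum>j<L. (\<kappa> j)^2 * \<delta> j"
 have IH: "integrable M (%w. (?S w) ^ 4)" "expectation (%w. (?S w) ^ 4) <= 3 * ?s\<^sup>2"
  using Suc by auto
 have S: "?S \<in> borel_measurable (G L)" using Suc by (intro sum_meas) auto
 have aL: "a L \<in> borel_measurable (G L)" using Suc by auto
 have ab: "\<bar>a j w\<bar> ^ k <= \<kappa> j ^ k" if "j < Suc L" "w \<in> space M" for w k j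
  using Suc(3)[of j w] that by (intro power_mono) auto
 have [measurable]: "?S \<in> borel_measurable M" "a L \<in> borel_measurable M"
  using meas_M[OF S] meas_M[OF aL] by auto
 have gi: "integrable M (%w. ?S w ^ i * a L w ^ k)" if "i <= 4" for i k
 proof (rule Bochner_Integration.integrable_bound)
  show "integrable M (%w. \<kappa> L ^ k * ?S w ^ i)"
   using integrable_lower_power[OF _ IH(1), of i] that by auto
  show "AE x in M. norm (?S x ^ i * a L x ^ k) <= norm (\<kappa> L ^ k * ?S x ^ i)"
  proof (rule AE_I2)
   fix x assume "x \<in> space M"
   then have "\<bar>a L x\<bar> ^ k <= \<bar>\<kappa> L ^ k\<bar>" using ab[of L x k] by simp
   then show "norm (?S x ^ i * a L x ^ k) <= norm (\<kappa> L ^ k * ?S x ^ i)"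
    using mult_right_mono[OF \<open>\<bar>a L x\<bar> ^ k <= \<bar>\<kappa> L ^ k\<bar>\<close>, of "\<bar>?S x\<bar> ^ i"]
    by (simp add: abs_mult power_abs mult.commute)
  qed
 qed auto
 have gm: "(%w. ?S w ^ i * a L w ^ k) \<in> borel_measurable (G L)" for i k using S aL by measurable
 have a_int: "integrable M (%w. (a j w)^2)" if "j < Suc L" for j
 proof (rule integrable_const_bound[where B="(\<kappa> j)^2"])
  show "AE x in M. norm ((a j x)^2) <= (\<kappa> j)^2" using ab[of j _ 2] that by auto
  show "(%x. (a j x)^2) \<in> borel_measurable M" using meas_M[OF Suc(2)[OF that]] by measurable
 qed
 have a2: "expectation (%w. (a j w)^2) <= (\<kappa> j)^2" if "j < Suc L" for j
  using integral_mono[OF a_int[OF that], of "%_. (\<kappa> j)^2"] ab[of j _ 2] that by (auto simp: prob_space)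
 have S2: "expectation (%w. (?S w)^2) <= ?s"
 proof -
  have "expectation (%w. (?S w)^2) = (\<Sum>j<L. \<delta> j * expectation (%w. (a j w)^2))"
   using isometry[of L a] Suc(2) a_int by auto
  also have "... <= ?s"
   using a2 \<delta>_pos by (intro sum_mono) (auto simp: mult.commute less_imp_le intro: mult_left_mono)
  finally show ?thesis .
 qed
 have e22: "expectation (%w. ?S w ^ 2 * a L w ^ 2) <= (\<kappa> L)^2 * ?s"
 proof -
  have "expectation (%w. ?S w ^ 2 * a L w ^ 2) <= expectation (%w. (\<kappa> L)^2 * ?S w ^ 2)"
   using gi[of 2 2] gi[of 2 0] ab[of L _ 2]
   by (intro integral_mono) (auto simp: mult.commute intro: mult_right_mono)
  also have "... = (\<kappa> L)^2 * expectation (%w. ?S w ^ 2)" by simp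
  also have "... <= (\<kappa> L)^2 * ?s" using S2 by (intro mult_left_mono) auto
  finally show ?thesis .
 qed
 have e04: "expectation (%w. a L w ^ 4) <= (\<kappa> L)^4"
 proof -
  have "expectation (%w. a L w ^ 4) <= expectation (%w. (\<kappa> L)^4)"
   using gi[of 0 4] ab[of L _ 4] by (intro integral_mono) auto
  then show ?thesis by (simp add: prob_space)
 qed
 have gen: "(s + x * y) ^ 4 = s ^ 4 + (4 * (s ^ 3 * x ^ 1 * y ^ 1) + (6 * (s ^ 2 * x ^ 2 * y ^ 2)
  + (4 * (s ^ 1 * x ^ 3 * y ^ 3) + s ^ 0 * x ^ 4 * y ^ 4)))" for s x y :: real
  by (simp add: power4_eq_xxxx power3_eq_cube power2_eq_square algebra_simps)
 have eq: "(\<Sum>j<Suc L. a j w * d j w) ^ 4 = ?S w ^ 4 + (4 * (?S w ^ 3 * a L w ^ 1 * d L w ^ 1)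
  + (6 * (?S w ^ 2 * a L w ^ 2 * d L w ^ 2)
  + (4 * (?S w ^ 1 * a L w ^ 3 * d L w ^ 3) + ?S w ^ 0 * a L w ^ 4 * d L w ^ 4)))" for w
  unfolding sum.lessThan_Suc by (rule gen)
 have i: "integrable M (%w. ?S w ^ 3 * a L w ^ 1 * d L w ^ 1)"
  "integrable M (%w. ?S w ^ 2 * a L w ^ 2 * d L w ^ 2)"
  "integrable M (%w. ?S w ^ 1 * a L w ^ 3 * d L w ^ 3)"
  "integrable M (%w. ?S w ^ 0 * a L w ^ 4 * d L w ^ 4)"
  using d_int[OF gm[of 3 1] gi, of 1] d_int[OF gm[of 2 2] gi, of 2] d_int[OF gm[of 1 3] gi, of 3]
   d_int[OF gm[of 0 4] gi, of 4] by simp_all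
 have e1: "expectation (%w. ?S w ^ 3 * a L w ^ 1 * d L w ^ 1) = 0"
  using m1[OF gm[of 3 1] gi] by simp
 have e3: "expectation (%w. ?S w ^ 1 * a L w ^ 3 * d L w ^ 3) = 0"
  using m3[OF gm[of 1 3] gi] by simp
 have e2: "expectation (%w. ?S w ^ 2 * a L w ^ 2 * d L w ^ 2) <= \<delta> L * ((\<kappa> L)^2 * ?s)"
  using m2[OF gm[of 2 2] gi] e22 \<delta>_pos[of L] by (simp add: mult_left_mono)
 have e4: "expectation (%w. ?S w ^ 0 * a L w ^ 4 * d L w ^ 4) <= 3 * (\<delta> L)^2 * (\<kappa> L)^4"
  using m4[OF gm[of 0 4] gi] e04 \<delta>_pos[of L] by (simp add: mult_left_mono)
 have "integrable M (%w. (\<Sum>j<Suc L. a j w * d j w) ^ 4)"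
  unfolding eq by (intro Bochner_Integration.integrable_add integrable_mult_right IH i)
 moreover have "expectation (%w. (\<Sum>j<Suc L. a j w * d j w) ^ 4) =
  expectation (%w. ?S w ^ 4) + 4 * 0 + 6 * expectation (%w. ?S w ^ 2 * a L w ^ 2 * d L w ^ 2)
  + 4 * 0 + expectation (%w. ?S w ^ 0 * a L w ^ 4 * d L w ^ 4)"
  unfolding eq using e1 e3
  by (subst Bochner_Integration.integral_add; (intro Bochner_Integration.integrable_add integrable_mult_right IH i)?)+
   simp
 moreover have "3 * (\<Sum>j<Suc L. (\<kappa> j)^2 * \<delta> j)^2 = 3 * ?s\<^sup>2 + 6 * (\<delta> L * ((\<kappa> L)^2 * ?s)) + 3 * (\<delta> L)^2 * (\<kappa> L)^4"
  by (simp add: power2_sum power_mult_distrib algebra_simps flip: power_mult)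
 ultimately show ?case using IH(2) e2 e4 by simp
qed

text \<open>The integrand is switched off as soon as its accumulated energy exceeds \<open>\<eta>\<close>; on the event in
 question this changes nothing, and the truncated integrand obeys the isometry.\<close>

lemma lenglart:
 assumes a: "!!j. j < L ==> a j \<in> borel_measurable (G j)" and e: "0 < eps" and \<eta>: "0 <= \<eta>"
 shows "prob {w \<in> space M. eps < \<bar>\<Sum>j<L. a j w * d j w\<bar> \<and> (\<Sum>j<L. (a j w)^2 * \<delta> j) <= \<eta>} <= \<eta> / eps^2"
proof -
 \<comment> \<open>The energy counts index \<open>j\<close> itself: \<open>a j\<close> is known at
   step \<open>j\<close>, so the cut-off stays predictable and the truncated energy never exceeds
   \<eta>.\<close>
 define c where "c j w = (\<Sum>l\<le>j. (a l w)^2 * \<delta> l)" for j w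
 define b where "b j w = a j w * indicator {w\<in>space M. c j w <= \<eta>} w" for j w
 have cm: "c j \<in> borel_measurable (G j)" if "j < L" for j
  unfolding c_def
 proof (intro borel_measurable_sum borel_measurable_times borel_measurable_power borel_measurable_const)
  fix l assume "l \<in> {..j}"
  then show "a l \<in> borel_measurable (G j)"
   using that by (intro meas_up[OF a, of l]) auto
 qed
 have sp: "space (G j) = space M" for j using sub[of j] by (simp add: subalgebra_def)
 have bm: "b j \<in> borel_measurable (G j)" if "j < L" for j
 proof -
  have "{w\<in>space (G j). c j w <= \<eta>} \<in> sets (G j)" using cm[OF that] by measurable
  then show ?thesis unfolding b_def sp using a[OF that] by (intro borel_measurable_times) auto
 qed
 have trm: "0 <= (a l w)^2 * \<delta> l" for l w using \<delta>_pos[of l] by simp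
 have bsum: "(\<Sum>j<n. (b j w)^2 * \<delta> j) <= \<eta>" if "w \<in> space M" for w n
 proof (induction n)
  case 0 then show ?case using \<eta> by simp
 next
  case (Suc n)
  show ?case
  proof (cases "c n w <= \<eta>")
   case True
   have "(\<Sum>j<Suc n. (b j w)^2 * \<delta> j) <= (\<Sum>j<Suc n. (a j w)^2 * \<delta> j)"
    by (rule sum_mono) (use trm in \<open>auto simp: b_def split: split_indicator\<close>)
   also have "... = c n w" by (simp add: c_def lessThan_Suc_atMost)
   finally show ?thesis using True by simp
  next
   case False
   then show ?thesis using Suc by (simp add: b_def)
  qed
 qed
 have bi: "integrable M (%w. (b j w)^2)" if j: "j < L" for j
 proof (rule integrable_const_bound[where B="\<eta> / \<delta> j"])
  show "AE x in M. norm ((b j x)^2) <= \<eta> / \<delta> j"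
  proof (rule AE_I2)
   fix x assume x: "x \<in> space M"
   have "(b j x)^2 * \<delta> j <= (\<Sum>j<Suc j. (b j x)^2 * \<delta> j)"
    using \<delta>_pos by (intro member_le_sum[of j _ "%j. (b j x)^2 * \<delta> j"]) (auto simp: less_imp_le)
   also have "... <= \<eta>" by (rule bsum[OF x])
   finally show "norm ((b j x)^2) <= \<eta> / \<delta> j" using \<delta>_pos[of j] by (simp add: field_simps)
  qed
  show "(%x. (b j x)^2) \<in> borel_measurable M" using meas_M[OF bm[OF j]] by measurable
 qed
 let ?T = "%w. \<Sum>j<L. b j w * d j w"
 note iso = isometry[of L b, OF bm bi]
 have "expectation (%w. (?T w)^2) = expectation (%w. \<Sum>j<L. (b j w)^2 * \<delta> j)"
  using iso bi by (simp add: mult.commute)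
 also have "... <= expectation (%w. \<eta>)"
  using bsum bi by (intro integral_mono) (auto simp: )
 finally have E: "expectation (%w. (?T w)^2) <= \<eta>" by (simp add: prob_space)
 have Tm: "?T \<in> borel_measurable M" using meas_M[OF sum_meas[OF bm]] .
 have "{w \<in> space M. eps < \<bar>\<Sum>j<L. a j w * d j w\<bar> \<and> (\<Sum>j<L. (a j w)^2 * \<delta> j) <= \<eta>}
   \<subseteq> {w \<in> space M. eps^2 <= (?T w)^2}" (is "?A \<subseteq> ?B")
 proof safe
  fix w assume ww: "w \<in> space M" and h: "eps < \<bar>\<Sum>j<L. a j w * d j w\<bar>"
   and s: "(\<Sum>j<L. (a j w)^2 * \<delta> j) <= \<eta>"
  have "c j w <= \<eta>" if "j < L" for j
  proof -
   have "c j w <= (\<Sum>j<L. (a j w)^2 * \<delta> j)" unfolding c_def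
    using that trm by (intro sum_mono2) auto
   then show ?thesis using s by simp
  qed
  then have "?T w = (\<Sum>j<L. a j w * d j w)" using ww by (intro sum.cong) (auto simp: b_def)
  then show "eps^2 <= (?T w)^2" using h e by (simp add: abs_le_square_iff[symmetric])
 qed
 then have "prob ?A <= prob ?B"
  by (intro finite_measure_mono borel_measurable_le borel_measurable_const borel_measurable_power Tm)
 also have "prob ?B <= expectation (%w. (?T w)^2) / eps^2"
  using e iso by (intro integral_Markov_inequality_measure[of _ _ "{}"]) auto
 also have "... <= \<eta> / eps^2" using E by (intro divide_right_mono) auto
 finally show ?thesis .
qed

end

section \<open>Summation by parts for products of block sums\<close>

text \<open>Off-diagonal pairs are grouped by their larger index, which makes the inner sums known
  before the outer increment.\<close>

lemma prod_sums:
 fixes x x' :: "nat => real"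
 shows "(\<Sum>j\<in>{a..<a+r}. x j) * (\<Sum>j\<in>{a..<a+r}. x' j) =
  (\<Sum>j\<in>{a..<a+r}. (\<Sum>l\<in>{a..<j}. x l) * x' j + (\<Sum>l\<in>{a..<j}. x' l) * x j + x j * x' j)"
 by (induction r) (auto simp: algebra_simps)

text \<open>\<open>j div r * r\<close> is the left end of the cell containing \<open>j\<close>; with
  it the blockwise sums become sums over the whole fine grid, to which the isometry applies.\<close>

lemma sum_prod_cells:
 fixes x x' :: "nat => real"
 assumes r: "0 < r"
 shows "(\<Sum>i<n. (\<Sum>j\<in>{i*r..<i*r+r}. x j) * (\<Sum>j\<in>{i*r..<i*r+r}. x' j)) =
  (\<Sum>j<n*r. (\<Sum>l\<in>{j div r * r..<j}. x l) * x' j) + (\<Sum>j<n*r. (\<Sum>l\<in>{j div r * r..<j}. x' l) * x j)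
   + (\<Sum>j<n*r. x j * x' j)"
proof -
 let ?g = "%j. (\<Sum>l\<in>{j div r * r..<j}. x l) * x' j + (\<Sum>l\<in>{j div r * r..<j}. x' l) * x j + x j * x' j"
 have "(\<Sum>i<n. (\<Sum>j\<in>{i*r..<i*r+r}. x j) * (\<Sum>j\<in>{i*r..<i*r+r}. x' j)) = (\<Sum>i<n. \<Sum>j\<in>{i*r..<i*r+r}. ?g j)"
 proof (intro sum.cong refl)
  fix i
  have "j div r = i" if "j \<in> {i*r..<i*r+r}" for j
  proof -
   have "i * r <= j" "j < Suc i * r" using that by auto
   then show ?thesis using div_nat_eqI[of r i j] by (simp add: mult.commute)
  qed
  then show "(\<Sum>j\<in>{i*r..<i*r+r}. x j) * (\<Sum>j\<in>{i*r..<i*r+r}. x' j) = (\<Sum>j\<in>{i*r..<i*r+r}. ?g j)"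
   unfolding prod_sums by (intro sum.cong) auto
 qed
 also have "... = (\<Sum>j<n*r. ?g j)" by (rule sum.nat_group)
 finally show ?thesis by (simp add: sum.distrib)
qed

context gauss_steps
begin

lemma d_M: "d j \<in> borel_measurable M"
 by (rule meas_M[OF d_meas])

lemma bounded_integrable_sq:
 fixes f :: "'a => real"
 assumes "f \<in> borel_measurable M" "!!w. w \<in> space M ==> \<bar>f w\<bar> <= K"
 shows "integrable M (%w. (f w) ^ k)" "expectation (%w. (f w) ^ k) <= K ^ k"
proof -
 have b: "\<bar>f w\<bar> ^ k <= K ^ k" if "w \<in> space M" for w
  using assms(2)[OF that] by (intro power_mono) auto
 show i: "integrable M (%w. (f w) ^ k)"
  using assms(1) b by (intro integrable_const_bound[where B="K ^ k"]) (auto simp: power_abs)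
 have "expectation (%w. (f w) ^ k) <= expectation (%_. K ^ k)"
 proof (rule integral_mono[OF i])
  fix w assume "w \<in> space M"
  then show "f w ^ k <= K ^ k" using b[of w] abs_ge_self[of "f w ^ k"] by (simp add: power_abs)
 qed simp
 then show "expectation (%w. (f w) ^ k) <= K ^ k" by (simp add: prob_space)
qed

lemma bounded_mult_integrable:
 fixes f g :: "'a => real"
 assumes [measurable]: "f \<in> borel_measurable M" "g \<in> borel_measurable M"
  and b: "!!w. w \<in> space M ==> \<bar>f w\<bar> <= K" and i: "integrable M g"
 shows "integrable M (%w. g w * f w)"
proof (rule Bochner_Integration.integrable_bound)
 show "integrable M (%w. K * g w)" using i by simp
 show "AE x in M. norm (g x * f x) <= norm (K * g x)"
 proof (rule AE_I2)
  fix x assume "x \<in> space M"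
  then have "\<bar>f x\<bar> <= \<bar>K\<bar>" using b[of x] by simp
  then show "norm (g x * f x) <= norm (K * g x)"
   by (simp add: abs_mult mult.commute[of "\<bar>g x\<bar>"] mult_right_mono)
 qed
qed auto

text \<open>The isometry for increments that are not a weight times \<open>d\<close>; it serves the
  diagonal terms with \<open>d1 * d2\<close> and \<open>d^2 - h\<close>. The test functions in the
  third assumption are square integrable so as to include the earlier sum.\<close>

lemma orth_sum:
 fixes x :: "nat => 'a => real"
 assumes "!!j. j < L ==> x j \<in> borel_measurable (G (Suc j))"
  and "!!j. j < L ==> integrable M (%w. (x j w)^2)"
  and "!!j g. j < L ==> g \<in> borel_measurable (G j) ==> integrable M (%w. (g w)^2) ==>
    expectation (%w. g w * x j w) = 0"
 shows "integrable M (%w. (\<Sum>j<L. x j w)^2) \<and>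
  expectation (%w. (\<Sum>j<L. x j w)^2) = (\<Sum>j<L. expectation (%w. (x j w)^2))"
 using assms
proof (induction L)
 case 0
 then show ?case by simp
next
 case (Suc L)
 let ?S = "%w. \<Sum>j<L. x j w"
 have IH: "integrable M (%w. (?S w)^2)"
  "expectation (%w. (?S w)^2) = (\<Sum>j<L. expectation (%w. (x j w)^2))"
  using Suc by auto
 have S: "?S \<in> borel_measurable (G L)"
 proof (rule borel_measurable_sum)
  fix j assume "j \<in> {..<L}"
  then have j: "j < Suc L" "Suc j <= L" by auto
  show "x j \<in> borel_measurable (G L)" by (rule meas_up[OF Suc.prems(1)[OF j(1)] j(2)])
 qed
 have xm: "x L \<in> borel_measurable M" "integrable M (%w. (x L w)^2)"
  using meas_M[OF Suc.prems(1)[of L]] Suc.prems(2)[of L] by auto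
 have c: "integrable M (%w. ?S w * x L w)"
  using IH meas_M[OF S] xm by (intro integrable_mult_sq) auto
 have eq: "(\<Sum>j<Suc L. x j w)^2 = (?S w)^2 + 2 * (?S w * x L w) + (x L w)^2" for w
  by (simp add: power2_sum algebra_simps)
 show ?case unfolding eq
  using IH c Suc.prems(3)[OF _ S IH(1)] xm by simp
qed

text \<open>Sums starting at \<open>c\<close> are full sums whose weights are 0 before
  \<open>c\<close>, so the moment bounds for initial sums apply.\<close>

lemma segment:
 assumes y: "!!j. j < L ==> y j \<in> borel_measurable (G j)"
  and yK: "!!j w. j < L ==> w \<in> space M ==> \<bar>y j w\<bar> <= K" and j: "j <= L"
 shows "(%w. \<Sum>l\<in>{c..<j}. y l w * d l w) \<in> borel_measurable (G j)"
  and "integrable M (%w. (\<Sum>l\<in>{c..<j}. y l w * d l w)^2)"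
  and "expectation (%w. (\<Sum>l\<in>{c..<j}. y l w * d l w)^2) = (\<Sum>l\<in>{c..<j}. \<delta> l * expectation (%w. (y l w)^2))"
  and "integrable M (%w. (\<Sum>l\<in>{c..<j}. y l w * d l w) ^ 4)"
  and "expectation (%w. (\<Sum>l\<in>{c..<j}. y l w * d l w) ^ 4) <= 3 * (\<Sum>l\<in>{c..<j}. K^2 * \<delta> l)^2"
proof -
 define z where "z l w = (if c <= l then y l w else 0)" for l w
 have zE: "z l = (if c <= l then y l else (%_. 0))" for l by (auto simp: z_def)
 have set: "{..<j} \<inter> {l. c <= l} = {c..<j}" by auto
 have eq: "(\<Sum>l\<in>{c..<j}. y l w * d l w) = (\<Sum>l<j. z l w * d l w)" for w
  unfolding z_def by (simp add: if_distrib[of "%x. x * _"] sum.If_cases set cong: if_cong)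
 have z: "z l \<in> borel_measurable (G l)" if "l < j" for l
  using y[of l] that j zE[of l] by simp
 have zi: "integrable M (%w. (z l w)^2)" if "l < j" for l
  using bounded_integrable_sq(1)[OF meas_M[OF y[of l]] yK[of l], of 2] that j zE[of l] by (cases "c <= l") simp_all
 show "(%w. \<Sum>l\<in>{c..<j}. y l w * d l w) \<in> borel_measurable (G j)"
  unfolding eq by (rule sum_meas[OF z])
 note iso = isometry[of j z, OF z zi]
 show "integrable M (%w. (\<Sum>l\<in>{c..<j}. y l w * d l w)^2)" unfolding eq using iso by simp
 have "(\<Sum>l<j. \<delta> l * expectation (%w. (z l w)^2)) = (\<Sum>l<j. if c <= l then \<delta> l * expectation (%w. (y l w)^2) else 0)"
  by (intro sum.cong) (auto simp: z_def)
 also have "... = (\<Sum>l\<in>{c..<j}. \<delta> l * expectation (%w. (y l w)^2))"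
  by (simp add: sum.If_cases set)
 finally show "expectation (%w. (\<Sum>l\<in>{c..<j}. y l w * d l w)^2) = (\<Sum>l\<in>{c..<j}. \<delta> l * expectation (%w. (y l w)^2))"
  unfolding eq using iso by simp
 have zb: "\<bar>z l w\<bar> <= (if c <= l then K else 0)" if "l < j" "w \<in> space M" for l w
  using yK[of l w] that j by (auto simp: z_def)
 note four = fourth_moment[of j z "%l. if c <= l then K else 0", OF z zb]
 show "integrable M (%w. (\<Sum>l\<in>{c..<j}. y l w * d l w) ^ 4)" unfolding eq using four by simp
 have "(\<Sum>l<j. (if c <= l then K else 0)^2 * \<delta> l) = (\<Sum>l<j. if c <= l then K\<^sup>2 * \<delta> l else 0)"
  by (intro sum.cong) auto
 also have "... = (\<Sum>l\<in>{c..<j}. K^2 * \<delta> l)" by (simp add: sum.If_cases set)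
 finally show "expectation (%w. (\<Sum>l\<in>{c..<j}. y l w * d l w) ^ 4) <= 3 * (\<Sum>l\<in>{c..<j}. K^2 * \<delta> l)^2"
  unfolding eq using four by simp
qed

end

text \<open>The joint behaviour enters as a vanishing conditional covariance; higher mixed moments
  are controlled by those of each family alone.\<close>

locale gauss_pair = B1: gauss_steps M G d1 \<delta> + B2: gauss_steps M G d2 \<delta>
 for M :: "'a measure" and G :: "nat => 'a measure" and d1 d2 :: "nat => 'a => real"
  and \<delta> :: "nat => real" +
 assumes cross: "g \<in> borel_measurable (G j) ==> integrable M g ==>
  B1.expectation (%w. g w * (d1 j w * d2 j w)) = 0"
begin

lemma pair_swap: "gauss_pair M G d2 d1 \<delta>"
 using cross by unfold_locales (simp add: mult.commute)

text \<open>The products of the increments over the cells are rewritten, by discrete integration by parts,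
 as two stochastic sums and a sum of products \<open>d1 d2\<close>; this needs second moments of the first
 integrand only, up to the fourth moment of the second integral.\<close>

lemma product_bound:
 assumes y: "!!j. j < n*r ==> y j \<in> borel_measurable (G j)"
  and yK: "!!j w. j < n*r ==> w \<in> space M ==> \<bar>y j w\<bar> <= K"
  and y': "!!j. j < n*r ==> y' j \<in> borel_measurable (G j)"
  and y'K: "!!j w. j < n*r ==> w \<in> space M ==> \<bar>y' j w\<bar> <= K"
  and \<delta>: "!!j. \<delta> j = h" and r: "0 < r" and q: "0 < q"
 defines "Z \<equiv> %w. \<Sum>i<n. (\<Sum>j\<in>{i*r..<i*r+r}. y j w * d1 j w) * (\<Sum>j\<in>{i*r..<i*r+r}. y' j w * d2 j w)"
  and "A \<equiv> \<Sum>j<n*r. h * B1.expectation (%w. (y j w)^2)"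
 shows "integrable M (%w. (Z w)^2)"
  and "B1.expectation (%w. (Z w)^2) <= 3 * (r * h) * (4 * K^2 * A + (3 * q * K^4 * (n * r * h) + K^2 * A / q) / 2)"
proof -
 have h: "0 < h" using B1.\<delta>_pos[of 0] \<delta> by simp
 define c where "c j = j div r * r" for j
 have cj: "c j <= j" "j < c j + r" for j
  using r mod_less_divisor[of r j] div_mult_mod_eq[of j r] unfolding c_def by linarith+
 define P where "P j w = (\<Sum>l\<in>{c j..<j}. y l w * d1 l w)" for j w
 define P' where "P' j w = (\<Sum>l\<in>{c j..<j}. y' l w * d2 l w)" for j w
 define U where "U w = (\<Sum>j<n*r. (P j w * y' j w) * d2 j w)" for w
 define U' where "U' w = (\<Sum>j<n*r. (P' j w * y j w) * d1 j w)" for w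
 define ww where "ww j w = (y j w * y' j w) * (d1 j w * d2 j w)" for j w
 define W where "W w = (\<Sum>j<n*r. ww j w)" for w
 have Z: "Z w = U w + U' w + W w" for w
  unfolding Z_def sum_prod_cells[OF r] U_def U'_def W_def ww_def P_def P'_def c_def
  by (simp add: mult.assoc mult.left_commute)
 note yM = B1.meas_M[OF y] and y'M = B1.meas_M[OF y']
 note seg = B1.segment[of "n*r" y K, OF y yK] and seg' = B2.segment[of "n*r" y' K, OF y' y'K]
 have A0: "0 <= h * B1.expectation (%w. (y j w)^2)" for j
  using h by simp
 have yi: "integrable M (%w. (y j w) ^ k)" "integrable M (%w. (y' j w) ^ k)" if "j < n*r" for j k
  using B1.bounded_integrable_sq(1)[OF yM[OF that] yK[OF that]]
   B1.bounded_integrable_sq(1)[OF y'M[OF that] y'K[OF that]] by auto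
 have sqle: "(y j w)^2 <= K^2" "(y' j w)^2 <= K^2" if "j < n*r" "w \<in> space M" for j w
  using power_mono[OF yK[OF that], of 2] power_mono[OF y'K[OF that], of 2] by auto

 have Pm: "P j \<in> borel_measurable (G j)" "integrable M (%w. (P j w)^2)" if "j < n*r" for j
  using seg(1,2)[of j "c j"] that unfolding P_def by auto
 have P'm: "P' j \<in> borel_measurable (G j)" "integrable M (%w. (P' j w) ^ 4)" if "j < n*r" for j
  using seg'(1,4)[of j "c j"] that unfolding P'_def by auto
 have a: "(%w. P j w * y' j w) \<in> borel_measurable (G j)" "(%w. P' j w * y j w) \<in> borel_measurable (G j)"
  if "j < n*r" for j
  using Pm[OF that] P'm[OF that] y[OF that] y'[OF that] by auto
 have ai: "integrable M (%w. (P j w * y' j w)^2)" if j: "j < n*r" for j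
  unfolding power_mult_distrib using sqle(2)[OF j] B1.meas_M[OF Pm(1)[OF j]] y'M[OF j] Pm(2)[OF j]
  by (intro B1.bounded_mult_integrable[where K="K^2"]) auto
 have P'2: "integrable M (%w. (P' j w)^2)" if j: "j < n*r" for j
  using seg'(2)[of j "c j"] j unfolding P'_def by auto
 have a'i: "integrable M (%w. (P' j w * y j w)^2)" if j: "j < n*r" for j
  unfolding power_mult_distrib using sqle(1)[OF j] B1.meas_M[OF P'm(1)[OF j]] yM[OF j] P'2[OF j]
  by (intro B1.bounded_mult_integrable[where K="K^2"]) auto

 have EP: "B1.expectation (%w. (P j w * y' j w)^2) <= K^2 * (\<Sum>l\<in>{c j..<c j + r}. h * B1.expectation (%w. (y l w)^2))"
  if j: "j < n*r" for j
 proof -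
  have "B1.expectation (%w. (P j w * y' j w)^2) <= B1.expectation (%w. K^2 * (P j w)^2)"
   using ai[OF j] Pm[OF j] sqle(2)[OF j]
   by (intro integral_mono) (auto simp: power_mult_distrib mult.commute[of "_^2" "(y' _ _)^2"] intro: mult_right_mono)
  also have "... = K^2 * (\<Sum>l\<in>{c j..<j}. h * B1.expectation (%w. (y l w)^2))"
   using seg(3)[of j "c j"] j unfolding P_def by (simp add: \<delta>)
  also have "... <= K^2 * (\<Sum>l\<in>{c j..<c j + r}. h * B1.expectation (%w. (y l w)^2))"
   using A0 cj[of j] by (intro mult_left_mono sum_mono2) auto
  finally show ?thesis .
 qed
 have EU: "integrable M (%w. (U w)^2)" "B1.expectation (%w. (U w)^2) <= (r * h) * (K^2 * A)"
 proof -
  note iso = B2.isometry[of "n*r" "%j w. P j w * y' j w", OF a(1) ai]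
  show "integrable M (%w. (U w)^2)" unfolding U_def using iso by simp
  have "B1.expectation (%w. (U w)^2) = (\<Sum>j<n*r. h * B1.expectation (%w. (P j w * y' j w)^2))"
   unfolding U_def using iso by (simp add: \<delta>)
  also have "... <= (\<Sum>j<n*r. h * (K^2 * (\<Sum>l\<in>{c j..<c j + r}. h * B1.expectation (%w. (y l w)^2))))"
   using EP h by (intro sum_mono mult_left_mono) auto
  also have "... = (\<Sum>i<n. \<Sum>j\<in>{i*r..<i*r+r}. h * (K^2 * (\<Sum>l\<in>{c j..<c j + r}. h * B1.expectation (%w. (y l w)^2))))"
   by (rule sum.nat_group[symmetric])
  also have "... = (\<Sum>i<n. \<Sum>j\<in>{i*r..<i*r+r}. h * (K^2 * (\<Sum>l\<in>{i*r..<i*r + r}. h * B1.expectation (%w. (y l w)^2))))"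
  proof (intro sum.cong refl)
   fix i j assume "j \<in> {i*r..<i*r+r}"
   then have "c j = i * r" unfolding c_def using div_nat_eqI[of r i j] by (simp add: mult.commute)
   then show "h * (K^2 * (\<Sum>l\<in>{c j..<c j + r}. h * B1.expectation (%w. (y l w)^2))) =
     h * (K^2 * (\<Sum>l\<in>{i*r..<i*r + r}. h * B1.expectation (%w. (y l w)^2)))" by simp
  qed
  also have "... = (r * h) * (K^2 * (\<Sum>i<n. \<Sum>l\<in>{i*r..<i*r + r}. h * B1.expectation (%w. (y l w)^2)))"
   by (simp add: sum_distrib_left mult.assoc mult.left_commute)
  also have "... = (r * h) * (K^2 * A)" unfolding A_def by (simp only: sum.nat_group)
  finally show "B1.expectation (%w. (U w)^2) <= (r * h) * (K^2 * A)" .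
 qed

 \<comment> \<open>Here the small factor \<open>y\<close> multiplies the unbounded partial sum
   \<open>P'\<close>. Young's inequality with weight \<open>q / (r * h)\<close> matches the size
   \<open>(r * h)^2\<close> of the fourth moment of \<open>P'\<close>; what remains is
   \<open>q\<close> times a constant plus \<open>1 / q\<close> times the energy of
   \<open>y\<close>.\<close>
 have EP': "B1.expectation (%w. (P' j w * y j w)^2) <= (3 * q * K^4 * (r * h) + (r * h) * K^2 / q * B1.expectation (%w. (y j w)^2)) / 2"
  if j: "j < n*r" for j
 proof -
  have rh: "0 < r * h" using r h by simp
  have pt: "(P' j w * y j w)^2 <= (q / (r * h) * P' j w ^ 4 + (r * h) * K^2 / q * (y j w)^2) / 2" if ww: "w \<in> space M" for w
  proof -
   define \<rho> where "\<rho> = q / (r * h)"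
   have \<rho>: "0 < \<rho>" unfolding \<rho>_def using q rh by simp
   define x where "x = (P' j w)^2"
   define z where "z = (y j w)^2"
   have "0 <= (\<rho> * x - z)^2 / \<rho>" using \<rho> by simp
   also have "... = \<rho> * x^2 - 2 * (x * z) + z^2 / \<rho>" using \<rho> by (simp add: power2_eq_square field_simps)
   finally have "2 * (x * z) <= \<rho> * x^2 + z^2 / \<rho>" by simp
   also have "x^2 = P' j w ^ 4" unfolding x_def by (simp flip: power_mult)
   also have "\<rho> * P' j w ^ 4 + z^2 / \<rho> <= \<rho> * P' j w ^ 4 + K^2 * z / \<rho>"
    using sqle(1)[OF j ww] \<rho> unfolding z_def[symmetric] power2_eq_square[of z]
    by (intro add_left_mono divide_right_mono mult_right_mono) (auto simp: z_def)
   also have "K^2 * z / \<rho> = (r * h) * K^2 / q * z" unfolding \<rho>_def by simp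
   finally have "2 * (x * z) <= \<rho> * P' j w ^ 4 + (r * h) * K^2 / q * z" .
   then show ?thesis unfolding x_def z_def \<rho>_def power_mult_distrib by simp
  qed
  have "B1.expectation (%w. (P' j w * y j w)^2) <= B1.expectation (%w. (q / (r * h) * P' j w ^ 4 + (r * h) * K^2 / q * (y j w)^2) / 2)"
   using a'i[OF j] P'm(2)[OF j] yi(1)[OF j, of 2] pt by (intro integral_mono) auto
  also have "... = (q / (r * h) * B1.expectation (%w. P' j w ^ 4) + (r * h) * K^2 / q * B1.expectation (%w. (y j w)^2)) / 2"
   using P'm(2)[OF j] yi(1)[OF j, of 2] by simp
  also have "... <= (q / (r * h) * (3 * K^4 * (r * h)^2) + (r * h) * K^2 / q * B1.expectation (%w. (y j w)^2)) / 2"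
  proof -
   have "B1.expectation (%w. P' j w ^ 4) <= 3 * (\<Sum>l\<in>{c j..<j}. K^2 * \<delta> l)^2"
    using seg'(5)[of j "c j"] j unfolding P'_def by auto
   also have "... <= 3 * (K^2 * (r * h))^2"
   proof -
    have "real (j - c j) <= real r" using cj[of j] by linarith
    then have "(j - c j) * (K^2 * h) <= r * (K^2 * h)"
     using h by (intro mult_right_mono) auto
    then have "(\<Sum>l\<in>{c j..<j}. K^2 * \<delta> l) <= K^2 * (r * h)" by (simp add: \<delta> mult.left_commute)
    then show ?thesis using h by (intro mult_left_mono power_mono) (auto simp: \<delta> intro!: sum_nonneg)
   qed
   also have "... = 3 * K^4 * (r * h)^2" by (simp add: power_mult_distrib flip: power_mult)
   finally have "B1.expectation (%w. P' j w ^ 4) <= 3 * K^4 * (r * h)^2" .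
   then show ?thesis using q rh by (intro divide_right_mono add_mono mult_left_mono order_refl) auto
  qed
  also have "... = (3 * q * K^4 * (r * h) + (r * h) * K^2 / q * B1.expectation (%w. (y j w)^2)) / 2"
   using rh q by (simp add: power2_eq_square)
  finally show ?thesis .
 qed
 have EU': "integrable M (%w. (U' w)^2)"
  "B1.expectation (%w. (U' w)^2) <= (r * h) * ((3 * q * K^4 * (n * r * h) + K^2 * A / q) / 2)"
 proof -
  note iso = B1.isometry[of "n*r" "%j w. P' j w * y j w", OF a(2) a'i]
  show "integrable M (%w. (U' w)^2)" unfolding U'_def using iso by simp
  have "B1.expectation (%w. (U' w)^2) = (\<Sum>j<n*r. h * B1.expectation (%w. (P' j w * y j w)^2))"
   unfolding U'_def using iso by (simp add: \<delta>)
  also have "... <= (\<Sum>j<n*r. h * ((3 * q * K^4 * (r * h) + (r * h) * K^2 / q * B1.expectation (%w. (y j w)^2)) / 2))"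
   using EP' h by (intro sum_mono mult_left_mono) auto
  also have "... = (\<Sum>j<n*r. h * (3 * q * K^4 * (r * h)) / 2) + (\<Sum>j<n*r. (r * h) * K^2 / q / 2 * (h * B1.expectation (%w. (y j w)^2)))"
   unfolding sum.distrib[symmetric] by (intro sum.cong) (auto simp: field_simps)
  also have "... = (r * h) * ((3 * q * K^4 * (n * r * h) + K^2 * A / q) / 2)"
  proof -
   have "(\<Sum>j<n*r. (r * h) * K^2 / q / 2 * (h * B1.expectation (%w. (y j w)^2))) = (r * h) * K^2 / q / 2 * A"
    unfolding A_def by (rule sum_distrib_left[symmetric])
   then show ?thesis by (simp add: field_simps)
  qed
  finally show "B1.expectation (%w. (U' w)^2) <= (r * h) * ((3 * q * K^4 * (n * r * h) + K^2 * A / q) / 2)" .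
 qed

 have EW: "integrable M (%w. (W w)^2)" "B1.expectation (%w. (W w)^2) <= 3 * (r * h) * (K^2 * A)"
 proof -
  have yy: "(%w. (y j w * y' j w)^2) \<in> borel_measurable (G j)" if "j < n*r" for j
   using y[OF that] y'[OF that] by measurable
  have yyi: "integrable M (%w. (y j w * y' j w)^2)" if j: "j < n*r" for j
   unfolding power_mult_distrib using sqle(2)[OF j] yM[OF j] y'M[OF j] yi(1)[OF j, of 2]
   by (intro B1.bounded_mult_integrable[where K="K^2"]) auto
  have yyE: "B1.expectation (%w. (y j w * y' j w)^2) <= K^2 * B1.expectation (%w. (y j w)^2)" if j: "j < n*r" for j
  proof -
   have "B1.expectation (%w. (y j w * y' j w)^2) <= B1.expectation (%w. K^2 * (y j w)^2)"
    using yyi[OF j] yi(1)[OF j, of 2] sqle(2)[OF j]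
    by (intro integral_mono) (auto simp: power_mult_distrib mult.commute[of "_^2" "(y' _ _)^2"] intro: mult_right_mono)
   then show ?thesis by simp
  qed
  have wm: "ww j \<in> borel_measurable (G (Suc j))" if "j < n*r" for j
   unfolding ww_def using B1.meas_up[OF y[OF that], of "Suc j"] B1.meas_up[OF y'[OF that], of "Suc j"] B1.d_meas B2.d_meas
   by (intro borel_measurable_times) auto
  have dom: "integrable M (%w. ((y j w * y' j w)^2 * d1 j w ^ 4 + (y j w * y' j w)^2 * d2 j w ^ 4) / 2)" if j: "j < n*r" for j
   using B1.d_int[OF yy[OF j] yyi[OF j], of 4] B2.d_int[OF yy[OF j] yyi[OF j], of 4] by auto
  \<comment> \<open>The mixed moment of \<open>d1^2 * d2^2\<close> is not part of the locale, so it
    is bounded by the fourth moments of both increments.\<close>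
  have wle: "(ww j w)^2 <= ((y j w * y' j w)^2 * d1 j w ^ 4 + (y j w * y' j w)^2 * d2 j w ^ 4) / 2" for j w
  proof -
   have "2 * (d1 j w)^2 * (d2 j w)^2 <= ((d1 j w)^2)^2 + ((d2 j w)^2)^2" by (rule sum_squares_bound)
   then have "(d1 j w * d2 j w)^2 <= (d1 j w ^ 4 + d2 j w ^ 4) / 2" by (simp add: power_mult_distrib flip: power_mult)
   from mult_left_mono[OF this, of "(y j w * y' j w)^2"] show ?thesis
    by (simp add: ww_def power_mult_distrib algebra_simps)
  qed
  have wi: "integrable M (%w. (ww j w)^2)" if j: "j < n*r" for j
  proof (rule Bochner_Integration.integrable_bound[OF dom[OF j]])
   show "(%w. (ww j w)^2) \<in> borel_measurable M" using B1.meas_M[OF wm[OF j]] by measurable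
   show "AE x in M. norm ((ww j x)^2) <= norm (((y j x * y' j x)^2 * d1 j x ^ 4 + (y j x * y' j x)^2 * d2 j x ^ 4) / 2)"
    using order_trans[OF wle abs_ge_self] by (intro AE_I2) simp
  qed
  have orth: "B1.expectation (%w. g w * ww j w) = 0"
   if j: "j < n*r" and g: "g \<in> borel_measurable (G j)" "integrable M (%w. (g w)^2)" for g j
  proof -
   have "integrable M (%w. g w * (y j w * y' j w))"
    using B1.meas_M[OF g(1)] yM[OF j] y'M[OF j] g(2) yyi[OF j] by (intro B1.integrable_mult_sq) auto
   moreover have "(%w. g w * (y j w * y' j w)) \<in> borel_measurable (G j)" using g y[OF j] y'[OF j] by measurable
   ultimately show ?thesis using cross[of "%w. g w * (y j w * y' j w)" j] by (simp add: ww_def mult.assoc)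
  qed
  have os: "integrable M (%w. (\<Sum>j<n*r. ww j w)^2) \<and>
   B1.expectation (%w. (\<Sum>j<n*r. ww j w)^2) = (\<Sum>j<n*r. B1.expectation (%w. (ww j w)^2))"
   by (rule B1.orth_sum[OF wm wi orth])
  show "integrable M (%w. (W w)^2)" unfolding W_def by (rule conjunct1[OF os])
  have ew: "B1.expectation (%w. (ww j w)^2) <= 3 * h * K^2 * (h * B1.expectation (%w. (y j w)^2))" if j: "j < n*r" for j
  proof -
   have "B1.expectation (%w. (ww j w)^2) <= B1.expectation (%w. ((y j w * y' j w)^2 * d1 j w ^ 4 + (y j w * y' j w)^2 * d2 j w ^ 4) / 2)"
    using wi[OF j] dom[OF j] wle by (intro integral_mono) auto
   also have "... = 3 * h^2 * B1.expectation (%w. (y j w * y' j w)^2)"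
    using B1.d_int[OF yy[OF j] yyi[OF j], of 4] B2.d_int[OF yy[OF j] yyi[OF j], of 4]
     B1.m4[OF yy[OF j] yyi[OF j]] B2.m4[OF yy[OF j] yyi[OF j]] by (simp add: \<delta>)
   also have "... <= 3 * h^2 * (K^2 * B1.expectation (%w. (y j w)^2))" using yyE[OF j] by (intro mult_left_mono) auto
   finally show ?thesis by (simp add: power2_eq_square mult_ac)
  qed
  have "B1.expectation (%w. (W w)^2) = (\<Sum>j<n*r. B1.expectation (%w. (ww j w)^2))" unfolding W_def by (rule conjunct2[OF os])
  also have "... <= (\<Sum>j<n*r. 3 * h * K^2 * (h * B1.expectation (%w. (y j w)^2)))" using ew by (intro sum_mono) auto
  also have "... = 3 * h * K^2 * A" unfolding A_def by (rule sum_distrib_left[symmetric])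
  also have "... = 3 * h * (K^2 * A)" by simp
  also have "... <= 3 * (r * h) * (K^2 * A)"
  proof -
   have "1 * h <= r * h" using r h by (intro mult_right_mono) auto
   moreover have "0 <= K^2 * A" unfolding A_def using A0 h by (intro mult_nonneg_nonneg sum_nonneg) auto
   ultimately show ?thesis by (intro mult_right_mono) auto
  qed
  finally show "B1.expectation (%w. (W w)^2) <= 3 * (r * h) * (K^2 * A)" .
 qed

 have Zle: "(Z w)^2 <= 3 * ((U w)^2 + (U' w)^2 + (W w)^2)" for w
 proof -
  have "3 * (a^2 + b^2 + e^2) - (a + b + e)^2 = (a - b)^2 + (b - e)^2 + (a - e)^2" for a b e :: real
   by (simp add: power2_eq_square algebra_simps)
  from this[of "U w" "U' w" "W w"] show ?thesis unfolding Z
   by (metis add_nonneg_nonneg diff_ge_0_iff_ge zero_le_power2)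
 qed
 have UM: "U \<in> borel_measurable M" "U' \<in> borel_measurable M" "W \<in> borel_measurable M"
 proof -
  show "U \<in> borel_measurable M" unfolding U_def
   by (intro borel_measurable_sum borel_measurable_times B2.d_M B1.meas_M[OF Pm(1)] y'M) auto
  show "U' \<in> borel_measurable M" unfolding U'_def
   by (intro borel_measurable_sum borel_measurable_times B1.d_M B1.meas_M[OF P'm(1)] yM) auto
  show "W \<in> borel_measurable M" unfolding W_def ww_def
   by (intro borel_measurable_sum borel_measurable_times B1.d_M B2.d_M y'M yM) auto
 qed
 have ZM: "Z \<in> borel_measurable M" unfolding Z[abs_def] using UM by measurable
 have sumi: "integrable M (%w. 3 * ((U w)^2 + (U' w)^2 + (W w)^2))" using EU EU' EW by auto
 show Zi: "integrable M (%w. (Z w)^2)"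
 proof (rule Bochner_Integration.integrable_bound[OF sumi])
  show "(%w. (Z w)^2) \<in> borel_measurable M" using ZM by measurable
  show "AE x in M. norm ((Z x)^2) <= norm (3 * ((U x)^2 + (U' x)^2 + (W x)^2))"
   using order_trans[OF Zle abs_ge_self] by (intro AE_I2) simp
 qed
 have "B1.expectation (%w. (Z w)^2) <= B1.expectation (%w. 3 * ((U w)^2 + (U' w)^2 + (W w)^2))"
  using Zi sumi Zle by (intro integral_mono) auto
 also have "... = 3 * (B1.expectation (%w. (U w)^2) + B1.expectation (%w. (U' w)^2) + B1.expectation (%w. (W w)^2))"
  using EU EU' EW by simp
 also have "... <= 3 * ((r * h) * (K^2 * A) + (r * h) * ((3 * q * K^4 * (n * r * h) + K^2 * A / q) / 2) + 3 * (r * h) * (K^2 * A))"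
  using EU EU' EW by (intro mult_left_mono add_mono) auto
 also have "... = 3 * (r * h) * (4 * K^2 * A + (3 * q * K^4 * (n * r * h) + K^2 * A / q) / 2)"
  by (simp add: algebra_simps)
 finally show "B1.expectation (%w. (Z w)^2) <= 3 * (r * h) * (4 * K^2 * A + (3 * q * K^4 * (n * r * h) + K^2 * A / q) / 2)" .
qed

end

text \<open>Summation by parts leaves \<open>2 * U + V\<close>: \<open>U\<close> is a stochastic
  sum, and \<open>V\<close> collects the centred squares \<open>d^2 - h\<close>, whose conditional
  variance is \<open>2 * h^2\<close>. In units of \<open>K^4 * (n * r * h) * (r * h)\<close> the
  second moments are at most 1 and 2, which gives 8 + 4 = 12.\<close>

lemma (in gauss_steps) quadratic_variation_bound:
 assumes y: "!!j. j < n*r ==> y j \<in> borel_measurable (G j)"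
  and yK: "!!j w. j < n*r ==> w \<in> space M ==> \<bar>y j w\<bar> <= K"
  and \<delta>: "!!j. \<delta> j = h" and r: "0 < r"
 defines "Z \<equiv> %w. (\<Sum>i<n. (\<Sum>j\<in>{i*r..<i*r+r}. y j w * d j w)^2) - (\<Sum>j<n*r. h * (y j w)^2)"
 shows "integrable M (%w. (Z w)^2)"
  and "expectation (%w. (Z w)^2) <= 12 * K^4 * (n * r * h) * (r * h)"
proof -
 have h: "0 < h" using \<delta>_pos[of 0] \<delta> by simp
 define c where "c j = j div r * r" for j
 have cj: "c j <= j" "j < c j + r" for j
  using r mod_less_divisor[of r j] div_mult_mod_eq[of j r] unfolding c_def by linarith+
 define P where "P j w = (\<Sum>l\<in>{c j..<j}. y l w * d l w)" for j w
 define U where "U w = (\<Sum>j<n*r. (P j w * y j w) * d j w)" for w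
 define v where "v j w = (y j w)^2 * ((d j w)^2 - h)" for j w
 define V where "V w = (\<Sum>j<n*r. v j w)" for w
 have Z: "Z w = 2 * U w + V w" for w
 proof -
  have "(\<Sum>i<n. (\<Sum>j\<in>{i*r..<i*r+r}. y j w * d j w)^2) = 2 * U w + (\<Sum>j<n*r. (y j w * d j w) * (y j w * d j w))"
   unfolding power2_eq_square sum_prod_cells[OF r] U_def P_def c_def by (simp add: mult.assoc)
  moreover have "V w = (\<Sum>j<n*r. (y j w * d j w) * (y j w * d j w)) - (\<Sum>j<n*r. h * (y j w)^2)"
   unfolding V_def v_def sum_subtractf[symmetric]
   by (intro sum.cong) (auto simp: power2_eq_square right_diff_distrib mult_ac)
  ultimately show ?thesis unfolding Z_def by simp
 qed
 note yM = meas_M[OF y]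
 note seg = segment[of "n*r" y K, OF y yK]
 have yi: "integrable M (%w. (y j w) ^ k)" "expectation (%w. (y j w) ^ k) <= K ^ k" if "j < n*r" for j k
  using bounded_integrable_sq[OF yM[OF that] yK[OF that]] by auto
 have sqle: "(y j w)^2 <= K^2" if "j < n*r" "w \<in> space M" for j w
  using power_mono[OF yK[OF that], of 2] by auto
 have Pm: "P j \<in> borel_measurable (G j)" "integrable M (%w. (P j w)^2)" if "j < n*r" for j
  using seg(1,2)[of j "c j"] that unfolding P_def by auto
 have a: "(%w. P j w * y j w) \<in> borel_measurable (G j)" if "j < n*r" for j
  using Pm[OF that] y[OF that] by auto
 have ai: "integrable M (%w. (P j w * y j w)^2)" if j: "j < n*r" for j
  unfolding power_mult_distrib using sqle[OF j] meas_M[OF Pm(1)[OF j]] yM[OF j] Pm(2)[OF j]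
  by (intro bounded_mult_integrable[where K="K^2"]) auto
 have EP: "expectation (%w. (P j w * y j w)^2) <= K^4 * (r * h)" if j: "j < n*r" for j
 proof -
  have "expectation (%w. (P j w * y j w)^2) <= expectation (%w. K^2 * (P j w)^2)"
   using ai[OF j] Pm[OF j] sqle[OF j]
   by (intro integral_mono) (auto simp: power_mult_distrib mult.commute[of "_^2" "(y _ _)^2"] intro: mult_right_mono)
  also have "... = K^2 * (\<Sum>l\<in>{c j..<j}. h * expectation (%w. (y l w)^2))"
   using seg(3)[of j "c j"] j unfolding P_def by (simp add: \<delta>)
  also have "... <= K^2 * (\<Sum>l\<in>{c j..<j}. h * K^2)"
   using yi(2)[of _ 2] h j by (intro mult_left_mono sum_mono) auto
  also have "... = K^4 * ((j - c j) * h)" by (simp add: power4_eq_xxxx power2_eq_square)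
  also have "... <= K^4 * (r * h)"
  proof -
   have "real (j - c j) <= real r" using cj[of j] by linarith
   then show ?thesis using h by (intro mult_left_mono mult_right_mono) auto
  qed
  finally show ?thesis .
 qed
 have EU: "integrable M (%w. (U w)^2)" "expectation (%w. (U w)^2) <= K^4 * (n * r * h) * (r * h)"
 proof -
  note iso = isometry[of "n*r" "%j w. P j w * y j w", OF a ai]
  show "integrable M (%w. (U w)^2)" unfolding U_def using iso by simp
  have "expectation (%w. (U w)^2) = (\<Sum>j<n*r. h * expectation (%w. (P j w * y j w)^2))"
   unfolding U_def using iso by (simp add: \<delta>)
  also have "... <= (\<Sum>j<n*r. h * (K^4 * (r * h)))"
   using EP h by (intro sum_mono mult_left_mono) auto
  also have "... = K^4 * (n * r * h) * (r * h)" by simp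
  finally show "expectation (%w. (U w)^2) <= K^4 * (n * r * h) * (r * h)" .
 qed
 have ym: "(%w. (y j w) ^ k) \<in> borel_measurable (G j)" if "j < n*r" for j k
  using y[OF that] by measurable
 have vsq: "(v j w)^2 = y j w ^ 4 * d j w ^ 4 - 2 * h * (y j w ^ 4 * d j w ^ 2) + h^2 * y j w ^ 4" for j w
  by (simp add: v_def power2_eq_square power4_eq_xxxx algebra_simps)
 have EV: "integrable M (%w. (V w)^2)" "expectation (%w. (V w)^2) <= 2 * K^4 * (n * r * h) * (r * h)"
 proof -
  have vm: "v j \<in> borel_measurable (G (Suc j))" if "j < n*r" for j
   unfolding v_def using meas_up[OF y[OF that], of "Suc j"] d_meas
   by (intro borel_measurable_times borel_measurable_power borel_measurable_diff borel_measurable_const) auto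
  have vi: "integrable M (%w. (v j w)^2)" if j: "j < n*r" for j
   unfolding vsq using d_int[OF ym[OF j, of 4] yi(1)[OF j], of 4] d_int[OF ym[OF j, of 4] yi(1)[OF j], of 2] yi(1)[OF j, of 4]
   by auto
  have vE: "expectation (%w. (v j w)^2) <= 2 * h^2 * K^4" if j: "j < n*r" for j
  proof -
   have "expectation (%w. (v j w)^2) = 2 * h^2 * expectation (%w. y j w ^ 4)"
    unfolding vsq using d_int[OF ym[OF j, of 4] yi(1)[OF j], of 4] d_int[OF ym[OF j, of 4] yi(1)[OF j], of 2] yi(1)[OF j, of 4]
     m4[OF ym[OF j, of 4] yi(1)[OF j]] m2[OF ym[OF j, of 4] yi(1)[OF j]]
    by (simp add: \<delta> power2_eq_square algebra_simps)
   also have "... <= 2 * h^2 * K^4" using yi(2)[OF j, of 4] by (intro mult_left_mono) auto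
   finally show ?thesis .
  qed
  have orth: "expectation (%w. g w * v j w) = 0"
   if j: "j < n*r" and g: "g \<in> borel_measurable (G j)" "integrable M (%w. (g w)^2)" for g j
  proof -
   have gi: "integrable M (%w. g w * (y j w)^2)"
   proof (rule integrable_mult_sq[OF meas_M[OF g(1)] meas_M[OF ym[OF j]] g(2)])
    show "integrable M (%w. ((y j w)^2)^2)" using yi(1)[OF j, of 4] by (simp flip: power_mult)
   qed
   have gm: "(%w. g w * (y j w)^2) \<in> borel_measurable (G j)" using g y[OF j] by measurable
   have eq: "g w * v j w = g w * (y j w)^2 * d j w ^ 2 - h * (g w * (y j w)^2)" for w
    by (simp add: v_def algebra_simps)
   show ?thesis unfolding eq using d_int[OF gm gi, of 2] m2[OF gm gi] gi by (simp add: \<delta>)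
  qed
  have os: "integrable M (%w. (\<Sum>j<n*r. v j w)^2) \<and>
   expectation (%w. (\<Sum>j<n*r. v j w)^2) = (\<Sum>j<n*r. expectation (%w. (v j w)^2))"
   by (rule orth_sum[OF vm vi orth])
  show "integrable M (%w. (V w)^2)" unfolding V_def by (rule conjunct1[OF os])
  have "expectation (%w. (V w)^2) = (\<Sum>j<n*r. expectation (%w. (v j w)^2))" unfolding V_def by (rule conjunct2[OF os])
  also have "... <= (\<Sum>j<n*r. 2 * h^2 * K^4)" using vE by (intro sum_mono) auto
  also have "... = 2 * K^4 * (n * r * h) * h" by (simp add: power2_eq_square)
  also have "... <= 2 * K^4 * (n * r * h) * (r * h)"
  proof -
   have "1 * h <= r * h" using r h by (intro mult_right_mono) auto
   then show ?thesis using h by (intro mult_left_mono) auto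
  qed
  finally show "expectation (%w. (V w)^2) <= 2 * K^4 * (n * r * h) * (r * h)" .
 qed
 have Zle: "(Z w)^2 <= 8 * (U w)^2 + 2 * (V w)^2" for w
 proof -
  have "8 * a^2 + 2 * b^2 - (2 * a + b)^2 = (2 * a - b)^2" for a b :: real
   by (simp add: power2_eq_square algebra_simps)
  from this[of "U w" "V w"] show ?thesis unfolding Z
   by (metis diff_ge_0_iff_ge zero_le_power2)
 qed
 have ZM: "Z \<in> borel_measurable M"
 proof -
  have "U \<in> borel_measurable M" unfolding U_def
   by (intro borel_measurable_sum borel_measurable_times d_M meas_M[OF Pm(1)] yM) auto
  moreover have "V \<in> borel_measurable M" unfolding V_def v_def
   by (intro borel_measurable_sum borel_measurable_times borel_measurable_power borel_measurable_diff borel_measurable_const d_M yM) auto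
  ultimately show ?thesis unfolding Z[abs_def] by measurable
 qed
 have sumi: "integrable M (%w. 8 * (U w)^2 + 2 * (V w)^2)" using EU EV by auto
 show Zi: "integrable M (%w. (Z w)^2)"
 proof (rule Bochner_Integration.integrable_bound[OF sumi])
  show "(%w. (Z w)^2) \<in> borel_measurable M" using ZM by measurable
  show "AE x in M. norm ((Z x)^2) <= norm (8 * (U x)^2 + 2 * (V x)^2)"
   using order_trans[OF Zle abs_ge_self] by (intro AE_I2) simp
 qed
 have "expectation (%w. (Z w)^2) <= expectation (%w. 8 * (U w)^2 + 2 * (V w)^2)"
  using Zi sumi Zle by (intro integral_mono) auto
 also have "... = 8 * expectation (%w. (U w)^2) + 2 * expectation (%w. (V w)^2)" using EU EV by simp
 also have "... <= 8 * (K^4 * (n * r * h) * (r * h)) + 2 * (2 * K^4 * (n * r * h) * (r * h))"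
  using EU EV by (intro mult_left_mono add_mono) auto
 also have "... = 12 * K^4 * (n * r * h) * (r * h)" by simp
 finally show "expectation (%w. (Z w)^2) <= 12 * K^4 * (n * r * h) * (r * h)" .
qed

section \<open>Brownian increments\<close>

lemma filtered_prob_spaceD:
 assumes "filtered_prob_space M F"
 shows "prob_space M" "subalgebra M (F t)" "s <= t ==> sets (F s) \<subseteq> sets (F t)"
 using assms by (auto simp: filtered_prob_space_def filtration_def)

text \<open>Every \<open>F s\<close>-measurable \<open>g\<close> generates a sub-\<sigma>-algebra of
  \<open>F s\<close>, so independence of \<sigma>-algebras turns into independence of random
  variables.\<close>

lemma bm_increment:
 assumes fsp: "filtered_prob_space M F" and B: "brownian_motion M F B" and st: "0 <= s" "s < t"
 shows "distributed M lborel (%w. B t w - B s w) (normal_density 0 (sqrt (t - s)))"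
  and "g \<in> borel_measurable (F s) ==> prob_space.indep_var M borel g borel (%w. B t w - B s w)"
  and "(%w. B t w - B s w) \<in> borel_measurable M"
proof -
 interpret prob_space M by (rule filtered_prob_spaceD[OF fsp])
 show D: "distributed M lborel (%w. B t w - B s w) (normal_density 0 (sqrt (t - s)))"
  using B st by (auto simp: brownian_motion_def)
 show dm: "(%w. B t w - B s w) \<in> borel_measurable M" using distributed_measurable[OF D] by simp
 assume g: "g \<in> borel_measurable (F s)"
 have "indep_set (sets (vimage_algebra (space M) (%w. B t w - B s w) borel)) (sets (F s))"
  using B st by (auto simp: brownian_motion_def)
 then have ind: "prob (a \<inter> b) = prob a * prob b"
  if "a \<in> sets (vimage_algebra (space M) (%w. B t w - B s w) borel)" "b \<in> sets (F s)" for a b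
  using that by (auto simp: indep_sets2_eq)
 have gm: "g \<in> borel_measurable M" by (rule measurable_from_subalg[OF filtered_prob_spaceD(2)[OF fsp] g])
 have sp: "space (F s) = space M" using filtered_prob_spaceD(2)[OF fsp, of s] by (simp add: subalgebra_def)
 have "sigma_sets (space M) {g -` A \<inter> space M |A. A \<in> sets borel} \<subseteq> sets (F s)"
 proof (rule sets.sigma_sets_subset'[of _ "F s", unfolded sp])
  show "{g -` A \<inter> space M |A. A \<in> sets borel} \<subseteq> sets (F s)" using measurable_sets[OF g] sp by auto
  show "space M \<in> sets (F s)" using sets.top[of "F s"] sp by simp
 qed
 then show "indep_var borel g borel (%w. B t w - B s w)"
  unfolding indep_var_eq
 proof (intro conjI gm dm indep_setI)
  show "sigma_sets (space M) {g -` A \<inter> space M |A. A \<in> sets borel} \<subseteq> events"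
   using gm by (intro sets.sigma_sets_subset) (auto intro: measurable_sets)
  show "sigma_sets (space M) {(%w. B t w - B s w) -` A \<inter> space M |A. A \<in> sets borel} \<subseteq> events"
   using dm by (intro sets.sigma_sets_subset) (auto intro: measurable_sets)
  fix a b assume a: "a \<in> sigma_sets (space M) {g -` A \<inter> space M |A. A \<in> sets borel}"
   and b: "b \<in> sigma_sets (space M) {(%w. B t w - B s w) -` A \<inter> space M |A. A \<in> sets borel}"
  assume sub: "sigma_sets (space M) {g -` A \<inter> space M |A. A \<in> sets borel} \<subseteq> sets (F s)"
  show "prob (a \<inter> b) = prob a * prob b"
   using ind[of b a] a b sub by (auto simp: sets_vimage_algebra Int_commute mult.commute)
 qed
qed

text \<open>\<open>g\<close> is independent of the increment, so the conditional moments are the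
  plain moments of the normal law.\<close>

lemma bm_gauss_steps:
 fixes M :: "'a measure"
 assumes fsp: "filtered_prob_space M F" and B: "brownian_motion M F B"
  and p: "strict_mono p" "0 <= p (0::nat)"
 shows "gauss_steps M (%j. F (p j)) (%j w. B (p (Suc j)) w - B (p j) w) (%j. p (Suc j) - p j)"
proof -
 interpret prob_space M by (rule filtered_prob_spaceD[OF fsp])
 have lt: "p j < p (Suc j)" for j using p(1) by (simp add: strict_mono_Suc_iff)
 have p0: "0 <= p j" for j using p(2) strict_mono_less_eq[OF p(1), of 0 j] by simp
 note inc = bm_increment[OF fsp B p0 lt]
 define D where "D j w = B (p (Suc j)) w - B (p j) w" for j w
 define h where "h j = p (Suc j) - p j" for j
 have h: "0 < h j" for j using lt by (simp add: h_def)
 have Dd: "distributed M lborel (D j) (normal_density 0 (sqrt (h j)))" for j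
  unfolding D_def[abs_def] h_def by (rule inc(1))
 have Di: "integrable M (%w. D j w ^ k)" for j k
  using distributed_integrable[OF Dd[of j], of "%x. x ^ k"] integrable_normal_moment[of "sqrt (h j)" 0 k] h[of j]
  by (simp add: normal_density_nonneg)
 have DE: "expectation (%w. D j w ^ k) = integral\<^sup>L lborel (%x. normal_density 0 (sqrt (h j)) x * (x - 0) ^ k)" for j k
  using distributed_integral[OF Dd[of j], of "%x. x ^ k"] by (simp add: normal_density_nonneg)
 have E1: "expectation (%w. D j w ^ 1) = 0" and E3: "expectation (%w. D j w ^ 3) = 0" for j
  unfolding DE using integral_normal_moment_odd[of "sqrt (h j)" 0 0] integral_normal_moment_odd[of "sqrt (h j)" 0 1] h[of j]
  by auto
 have E2: "expectation (%w. D j w ^ 2) = h j" for j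
  unfolding DE using integral_normal_moment_even[of "sqrt (h j)" 0 1] h[of j] by simp
 have E4: "expectation (%w. D j w ^ 4) = 3 * (h j)^2" for j
  unfolding DE using integral_normal_moment_even[of "sqrt (h j)" 0 2] h[of j]
  by (simp add: fact_numeral power_divide)
 have ind: "indep_var borel g borel (%w. D j w ^ k)" if "g \<in> borel_measurable (F (p j))" for g j k
  using indep_var_compose[OF inc(2)[OF that], of "%x. x" borel "%x. x ^ k" borel]
  by (simp add: comp_def D_def)
 have gi: "integrable M (%w. g w * D j w ^ k)"
  "expectation (%w. g w * D j w ^ k) = expectation g * expectation (%w. D j w ^ k)"
  if "g \<in> borel_measurable (F (p j))" "integrable M g" for g j k
  using indep_var_integrable[OF ind that(2) Di] indep_var_lebesgue_integral[OF ind that(2) Di] that by auto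
 have ad: "B (p j) \<in> borel_measurable (F (p j))" for j
  using B p0 by (simp add: brownian_motion_def adapted_process_def)
 have "gauss_steps M (%j. F (p j)) D h"
 proof (unfold_locales)
  fix i j show "subalgebra M (F (p j))" by (rule filtered_prob_spaceD(2)[OF fsp])
  show "i <= j ==> sets (F (p i)) \<subseteq> sets (F (p j))"
   using p(1) by (intro filtered_prob_spaceD(3)[OF fsp]) (simp add: strict_mono_less_eq)
  have "subalgebra (F (p (Suc j))) (F (p j))"
   using filtered_prob_spaceD(3)[OF fsp, of "p j" "p (Suc j)"] filtered_prob_spaceD(2)[OF fsp, of "p (Suc j)"]
    filtered_prob_spaceD(2)[OF fsp, of "p j"] lt[of j] by (simp add: subalgebra_def)
  then have "B (p j) \<in> borel_measurable (F (p (Suc j)))" using ad by (rule measurable_from_subalg)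
  then show "D j \<in> borel_measurable (F (p (Suc j)))" unfolding D_def[abs_def] using ad by (intro borel_measurable_diff)
  show "0 < h j" by (rule h)
  fix g :: "'a => real" assume g: "g \<in> borel_measurable (F (p j))" "integrable M g"
  show "integrable M (%w. g w * D j w ^ k)" for k by (rule gi[OF g])
  show "expectation (%w. g w * D j w) = 0" using gi(2)[OF g, of 1] E1 by simp
  show "expectation (%w. g w * D j w ^ 2) = h j * expectation g" using gi(2)[OF g, of 2] E2 by simp
  show "expectation (%w. g w * D j w ^ 3) = 0" using gi(2)[OF g, of 3] E3 by simp
  show "expectation (%w. g w * D j w ^ 4) = 3 * (h j)^2 * expectation g" using gi(2)[OF g, of 4] E4 by simp
 qed
 then show ?thesis by (simp add: D_def[abs_def] h_def[abs_def])
qed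

lemma (in prob_space) square_expectation_le:
 fixes X :: "'a => real"
 assumes X: "X \<in> borel_measurable M" "integrable M (%w. (X w)^2)"
 shows "integrable M X" "(expectation X)^2 <= expectation (%w. (X w)^2)"
proof -
 show i: "integrable M X" using integrable_mult_sq[of X "%_. 1"] X by simp
 have "0 <= variance X" by (intro integral_nonneg_AE) auto
 then show "(expectation X)^2 <= expectation (%w. (X w)^2)" using variance_eq[OF i X(2)] by simp
qed

lemma indep_processesD:
 fixes f g :: "(real => real) => real"
 assumes M: "prob_space M" and ind: "independent_processes M B B'"
  and f: "f \<in> borel_measurable (Pi\<^sub>M {0..} (%_. borel))" "integrable M (%w. f (\<lambda>t\<in>{0..}. B t w))"
  and g: "g \<in> borel_measurable (Pi\<^sub>M {0..} (%_. borel))" "integrable M (%w. g (\<lambda>t\<in>{0..}. B' t w))"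
 shows "integrable M (%w. f (\<lambda>t\<in>{0..}. B t w) * g (\<lambda>t\<in>{0..}. B' t w))"
  "integral\<^sup>L M (%w. f (\<lambda>t\<in>{0..}. B t w) * g (\<lambda>t\<in>{0..}. B' t w)) =
   integral\<^sup>L M (%w. f (\<lambda>t\<in>{0..}. B t w)) * integral\<^sup>L M (%w. g (\<lambda>t\<in>{0..}. B' t w))"
proof -
 interpret prob_space M by (rule M)
 have "indep_var borel (%w. f (\<lambda>t\<in>{0..}. B t w)) borel (%w. g (\<lambda>t\<in>{0..}. B' t w))"
  using indep_var_compose[OF ind[unfolded independent_processes_def] f(1) g(1)] by (simp add: comp_def)
 from indep_var_integrable[OF this f(2) g(2)] indep_var_lebesgue_integral[OF this f(2) g(2)]
 show "integrable M (%w. f (\<lambda>t\<in>{0..}. B t w) * g (\<lambda>t\<in>{0..}. B' t w))"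
  "integral\<^sup>L M (%w. f (\<lambda>t\<in>{0..}. B t w) * g (\<lambda>t\<in>{0..}. B' t w)) =
   integral\<^sup>L M (%w. f (\<lambda>t\<in>{0..}. B t w)) * integral\<^sup>L M (%w. g (\<lambda>t\<in>{0..}. B' t w))" by auto
qed

text \<open>Only each of \<open>B\<close>, \<open>B'\<close> separately is assumed to be a Brownian motion of the filtration.
 Subdividing the interval, the off-diagonal products of increments have conditional mean zero,
 and the sum of the diagonal ones tends to 0 in mean square since \<open>B\<close> and \<open>B'\<close> are independent.\<close>

lemma bm_cross:
 assumes fsp: "filtered_prob_space M F" and B: "brownian_motion M F B" and B': "brownian_motion M F B'"
  and ind: "independent_processes M B B'" and st: "0 <= s" "s < t"
  and g: "g \<in> borel_measurable (F s)" "integrable M g"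
 shows "integral\<^sup>L M (%w. g w * ((B t w - B s w) * (B' t w - B' s w))) = 0"
proof -
 interpret prob_space M by (rule filtered_prob_spaceD[OF fsp])
 define D where "D w = B t w - B s w" for w
 define D' where "D' w = B' t w - B' s w" for w
 \<comment> \<open>Bounded test functions come first, so that \<open>g * S\<close> is square
   integrable together with \<open>S\<close>; integrable ones follow by truncation and dominated
   convergence.\<close>
 have bounded: "expectation (%w. g w * (D w * D' w)) = 0"
  if g: "g \<in> borel_measurable (F s)" and C: "!!w. w \<in> space M ==> \<bar>g w\<bar> <= C" for g C
 proof -
  let ?E = "expectation (%w. g w * (D w * D' w))"
  have "?E\<^sup>2 <= C^2 * (t - s)^2 / real N" if N: "0 < N" for N
  proof -
   define h where "h = (t - s) / N"
   have h: "0 < h" using st N by (simp add: h_def)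
   define p where "p j = s + real j * h" for j
   have p: "strict_mono p" "0 <= p 0" using st h by (auto simp: p_def strict_mono_Suc_iff algebra_simps)
   have pp: "0 <= p j" for j using st h by (simp add: p_def)
   have pN: "p N = t" "p 0 = s" using N by (auto simp: p_def h_def)
   define d where "d j w = B (p (Suc j)) w - B (p j) w" for j w
   define d' where "d' j w = B' (p (Suc j)) w - B' (p j) w" for j w
   have ph: "p (Suc j) - p j = h" for j by (simp add: p_def algebra_simps)
   interpret b: gauss_steps M "%j. F (p j)" d "%_. h"
    using bm_gauss_steps[OF fsp B p] by (simp add: d_def[abs_def] ph)
   interpret b': gauss_steps M "%j. F (p j)" d' "%_. h"
    using bm_gauss_steps[OF fsp B' p] by (simp add: d'_def[abs_def] ph)
   have D: "D w = (\<Sum>j<N. d j w)" "D' w = (\<Sum>j<N. d' j w)" for w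
    unfolding D_def D'_def d_def d'_def pN[symmetric] by (simp_all add: sum_lessThan_telescope[of "%j. _ (p j) w"])
   have one: "(%_. 1) \<in> borel_measurable (F (p j))" for j by simp
   have di: "integrable M (%w. d j w ^ k)" "integrable M (%w. d' j w ^ k)" if "k <= 4" for j k
    using b.d_int[OF one _ that, of j] b'.d_int[OF one _ that, of j] by auto
   have d2: "expectation (%w. d j w * d j w) = h" "expectation (%w. d' j w * d' j w) = h" for j
    using b.m2[OF one, of j] b'.m2[OF one, of j] by (auto simp: prob_space power2_eq_square)
   have dd: "integrable M (%w. d j w * d l w)" "integrable M (%w. d' j w * d' l w)" "integrable M (%w. d j w * d' l w)" for j l
    using di[of 2] b.d_M b'.d_M by (auto intro!: integrable_mult_sq)
   have dz: "expectation (%w. d j w * d l w) = 0" if "j < l" for j l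
    using that di(1)[of 1 j] by (intro b.m1 b.meas_up[OF b.d_meas]) auto
   have gM: "g \<in> borel_measurable M" by (rule measurable_from_subalg[OF filtered_prob_spaceD(2)[OF fsp] g])
   have gj: "g \<in> borel_measurable (F (p j))" for j
    using b.meas_up[of g 0 j] g pN by simp
   have gdd: "integrable M (%w. g w * (d j w * d' l w))" for j l
    using b.bounded_mult_integrable[OF gM _ C dd(3)[of j l]] b.d_M b'.d_M by (simp add: mult.commute)
   have off: "expectation (%w. g w * (d j w * d' l w)) = 0" if "j ~= l" for j l
   proof (cases "j < l")
    case True
    have "integrable M (%w. g w * d j w)"
     using b.bounded_mult_integrable[OF gM _ C, of "d j"] di(1)[of 1 j] b.d_M by (simp add: mult.commute)
    moreover have "(%w. g w * d j w) \<in> borel_measurable (F (p l))"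
     using gj[of l] True b.meas_up[OF b.d_meas, of j l] by (intro borel_measurable_times) auto
    ultimately show ?thesis using b'.m1[of "%w. g w * d j w" l] by (simp add: mult.assoc)
   next
    case False
    then have lj: "l < j" using that by simp
    have "integrable M (%w. g w * d' l w)"
     using b.bounded_mult_integrable[OF gM _ C, of "d' l"] di(2)[of 1 l] b'.d_M by (simp add: mult.commute)
    moreover have "(%w. g w * d' l w) \<in> borel_measurable (F (p j))"
     using gj[of j] lj b.meas_up[OF b'.d_meas, of l j] by (intro borel_measurable_times) auto
    ultimately show ?thesis using b.m1[of "%w. g w * d' l w" j] by (simp add: mult_ac)
   qed
   define S where "S w = (\<Sum>j<N. d j w * d' j w)" for w
   have "?E = expectation (%w. \<Sum>j<N. \<Sum>l<N. g w * (d j w * d' l w))"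
    unfolding D sum_product by (simp add: sum_distrib_left)
   also have "... = (\<Sum>j<N. \<Sum>l<N. expectation (%w. g w * (d j w * d' l w)))"
    using gdd by simp
   also have "... = (\<Sum>j<N. \<Sum>l<N. if l = j then expectation (%w. g w * (d j w * d' j w)) else 0)"
    by (intro sum.cong refl) (auto simp: off)
   also have "... = (\<Sum>j<N. expectation (%w. g w * (d j w * d' j w)))" by simp
   also have "... = expectation (%w. g w * S w)"
    using gdd by (simp add: S_def sum_distrib_left)
   finally have E: "?E = expectation (%w. g w * S w)" .
   \<comment> \<open>The first pair of factors is a function of the path of \<open>B\<close>, the
     second of that of \<open>B'\<close>; this is where independence of the whole processes
     enters.\<close>
   have prod: "integrable M (%w. (d j w * d l w) * (d' j w * d' l w))"
    "expectation (%w. (d j w * d l w) * (d' j w * d' l w)) = expectation (%w. d j w * d l w) * expectation (%w. d' j w * d' l w)" for j l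
   proof -
    let ?f = "%x::real => real. (x (p (Suc j)) - x (p j)) * (x (p (Suc l)) - x (p l))"
    have [measurable]: "(%x. x (p i)) \<in> borel_measurable (Pi\<^sub>M {0..} (%_. borel))" for i
     using pp by (intro measurable_component_singleton) simp
    have "?f \<in> borel_measurable (Pi\<^sub>M {0..} (%_. borel))" by measurable
    from indep_processesD[OF prob_space_axioms ind this _ this] dd(1,2)[of j l] pp
    show "integrable M (%w. (d j w * d l w) * (d' j w * d' l w))"
    "expectation (%w. (d j w * d l w) * (d' j w * d' l w)) = expectation (%w. d j w * d l w) * expectation (%w. d' j w * d' l w)"
     by (auto simp: d_def d'_def)
   qed
   have S2: "(S w)^2 = (\<Sum>j<N. \<Sum>l<N. (d j w * d l w) * (d' j w * d' l w))" for w
    unfolding S_def power2_eq_square sum_product by (intro sum.cong refl) (simp add: mult_ac)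
   have S2i: "integrable M (%w. (S w)^2)" unfolding S2 using prod by auto
   have "expectation (%w. (S w)^2) = (\<Sum>j<N. \<Sum>l<N. expectation (%w. d j w * d l w) * expectation (%w. d' j w * d' l w))"
    unfolding S2 using prod by simp
   \<comment> \<open>Only the diagonal survives and gives \<open>N * h^2 = (t - s)^2 / N\<close>,
     which tends to 0 under refinement.\<close>
   also have "... = (\<Sum>j<N. \<Sum>l<N. if l = j then h\<^sup>2 else 0)"
   proof (intro sum.cong refl)
    fix j l
    have "expectation (%w. d j w * d l w) = 0" if "l ~= j"
     using that dz[of j l] dz[of l j] by (cases "j < l") (auto simp: mult.commute)
    then show "expectation (%w. d j w * d l w) * expectation (%w. d' j w * d' l w) = (if l = j then h\<^sup>2 else 0)"
     using d2[of j] by (auto simp: power2_eq_square)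
   qed
   also have "... = (t - s)^2 / N" using N by (simp add: h_def power2_eq_square)
   finally have S2E: "expectation (%w. (S w)^2) = (t - s)^2 / N" .
   have SM: "S \<in> borel_measurable M" unfolding S_def[abs_def] using b.d_M b'.d_M by (intro borel_measurable_sum borel_measurable_times) auto
   have gS: "(g w * S w)^2 <= C^2 * (S w)^2" if "w \<in> space M" for w
    using power_mono[OF C[OF that], of 2] by (simp add: power_mult_distrib mult_right_mono)
   have gSi: "integrable M (%w. (g w * S w)^2)"
   proof (rule Bochner_Integration.integrable_bound)
    show "integrable M (%w. C^2 * (S w)^2)" using S2i by simp
    show "(%w. (g w * S w)^2) \<in> borel_measurable M"
     by (intro borel_measurable_power borel_measurable_times gM SM)
    show "AE w in M. norm ((g w * S w)^2) <= norm (C^2 * (S w)^2)"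
    proof (rule AE_I2)
     fix w assume "w \<in> space M"
     from order_trans[OF gS[OF this] abs_ge_self] show "norm ((g w * S w)^2) <= norm (C^2 * (S w)^2)" by simp
    qed
   qed
   have "(expectation (%w. g w * S w))^2 <= expectation (%w. (g w * S w)^2)"
    by (rule square_expectation_le(2)[OF borel_measurable_times[OF gM SM] gSi])
   also have "... <= expectation (%w. C^2 * (S w)^2)" using gSi S2i gS by (intro integral_mono) auto
   also have "... = C^2 * (t - s)^2 / N" using S2E by simp
   finally show ?thesis using E by simp
  qed
  moreover have "(%N. C^2 * (t - s)^2 / real N) \<longlonglongrightarrow> 0" by (rule lim_const_over_n)
  ultimately have "?E\<^sup>2 <= 0"
   by (intro LIMSEQ_le_const[of "%N. C^2 * (t - s)^2 / real N" 0]) (auto intro!: exI[of _ 1])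
  then show ?thesis by simp
 qed
 define p where "p j = s + real j * (t - s)" for j
 have p: "strict_mono p" "0 <= p 0" using st by (auto simp: p_def strict_mono_Suc_iff algebra_simps)
 interpret b: gauss_steps M "%j. F (p j)" "%j w. B (p (Suc j)) w - B (p j) w" "%j. p (Suc j) - p j"
  by (rule bm_gauss_steps[OF fsp B p])
 interpret b': gauss_steps M "%j. F (p j)" "%j w. B' (p (Suc j)) w - B' (p j) w" "%j. p (Suc j) - p j"
  by (rule bm_gauss_steps[OF fsp B' p])
 have p01: "p 0 = s" "p (Suc 0) = t" by (auto simp: p_def)
 have gM[measurable]: "g \<in> borel_measurable M" by (rule measurable_from_subalg[OF filtered_prob_spaceD(2)[OF fsp] g(1)])
 have Dm[measurable]: "D \<in> borel_measurable M" "D' \<in> borel_measurable M"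
  using b.d_M[of 0] b'.d_M[of 0] unfolding p01 D_def[abs_def] D'_def[abs_def] by auto
 have ag: "(%w. \<bar>g w\<bar>) \<in> borel_measurable (F (p 0))" "integrable M (%w. \<bar>g w\<bar>)"
  using g p01 by auto
 have dom: "integrable M (%w. \<bar>g w\<bar> * (D w)^2 + \<bar>g w\<bar> * (D' w)^2)"
  using b.d_int[OF ag, of 2] b'.d_int[OF ag, of 2] unfolding p01 D_def D'_def by auto
 define gn where "gn n w = (if \<bar>g w\<bar> <= real n then g w else 0)" for n w
 have gnm: "gn n \<in> borel_measurable (F s)" for n
  unfolding gn_def[abs_def] using g(1) by measurable
 have z: "expectation (%w. gn n w * (D w * D' w)) = 0" for n
  by (rule bounded[OF gnm, of _ "real n"]) (auto simp: gn_def)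
 have gnM[measurable]: "gn n \<in> borel_measurable M" for n by (rule measurable_from_subalg[OF filtered_prob_spaceD(2)[OF fsp] gnm])
 have "(%n. expectation (%w. gn n w * (D w * D' w))) \<longlonglongrightarrow> expectation (%w. g w * (D w * D' w))"
 proof (rule integral_dominated_convergence[OF _ _ dom])
  show "AE x in M. (%n. gn n x * (D x * D' x)) \<longlonglongrightarrow> g x * (D x * D' x)"
  proof (rule AE_I2)
   fix x
   have "\<forall>\<^sub>F n in sequentially. g x = gn n x"
    using eventually_ge_at_top[of "nat \<lceil>\<bar>g x\<bar>\<rceil>"] by eventually_elim (auto simp: gn_def ceiling_le_iff nat_le_iff)
   then have "(%n. gn n x) \<longlonglongrightarrow> g x" by (rule Lim_transform_eventually[OF tendsto_const])
   then show "(%n. gn n x * (D x * D' x)) \<longlonglongrightarrow> g x * (D x * D' x)" by (intro tendsto_mult tendsto_const)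
  qed
  show "AE x in M. norm (gn n x * (D x * D' x)) <= \<bar>g x\<bar> * (D x)^2 + \<bar>g x\<bar> * (D' x)^2" for n
  proof (rule AE_I2)
   fix x
   have "\<bar>D x\<bar> * \<bar>D' x\<bar> <= (D x)^2 + (D' x)^2"
   proof -
    have "2 * \<bar>D x\<bar> * \<bar>D' x\<bar> <= \<bar>D x\<bar>\<^sup>2 + \<bar>D' x\<bar>\<^sup>2" by (rule sum_squares_bound)
    moreover have "0 <= \<bar>D x\<bar> * \<bar>D' x\<bar>" by (rule mult_nonneg_nonneg) auto
    ultimately have "\<bar>D x\<bar> * \<bar>D' x\<bar> <= \<bar>D x\<bar>\<^sup>2 + \<bar>D' x\<bar>\<^sup>2" by linarith
    then show ?thesis by simp
   qed
   moreover have "\<bar>gn n x\<bar> <= \<bar>g x\<bar>" by (auto simp: gn_def)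
   ultimately have "\<bar>gn n x\<bar> * (\<bar>D x\<bar> * \<bar>D' x\<bar>) <= \<bar>g x\<bar> * ((D x)^2 + (D' x)^2)" by (intro mult_mono) auto
   then show "norm (gn n x * (D x * D' x)) <= \<bar>g x\<bar> * (D x)^2 + \<bar>g x\<bar> * (D' x)^2"
    by (simp add: abs_mult distrib_left)
  qed
 qed auto
 then have "expectation (%w. g w * (D w * D' w)) = 0" unfolding z by (simp add: LIMSEQ_const_iff)
 then show ?thesis by (simp add: D_def D'_def)
qed

lemma bm_gauss_pair:
 assumes fsp: "filtered_prob_space M F" and B: "brownian_motion M F B" and B': "brownian_motion M F B'"
  and ind: "independent_processes M B B'" and p: "strict_mono p" "0 <= p (0::nat)"
 shows "gauss_pair M (%j. F (p j)) (%j w. B (p (Suc j)) w - B (p j) w)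
  (%j w. B' (p (Suc j)) w - B' (p j) w) (%j. p (Suc j) - p j)"
proof -
 interpret b: gauss_steps M "%j. F (p j)" "%j w. B (p (Suc j)) w - B (p j) w" "%j. p (Suc j) - p j"
  by (rule bm_gauss_steps[OF fsp B p])
 interpret b': gauss_steps M "%j. F (p j)" "%j w. B' (p (Suc j)) w - B' (p j) w" "%j. p (Suc j) - p j"
  by (rule bm_gauss_steps[OF fsp B' p])
 have lt: "p j < p (Suc j)" for j using p(1) by (simp add: strict_mono_Suc_iff)
 have p0: "0 <= p j" for j using p(2) strict_mono_less_eq[OF p(1), of 0 j] by simp
 show ?thesis
  by unfold_locales (rule bm_cross[OF fsp B B' ind p0 lt])
qed

text \<open>Independence of the last increment from the earlier sum makes the characteristic
  function multiplicative.\<close>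

lemma bm_char:
 assumes fsp: "filtered_prob_space M F" and B: "brownian_motion M F B"
  and p: "strict_mono p" "0 <= p (0::nat)"
 shows "char (distr M borel (%w. \<Sum>j<L. a j * (B (p (Suc j)) w - B (p j) w))) t =
  complex_of_real (exp (- (t^2 * (\<Sum>j<L. (a j)^2 * (p (Suc j) - p j))) / 2))"
proof (induction L)
 interpret prob_space M by (rule filtered_prob_spaceD[OF fsp])
 case 0
 show ?case by (simp add: char_def integral_distr prob_space del: distr_const)
next
 interpret prob_space M by (rule filtered_prob_spaceD[OF fsp])
 interpret b: gauss_steps M "%j. F (p j)" "%j w. B (p (Suc j)) w - B (p j) w" "%j. p (Suc j) - p j"
  by (rule bm_gauss_steps[OF fsp B p])
 case (Suc L)
 let ?S = "%w. \<Sum>j<L. a j * (B (p (Suc j)) w - B (p j) w)"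
 let ?d = "%w. B (p (Suc L)) w - B (p L) w"
 have lt: "p L < p (Suc L)" using p(1) by (simp add: strict_mono_Suc_iff)
 have p0: "0 <= p L" using p(2) strict_mono_less_eq[OF p(1), of 0 L] by simp
 have S: "?S \<in> borel_measurable (F (p L))" by (rule b.sum_meas) simp
 have "indep_var borel ?S borel (%w. a L * ?d w)"
  using indep_var_compose[OF bm_increment(2)[OF fsp B p0 lt S], of "%x. x" borel "%x. a L * x" borel] by (simp add: comp_def)
 from char_distr_add[OF this, of t]
 have 1: "char (distr M borel (%w. \<Sum>j<Suc L. a j * (B (p (Suc j)) w - B (p j) w))) t =
  char (distr M borel ?S) t * char (distr M borel (%w. a L * ?d w)) t" by simp
 let ?h = "p (Suc L) - p L"
 have h: "0 < sqrt ?h" using lt by simp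
 have dm: "?d \<in> borel_measurable M" by (rule b.d_M)
 have "distributed M lborel (%x. (?d x - 0) / sqrt ?h) std_normal_density"
  using bm_increment(1)[OF fsp B p0 lt] normal_standard_normal_convert[OF h, of ?d 0] by simp
 then have dd: "distr M lborel (%x. ?d x / sqrt ?h) = std_normal_distribution"
  by (simp add: distributed_distr_eq_density)
 have "char (distr M borel (%w. a L * ?d w)) t = (CLINT x|M. iexp (t * (a L * ?d x)))"
  using dm by (simp add: char_def integral_distr)
 also have "... = (CLINT x|M. iexp ((t * a L * sqrt ?h) * (?d x / sqrt ?h)))"
  using h by (simp add: mult.assoc)
 also have "... = (CLINT x|distr M lborel (%x. ?d x / sqrt ?h). iexp ((t * a L * sqrt ?h) * x))"
  using dm by (subst integral_distr) auto
 also have "... = char std_normal_distribution (t * a L * sqrt ?h)" unfolding dd by (simp add: char_def)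
 also have "... = complex_of_real (exp (- (t^2 * ((a L)^2 * ?h)) / 2))"
  using h by (simp add: char_std_normal_distribution power_mult_distrib mult.assoc)
 finally show ?case unfolding 1 Suc.IH
  by (simp add: exp_add[symmetric] of_real_mult[symmetric] field_simps del: of_real_mult)
qed

section \<open>Cadlag paths\<close>

text \<open>One radius serves both sides. At \<open>t = 0\<close> there is no left limit;
  \<open>l\<close> is then arbitrary and the last two conclusions are vacuous.\<close>

lemma cadlag_nhd:
 assumes f: "cadlag f" and t: "0 <= t" and e: "0 < e"
 obtains \<delta> l where "0 < \<delta>" "!!u. t <= u ==> u < t + \<delta> ==> \<bar>f u - f t\<bar> < e"
  "!!u. 0 <= u ==> t - \<delta> < u ==> u < t ==> \<bar>f u - l\<bar> < e" "0 < t ==> (f \<longlongrightarrow> l) (at_left t)"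
proof -
 have "(f \<longlongrightarrow> f t) (at_right t)" using f t by (auto simp: cadlag_def continuous_within)
 then have "\<forall>\<^sub>F u in at_right t. dist (f u) (f t) < e" using e by (rule tendstoD)
 then obtain b where b: "t < b" "!!u. t < u ==> u < b ==> dist (f u) (f t) < e"
  unfolding eventually_at_right_field by blast
 obtain l a where a: "a < t" "!!u. 0 <= u ==> a < u ==> u < t ==> dist (f u) l < e" "0 < t ==> (f \<longlongrightarrow> l) (at_left t)"
 proof (cases "0 < t")
  case True
  then obtain l where l: "(f \<longlongrightarrow> l) (at_left t)" using f by (auto simp: cadlag_def)
  then have "\<forall>\<^sub>F u in at_left t. dist (f u) l < e" using e by (rule tendstoD)
  then obtain a where "a < t" "!!u. a < u ==> u < t ==> dist (f u) l < e"
   unfolding eventually_at_left_field by blast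
  then show ?thesis using that l by blast
 next
  case False
  then show ?thesis using that[of "t - 1" 0] t by auto
 qed
 show ?thesis
 proof (rule that[of "min (b - t) (t - a)" l])
  fix u assume "t <= u" "u < t + min (b - t) (t - a)"
  then show "\<bar>f u - f t\<bar> < e" using b(2)[of u] e by (cases "u = t") (auto simp: dist_real_def)
 next
  fix u assume "0 <= u" "t - min (b - t) (t - a) < u" "u < t"
  then show "\<bar>f u - l\<bar> < e" using a(2)[of u] by (auto simp: dist_real_def)
 qed (use a b in auto)
qed

text \<open>Bisection: boundedness passes to the union of adjacent intervals and holds on short ones
  by \<open>cadlag_nhd\<close>. Intersecting with \<open>{0..}\<close> takes care of intervals that
  reach below 0.\<close>

lemma cadlag_bounded:
 assumes f: "cadlag f" and T: "0 <= T"
 obtains C where "0 <= C" "!!t. t \<in> {0..T} ==> \<bar>f t\<bar> <= C"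
proof -
 let ?P = "%a b. \<exists>C. \<forall>u\<in>{a..b} \<inter> {0..}. \<bar>f u\<bar> <= C"
 have "?P 0 T"
 proof (rule Bolzano[of 0 T ?P])
  show "0 <= T" by (rule T)
  fix a b c
  assume trans: "?P a b" "?P b c"
  from trans(1) obtain C where "\<forall>u\<in>{a..b} \<inter> {0..}. \<bar>f u\<bar> <= C" by blast
  moreover from trans(2) obtain D where "\<forall>u\<in>{b..c} \<inter> {0..}. \<bar>f u\<bar> <= D" by blast
  ultimately have "\<bar>f u\<bar> <= max C D" if "u \<in> {a..c} \<inter> {0..}" for u
   using that by (cases "u <= b") (auto simp: le_max_iff_disj)
  then show "?P a c" by blast
 next
  fix t assume local: "0 <= t" "t <= T"
  obtain \<delta> l where \<delta>: "0 < \<delta>" "!!u. t <= u ==> u < t + \<delta> ==> \<bar>f u - f t\<bar> < 1"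
   "!!u. 0 <= u ==> t - \<delta> < u ==> u < t ==> \<bar>f u - l\<bar> < 1"
   by (rule cadlag_nhd[OF f local(1), of 1]) auto
  show "\<exists>d>0. \<forall>a b. a <= t \<and> t <= b \<and> b - a < d --> ?P a b"
  proof (rule exI[of _ \<delta>], intro conjI allI impI \<delta>(1))
   fix a b assume ab: "a <= t \<and> t <= b \<and> b - a < \<delta>"
   show "?P a b"
   proof (intro exI[of _ "max (\<bar>f t\<bar> + 1) (\<bar>l\<bar> + 1)"] ballI)
    fix u assume u: "u \<in> {a..b} \<inter> {0..}"
    show "\<bar>f u\<bar> <= max (\<bar>f t\<bar> + 1) (\<bar>l\<bar> + 1)"
     using \<delta>(2)[of u] \<delta>(3)[of u] ab u by (cases "t <= u") auto
   qed
  qed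
 qed
 then obtain C where "\<forall>u\<in>{0..T} \<inter> {0..}. \<bar>f u\<bar> <= C" by blast
 then have C: "!!u. u \<in> {0..T} ==> \<bar>f u\<bar> <= C" by simp
 have "0 <= C" using C[of 0] T by (auto intro: order_trans[OF abs_ge_zero])
 with C show ?thesis using that by blast
qed

text \<open>Jumps above a fixed size do not accumulate: close to any \<open>t\<close> the path stays
  near \<open>f t\<close> on the right and near its left limit on the left. The set
  \<open>D k\<close> of jumps above \<open>1 / (k + 1)\<close> is thus sparse, hence countable, and
  by right-continuity the sets \<open>D k\<close> exhaust the discontinuities.\<close>

lemma cadlag_countable_discont:
 assumes f: "cadlag f"
 shows "countable {t. 0 < t \<and> \<not> isCont f t}"
proof -
 have "\<forall>t\<in>{0<..}. \<exists>l. (f \<longlongrightarrow> l) (at_left t)" using f by (auto simp: cadlag_def)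
 then obtain l where l: "!!t. 0 < t ==> (f \<longlongrightarrow> l t) (at_left t)" by (metis greaterThan_iff)
 define D where "D k = {t. 0 < t \<and> 1 / real (Suc k) < \<bar>l t - f t\<bar>}" for k
 have sp: "D k sparse_in {0<..}" for k
  unfolding sparse_in_ball_def
 proof (intro ballI)
  fix t :: real assume t: "t \<in> {0<..}"
  \<comment> \<open>Half the jump size of \<open>D k\<close>: value and left limit at
    \<open>u\<close> both lie within \<open>e\<close> of the same constant.\<close>
  define e where "e = 1 / (2 * real (Suc k))"
  have e: "0 < e" by (simp add: e_def)
  obtain \<delta> m where \<delta>: "0 < \<delta>" "!!u. t <= u ==> u < t + \<delta> ==> \<bar>f u - f t\<bar> < e"
   "!!u. 0 <= u ==> t - \<delta> < u ==> u < t ==> \<bar>f u - m\<bar> < e"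
   using cadlag_nhd[OF f _ e, of t] t by (metis greaterThan_iff less_imp_le)
  define r where "r = min \<delta> t"
  have sub: "D k \<inter> ball t r \<subseteq> {t}"
  proof (rule ccontr)
   assume "\<not> ?thesis"
   then obtain u where u: "u \<in> D k" "u \<in> ball t r" "u ~= t" by blast
   define c where "c = (if t < u then f t else m)"
   have u0: "0 < u" "\<bar>u - t\<bar> < \<delta>" "\<bar>u - t\<bar> < t" using u t by (auto simp: D_def r_def dist_real_def)
   have fu: "\<bar>f v - c\<bar> <= e" if v: "v <= u" "max (u / 2) (if t < u then t else t - \<delta>) < v" for v
    using \<delta>(2)[of v] \<delta>(3)[of v] v u u0 unfolding c_def by (cases "t < u") auto
   have le: "max (u / 2) (if t < u then t else t - \<delta>) < u" using u0 u(3) by auto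
   have "\<forall>\<^sub>F v in at_left u. \<bar>f v - c\<bar> <= e"
    unfolding eventually_at_left_field using fu le by (intro exI[of _ "max (u / 2) (if t < u then t else t - \<delta>)"]) auto
   moreover have "((%v. \<bar>f v - c\<bar>) \<longlongrightarrow> \<bar>l u - c\<bar>) (at_left u)" by (intro tendsto_intros l u0)
   ultimately have "\<bar>l u - c\<bar> <= e" by (intro tendsto_upperbound) auto
   moreover have "\<bar>f u - c\<bar> <= e" using fu[of u] le by auto
   ultimately have "\<bar>l u - f u\<bar> <= 2 * e" by linarith
   moreover have "2 * e = 1 / real (Suc k)" by (simp add: e_def field_simps)
   ultimately show False using u(1) by (simp add: D_def)
  qed
  show "\<exists>e>0. \<forall>y\<in>ball t e. \<not> y islimpt D k"
  proof (intro exI[of _ r] conjI ballI notI)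
   show "0 < r" using \<delta> t by (simp add: r_def)
   fix y assume y: "y \<in> ball t r" "y islimpt D k"
   obtain d where d: "0 < d" "ball y d \<subseteq> ball t r" using y(1) open_ball open_contains_ball by blast
   have "infinite (D k \<inter> ball y d)" using y(2) d(1) by (simp add: islimpt_eq_infinite_ball)
   moreover have "D k \<inter> ball y d \<subseteq> {t}" using d sub by blast
   ultimately show False using finite_subset by blast
  qed
 qed
 have "countable ({0<..} \<inter> D k)" for k by (rule sparse_imp_countable[OF _ sp]) simp
 moreover have "{t. 0 < t \<and> \<not> isCont f t} \<subseteq> (\<Union>k. {0<..} \<inter> D k)"
 proof safe
  fix t :: real assume t: "0 < t" "\<not> isCont f t"
  have "l t ~= f t"
  proof
   assume eq: "l t = f t"
   have "(f \<longlongrightarrow> f t) (at_right t)" using f t by (auto simp: cadlag_def continuous_within)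
   then have "(f \<longlongrightarrow> f t) (at t)" using l[OF t(1)] eq by (simp add: filterlim_split_at)
   then show False using t by (simp add: isCont_def)
  qed
  then obtain k where "1 / real (Suc k) < \<bar>l t - f t\<bar>" using nat_approx_posE[of "\<bar>l t - f t\<bar>"] by auto
  then show "t \<in> (\<Union>k. {0<..} \<inter> D k)" using t by (auto simp: D_def)
 qed
 ultimately show ?thesis by (meson countable_UN countable_subset countableI_type)
qed

lemma cadlag_AE_isCont:
 assumes "cadlag f"
 shows "AE s in lborel. 0 < s --> isCont f s"
proof (rule AE_I')
 show "{t. 0 < t \<and> \<not> isCont f t} \<in> null_sets lborel"
  by (rule countable_imp_null_set_lborel[OF cadlag_countable_discont[OF assms]])
qed auto

text \<open>Nothing is known for negative times; the value 0 there makes the function continuous off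
  a countable set.\<close>

lemma cadlag_measurable:
 assumes f: "cadlag f"
 shows "(%s. if 0 <= s then f s else 0) \<in> borel_measurable borel"
proof (rule borel_measurable_continuous_countable_exceptions)
 show "countable ({t. 0 < t \<and> \<not> isCont f t} \<union> {0})" using cadlag_countable_discont[OF f] by simp
 show "continuous_on (- ({t. 0 < t \<and> \<not> isCont f t} \<union> {0})) (%s. if 0 <= s then f s else 0)"
 proof (rule continuous_at_imp_continuous_on, rule ballI)
  fix x assume x: "x \<in> - ({t. 0 < t \<and> \<not> isCont f t} \<union> {0})"
  show "isCont (%s. if 0 <= s then f s else 0) x"
  proof (cases "0 < x")
   case True
   have ev: "\<forall>\<^sub>F s in nhds x. (if 0 <= s then f s else 0) = f s"
    using eventually_nhds_in_open[of "{0<..}" x] True by (auto elim!: eventually_mono)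
   have "isCont f x" using x True by auto
   then show ?thesis using isCont_cong[OF ev] by simp
  next
   case False
   have ev: "\<forall>\<^sub>F s in nhds x. (if 0 <= s then f s else 0) = 0"
    using eventually_nhds_in_open[of "{..<0}" x] False x by (auto elim!: eventually_mono)
   show ?thesis using isCont_cong[OF ev] by simp
  qed
 qed
qed

lemma cadlag_const [intro]: "cadlag (%_. c)"
 by (auto simp: cadlag_def)

lemma cadlag_continuous [intro]: "(!!t. isCont f t) ==> cadlag f"
 unfolding cadlag_def
 by (metis continuous_at_imp_continuous_at_within continuous_within filterlim_at_split isCont_def)

lemma cadlag_mult [intro]: "cadlag f ==> cadlag g ==> cadlag (%t. f t * g t)"
proof -
 assume f: "cadlag f" and g: "cadlag g"
 have "\<exists>l. ((%t. f t * g t) \<longlongrightarrow> l) (at_left t)" if "0 < t" for t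
 proof -
  from f that obtain l where l: "(f \<longlongrightarrow> l) (at_left t)" by (auto simp: cadlag_def)
  from g that obtain l' where "(g \<longlongrightarrow> l') (at_left t)" by (auto simp: cadlag_def)
  from tendsto_mult[OF l this] show ?thesis by (rule exI)
 qed
 moreover have "continuous (at_right t) (%t. f t * g t)" if "0 <= t" for t
  using f g that by (auto simp: cadlag_def intro: continuous_mult)
 ultimately show ?thesis by (simp add: cadlag_def)
qed

lemma cadlag_add [intro]: "cadlag f ==> cadlag g ==> cadlag (%t. f t + g t)"
proof -
 assume f: "cadlag f" and g: "cadlag g"
 have "\<exists>l. ((%t. f t + g t) \<longlongrightarrow> l) (at_left t)" if "0 < t" for t
 proof -
  from f that obtain l where l: "(f \<longlongrightarrow> l) (at_left t)" by (auto simp: cadlag_def)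
  from g that obtain l' where "(g \<longlongrightarrow> l') (at_left t)" by (auto simp: cadlag_def)
  from tendsto_add[OF l this] show ?thesis by (rule exI)
 qed
 moreover have "continuous (at_right t) (%t. f t + g t)" if "0 <= t" for t
  using f g that by (auto simp: cadlag_def intro: continuous_add)
 ultimately show ?thesis by (simp add: cadlag_def)
qed

lemma cadlag_power [intro]: "cadlag f ==> cadlag (%t. f t ^ n)"
 by (induction n) auto

definition clip :: "real => real => real" where
 "clip K x = max (- K) (min K x)"

lemma clip_abs: "0 <= K ==> \<bar>clip K x\<bar> <= K"
 by (auto simp: clip_def)

lemma clip_id: "\<bar>x\<bar> <= K ==> clip K x = x"
 by (auto simp: clip_def)

lemma clip_measurable [measurable]: "clip K \<in> borel_measurable borel"
 unfolding clip_def by measurable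

lemma cadlag_clip [intro]: "cadlag f ==> cadlag (%t. clip K (f t))"
proof -
 assume f: "cadlag f"
 have "\<exists>l. ((%t. clip K (f t)) \<longlongrightarrow> l) (at_left t)" if "0 < t" for t
 proof -
  from f that obtain l where l: "(f \<longlongrightarrow> l) (at_left t)" by (auto simp: cadlag_def)
  have "((%t. clip K (f t)) \<longlongrightarrow> clip K l) (at_left t)" unfolding clip_def by (intro tendsto_max tendsto_min tendsto_const l)
  then show ?thesis by (rule exI)
 qed
 moreover have "continuous (at_right t) (%t. clip K (f t))" if "0 <= t" for t
 proof -
  from f that have c: "continuous (at_right t) f" by (simp add: cadlag_def)
  show ?thesis unfolding clip_def by (rule continuous_max[OF continuous_const continuous_min[OF continuous_const c]])
 qed
 ultimately show ?thesis by (simp add: cadlag_def)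
qed

text \<open>The last point of the grid of mesh \<open>T / n\<close> not after \<open>s\<close>; the
  value is 0 when \<open>n = 0\<close>. A frozen integrand is the path composed with this function,
  which turns sums into integrals.\<close>

definition gfl :: "real => nat => real => real" where
 "gfl T n s = of_int \<lfloor>s * n / T\<rfloor> * (T / n)"

lemma gfl_measurable [measurable]: "gfl T n \<in> borel_measurable borel"
 unfolding gfl_def by measurable

context
 fixes T :: real and n :: nat
 assumes T: "0 < T" and n: "0 < n"
begin

lemma gfl_le: "gfl T n s <= s"
proof -
 have "of_int \<lfloor>s * n / T\<rfloor> * (T / n) <= (s * n / T) * (T / n)" using T n by (intro mult_right_mono) auto
 then show ?thesis using T n by (simp add: gfl_def)
qed

lemma gfl_gt: "s - T / n < gfl T n s"
proof -
 have "s * n / T < of_int \<lfloor>s * n / T\<rfloor> + 1" by linarith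
 then have "(s * n / T) * (T / n) < (of_int \<lfloor>s * n / T\<rfloor> + 1) * (T / n)" using T n by (intro mult_strict_right_mono) auto
 moreover have "(s * n / T) * (T / n) = s" using T n by simp
 moreover have "(of_int \<lfloor>s * n / T\<rfloor> + 1) * (T / n) = of_int \<lfloor>s * n / T\<rfloor> * (T / n) + T / n"
  by (simp only: distrib_right mult_1)
 ultimately show ?thesis unfolding gfl_def by linarith
qed

lemma gfl_nonneg: "0 <= s ==> 0 <= gfl T n s"
 using T by (simp add: gfl_def)

lemma gfl_range: "s \<in> {0..T} ==> gfl T n s \<in> {0..T}"
 using gfl_nonneg[of s] gfl_le[of s] by auto

lemma gfl_cell: "real j * (T / n) <= s ==> s < (real j + 1) * (T / n) ==> gfl T n s = real j * (T / n)"
proof -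
 assume a: "real j * (T / n) <= s" "s < (real j + 1) * (T / n)"
 have "\<lfloor>s * n / T\<rfloor> = int j"
  using a T n by (intro floor_unique) (auto simp: field_simps)
 then show ?thesis by (simp add: gfl_def)
qed

text \<open>The half-open interval matters: at \<open>s = T\<close> the function \<open>gfl\<close>
  returns \<open>T\<close>, which is not the left end of one of the \<open>n\<close> cells. This
  single point is dropped in the integral that follows.\<close>

lemma gfl_sum_indicator:
 fixes f :: "real => real"
 shows "indicator {0..<T} s * f (gfl T n s) = (\<Sum>j<n. f (real j * (T / n)) * indicator {real j * (T / n)..<(real j + 1) * (T / n)} s)"
proof (cases "s \<in> {0..<T}")
 case True
 define j where "j = nat \<lfloor>s * n / T\<rfloor>"
 have "0 <= s * n / T" using True T by simp
 then have jr: "real j = of_int \<lfloor>s * n / T\<rfloor>" by (simp add: j_def)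
 have "s * n / T < n" using True T n by (simp add: field_simps)
 then have jn: "j < n" using jr by linarith
 have "real j <= s * n / T" "s * n / T < real j + 1" unfolding jr by linarith+
 then have js: "real j * (T / n) <= s" "s < (real j + 1) * (T / n)" using T n by (auto simp: field_simps)
 have "(\<Sum>i<n. f (real i * (T / n)) * indicator {real i * (T / n)..<(real i + 1) * (T / n)} s)
   = (\<Sum>i<n. if i = j then f (real j * (T / n)) else 0)"
 proof (intro sum.cong refl)
  fix i
  have "s \<in> {real i * (T / n)..<(real i + 1) * (T / n)} \<longleftrightarrow> i = j"
  proof
   assume "s \<in> {real i * (T / n)..<(real i + 1) * (T / n)}"
   then have "gfl T n s = real i * (T / n)" by (intro gfl_cell) auto
   moreover have "gfl T n s = real j * (T / n)" by (rule gfl_cell[OF js])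
   ultimately show "i = j" using T n by simp
  qed (use js in auto)
  then show "f (real i * (T / n)) * indicator {real i * (T / n)..<(real i + 1) * (T / n)} s = (if i = j then f (real j * (T / n)) else 0)"
   by (auto simp: indicator_def)
 qed
 also have "... = f (gfl T n s)" using jn gfl_cell[OF js] by simp
 finally show ?thesis using True by simp
next
 case False
 have "s \<notin> {real j * (T / n)..<(real j + 1) * (T / n)}" if "j < n" for j
 proof
  assume s: "s \<in> {real j * (T / n)..<(real j + 1) * (T / n)}"
  have "(real j + 1) * (T / n) <= n * (T / n)" using that T by (intro mult_right_mono) auto
  moreover have "0 <= real j * (T / n)" using T by simp
  ultimately show False using s False n by auto
 qed
 then have "(\<Sum>j<n. f (real j * (T / n)) * indicator {real j * (T / n)..<(real j + 1) * (T / n)} s) = 0"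
  by (intro sum.neutral) auto
 then show ?thesis using False by simp
qed

lemma gfl_integral:
 fixes f :: "real => real"
 shows "(LINT s:{0..T}|lborel. f (gfl T n s)) = (\<Sum>j<n. T / n * f (real j * (T / n)))"
proof -
 have "(LINT s:{0..T}|lborel. f (gfl T n s)) = (LINT s:{0..<T}|lborel. f (gfl T n s))"
 proof -
  have 1: "(%s. indicator {0..<T} s * f (gfl T n s)) \<in> borel_measurable lborel"
   unfolding gfl_sum_indicator by measurable
  have eq: "indicator {0..T} s * f (gfl T n s) = indicator {0..<T} s * f (gfl T n s) + indicator {T} s * f (gfl T n T)" for s
   using T by (auto simp: indicator_def)
  have 2: "(%s. indicator {0..T} s * f (gfl T n s)) \<in> borel_measurable lborel"
   unfolding eq using 1 by measurable
  have "AE s in lborel. s ~= T" by (rule AE_lborel_singleton)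
  then have "AE s in lborel. indicator {0..T} s *\<^sub>R f (gfl T n s) = indicator {0..<T} s *\<^sub>R f (gfl T n s)"
   by eventually_elim (auto simp: indicator_def)
  then show ?thesis unfolding set_lebesgue_integral_def using 1 2 by (intro integral_cong_AE) auto
 qed
 also have "... = (LINT s|lborel. (\<Sum>j<n. f (real j * (T / n)) * indicator {real j * (T / n)..<(real j + 1) * (T / n)} s))"
  unfolding set_lebesgue_integral_def by (simp add: gfl_sum_indicator)
 also have "... = (\<Sum>j<n. T / n * f (real j * (T / n)))"
 proof -
  have le: "real j * (T / n) <= (real j + 1) * (T / n)" for j using T by (intro mult_right_mono) auto
  have int: "integrable lborel (%s. f c * indicator {real j * (T / n)..<(real j + 1) * (T / n)} s)" for c j
  proof (intro integrable_mult_right integrable_real_indicator)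
   show "emeasure lborel {real j * (T / n)..<(real j + 1) * (T / n)} < \<infinity>"
    unfolding emeasure_lborel_Ico[OF le] by simp
  qed simp
  have val: "(LINT s|lborel. f c * indicator {real j * (T / n)..<(real j + 1) * (T / n)} s) = T / n * f c" for c j
  proof -
   have "(LINT s|lborel. f c * indicator {real j * (T / n)..<(real j + 1) * (T / n)} s) = f c * ((real j + 1) * (T / n) - real j * (T / n))"
    using measure_lborel_Ico[OF le[of j]] by (subst integral_mult_right_zero) simp
   also have "(real j + 1) * (T / n) - real j * (T / n) = T / n" by (simp only: distrib_right mult_1 add_diff_cancel_left')
   finally show ?thesis by (simp add: mult.commute)
  qed
  show ?thesis using int val by (subst Bochner_Integration.integral_sum) auto
 qed
 finally show ?thesis .
qed

end

lemma gfl_limit: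
 assumes T: "0 < T" and k: "filterlim k at_top sequentially"
  and s: "x \<longlonglongrightarrow> s"
 shows "(%i. gfl T (k i) (x i)) \<longlonglongrightarrow> s"
proof (rule tendsto_sandwich)
 have kp: "\<forall>\<^sub>F i in sequentially. 0 < k i" using k unfolding filterlim_at_top by (auto elim!: allE[of _ 1] eventually_mono)
 show "\<forall>\<^sub>F i in sequentially. x i - T / k i <= gfl T (k i) (x i)"
  using kp by eventually_elim (use gfl_gt[OF T] in \<open>auto intro: less_imp_le\<close>)
 show "\<forall>\<^sub>F i in sequentially. gfl T (k i) (x i) <= x i"
  using kp by eventually_elim (use gfl_le[OF T] in auto)
 have "(%i. T / real (k i)) \<longlonglongrightarrow> 0"
  by (intro tendsto_divide_0[OF tendsto_const] filterlim_at_top_imp_at_infinity filterlim_compose[OF filterlim_real_sequentially k])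
 then show "(%i. x i - T / k i) \<longlonglongrightarrow> s" using tendsto_diff[OF s] by fastforce
 show "x \<longlonglongrightarrow> s" by (rule s)
qed

lemma cadlag_AE_tendsto:
 assumes f: "cadlag f"
  and \<phi>: "!!s. s \<in> {0<..} ==> (%i. \<phi> i s) \<longlonglongrightarrow> s"
 shows "AE s in lborel. 0 < s --> (%i. f (\<phi> i s)) \<longlonglongrightarrow> f s"
 using cadlag_AE_isCont[OF f]
proof eventually_elim
 fix s :: real assume "0 < s --> isCont f s"
 then show "0 < s --> (%i. f (\<phi> i s)) \<longlonglongrightarrow> f s" using \<phi>[of s] by (auto intro: isCont_tendsto_compose)
qed

lemma set_integral_bounded_convergence:
 fixes h :: "nat => real => real"
 assumes m: "!!i. set_borel_measurable lborel {0..T} (h i)" "set_borel_measurable lborel {0..T} h'"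
  and b: "!!i s. s \<in> {0..T} ==> \<bar>h i s\<bar> <= C"
  and lim: "AE s in lborel. 0 < s --> s <= T --> (%i. h i s) \<longlonglongrightarrow> h' s"
 shows "(%i. LINT s:{0..T}|lborel. h i s) \<longlonglongrightarrow> (LINT s:{0..T}|lborel. h' s)"
 unfolding set_lebesgue_integral_def
proof (rule integral_dominated_convergence)
 show "(%x. indicat_real {0..T} x *\<^sub>R h' x) \<in> borel_measurable lborel" using m(2) by (simp add: set_borel_measurable_def)
 show "(%x. indicat_real {0..T} x *\<^sub>R h i x) \<in> borel_measurable lborel" for i using m(1) by (simp add: set_borel_measurable_def)
 show "integrable lborel (%s. indicat_real {0..T} s * C)"
  by (rule integrable_mult_left) (auto intro: integrable_real_indicator simp: emeasure_lborel_Icc_eq)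
 have "AE s in lborel. s ~= (0::real)" by (rule AE_lborel_singleton)
 then show "AE s in lborel. (%i. indicat_real {0..T} s *\<^sub>R h i s) \<longlonglongrightarrow> indicat_real {0..T} s *\<^sub>R h' s"
  using lim
 proof eventually_elim
  fix s :: real assume a: "s ~= 0" "0 < s --> s <= T --> (%i. h i s) \<longlonglongrightarrow> h' s"
  then show "(%i. indicat_real {0..T} s *\<^sub>R h i s) \<longlonglongrightarrow> indicat_real {0..T} s *\<^sub>R h' s"
   by (cases "s \<in> {0..T}") (auto)
 qed
 show "AE s in lborel. norm (indicat_real {0..T} s *\<^sub>R h i s) <= indicat_real {0..T} s * C" for i
  using b by (intro AE_I2) (auto simp: indicator_def)
qed

lemma cadlag_set_measurable:
 fixes T :: real
 assumes f: "cadlag f" and \<phi>: "\<phi> \<in> borel_measurable borel" "!!s. s \<in> {0..T} ==> 0 <= \<phi> s"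
 shows "set_borel_measurable lborel {0..T} (%s. f (\<phi> s))"
proof -
 have "(%s. indicat_real {0..T} s * (if 0 <= \<phi> s then f (\<phi> s) else 0)) \<in> borel_measurable borel"
  using measurable_compose[OF \<phi>(1) cadlag_measurable[OF f]]
  by (intro borel_measurable_times borel_measurable_indicator) auto
 moreover have "(%s. indicat_real {0..T} s * (if 0 <= \<phi> s then f (\<phi> s) else 0)) = (%s. indicat_real {0..T} s * f (\<phi> s))"
  using \<phi>(2) by (auto simp: indicator_def)
 ultimately show ?thesis by (simp add: set_borel_measurable_def)
qed

text \<open>The sum is the integral of the path composed with \<open>gfl\<close>, which converges at
  every continuity point, hence almost everywhere, under a common bound.\<close>

lemma cadlag_riemann:
 assumes f: "cadlag f" and T: "0 < T" and k: "filterlim k at_top sequentially"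
 shows "(%i. \<Sum>j<k i. T / k i * f (real j * (T / k i))) \<longlonglongrightarrow> (LINT s:{0..T}|lborel. f s)"
proof -
 obtain C where C: "!!t. t \<in> {0..T} ==> \<bar>f t\<bar> <= C" using cadlag_bounded[OF f, of T] T by (metis less_imp_le)
 have r: "gfl T (k i) s \<in> {0..T}" if "s \<in> {0..T}" for i s
  using gfl_range[OF T, of "k i" s] that T by (cases "k i = 0") (auto simp: gfl_def)
 have "(%i. LINT s:{0..T}|lborel. f (gfl T (k i) s)) \<longlonglongrightarrow> (LINT s:{0..T}|lborel. f s)"
 proof (rule set_integral_bounded_convergence[where C=C])
  show "set_borel_measurable lborel {0..T} (%s. f (gfl T (k i) s))" for i
   using r by (intro cadlag_set_measurable[OF f]) auto
  show "set_borel_measurable lborel {0..T} f" by (rule cadlag_set_measurable[OF f, of "%s. s"]) auto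
  show "\<bar>f (gfl T (k i) s)\<bar> <= C" if "s \<in> {0..T}" for i s using C[OF r[OF that]] .
  show "AE s in lborel. 0 < s --> s <= T --> (%i. f (gfl T (k i) s)) \<longlonglongrightarrow> f s"
   using cadlag_AE_tendsto[OF f, of "%i. gfl T (k i)"] gfl_limit[OF T k tendsto_const] by (auto elim!: eventually_mono)
 qed
 moreover have "\<forall>\<^sub>F i in sequentially. (LINT s:{0..T}|lborel. f (gfl T (k i) s)) = (\<Sum>j<k i. T / k i * f (real j * (T / k i)))"
 proof -
  have "\<forall>\<^sub>F i in sequentially. 0 < k i" using k unfolding filterlim_at_top by (auto elim!: allE[of _ 1] eventually_mono)
  then show ?thesis by eventually_elim (rule gfl_integral[OF T])
 qed
 ultimately show ?thesis by (rule Lim_transform_eventually)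
qed

section \<open>Stochastic order symbols\<close>

text \<open>The symbol \<open>o_P(1)\<close>. Measurability is included, so that the rules of
  calculus need no side conditions.\<close>

definition vanishing :: "'a measure => (nat => 'a => real) => bool" where
 "vanishing M Y \<longleftrightarrow> (\<forall>n. Y n \<in> borel_measurable M) \<and>
  (\<forall>eps>0. (%n. measure M {w \<in> space M. eps < \<bar>Y n w\<bar>}) \<longlonglongrightarrow> 0)"

text \<open>The symbol \<open>O_P(1)\<close>, asked for large \<open>n\<close> only, as the
  estimates start at some grid size.\<close>

definition stoch_bounded :: "'a measure => (nat => 'a => real) => bool" where
 "stoch_bounded M Y \<longleftrightarrow> (\<forall>n. Y n \<in> borel_measurable M) \<and>
  (\<forall>eps>0. \<exists>C>0. \<forall>\<^sub>F n in sequentially. measure M {w \<in> space M. C < \<bar>Y n w\<bar>} <= eps)"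

lemma vanishing_measurable: "vanishing M Y ==> Y n \<in> borel_measurable M"
 by (simp add: vanishing_def)

lemma stoch_bounded_measurable: "stoch_bounded M Y ==> Y n \<in> borel_measurable M"
 by (simp add: stoch_bounded_def)

lemma vanishingI:
 assumes "!!n. Y n \<in> borel_measurable M"
  and "!!eps \<delta>. 0 < eps ==> 0 < \<delta> ==> \<forall>\<^sub>F n in sequentially. measure M {w \<in> space M. eps < \<bar>Y n w\<bar>} <= \<delta>"
 shows "vanishing M Y"
 unfolding vanishing_def
proof (intro conjI allI impI assms(1))
 fix eps :: real assume "0 < eps"
 show "(%n. measure M {w \<in> space M. eps < \<bar>Y n w\<bar>}) \<longlonglongrightarrow> 0"
 proof (rule tendstoI)
  fix e :: real assume "0 < e"
  then have "\<forall>\<^sub>F n in sequentially. measure M {w \<in> space M. eps < \<bar>Y n w\<bar>} <= e / 2" using assms(2)[OF \<open>0 < eps\<close>, of "e/2"] by simp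
  then show "\<forall>\<^sub>F n in sequentially. dist (measure M {w \<in> space M. eps < \<bar>Y n w\<bar>}) 0 < e"
   by eventually_elim (use \<open>0 < e\<close> in simp)
 qed
qed

lemma vanishingD:
 assumes "vanishing M Y" "0 < eps" "0 < \<delta>"
 shows "\<forall>\<^sub>F n in sequentially. measure M {w \<in> space M. eps < \<bar>Y n w\<bar>} <= \<delta>"
proof -
 have "(%n. measure M {w \<in> space M. eps < \<bar>Y n w\<bar>}) \<longlonglongrightarrow> 0" using assms by (simp add: vanishing_def)
 from order_tendstoD(2)[OF this assms(3)] show ?thesis by (auto elim: eventually_mono)
qed

lemma tendsto_in_prob_iff_vanishing:
 "tendsto_in_prob M Y Z \<longleftrightarrow> Z \<in> borel_measurable M \<and> (\<forall>n. Y n \<in> borel_measurable M) \<and> vanishing M (%n w. Y n w - Z w)"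
 unfolding tendsto_in_prob_def vanishing_def by (auto intro: borel_measurable_diff)

context prob_space
begin

lemma prob_le_add:
 assumes "A \<subseteq> B \<union> C" "B \<in> events" "C \<in> events"
 shows "prob A <= prob B + prob C"
proof -
 have "prob A <= prob (B \<union> C)" using assms by (intro finite_measure_mono) auto
 also have "... <= prob B + prob C" using assms by (intro measure_Un_le) auto
 finally show ?thesis .
qed

lemma event_abs_gt [measurable]: "Y \<in> borel_measurable M ==> {w \<in> space M. (c::real) < \<bar>Y w\<bar>} \<in> events"
 by measurable

lemma vanishing_mono:
 assumes Y: "vanishing M Y" and X: "!!n. X n \<in> borel_measurable M"
  and le: "\<forall>\<^sub>F n in sequentially. AE w in M. \<bar>X n w\<bar> <= \<bar>Y n w\<bar>"
 shows "vanishing M X"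
proof (rule vanishingI[OF X])
 fix eps \<delta> :: real assume "0 < eps" "0 < \<delta>"
 from vanishingD[OF Y this] le show "\<forall>\<^sub>F n in sequentially. prob {w \<in> space M. eps < \<bar>X n w\<bar>} <= \<delta>"
 proof eventually_elim
  fix n assume p: "prob {w \<in> space M. eps < \<bar>Y n w\<bar>} <= \<delta>" and ae: "AE w in M. \<bar>X n w\<bar> <= \<bar>Y n w\<bar>"
  have "prob {w \<in> space M. eps < \<bar>X n w\<bar>} <= prob {w \<in> space M. eps < \<bar>Y n w\<bar>}"
   using ae vanishing_measurable[OF Y] by (intro finite_measure_mono_AE) auto
  then show "prob {w \<in> space M. eps < \<bar>X n w\<bar>} <= \<delta>" using p by simp
 qed
qed

lemma vanishing_add:
 assumes X: "vanishing M X" and Y: "vanishing M Y"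
 shows "vanishing M (%n w. X n w + Y n w)"
proof (rule vanishingI)
 note m = vanishing_measurable[OF X] vanishing_measurable[OF Y]
 show "(%w. X n w + Y n w) \<in> borel_measurable M" for n using m by measurable
 fix eps \<delta> :: real assume e: "0 < eps" "0 < \<delta>"
 from vanishingD[OF X, of "eps/2" "\<delta>/2"] vanishingD[OF Y, of "eps/2" "\<delta>/2"] e
 have "\<forall>\<^sub>F n in sequentially. prob {w \<in> space M. eps/2 < \<bar>X n w\<bar>} <= \<delta>/2"
  "\<forall>\<^sub>F n in sequentially. prob {w \<in> space M. eps/2 < \<bar>Y n w\<bar>} <= \<delta>/2" by auto
 then show "\<forall>\<^sub>F n in sequentially. prob {w \<in> space M. eps < \<bar>X n w + Y n w\<bar>} <= \<delta>"
 proof eventually_elim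
  case (elim n)
  have "prob {w \<in> space M. eps < \<bar>X n w + Y n w\<bar>} <= prob {w \<in> space M. eps/2 < \<bar>X n w\<bar>} + prob {w \<in> space M. eps/2 < \<bar>Y n w\<bar>}"
   by (intro prob_le_add event_abs_gt m) (auto; linarith)
  then show ?case using elim by linarith
 qed
qed

lemma vanishing_imp_stoch_bounded:
 assumes "vanishing M X" shows "stoch_bounded M X"
 unfolding stoch_bounded_def using vanishing_measurable[OF assms] vanishingD[OF assms, of 1]
 by (auto intro!: exI[of _ "1::real"])

lemma vanishing_mult:
 assumes X: "vanishing M X" and Y: "stoch_bounded M Y"
 shows "vanishing M (%n w. X n w * Y n w)"
proof (rule vanishingI)
 note m = vanishing_measurable[OF X] stoch_bounded_measurable[OF Y]
 show "(%w. X n w * Y n w) \<in> borel_measurable M" for n using m by measurable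
 fix eps \<delta> :: real assume e: "0 < eps" "0 < \<delta>"
 obtain C where C: "0 < C" "\<forall>\<^sub>F n in sequentially. prob {w \<in> space M. C < \<bar>Y n w\<bar>} <= \<delta>/2"
  using Y half_gt_zero[OF e(2)] unfolding stoch_bounded_def by blast
 have "\<forall>\<^sub>F n in sequentially. prob {w \<in> space M. eps/C < \<bar>X n w\<bar>} <= \<delta>/2"
  using e C by (intro vanishingD[OF X]) auto
 with C(2) show "\<forall>\<^sub>F n in sequentially. prob {w \<in> space M. eps < \<bar>X n w * Y n w\<bar>} <= \<delta>"
 proof eventually_elim
  case (elim n)
  have "prob {w \<in> space M. eps < \<bar>X n w * Y n w\<bar>} <= prob {w \<in> space M. eps/C < \<bar>X n w\<bar>} + prob {w \<in> space M. C < \<bar>Y n w\<bar>}"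
  proof (intro prob_le_add event_abs_gt m subsetI)
   fix w assume ww: "w \<in> {w \<in> space M. eps < \<bar>X n w * Y n w\<bar>}"
   show "w \<in> {w \<in> space M. eps/C < \<bar>X n w\<bar>} \<union> {w \<in> space M. C < \<bar>Y n w\<bar>}"
   proof (rule ccontr)
    assume "\<not> ?thesis"
    then have "\<bar>X n w\<bar> <= eps/C" "\<bar>Y n w\<bar> <= C" using ww by auto
    then have "\<bar>X n w\<bar> * \<bar>Y n w\<bar> <= eps/C * C" using e C by (intro mult_mono) auto
    then show False using ww C by (simp add: abs_mult)
   qed
  qed
  then show ?case using elim by linarith
 qed
qed

lemma stoch_bounded_const:
 assumes X: "X \<in> borel_measurable M" shows "stoch_bounded M (%_. X)"
 unfolding stoch_bounded_def
proof (intro conjI allI impI X)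
 fix eps :: real assume e: "0 < eps"
 have "(%k. prob {w \<in> space M. real k < \<bar>X w\<bar>}) \<longlonglongrightarrow> prob (\<Inter>k. {w \<in> space M. real k < \<bar>X w\<bar>})"
  using X by (intro finite_Lim_measure_decseq) (auto simp: decseq_def)
 moreover have "(\<Inter>k. {w \<in> space M. real k < \<bar>X w\<bar>}) = {}"
 proof (rule ccontr)
  assume "\<not> ?thesis"
  then obtain w where "!!k. real k < \<bar>X w\<bar>" by auto
  then show False using reals_Archimedean2[of "\<bar>X w\<bar>"] by (meson less_asym)
 qed
 ultimately have "(%k. prob {w \<in> space M. real k < \<bar>X w\<bar>}) \<longlonglongrightarrow> 0" by simp
 from order_tendstoD(2)[OF this e] have "\<forall>\<^sub>F k in sequentially. prob {w \<in> space M. real k < \<bar>X w\<bar>} < eps" .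
 then obtain k\<^sub>0 where k0: "\<forall>k\<ge>k\<^sub>0. prob {w \<in> space M. real k < \<bar>X w\<bar>} < eps"
  unfolding eventually_at_top_linorder by blast
 define k where "k = max 1 k\<^sub>0"
 have "1 <= k" "prob {w \<in> space M. real k < \<bar>X w\<bar>} < eps" using k0 by (auto simp: k_def simp del: of_nat_max)
 then show "\<exists>C>0. \<forall>\<^sub>F n in sequentially. prob {w \<in> space M. C < \<bar>X w\<bar>} <= eps"
  by (intro exI[of _ "real k"]) auto
qed

lemma stoch_bounded_add:
 assumes X: "stoch_bounded M X" and Y: "stoch_bounded M Y"
 shows "stoch_bounded M (%n w. X n w + Y n w)"
 unfolding stoch_bounded_def
proof (intro conjI allI impI)
 note m = stoch_bounded_measurable[OF X] stoch_bounded_measurable[OF Y]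
 show "(%w. X n w + Y n w) \<in> borel_measurable M" for n using m by measurable
 fix eps :: real assume e: "0 < eps"
 obtain C where C: "0 < C" "\<forall>\<^sub>F n in sequentially. prob {w \<in> space M. C < \<bar>X n w\<bar>} <= eps/2"
  using X half_gt_zero[OF e] unfolding stoch_bounded_def by blast
 obtain D where D: "0 < D" "\<forall>\<^sub>F n in sequentially. prob {w \<in> space M. D < \<bar>Y n w\<bar>} <= eps/2"
  using Y half_gt_zero[OF e] unfolding stoch_bounded_def by blast
 from C(2) D(2) have "\<forall>\<^sub>F n in sequentially. prob {w \<in> space M. C + D < \<bar>X n w + Y n w\<bar>} <= eps"
 proof eventually_elim
  case (elim n)
  have "prob {w \<in> space M. C + D < \<bar>X n w + Y n w\<bar>} <= prob {w \<in> space M. C < \<bar>X n w\<bar>} + prob {w \<in> space M. D < \<bar>Y n w\<bar>}"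
   by (intro prob_le_add event_abs_gt m) (auto; linarith)
  then show ?case using elim by linarith
 qed
 then show "\<exists>C>0. \<forall>\<^sub>F n in sequentially. prob {w \<in> space M. C < \<bar>X n w + Y n w\<bar>} <= eps"
  using C(1) D(1) by (intro exI[of _ "C + D"]) auto
qed

lemma prob_gt_le_second_moment:
 assumes X: "X \<in> borel_measurable M" and i: "integrable M (%w. (X w)^2)" and e: "0 < eps"
 shows "prob {w \<in> space M. eps < \<bar>X w\<bar>} <= expectation (%w. (X w)^2) / eps^2"
proof -
 have "prob {w \<in> space M. eps < \<bar>X w\<bar>} <= prob {w \<in> space M. eps^2 <= (X w)^2}"
  using X e by (intro finite_measure_mono) (auto simp: abs_le_square_iff[symmetric])
 also have "... <= expectation (%w. (X w)^2) / eps^2"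
  using e i by (intro integral_Markov_inequality_measure[of _ _ "{}"]) auto
 finally show ?thesis .
qed

lemma vanishing_AE:
 assumes X: "!!n. X n \<in> borel_measurable M" and lim: "AE w in M. (%n. X n w) \<longlonglongrightarrow> 0"
 shows "vanishing M X"
 unfolding vanishing_def
proof (intro conjI allI impI X)
 fix eps :: real assume e: "0 < eps"
 let ?A = "%n. {w \<in> space M. eps < \<bar>X n w\<bar>}"
 have "(%n. expectation (indicator (?A n))) \<longlonglongrightarrow> expectation (%_. 0::real)"
 proof (rule integral_dominated_convergence[where w="%_. 1"])
  show "AE x in M. (%n. indicator (?A n) x) \<longlonglongrightarrow> (0::real)"
   using lim
  proof eventually_elim
   fix w assume "(%n. X n w) \<longlonglongrightarrow> 0"
   then have "\<forall>\<^sub>F n in sequentially. dist (X n w) 0 < eps" using e by (rule tendstoD)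
   then have "\<forall>\<^sub>F n in sequentially. indicator (?A n) w = (0::real)"
    by eventually_elim (auto simp: indicator_def)
   then show "(%n. indicator (?A n) w) \<longlonglongrightarrow> (0::real)" by (rule tendsto_eventually)
  qed
 qed (use X in auto)
 then show "(%n. prob (?A n)) \<longlonglongrightarrow> 0" using X by simp
qed

text \<open>Continuity is asked at the single point 0, because the difference quotient in the delta
  method is known to be continuous only there.\<close>

lemma vanishing_isCont:
 assumes X: "vanishing M X" and f: "isCont f 0" "f 0 = (0::real)" "f \<in> borel_measurable borel"
 shows "vanishing M (%n w. f (X n w))"
proof (rule vanishingI)
 note m = vanishing_measurable[OF X]
 show "(%w. f (X n w)) \<in> borel_measurable M" for n using m f(3) by measurable
 fix eps \<delta> :: real assume e: "0 < eps" "0 < \<delta>"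
 obtain d where d: "0 < d" "!!x. \<bar>x\<bar> < d ==> \<bar>f x\<bar> < eps"
  using f(1,2) e(1) unfolding continuous_at_eps_delta by (auto simp: dist_real_def)
 have "\<forall>\<^sub>F n in sequentially. prob {w \<in> space M. d/2 < \<bar>X n w\<bar>} <= \<delta>"
  using d e by (intro vanishingD[OF X]) auto
 then show "\<forall>\<^sub>F n in sequentially. prob {w \<in> space M. eps < \<bar>f (X n w)\<bar>} <= \<delta>"
 proof eventually_elim
  case (elim n)
  have "prob {w \<in> space M. eps < \<bar>f (X n w)\<bar>} <= prob {w \<in> space M. d/2 < \<bar>X n w\<bar>}"
  proof (intro finite_measure_mono event_abs_gt m subsetI)
   fix w assume "w \<in> {w \<in> space M. eps < \<bar>f (X n w)\<bar>}"
   then show "w \<in> {w \<in> space M. d/2 < \<bar>X n w\<bar>}" using d(2)[of "X n w"] d(1) by force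
  qed
  then show ?case using elim by linarith
 qed
qed

lemma tendsto_in_prob_add:
 assumes X: "tendsto_in_prob M X X'" and Y: "tendsto_in_prob M Y Y'"
 shows "tendsto_in_prob M (%n w. X n w + Y n w) (%w. X' w + Y' w)"
proof -
 have m: "X' \<in> borel_measurable M" "Y' \<in> borel_measurable M" "X n \<in> borel_measurable M" "Y n \<in> borel_measurable M" for n
  using X Y by (auto simp: tendsto_in_prob_def)
 have v: "vanishing M (%n w. X n w - X' w)" "vanishing M (%n w. Y n w - Y' w)"
  using X Y by (auto simp: tendsto_in_prob_iff_vanishing)
 have "vanishing M (%n w. X n w + Y n w - (X' w + Y' w))"
  using vanishing_add[OF v] by (simp add: algebra_simps)
 then show ?thesis unfolding tendsto_in_prob_iff_vanishing using m by (intro conjI allI borel_measurable_add) auto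
qed

lemma tendsto_in_prob_imp_stoch_bounded:
 assumes "tendsto_in_prob M X X'" shows "stoch_bounded M X"
 using assms stoch_bounded_add[OF vanishing_imp_stoch_bounded[of "%n w. X n w - X' w"] stoch_bounded_const[of X']]
 unfolding tendsto_in_prob_iff_vanishing by auto

lemma tendsto_in_prob_const:
 assumes "X \<in> borel_measurable M" shows "tendsto_in_prob M (%_. X) X"
 using assms by (simp add: tendsto_in_prob_def)

lemma tendsto_in_prob_mult:
 assumes X: "tendsto_in_prob M X X'" and Y: "tendsto_in_prob M Y Y'"
 shows "tendsto_in_prob M (%n w. X n w * Y n w) (%w. X' w * Y' w)"
proof -
 have m: "X' \<in> borel_measurable M" "Y' \<in> borel_measurable M" "X n \<in> borel_measurable M" "Y n \<in> borel_measurable M" for n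
  using X Y by (auto simp: tendsto_in_prob_def)
 have v: "vanishing M (%n w. X n w - X' w)" "vanishing M (%n w. Y n w - Y' w)"
  using X Y by (auto simp: tendsto_in_prob_iff_vanishing)
 have "vanishing M (%n w. (X n w - X' w) * Y n w + (Y n w - Y' w) * X' w)"
  by (intro vanishing_add vanishing_mult v tendsto_in_prob_imp_stoch_bounded[OF Y] stoch_bounded_const m)
 then have "vanishing M (%n w. X n w * Y n w - X' w * Y' w)" by (simp add: algebra_simps)
 then show ?thesis unfolding tendsto_in_prob_iff_vanishing using m by (intro conjI allI borel_measurable_times) auto
qed

lemma tendsto_in_prob_sum:
 assumes "!!i. i \<in> I ==> tendsto_in_prob M (X i) (X' i)"
 shows "tendsto_in_prob M (%n w. \<Sum>i\<in>I. X i n w) (%w. \<Sum>i\<in>I. X' i w)"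
 using assms
proof (induction I rule: infinite_finite_induct)
 case (insert x F)
 then show ?case using tendsto_in_prob_add[of "X x" "X' x"] by simp
qed (auto intro: tendsto_in_prob_const)

lemma tendsto_in_prob_compose:
 assumes "tendsto_in_prob M X X'" "filterlim k at_top sequentially"
 shows "tendsto_in_prob M (%n. X (k n)) X'"
 using assms unfolding tendsto_in_prob_def
 by (auto intro: filterlim_compose[of "%n. prob {w \<in> space M. _ < \<bar>X n w - X' w\<bar>}"])

text \<open>Carries a tail bound from approximations to the limit variable; the gap between
  \<open>a\<close> and \<open>b\<close> absorbs the error of approximation. The event
  \<open>A\<close> allows for bounds that are obtained after clipping.\<close>

lemma tendsto_in_prob_tail:
 assumes X: "tendsto_in_prob M X X'" and A: "A \<in> events" and ab: "a < b"
  and le: "\<forall>\<^sub>F n in sequentially. prob {w \<in> A. a < \<bar>X n w\<bar>} <= \<beta> n" and \<beta>: "\<beta> \<longlonglongrightarrow> \<beta>'"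
 shows "prob {w \<in> A. b < \<bar>X' w\<bar>} <= \<beta>'"
proof -
 have m: "X' \<in> borel_measurable M" "X n \<in> borel_measurable M" for n using X by (auto simp: tendsto_in_prob_def)
 have lim: "(%n. prob {w \<in> space M. b - a < \<bar>X n w - X' w\<bar>}) \<longlonglongrightarrow> 0"
  using X ab by (auto simp: tendsto_in_prob_def)
 have AE: "{w \<in> A. a < \<bar>X n w\<bar>} \<in> events" for n
 proof -
  have "{w \<in> A. a < \<bar>X n w\<bar>} = A \<inter> {w \<in> space M. a < \<bar>X n w\<bar>}" using sets.sets_into_space[OF A] by auto
  then show ?thesis using A m by simp
 qed
 have "\<forall>\<^sub>F n in sequentially. prob {w \<in> A. b < \<bar>X' w\<bar>} <= \<beta> n + prob {w \<in> space M. b - a < \<bar>X n w - X' w\<bar>}"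
  using le
 proof eventually_elim
  case (elim n)
  have "prob {w \<in> A. b < \<bar>X' w\<bar>} <= prob {w \<in> A. a < \<bar>X n w\<bar>} + prob {w \<in> space M. b - a < \<bar>X n w - X' w\<bar>}"
   using m sets.sets_into_space[OF A] by (intro prob_le_add AE event_abs_gt) auto
  then show ?case using elim by linarith
 qed
 then show ?thesis
  using tendsto_lowerbound[OF tendsto_add[OF \<beta> lim], of "prob {w \<in> A. b < \<bar>X' w\<bar>}"] by simp
qed

end

text \<open>The events that some member of the family exceeds \<open>k\<close> decrease to the empty
  set, since each path is bounded. The conclusion covers all larger \<open>K'\<close>, so that
  several requirements on the level can be met at once.\<close>

lemma prob_good_event:
 fixes f :: "'i::countable => 'a => real"
 assumes "prob_space M" and f: "!!q. f q \<in> borel_measurable M" 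
  and b: "!!w. w \<in> space M ==> \<exists>C. \<forall>q. \<bar>f q w\<bar> <= C" and e: "0 < e"
 shows "\<exists>K>0. \<forall>K'\<ge>K. {w \<in> space M. \<forall>q. \<bar>f q w\<bar> <= K'} \<in> sets M \<and>
  measure M {w \<in> space M. \<not> (\<forall>q. \<bar>f q w\<bar> <= K')} <= e"
proof -
 interpret prob_space M by fact
 have ev: "{w \<in> space M. \<forall>q. \<bar>f q w\<bar> <= K} \<in> events" for K :: real
 proof -
  have "{w \<in> space M. \<bar>f q w\<bar> <= K} \<in> events" for q using f[of q] by measurable
  then show ?thesis by (intro sets.sets_Collect_countable_All) auto
 qed
 then have ev': "{w \<in> space M. \<not> (\<forall>q. \<bar>f q w\<bar> <= K)} \<in> events" for K :: real
  by (intro sets.sets_Collect_neg)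
 let ?A = "%k. {w \<in> space M. \<not> (\<forall>q. \<bar>f q w\<bar> <= real k)}"
 have "decseq ?A" unfolding decseq_def
 proof (intro allI impI subsetI)
  fix m n w assume mn: "m <= n" and ww: "w \<in> ?A n"
  show "w \<in> ?A m"
  proof (rule ccontr)
   assume "w \<notin> ?A m"
   then have "\<forall>q. \<bar>f q w\<bar> <= real m" using ww by auto
   then have "\<forall>q. \<bar>f q w\<bar> <= real n" using mn by (meson of_nat_mono order_trans)
   then show False using ww by auto
  qed
 qed
 then have "(%k. prob (?A k)) \<longlonglongrightarrow> prob (\<Inter>k. ?A k)"
  using ev' by (intro finite_Lim_measure_decseq) auto
 moreover have "(\<Inter>k. ?A k) = {}"
 proof (rule ccontr)
  assume "\<not> ?thesis"
  then obtain w where ww: "!!k. w \<in> ?A k" by auto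
  then obtain C where C: "\<forall>q. \<bar>f q w\<bar> <= C" using b by blast
  obtain k where "C <= real k" using real_arch_simple by blast
  then have "\<forall>q. \<bar>f q w\<bar> <= real k" using C by (meson order_trans)
  then show False using ww[of k] by auto
 qed
 ultimately have "(%k. prob (?A k)) \<longlonglongrightarrow> 0" by simp
 from order_tendstoD(2)[OF this e] have "\<forall>\<^sub>F k in sequentially. prob (?A k) < e" .
 then obtain k\<^sub>0 where k0: "\<forall>k\<ge>k\<^sub>0. prob (?A k) < e"
  unfolding eventually_at_top_linorder by blast
 define k where "k = max 1 k\<^sub>0"
 have k: "1 <= k" "prob (?A k) < e" using k0 by (auto simp: k_def simp del: of_nat_max)
 show ?thesis
 proof (intro exI[of _ "real k"] conjI allI impI ev)
  show "0 < real k" using k by simp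
  fix K' :: real assume K': "real k <= K'"
  have "prob {w \<in> space M. \<not> (\<forall>q. \<bar>f q w\<bar> <= K')} <= prob (?A k)"
   using K' ev' by (intro finite_measure_mono) (auto intro: order_trans)
  then show "prob {w \<in> space M. \<not> (\<forall>q. \<bar>f q w\<bar> <= K')} <= e" using k by linarith
 qed
qed

section \<open>Ito integrals as limits of Riemann sums\<close>

lemma enumerate_grid:
 fixes P :: "real set"
 assumes "finite P" "P ~= {}"
 obtains p :: "nat => real" and L where "strict_mono p" "P = p ` {..L}"
proof -
 define xs where "xs = sorted_list_of_set P"
 define L where "L = length xs - 1"
 have xs: "set xs = P" "sorted xs" "distinct xs" using assms by (auto simp: xs_def)
 have len: "length xs = Suc L" using assms xs(1) by (cases xs) (auto simp: L_def)
 \<comment> \<open>Past the last point the grid goes on in unit steps, because a strictly increasing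
   infinite sequence is wanted.\<close>
 define p where "p j = (if j <= L then xs ! j else xs ! L + real (j - L))" for j
 have "strict_mono p"
 proof (rule strict_monoI_Suc)
  fix j
  show "p j < p (Suc j)"
  proof (cases "Suc j <= L")
   case True
   then have "xs ! j <= xs ! Suc j" using xs(2) len by (intro sorted_nth_mono) auto
   moreover have "xs ! j ~= xs ! Suc j" using xs(3) len True by (simp add: nth_eq_iff_index_eq)
   ultimately have "xs ! j < xs ! Suc j" by simp
   then show ?thesis using True by (simp add: p_def)
  next
   case False
   then show ?thesis by (cases "j <= L") (auto simp: p_def le_less Suc_le_eq)
  qed
 qed
 moreover have "P = p ` {..L}"
 proof -
  have "p ` {..L} = (%j. xs ! j) ` {..<length xs}" using len by (intro image_cong) (auto simp: p_def)
  also have "... = set xs" by (auto simp: set_conv_nth)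
  finally show ?thesis using xs by simp
 qed
 ultimately show ?thesis using that by blast
qed

text \<open>The cells are selected by their right ends lying in the left-open interval, the form in
  which simple processes are evaluated.\<close>

lemma telescope_on_grid:
 fixes B :: "real => real"
 assumes p: "strict_mono p" and a: "a \<in> p ` {..L}" and b: "b \<in> p ` {..L}" and ab: "a <= b"
 shows "B b - B a = (\<Sum>j<L. (if a < p (Suc j) \<and> p (Suc j) <= b then 1 else 0) * (B (p (Suc j)) - B (p j)))"
proof -
 obtain i k where ik: "i <= L" "k <= L" "a = p i" "b = p k" using a b by auto
 have "i <= k" using ab ik p by (simp add: strict_mono_less_eq)
 have "B b - B a = (\<Sum>j\<in>{i..<k}. B (p (Suc j)) - B (p j))"
  using sum_Suc_diff'[OF \<open>i <= k\<close>, of "%j. B (p j)"] ik by simp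
 also have "... = (\<Sum>j\<in>{..<L} \<inter> {j. i <= j \<and> j < k}. B (p (Suc j)) - B (p j))"
  using ik by (intro sum.cong) auto
 also have "... = (\<Sum>j<L. if i <= j \<and> j < k then B (p (Suc j)) - B (p j) else 0)"
  by (simp add: sum.inter_restrict)
 also have "... = (\<Sum>j<L. (if a < p (Suc j) \<and> p (Suc j) <= b then 1 else 0) * (B (p (Suc j)) - B (p j)))"
  using p by (intro sum.cong) (auto simp: ik strict_mono_less strict_mono_less_eq less_Suc_eq_le Suc_le_eq)
 finally show ?thesis .
qed

text \<open>Unlike in \<open>simple_process_data\<close>, the values may be unbounded, so a cadlag
  integrand frozen at grid points is covered.\<close>

definition weak_simple_data :: "(real => 'a measure) => nat => (nat => real) => (nat => 'a => real) => bool" where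
 "weak_simple_data F m \<tau> \<xi> \<longleftrightarrow>
  (\<forall>i\<le>m. 0 <= \<tau> i) \<and> (\<forall>i<m. \<tau> i <= \<tau> (Suc i)) \<and> (\<forall>i<m. \<xi> i \<in> borel_measurable (F (\<tau> i)))"

lemma simple_process_data_weak:
 assumes "simple_process_data M F m \<tau> \<xi>" shows "weak_simple_data F m \<tau> \<xi>"
proof -
 have "0 <= \<tau> i" if "i <= m" for i
  using that assms by (induction i) (auto simp: simple_process_data_def intro: order_trans[of 0])
 then show ?thesis using assms by (auto simp: weak_simple_data_def simple_process_data_def)
qed

context
 fixes M :: "'a measure" and F :: "real => 'a measure" and m :: nat and \<tau> :: "nat => real" and \<xi> :: "nat => 'a => real"
  and p :: "nat => real" and L :: nat and t :: real
 assumes fsp: "filtered_prob_space M F" and data: "weak_simple_data F m \<tau> \<xi>" and p: "strict_mono p"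
  and pL: "p L = t" and P: "!!i. i <= m ==> min t (\<tau> i) \<in> p ` {..L}"
begin

lemma simple_on_grid_le: "j < L ==> p (Suc j) <= t"
 using p pL by (metis Suc_leI strict_mono_less_eq)

text \<open>Jump times before \<open>t\<close> are themselves grid points, so lying before
  \<open>p (Suc j)\<close> means lying at or before \<open>p j\<close>.\<close>

lemma simple_on_grid_point:
 assumes j: "j < L" and i: "i <= m" and lt: "\<tau> i < p (Suc j)"
 shows "\<tau> i <= p j"
proof -
 have "\<tau> i < t" using lt simple_on_grid_le[OF j] by simp
 then obtain k where "k <= L" "\<tau> i = p k" using P[OF i] by auto
 then show ?thesis using lt p by (simp add: strict_mono_less strict_mono_less_eq less_Suc_eq_le)
qed

lemma simple_integral_on_grid:
 "simple_integral_process m \<tau> \<xi> B t w =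
  (\<Sum>j<L. simple_process_val m \<tau> \<xi> (p (Suc j)) w * (B (p (Suc j)) w - B (p j) w))"
proof -
 have "simple_integral_process m \<tau> \<xi> B t w = (\<Sum>i<m. \<xi> i w * (\<Sum>j<L. indicator {\<tau> i<..\<tau> (Suc i)} (p (Suc j)) * (B (p (Suc j)) w - B (p j) w)))"
  unfolding simple_integral_process_def
 proof (intro sum.cong refl)
  fix i assume "i \<in> {..<m}"
  then have i: "i < m" by simp
  have le: "min t (\<tau> i) <= min t (\<tau> (Suc i))" using data i by (auto simp: weak_simple_data_def)
  have "B (min t (\<tau> (Suc i))) w - B (min t (\<tau> i)) w =
   (\<Sum>j<L. (if min t (\<tau> i) < p (Suc j) \<and> p (Suc j) <= min t (\<tau> (Suc i)) then 1 else 0) * (B (p (Suc j)) w - B (p j) w))"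
   using telescope_on_grid[OF p P[of i] P[of "Suc i"] le, of "%s. B s w"] i by simp
  also have "... = (\<Sum>j<L. indicator {\<tau> i<..\<tau> (Suc i)} (p (Suc j)) * (B (p (Suc j)) w - B (p j) w))"
  proof (intro sum.cong refl arg_cong2[where f="(*)"])
   fix j assume "j \<in> {..<L}"
   then have "p (Suc j) <= t" by (intro simple_on_grid_le) simp
   then show "(if min t (\<tau> i) < p (Suc j) \<and> p (Suc j) <= min t (\<tau> (Suc i)) then 1 else 0) = indicator {\<tau> i<..\<tau> (Suc i)} (p (Suc j))"
    by (auto simp: indicator_def min_less_iff_disj)
  qed
  finally show "\<xi> i w * (B (min t (\<tau> (Suc i))) w - B (min t (\<tau> i)) w) =
   \<xi> i w * (\<Sum>j<L. indicator {\<tau> i<..\<tau> (Suc i)} (p (Suc j)) * (B (p (Suc j)) w - B (p j) w))" by simp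
 qed
 also have "... = (\<Sum>j<L. simple_process_val m \<tau> \<xi> (p (Suc j)) w * (B (p (Suc j)) w - B (p j) w))"
  unfolding simple_process_val_def sum_distrib_left sum_distrib_right
  by (subst sum.swap) (simp add: mult.assoc)
 finally show ?thesis .
qed

text \<open>Simple processes are constant on left-open cells, so the value is read at the right end;
  it involves only jump times before that end, hence is known at the left end.\<close>

lemma simple_val_measurable:
 assumes j: "j < L"
 shows "(%w. simple_process_val m \<tau> \<xi> (p (Suc j)) w) \<in> borel_measurable (F (p j))"
 unfolding simple_process_val_def
proof (rule borel_measurable_sum)
 fix i assume "i \<in> {..<m}"
 then have i: "i < m" by simp
 show "(%w. \<xi> i w * indicator {\<tau> i<..\<tau> (Suc i)} (p (Suc j))) \<in> borel_measurable (F (p j))"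
 proof (cases "\<tau> i < p (Suc j)")
  case True
  then have le: "\<tau> i <= p j" using simple_on_grid_point[OF j, of i] i by simp
  have "subalgebra (F (p j)) (F (\<tau> i))"
   using filtered_prob_spaceD(2)[OF fsp, of "p j"] filtered_prob_spaceD(2)[OF fsp, of "\<tau> i"] filtered_prob_spaceD(3)[OF fsp le]
   by (simp add: subalgebra_def)
  moreover have "\<xi> i \<in> borel_measurable (F (\<tau> i))" using data i by (simp add: weak_simple_data_def)
  ultimately have "\<xi> i \<in> borel_measurable (F (p j))" by (rule measurable_from_subalg)
  then show ?thesis by (intro borel_measurable_times) auto
 next
  case False
  then show ?thesis by simp
 qed
qed

lemma simple_val_cell:
 assumes j: "j < L" and s: "p j < s" "s <= p (Suc j)"
 shows "simple_process_val m \<tau> \<xi> s w = simple_process_val m \<tau> \<xi> (p (Suc j)) w"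
 unfolding simple_process_val_def
proof (intro sum.cong refl arg_cong2[where f="(*)"])
 fix i assume "i \<in> {..<m}"
 then show "indicator {\<tau> i<..\<tau> (Suc i)} s = (indicator {\<tau> i<..\<tau> (Suc i)} (p (Suc j)) :: real)"
  using simple_on_grid_point[OF j, of i] simple_on_grid_point[OF j, of "Suc i"] s
  by (auto simp: indicator_def not_le)
qed

end

text \<open>On the common refinement of both partitions the difference of the integrals is one
  stochastic sum, and \<open>lenglart\<close> copes with unbounded values.\<close>

lemma simple_lenglart:
 assumes fsp: "filtered_prob_space M F" and B: "brownian_motion M F B"
  and d1: "weak_simple_data F m \<tau> \<xi>" and d2: "weak_simple_data F m' \<tau>' \<xi>'"
  and t: "0 < t" and e: "0 < eps" and \<eta>: "0 <= \<eta>"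
 shows "measure M {w \<in> space M. eps < \<bar>simple_integral_process m \<tau> \<xi> B t w - simple_integral_process m' \<tau>' \<xi>' B t w\<bar> \<and>
  (\<integral>\<^sup>+ s\<in>{0..t}. ennreal ((simple_process_val m \<tau> \<xi> s w - simple_process_val m' \<tau>' \<xi>' s w)^2) \<partial>lborel) <= ennreal \<eta>} <= \<eta> / eps^2"
proof -
 define P where "P = {0, t} \<union> (%i. min t (\<tau> i)) ` {..m} \<union> (%i. min t (\<tau>' i)) ` {..m'}"
 have Pf: "finite P" "P ~= {}" by (auto simp: P_def)
 obtain p :: "nat => real" and L :: nat where p: "strict_mono p" "P = p ` {..L}" using enumerate_grid[OF Pf] by blast
 have P0: "0 <= x \<and> x <= t" if "x \<in> P" for x
  using that t d1 d2 by (auto simp: P_def weak_simple_data_def)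
 have p0: "p 0 = 0"
 proof -
  have "0 \<in> P" by (simp add: P_def)
  then obtain k where "0 = p k" "k <= L" unfolding p(2) by blast
  moreover have "p 0 \<in> P" using p(2) by auto
  ultimately show ?thesis using P0[of "p 0"] p(1) by (metis antisym le0 strict_mono_less_eq)
 qed
 have pL: "p L = t"
 proof -
  have "t \<in> P" by (simp add: P_def)
  then obtain k where "t = p k" "k <= L" unfolding p(2) by blast
  moreover have "p L \<in> P" using p(2) by auto
  ultimately show ?thesis using P0[of "p L"] p(1) by (metis antisym strict_mono_less_eq)
 qed
 have P1: "min t (\<tau> i) \<in> p ` {..L}" if "i <= m" for i using that p(2) by (auto simp: P_def)
 have P2: "min t (\<tau>' i) \<in> p ` {..L}" if "i <= m'" for i using that p(2) by (auto simp: P_def)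
 interpret gauss_steps M "%j. F (p j)" "%j w. B (p (Suc j)) w - B (p j) w" "%j. p (Suc j) - p j"
  using p0 by (intro bm_gauss_steps[OF fsp B p(1)]) simp
 let ?v = "%s w. simple_process_val m \<tau> \<xi> s w - simple_process_val m' \<tau>' \<xi>' s w"
 let ?u = "%j w. ?v (p (Suc j)) w"
 note g1 = fsp d1 p(1) pL P1 and g2 = fsp d2 p(1) pL P2
 have um: "?u j \<in> borel_measurable (F (p j))" if "j < L" for j
  using simple_val_measurable[OF g1 that] simple_val_measurable[OF g2 that] by (intro borel_measurable_diff) auto
 have I: "simple_integral_process m \<tau> \<xi> B t w - simple_integral_process m' \<tau>' \<xi>' B t w = (\<Sum>j<L. ?u j w * (B (p (Suc j)) w - B (p j) w))" for w
  using simple_integral_on_grid[OF g1, of B w] simple_integral_on_grid[OF g2, of B w]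
  by (simp add: sum_subtractf left_diff_distrib)
 have le: "(\<Sum>j<L. (?u j w)^2 * (p (Suc j) - p j)) <= \<eta>"
  if h: "(\<integral>\<^sup>+ s\<in>{0..t}. ennreal ((?v s w)^2) \<partial>lborel) <= ennreal \<eta>" for w
 proof -
  have dj: "s \<notin> {p k<..p (Suc k)}" if "s \<in> {p j<..p (Suc j)}" "k ~= j" for s j k
  proof
   assume "s \<in> {p k<..p (Suc k)}"
   with that have "p k < p (Suc j)" "p j < p (Suc k)" by auto
   then show False using p(1) that(2) by (simp add: strict_mono_less)
  qed
  have pt: "(\<Sum>j<L. ennreal ((?u j w)^2) * indicator {p j<..p (Suc j)} s) <= ennreal ((?v s w)^2) * indicator {0..t} s" for s
  proof (cases "\<exists>j<L. s \<in> {p j<..p (Suc j)}")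
   case True
   then obtain j where j: "j < L" "s \<in> {p j<..p (Suc j)}" by blast
   have "(\<Sum>k<L. ennreal ((?u k w)^2) * indicator {p k<..p (Suc k)} s) = (\<Sum>k<L. if k = j then ennreal ((?u j w)^2) else 0)"
    using dj[OF j(2)] j(2) by (intro sum.cong refl) (auto simp: indicator_def)
   also have "... = ennreal ((?v s w)^2)"
    using j simple_val_cell[OF g1 j(1), of s w] simple_val_cell[OF g2 j(1), of s w] by simp
   finally show ?thesis
    using j simple_on_grid_le[OF g1 j(1)] p0 p(1) strict_mono_less_eq[OF p(1), of 0 j] by (auto simp: indicator_def)
  next
   case False
   then have "(\<Sum>j<L. ennreal ((?u j w)^2) * indicator {p j<..p (Suc j)} s) = 0" by (intro sum.neutral) auto
   then show ?thesis by simp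
  qed
  have le: "p j <= p (Suc j)" for j using p(1) by (simp add: strict_mono_less_eq)
  have "ennreal (\<Sum>j<L. (?u j w)^2 * (p (Suc j) - p j)) = (\<Sum>j<L. ennreal ((?u j w)^2) * emeasure lborel {p j<..p (Suc j)})"
   using le by (simp add: ennreal_mult flip: sum_ennreal)
  also have "... = (\<integral>\<^sup>+ s. (\<Sum>j<L. ennreal ((?u j w)^2) * indicator {p j<..p (Suc j)} s) \<partial>lborel)"
   by (subst nn_integral_sum) (auto simp: nn_integral_cmult_indicator)
  also have "... <= (\<integral>\<^sup>+ s\<in>{0..t}. ennreal ((?v s w)^2) \<partial>lborel)" by (intro nn_integral_mono pt)
  also have "... <= ennreal \<eta>" by (rule h)
  finally show ?thesis using \<eta> by simp
 qed
 have "prob {w \<in> space M. eps < \<bar>simple_integral_process m \<tau> \<xi> B t w - simple_integral_process m' \<tau>' \<xi>' B t w\<bar> \<and>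
  (\<integral>\<^sup>+ s\<in>{0..t}. ennreal ((?v s w)^2) \<partial>lborel) <= ennreal \<eta>}
  <= prob {w \<in> space M. eps < \<bar>\<Sum>j<L. ?u j w * (B (p (Suc j)) w - B (p j) w)\<bar> \<and> (\<Sum>j<L. (?u j w)^2 * (p (Suc j) - p j)) <= \<eta>}"
 proof (rule finite_measure_mono)
  show "{w \<in> space M. eps < \<bar>simple_integral_process m \<tau> \<xi> B t w - simple_integral_process m' \<tau>' \<xi>' B t w\<bar> \<and>
  (\<integral>\<^sup>+ s\<in>{0..t}. ennreal ((?v s w)^2) \<partial>lborel) <= ennreal \<eta>} \<subseteq>
   {w \<in> space M. eps < \<bar>\<Sum>j<L. ?u j w * (B (p (Suc j)) w - B (p j) w)\<bar> \<and> (\<Sum>j<L. (?u j w)^2 * (p (Suc j) - p j)) <= \<eta>}"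
   using le unfolding I by blast
  have [measurable]: "(%w. \<Sum>j<L. ?u j w * (B (p (Suc j)) w - B (p j) w)) \<in> borel_measurable M"
   by (rule meas_M[OF sum_meas[OF um]])
  have [measurable]: "(%w. \<Sum>j<L. (?u j w)^2 * (p (Suc j) - p j)) \<in> borel_measurable M"
   by (intro borel_measurable_sum borel_measurable_times borel_measurable_power borel_measurable_const meas_M[OF um]) auto
  show "{w \<in> space M. eps < \<bar>\<Sum>j<L. ?u j w * (B (p (Suc j)) w - B (p j) w)\<bar> \<and> (\<Sum>j<L. (?u j w)^2 * (p (Suc j) - p j)) <= \<eta>} \<in> events"
   by measurable
 qed
 also have "... <= \<eta> / eps^2" by (rule lenglart[OF um e \<eta>])
 finally show ?thesis .
qed

text \<open>By right-continuity the process is the limit of its values at grid points to the right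
  of \<open>s\<close>, and each approximation uses countably many times.\<close>

lemma cadlag_joint_measurable:
 fixes M :: "'a measure"
 assumes fsp: "filtered_prob_space M F" and Y: "cadlag_adapted M F Y"
 shows "(%(s, w). Y (max 0 s) w) \<in> borel_measurable (borel \<Otimes>\<^sub>M M)"
proof (rule borel_measurable_LIMSEQ_real)
 \<comment> \<open>The added 1 keeps \<open>c N s\<close> strictly above \<open>max 0 s\<close>,
   even when that is a grid point, so that the limit is one from the right.\<close>
 define c where "c N s = (\<lfloor>max 0 s * real (Suc N)\<rfloor> + 1) / real (Suc N)" for N and s :: real
 show "(%(s, w). Y (c N s) w) \<in> borel_measurable (borel \<Otimes>\<^sub>M M)" for N
 proof -
  define g where "g x = nat (\<lfloor>max 0 (fst x) * real (Suc N)\<rfloor> + 1)" for x :: "real \<times> 'a"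
  have g: "g \<in> measurable (borel \<Otimes>\<^sub>M M) (count_space UNIV)" unfolding g_def by measurable
  have f: "(%x. Y (real i / real (Suc N)) (snd x)) \<in> borel_measurable (borel \<Otimes>\<^sub>M M)" for i
  proof -
   have "Y (real i / real (Suc N)) \<in> borel_measurable M"
    using Y by (intro measurable_from_subalg[OF filtered_prob_spaceD(2)[OF fsp, of "real i / real (Suc N)"]])
     (simp add: cadlag_adapted_def adapted_process_def)
   then show ?thesis by measurable
  qed
  have "(%x. Y (real (g x) / real (Suc N)) (snd x)) \<in> borel_measurable (borel \<Otimes>\<^sub>M M)"
   by (rule measurable_compose_countable[OF f g])
  moreover have "real (g x) / real (Suc N) = c N (fst x)" for x
  proof -
   have "0 <= max 0 (fst x) * real (Suc N)" by simp
   then have "0 <= \<lfloor>max 0 (fst x) * real (Suc N)\<rfloor> + 1" by linarith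
   then show ?thesis by (simp add: g_def c_def)
  qed
  ultimately show ?thesis by (simp add: case_prod_beta')
 qed
 fix x :: "real \<times> 'a" assume x: "x \<in> space (borel \<Otimes>\<^sub>M M)"
 obtain s w where xs: "x = (s, w)" by (cases x)
 have ww: "w \<in> space M" using x xs by (simp add: space_pair_measure)
 let ?s = "max 0 s"
 have "continuous (at_right ?s) (%t. Y t w)" using Y ww by (auto simp: cadlag_adapted_def cadlag_def)
 then have R: "((%t. Y t w) \<longlongrightarrow> Y ?s w) (at_right ?s)" by (simp add: continuous_within)
 have gt: "?s < c N s" "c N s <= ?s + 1 / real (Suc N)" for N
 proof -
  define u where "u = ?s"
  define k where "k = real (Suc N)"
  have "0 < k" by (simp add: k_def)
  moreover have "u * k < \<lfloor>u * k\<rfloor> + 1" "\<lfloor>u * k\<rfloor> <= u * k" by linarith+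
  ultimately show "?s < c N s" "c N s <= ?s + 1 / real (Suc N)"
   unfolding c_def u_def[symmetric] k_def[symmetric] by (simp_all add: field_simps)
 qed
 have "(%N. ?s + 1 / real (Suc N)) \<longlonglongrightarrow> ?s + 0" by (intro tendsto_add tendsto_const LIMSEQ_Suc lim_1_over_n)
 then have up: "(%N. ?s + 1 / real (Suc N)) \<longlonglongrightarrow> ?s" by simp
 have "(%N. c N s) \<longlonglongrightarrow> ?s"
  by (rule tendsto_sandwich[OF always_eventually always_eventually tendsto_const up]) (use gt less_imp_le in blast)+
 then have "filterlim (%N. c N s) (at_right ?s) sequentially"
  using gt(1) by (intro tendsto_imp_filterlim_at_right) auto
 from filterlim_compose[OF R this] show "(%N. (%(s, w). Y (c N s) w) x) \<longlonglongrightarrow> (%(s, w). Y (max 0 s) w) x"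
  by (simp add: xs)
qed

lemma left_step_value:
 fixes f :: "real => real"
 assumes t: "0 < t" and r: "0 < r" and s: "0 < s" "s <= t"
 shows "\<exists>u. 0 <= u \<and> u < s \<and> s - t / real r <= u \<and>
  (\<Sum>i<r. f (real i * (t / real r)) * indicator {real i * (t / real r)<..real (Suc i) * (t / real r)} s) = f u"
proof -
 define h where "h = t / real r"
 have h: "0 < h" "real r * h = t" using t r by (auto simp: h_def)
 \<comment> \<open>Ceiling minus one instead of the floor, since the cells are left-open.\<close>
 define j where "j = nat (\<lceil>s / h\<rceil> - 1)"
 have "0 < s / h" using s h by simp
 then have "0 <= \<lceil>s / h\<rceil> - 1" by linarith
 then have jr: "real j = of_int \<lceil>s / h\<rceil> - 1" unfolding j_def by simp
 have b: "real j < s / h" "s / h <= real j + 1" unfolding jr by linarith+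
 then have js: "real j * h < s" "s <= real (Suc j) * h" using h by (auto simp: field_simps)
 have "real j * h < real r * h" using js s h by linarith
 then have "real j < real r" using h(1) by (simp only: mult_less_cancel_right_pos)
 then have jn: "j < r" by simp
 have iff: "s \<in> {real i * h<..real (Suc i) * h} \<longleftrightarrow> i = j" for i
 proof
  assume i: "s \<in> {real i * h<..real (Suc i) * h}"
  have "real i * h < real (Suc j) * h" "real j * h < real (Suc i) * h" using i js by auto
  then have "real i < real (Suc j)" "real j < real (Suc i)" using h by (auto simp del: of_nat_Suc)
  then show "i = j" by simp
 qed (use js in simp)
 have "(\<Sum>i<r. f (real i * h) * indicator {real i * h<..real (Suc i) * h} s) = (\<Sum>i<r. if i = j then f (real j * h) else 0)"
  unfolding indicator_def iff by (intro sum.cong) auto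
 also have "... = f (real j * h)" using jn by simp
 finally have "(\<Sum>i<r. f (real i * h) * indicator {real i * h<..real (Suc i) * h} s) = f (real j * h)" .
 moreover have "s - h <= real j * h" using js(2) by (simp add: algebra_simps)
 ultimately show ?thesis using js(1) h unfolding h_def[symmetric] by (intro exI[of _ "real j * h"]) auto
qed

text \<open>The definition of the integral provides some approximating simple processes. Riemann
  sums belong to another approximation of \<open>H\<close>, converging along each path in
  \<open>L^2\<close>, and Lenglart's inequality shows that integrals of two approximations of one
  integrand have the same limit.\<close>

lemma ito_riemann_sums:
 fixes M :: "'a measure"
 assumes fsp: "filtered_prob_space M F" and B: "brownian_motion M F B"
  and H: "cadlag_adapted M F H" and I: "has_ito_integral M F B H I" and t: "0 < t"
 shows "tendsto_in_prob M (%r w. \<Sum>j<r. H (real j * (t / real r)) w *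
  (B (real (Suc j) * (t / real r)) w - B (real j * (t / real r)) w)) (I t)"
proof -
 interpret prob_space M by (rule filtered_prob_spaceD[OF fsp])
 obtain m \<tau> \<xi> where
  data: "\<forall>k. simple_process_data M F (m k) (\<tau> k) (\<xi> k)" and
  conv: "\<forall>t\<ge>0. \<forall>eps>0. (%k::nat. prob {w \<in> space M.
      (\<integral>\<^sup>+ s\<in>{0..t}. ennreal ((simple_process_val (m k) (\<tau> k) (\<xi> k) s w - H s w)^2) \<partial>lborel)
       > ennreal eps}) \<longlonglongrightarrow> 0" and
  lim: "\<forall>t\<ge>0. tendsto_in_prob M (%k. simple_integral_process (m k) (\<tau> k) (\<xi> k) B t) (I t)"
  using I unfolding has_ito_integral_def by blast
 note lim = lim[rule_format, OF less_imp_le[OF t]] and conv = conv[rule_format, OF less_imp_le[OF t]] and data = data[rule_format]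
 note wd = simple_process_data_weak[OF data]
 define p where "p r j = real j * (t / real r)" for r j :: nat
 define V where "V k s w = simple_process_val (m k) (\<tau> k) (\<xi> k) s w" for k s w
 define W where "W r s w = simple_process_val r (p r) (%j. H (p r j)) s w" for r s w
 define S where "S r w = (\<Sum>j<r. H (p r j) w * (B (p r (Suc j)) w - B (p r j) w))" for r w
 define SI where "SI k w = simple_integral_process (m k) (\<tau> k) (\<xi> k) B t w" for k w
 have pp: "0 <= p r j" "p r j <= p r (Suc j)" for r j
  using t unfolding p_def by (auto intro: mult_right_mono simp del: times_divide_eq_right)
 have Had: "H s \<in> borel_measurable (F s)" if "0 <= s" for s using H that by (simp add: cadlag_adapted_def adapted_process_def)
 have HM: "H s \<in> borel_measurable M" if "0 <= s" for s by (rule measurable_from_subalg[OF filtered_prob_spaceD(2)[OF fsp] Had[OF that]])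
 have wW: "weak_simple_data F r (p r) (%j. H (p r j))" for r using pp Had by (simp add: weak_simple_data_def)
 have S_eq: "S r w = simple_integral_process r (p r) (%j. H (p r j)) B t w" for r w
  unfolding S_def simple_integral_process_def
 proof (intro sum.cong refl)
  fix j assume "j \<in> {..<r}"
  then have "real j <= real r" "real (Suc j) <= real r" "0 < real r" by auto
  then have eq: "real r * (t / real r) = t" and "0 <= t / real r" using t by auto
  have "p r j <= t" "p r (Suc j) <= t"
   unfolding p_def
   using mult_right_mono[OF \<open>real j <= real r\<close> \<open>0 <= t / real r\<close>]
    mult_right_mono[OF \<open>real (Suc j) <= real r\<close> \<open>0 <= t / real r\<close>] unfolding eq .
  then have "min t (p r j) = p r j" "min t (p r (Suc j)) = p r (Suc j)" by auto
  then show "H (p r j) w * (B (p r (Suc j)) w - B (p r j) w) = H (p r j) w * (B (min t (p r (Suc j))) w - B (min t (p r j)) w)" by simp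
 qed
 have BM: "B s \<in> borel_measurable M" if "0 <= s" for s
  using B that by (intro measurable_from_subalg[OF filtered_prob_spaceD(2)[OF fsp, of s]]) (simp add: brownian_motion_def adapted_process_def)
 have SM: "S r \<in> borel_measurable M" for r
  unfolding S_def[abs_def] by (intro borel_measurable_sum borel_measurable_times borel_measurable_diff BM HM pp)
 have SIM: "SI k \<in> borel_measurable M" "I t \<in> borel_measurable M" for k
  using lim by (auto simp: tendsto_in_prob_def SI_def[abs_def])
 \<comment> \<open>Constant continuation to negative times gives a jointly measurable process; on
   \<open>{0..t}\<close> nothing changes.\<close>
 define H' where "H' s = H (max 0 s)" for s
 have Hj[measurable]: "(%(w, s). H' s w) \<in> borel_measurable (M \<Otimes>\<^sub>M lborel)"
 proof -
  have "(%x. (%(s, w). H (max 0 s) w) (snd x, fst x)) \<in> borel_measurable (M \<Otimes>\<^sub>M borel)"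
   by (rule measurable_compose[OF _ cadlag_joint_measurable[OF fsp H]]) measurable
  then have "(%(w, s). H' s w) \<in> borel_measurable (M \<Otimes>\<^sub>M borel)" by (simp add: H'_def case_prod_beta')
  moreover have "sets (M \<Otimes>\<^sub>M lborel) = sets (M \<Otimes>\<^sub>M (borel::real measure))" by (intro sets_pair_measure_cong) auto
  ultimately show ?thesis by (simp cong: measurable_cong_sets)
 qed
 have Vj[measurable]: "(%(w, s). V k s w) \<in> borel_measurable (M \<Otimes>\<^sub>M lborel)" for k
 proof -
  have [measurable]: "\<xi> k i \<in> borel_measurable M" if "i < m k" for i
   using data[of k] that by (intro measurable_from_subalg[OF filtered_prob_spaceD(2)[OF fsp, of "\<tau> k i"]]) (simp add: simple_process_data_def)
  show ?thesis unfolding V_def simple_process_val_def case_prod_beta'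
   by (intro borel_measurable_sum borel_measurable_times) measurable
 qed
 have Wj[measurable]: "(%(w, s). W r s w) \<in> borel_measurable (M \<Otimes>\<^sub>M lborel)" for r
 proof -
  have [measurable]: "H (p r i) \<in> borel_measurable M" for i by (rule HM[OF pp(1)])
  show ?thesis unfolding W_def simple_process_val_def case_prod_beta'
   by (intro borel_measurable_sum borel_measurable_times) measurable
 qed
 define a where "a r w = (\<integral>\<^sup>+ s\<in>{0..t}. ennreal ((W r s w - H' s w)^2) \<partial>lborel)" for r w
 define b where "b k w = (\<integral>\<^sup>+ s\<in>{0..t}. ennreal ((V k s w - H' s w)^2) \<partial>lborel)" for k w
 define c where "c r k w = (\<integral>\<^sup>+ s\<in>{0..t}. ennreal ((W r s w - V k s w)^2) \<partial>lborel)" for r k w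
 have [measurable]: "a r \<in> borel_measurable M" "b k \<in> borel_measurable M" "c r k \<in> borel_measurable M" for r k
  unfolding a_def b_def c_def by measurable
 have c_le: "c r k w <= 2 * a r w + 2 * b k w" if ww: "w \<in> space M" for r k w
 proof -
  have [measurable]: "(%s. W r s w) \<in> borel_measurable lborel" "(%s. V k s w) \<in> borel_measurable lborel" "(%s. H' s w) \<in> borel_measurable lborel"
   using measurable_compose[OF measurable_Pair1'[OF ww] Wj] measurable_compose[OF measurable_Pair1'[OF ww] Vj] measurable_compose[OF measurable_Pair1'[OF ww] Hj] by auto
  have "c r k w <= (\<integral>\<^sup>+ s. 2 * (ennreal ((W r s w - H' s w)^2) * indicator {0..t} s) + 2 * (ennreal ((V k s w - H' s w)^2) * indicator {0..t} s) \<partial>lborel)"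
   unfolding c_def
  proof (intro nn_integral_mono)
   fix s
   have "(x - y)^2 <= 2 * (x - z)^2 + 2 * (y - z)^2" for x y z :: real
   proof -
    have "2 * (x - z)^2 + 2 * (y - z)^2 - (x - y)^2 = (x + y - 2 * z)^2" by (simp add: power2_eq_square algebra_simps)
    then show ?thesis by (metis diff_ge_0_iff_ge zero_le_power2)
   qed
   from this[of "W r s w" "V k s w" "H' s w"]
   have "ennreal ((W r s w - V k s w)^2) <= ennreal (2 * (W r s w - H' s w)^2 + 2 * (V k s w - H' s w)^2)" by (rule ennreal_leI)
   also have "... = 2 * ennreal ((W r s w - H' s w)^2) + 2 * ennreal ((V k s w - H' s w)^2)"
    by (simp add: ennreal_plus ennreal_mult)
   finally show "ennreal ((W r s w - V k s w)^2) * indicator {0..t} s <= 2 * (ennreal ((W r s w - H' s w)^2) * indicator {0..t} s) + 2 * (ennreal ((V k s w - H' s w)^2) * indicator {0..t} s)"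
    by (auto simp: indicator_def)
  qed
  also have "... = 2 * a r w + 2 * b k w" unfolding a_def b_def by (simp add: nn_integral_add nn_integral_cmult)
  finally show ?thesis .
 qed
 have b_lim: "(%k. prob {w \<in> space M. ennreal \<eta> < b k w}) \<longlonglongrightarrow> 0" if "0 < \<eta>" for \<eta>
 proof -
  have "b k w = (\<integral>\<^sup>+ s\<in>{0..t}. ennreal ((simple_process_val (m k) (\<tau> k) (\<xi> k) s w - H s w)^2) \<partial>lborel)" for k w
   unfolding b_def V_def H'_def by (intro nn_integral_cong) (auto simp: indicator_def max_def)
  then show ?thesis using conv[OF that] by simp
 qed
 have a_lim: "(%r. a r w) \<longlonglongrightarrow> 0" if ww: "w \<in> space M" for w
 proof -
  have cad: "cadlag (%s. H s w)" using H ww by (simp add: cadlag_adapted_def)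
  obtain C where C: "0 <= C" "!!s. s \<in> {0..t} ==> \<bar>H s w\<bar> <= C" using cadlag_bounded[OF cad, of t] t by (metis less_imp_le)
  have [measurable]: "(%s. W r s w) \<in> borel_measurable lborel" "(%s. H' s w) \<in> borel_measurable lborel" for r
   using measurable_compose[OF measurable_Pair1'[OF ww] Wj] measurable_compose[OF measurable_Pair1'[OF ww] Hj] by auto
  have Wu: "\<exists>u. 0 <= u \<and> u < s \<and> s - t / real r <= u \<and> W r s w = H u w" if "0 < r" "0 < s" "s <= t" for r s
   using left_step_value[OF t that(1) that(2,3), of "%u. H u w"] unfolding W_def simple_process_val_def p_def .
  \<comment> \<open>Indices start at \<open>Suc r\<close> because \<open>left_step_value\<close>
    wants a positive number of cells. The time \<open>s = 0\<close> lies in no cell but is a null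
    set.\<close>
  have "(%r. \<integral>\<^sup>+ s. ennreal ((W (Suc r) s w - H' s w)^2) * indicator {0..t} s \<partial>lborel) \<longlonglongrightarrow> (\<integral>\<^sup>+ (s::real). 0 \<partial>lborel)"
  proof (rule nn_integral_dominated_convergence[where w="%s. ennreal ((2 * C)^2) * indicator {0..t} s"])
   show "(%s. ennreal ((W (Suc r) s w - H' s w)^2) * indicator {0..t} s) \<in> borel_measurable lborel" for r by measurable
   have "AE s in lborel. s ~= (0::real)" by (rule AE_lborel_singleton)
   then show "AE s in lborel. ennreal ((W (Suc r) s w - H' s w)^2) * indicator {0..t} s <= ennreal ((2 * C)^2) * indicator {0..t} s" for r
   proof eventually_elim
    fix s :: real assume s0: "s ~= 0"
    show "ennreal ((W (Suc r) s w - H' s w)^2) * indicator {0..t} s <= ennreal ((2 * C)^2) * indicator {0..t} s"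
    proof (cases "s \<in> {0..t}")
     case True
     then have s: "0 < s" "s <= t" using s0 by auto
     obtain u where u: "0 <= u" "u < s" "W (Suc r) s w = H u w" using Wu[of "Suc r" s] s by auto
     have "\<bar>W (Suc r) s w - H' s w\<bar> <= 2 * C" using C(2)[of u] C(2)[of s] u s by (auto simp: H'_def max_def)
     then have "(W (Suc r) s w - H' s w)^2 <= (2 * C)^2" by (metis abs_ge_zero power2_abs power_mono)
     then show ?thesis by (intro mult_right_mono ennreal_leI) auto
    qed simp
   qed
   show "(\<integral>\<^sup>+ s. ennreal ((2 * C)^2) * indicator {0..t} s \<partial>lborel) < \<infinity>"
    using t by (simp add: nn_integral_cmult_indicator ennreal_mult_less_top)
   show "AE s in lborel. (%r. ennreal ((W (Suc r) s w - H' s w)^2) * indicator {0..t} s) \<longlonglongrightarrow> 0"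
    using cadlag_AE_isCont[OF cad] \<open>AE s in lborel. s ~= (0::real)\<close>
   proof eventually_elim
    fix s :: real assume ic: "0 < s --> isCont (%s. H s w) s" and s0: "s ~= 0"
    show "(%r. ennreal ((W (Suc r) s w - H' s w)^2) * indicator {0..t} s) \<longlonglongrightarrow> 0"
    proof (cases "s \<in> {0..t}")
     case True
     then have s: "0 < s" "s <= t" using s0 by auto
     have "\<forall>r. \<exists>u. 0 <= u \<and> u < s \<and> s - t / real (Suc r) <= u \<and> W (Suc r) s w = H u w" using Wu s by blast
     then obtain u where u: "!!r. u r < s" "!!r. s - t / real (Suc r) <= u r" "!!r. W (Suc r) s w = H (u r) w" by metis
     have "(%r. s - t / real (Suc r)) \<longlonglongrightarrow> s - 0" by (intro tendsto_diff tendsto_const LIMSEQ_Suc lim_const_over_n)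
     then have low: "(%r. s - t / real (Suc r)) \<longlonglongrightarrow> s" by simp
     have "u \<longlonglongrightarrow> s"
      by (rule tendsto_sandwich[OF always_eventually always_eventually low tendsto_const]) (use u less_imp_le in blast)+
     then have "(%r. H (u r) w) \<longlonglongrightarrow> H s w" using ic s(1) by (intro isCont_tendsto_compose[of s "%s. H s w"]) auto
     then have "(%r. (W (Suc r) s w - H' s w)^2) \<longlonglongrightarrow> (H s w - H s w)^2"
      unfolding u(3) H'_def using s by (intro tendsto_intros) (auto simp: max_def)
     then have "(%r. ennreal ((W (Suc r) s w - H' s w)^2)) \<longlonglongrightarrow> ennreal 0" by (intro tendsto_ennrealI) simp
     then show ?thesis using True by simp
    qed simp
   qed
  qed auto
  then have "(%r. a (Suc r) w) \<longlonglongrightarrow> 0" by (simp add: a_def)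
  then show ?thesis by (rule LIMSEQ_imp_Suc)
 qed
 have a_prob: "(%r. prob {w \<in> space M. ennreal \<eta> < a r w}) \<longlonglongrightarrow> 0" if \<eta>: "0 < \<eta>" for \<eta>
 proof -
  let ?A = "%n. {w \<in> space M. ennreal \<eta> < a n w}"
  have "(%n. expectation (indicator (?A n))) \<longlonglongrightarrow> expectation (%_. 0::real)"
  proof (rule integral_dominated_convergence[where w="%_. 1"])
   show "AE x in M. (%n. indicator (?A n) x) \<longlonglongrightarrow> (0::real)"
   proof (rule AE_I2)
    fix w assume "w \<in> space M"
    from order_tendstoD(2)[OF a_lim[OF this], of "ennreal \<eta>"] \<eta>
    have "\<forall>\<^sub>F n in sequentially. a n w < ennreal \<eta>" by simp
    then have "\<forall>\<^sub>F n in sequentially. indicator (?A n) w = (0::real)"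
     by eventually_elim (auto simp: indicator_def)
    then show "(%n. indicator (?A n) w) \<longlonglongrightarrow> (0::real)" by (rule tendsto_eventually)
   qed
  qed auto
  then show ?thesis by simp
 qed
 \<comment> \<open>The index \<open>k\<close> of the given approximation occurs only in the upper
   bound and is sent to infinity. The level \<open>\<eta> / 4\<close> for both distances to
   \<open>H\<close> fits \<open>c <= 2 * a + 2 * b\<close>.\<close>
 have main: "prob {w \<in> space M. 2 * eps < \<bar>S r w - I t w\<bar>} <= \<eta> / eps^2 + prob {w \<in> space M. ennreal (\<eta> / 4) < a r w}"
  if e: "0 < eps" and \<eta>: "0 < \<eta>" for eps \<eta> r
 proof -
  let ?R = "prob {w \<in> space M. 2 * eps < \<bar>S r w - I t w\<bar>}"
  have bound: "?R <= (\<eta> / eps^2 + prob {w \<in> space M. ennreal (\<eta> / 4) < a r w}) +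
   (prob {w \<in> space M. ennreal (\<eta> / 4) < b k w} + prob {w \<in> space M. eps < \<bar>SI k w - I t w\<bar>})" for k
  proof -
   let ?E1 = "{w \<in> space M. eps < \<bar>S r w - SI k w\<bar> \<and> c r k w <= ennreal \<eta>}"
   let ?E2 = "{w \<in> space M. ennreal (\<eta> / 4) < a r w}"
   let ?E3 = "{w \<in> space M. ennreal (\<eta> / 4) < b k w}"
   let ?E4 = "{w \<in> space M. eps < \<bar>SI k w - I t w\<bar>}"
   have [measurable]: "S r \<in> borel_measurable M" "SI k \<in> borel_measurable M" "I t \<in> borel_measurable M" using SM SIM by auto
   have ev: "?E1 \<in> events" "?E2 \<in> events" "?E3 \<in> events" "?E4 \<in> events" by measurable
   have "{w \<in> space M. 2 * eps < \<bar>S r w - I t w\<bar>} \<subseteq> (?E1 \<union> ?E2) \<union> (?E3 \<union> ?E4)"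
   proof (rule subsetI, rule ccontr)
    fix w assume ww: "w \<in> {w \<in> space M. 2 * eps < \<bar>S r w - I t w\<bar>}" and n: "w \<notin> (?E1 \<union> ?E2) \<union> (?E3 \<union> ?E4)"
    have ab: "a r w <= ennreal (\<eta> / 4)" "b k w <= ennreal (\<eta> / 4)" using ww n by auto
    have "c r k w <= 2 * a r w + 2 * b k w" using c_le ww by simp
    also have "... <= 2 * ennreal (\<eta> / 4) + 2 * ennreal (\<eta> / 4)" by (intro add_mono mult_left_mono ab) auto
    also have "... = ennreal \<eta>"
    proof -
     have two: "2 * ennreal (\<eta> / 4) = ennreal (2 * (\<eta> / 4))" using \<eta> by (subst ennreal_mult) auto
     show ?thesis unfolding two using \<eta> by (subst ennreal_plus[symmetric]) auto
    qed
    finally have "c r k w <= ennreal \<eta>" .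
    then have "\<bar>S r w - SI k w\<bar> <= eps" "\<bar>SI k w - I t w\<bar> <= eps" using ww n by auto
    then show False using ww by auto
   qed
   then have "?R <= prob (?E1 \<union> ?E2) + prob (?E3 \<union> ?E4)" using ev by (intro prob_le_add) auto
   also have "... <= (prob ?E1 + prob ?E2) + (prob ?E3 + prob ?E4)" using ev by (intro add_mono measure_Un_le) auto
   also have "prob ?E1 <= \<eta> / eps^2"
    using simple_lenglart[OF fsp B wW wd t e, of \<eta> r k] \<eta> unfolding S_eq SI_def c_def W_def V_def by simp
   finally show ?thesis by simp
  qed
  have lim0: "(%k. prob {w \<in> space M. ennreal (\<eta> / 4) < b k w} + prob {w \<in> space M. eps < \<bar>SI k w - I t w\<bar>}) \<longlonglongrightarrow> 0 + 0"
   using \<eta> e lim by (intro tendsto_add b_lim) (auto simp: tendsto_in_prob_def SI_def)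
  have "?R <= (\<eta> / eps^2 + prob {w \<in> space M. ennreal (\<eta> / 4) < a r w}) + (0 + 0)"
   by (rule LIMSEQ_le_const[OF tendsto_add[OF tendsto_const lim0]]) (intro exI allI impI bound)
  then show ?thesis by simp
 qed
 have "vanishing M (%r w. S r w - I t w)"
 proof (rule vanishingI)
  show "(%w. S r w - I t w) \<in> borel_measurable M" for r using SM SIM by measurable
  fix eps \<delta> :: real assume e: "0 < eps" "0 < \<delta>"
  define \<eta> where "\<eta> = \<delta> / 2 * (eps / 2)^2"
  have \<eta>: "0 < \<eta>" "\<eta> / (eps / 2)^2 = \<delta> / 2" using e by (auto simp: \<eta>_def)
  have "\<forall>\<^sub>F r in sequentially. prob {w \<in> space M. ennreal (\<eta> / 4) < a r w} < \<delta> / 2"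
   using order_tendstoD(2)[OF a_prob[of "\<eta> / 4"], of "\<delta> / 2"] \<eta> e by simp
  then show "\<forall>\<^sub>F r in sequentially. prob {w \<in> space M. eps < \<bar>S r w - I t w\<bar>} <= \<delta>"
  proof eventually_elim
   case (elim r)
   then show ?case using main[of "eps / 2" \<eta> r] \<eta> e by simp
  qed
 qed
 then have "tendsto_in_prob M S (I t)" unfolding tendsto_in_prob_iff_vanishing using SM SIM by blast
 then show ?thesis by (simp add: S_def[abs_def] p_def)
qed

section \<open>Increments on equidistant grids, weak limits and conditional Gaussian laws\<close>

text \<open>Cells are counted from 0 here, whereas \<open>incr\<close> counts them from 1; hence the
  \<open>Suc i\<close> where the two meet.\<close>

definition inc :: "real => nat => (real => real) => nat => real" where
 "inc T n x i = x (real (Suc i) * (T / real n)) - x (real i * (T / real n))"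

lemma cos_lipschitz: "\<bar>cos a - cos b\<bar> <= \<bar>a - b :: real\<bar>"
proof -
 have "\<bar>cos a - cos b\<bar> = 2 * \<bar>sin ((a + b) / 2)\<bar> * \<bar>sin ((b - a) / 2)\<bar>" by (simp add: cos_diff_cos abs_mult)
 also have "... <= 2 * 1 * \<bar>(b - a) / 2\<bar>" by (intro mult_mono abs_sin_x_le_abs_x) auto
 finally show ?thesis by (simp add: abs_minus_commute)
qed

lemma sin_lipschitz: "\<bar>sin a - sin b\<bar> <= \<bar>a - b :: real\<bar>"
proof -
 have "\<bar>sin a - sin b\<bar> = 2 * \<bar>sin ((a - b) / 2)\<bar> * \<bar>cos ((a + b) / 2)\<bar>" by (simp add: sin_diff_sin abs_mult)
 also have "... <= 2 * \<bar>(a - b) / 2\<bar> * 1" by (intro mult_mono abs_sin_x_le_abs_x) auto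
 finally show ?thesis by simp
qed

lemma exp_neg_lipschitz:
 assumes "0 <= x" "0 <= y" shows "\<bar>exp (- x) - exp (- y)\<bar> <= \<bar>x - y :: real\<bar>"
proof -
 have main: "exp (- u) - exp (- v) <= v - u" if "0 <= u" "u <= v" for u v :: real
 proof -
  have "exp (- u) - exp (- v) = exp (- u) * (1 - exp (- (v - u)))" by (simp add: right_diff_distrib flip: exp_add)
  also have "... <= 1 * (v - u)"
  proof (intro mult_mono)
   show "1 - exp (- (v - u)) <= v - u" using exp_ge_add_one_self[of "- (v - u)"] by linarith
  qed (use that in auto)
  finally show ?thesis by simp
 qed
 show ?thesis
 proof (cases "x <= y")
  case True
  then show ?thesis using main[of x y] assms by auto
 next
  case False
  then show ?thesis using main[of y x] assms by auto
 qed
qed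

lemma sum_cells_const:
 fixes a d :: "nat => real"
 assumes m: "0 < m"
 shows "(\<Sum>l<n*m. a (l div m) * d l) = (\<Sum>i<n. a i * (\<Sum>l\<in>{i*m..<i*m+m}. d l))"
proof -
 have "(\<Sum>l<n*m. a (l div m) * d l) = (\<Sum>i<n. \<Sum>l\<in>{i*m..<i*m+m}. a (l div m) * d l)"
  by (rule sum.nat_group[symmetric])
 also have "... = (\<Sum>i<n. \<Sum>l\<in>{i*m..<i*m+m}. a i * d l)"
 proof (intro sum.cong refl)
  fix i l assume "l \<in> {i*m..<i*m+m}"
  then have "l div m = i" using div_nat_eqI[of m i l] by (simp add: mult.commute)
  then show "a (l div m) * d l = a i * d l" by simp
 qed
 finally show ?thesis by (simp add: sum_distrib_left)
qed

lemma inc_refine: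
 assumes m: "0 < m"
 shows "(\<Sum>l\<in>{i*m..<i*m+m}. inc T (n*m) x l) = inc T n x i"
proof -
 let ?g = "%l. x (real l * (T / real (n*m)))"
 have "(\<Sum>l\<in>{i*m..<i*m+m}. ?g (Suc l) - ?g l) = ?g (i*m+m) - ?g (i*m)" by (rule sum_Suc_diff') simp
 moreover have "real (i*m+m) * (T / real (n*m)) = real (Suc i) * (T / real n)" "real (i*m) * (T / real (n*m)) = real i * (T / real n)"
  using m by (cases "n = 0"; simp add: field_simps)+
 ultimately show ?thesis by (simp add: inc_def)
qed

text \<open>An argument of Renyi: a bounded sequence whose terms become orthogonal to each fixed term
 converges weakly to 0, since otherwise averages of suitable terms would be too large.\<close>

lemma (in prob_space) renyi_weak_limit:
 fixes \<psi> :: "nat => 'a => real"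
 assumes \<psi>: "!!n. \<psi> n \<in> borel_measurable M" and c: "!!n w. w \<in> space M ==> \<bar>\<psi> n w\<bar> <= c"
  and G: "G \<in> borel_measurable M" and g: "!!w. w \<in> space M ==> \<bar>G w\<bar> <= g"
  and lim: "!!m. (%n. expectation (%w. \<psi> n w * \<psi> m w)) \<longlonglongrightarrow> 0"
 shows "(%n. expectation (%w. G w * \<psi> n w)) \<longlonglongrightarrow> 0"
proof -
 obtain w0 where w0: "w0 \<in> space M" using not_empty by blast
 have c0: "0 <= c" using c[OF w0, of 0] by linarith
 have one_sided: "finite {n. eps <= expectation (%w. G w * \<psi> n w)}"
  if e: "0 < eps" and G: "G \<in> borel_measurable M" and g: "!!w. w \<in> space M ==> \<bar>G w\<bar> <= g" for G g eps
 proof (rule ccontr)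
  let ?S = "{n. eps <= expectation (%w. G w * \<psi> n w)}"
  assume inf: "infinite ?S"
  have g0: "0 < g + 1" using g[OF w0] by linarith
  have g1: "\<bar>G w\<bar> <= g + 1" if "w \<in> space M" for w using g[OF that] by linarith
  \<comment> \<open>Leaves \<open>(g + 1)^2 * \<eta> = eps^2 / 2\<close>, so the off-diagonal part
    of the second moment takes up only half of \<open>(k * eps)^2\<close>. The 1 added to
    \<open>g\<close> keeps the denominator positive.\<close>
  define \<eta> where "\<eta> = eps^2 / (2 * (g + 1)^2)"
  have \<eta>: "0 < \<eta>" using e g0 by (simp add: \<eta>_def)
  \<comment> \<open>Greedy selection: each further index is taken so late that it is nearly
    orthogonal to the finitely many already chosen.\<close>
  have ex: "\<exists>A. finite A \<and> A \<subseteq> ?S \<and> card A = k \<and> (\<forall>i\<in>A. \<forall>j\<in>A. i ~= j --> \<bar>expectation (%w. \<psi> i w * \<psi> j w)\<bar> <= \<eta>)" for k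
  proof (induction k)
   case 0
   show ?case by (intro exI[of _ "{}"]) auto
  next
   case (Suc k)
   then obtain A where A: "finite A" "A \<subseteq> ?S" "card A = k"
    "!!i j. i \<in> A ==> j \<in> A ==> i ~= j ==> \<bar>expectation (%w. \<psi> i w * \<psi> j w)\<bar> <= \<eta>" by blast
   have "\<forall>\<^sub>F n in sequentially. \<forall>m\<in>A. \<bar>expectation (%w. \<psi> n w * \<psi> m w)\<bar> < \<eta>"
   proof (rule eventually_ball_finite[OF A(1)], rule ballI)
    fix m
    from tendstoD[OF lim[of m] \<eta>] show "\<forall>\<^sub>F n in sequentially. \<bar>expectation (%w. \<psi> n w * \<psi> m w)\<bar> < \<eta>" by simp
   qed
   then obtain N where N: "!!n m. N <= n ==> m \<in> A ==> \<bar>expectation (%w. \<psi> n w * \<psi> m w)\<bar> < \<eta>"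
    unfolding eventually_at_top_linorder by blast
   have "infinite (?S - ({..<N} \<union> A))" using inf A(1) by simp
   then have "?S - ({..<N} \<union> A) ~= {}" by (rule infinite_imp_nonempty)
   then obtain n where n: "n \<in> ?S" "N <= n" "n \<notin> A" by fastforce
   have sym: "expectation (%w. \<psi> i w * \<psi> j w) = expectation (%w. \<psi> j w * \<psi> i w)" for i j by (simp add: mult.commute)
   show ?case
   proof (intro exI[of _ "insert n A"] conjI ballI impI)
    show "card (insert n A) = Suc k" using A n by simp
    fix i j assume "i \<in> insert n A" "j \<in> insert n A" "i ~= j"
    then show "\<bar>expectation (%w. \<psi> i w * \<psi> j w)\<bar> <= \<eta>"
     using N[OF n(2), of i] N[OF n(2), of j] A(4)[of i j] sym[of i j] by auto
   qed (use A n in auto)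
  qed
  \<comment> \<open>Large enough for \<open>k * eps^2\<close> to exceed twice the diagonal part,
    which contradicts the bound from Cauchy-Schwarz.\<close>
  obtain k :: nat where k: "2 * (g + 1)^2 * c^2 / eps^2 < real k" using reals_Archimedean2 by blast
  have k0: "0 < real k" using k c0 e by (intro le_less_trans[OF _ k]) simp
  obtain A where A: "finite A" "A \<subseteq> ?S" "card A = k"
    "!!i j. i \<in> A ==> j \<in> A ==> i ~= j ==> \<bar>expectation (%w. \<psi> i w * \<psi> j w)\<bar> <= \<eta>" using ex[of k] by blast
  define S where "S w = (\<Sum>n\<in>A. \<psi> n w)" for w
  have Sm: "S \<in> borel_measurable M" unfolding S_def[abs_def] using \<psi> by (intro borel_measurable_sum)
  have pp: "integrable M (%w. \<psi> i w * \<psi> j w)" "\<bar>expectation (%w. \<psi> i w * \<psi> j w)\<bar> <= c^2" for i j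
  proof -
   have b: "\<bar>\<psi> i w * \<psi> j w\<bar> <= c^2" if "w \<in> space M" for w
    using mult_mono[OF c[OF that, of i] c[OF that, of j]] c0 by (simp add: abs_mult power2_eq_square)
   show i: "integrable M (%w. \<psi> i w * \<psi> j w)"
    using \<psi>[of i] \<psi>[of j] b by (intro integrable_const_bound[where B="c^2"]) auto
   have "\<bar>expectation (%w. \<psi> i w * \<psi> j w)\<bar> <= expectation (%w. \<bar>\<psi> i w * \<psi> j w\<bar>)" by (rule integral_abs_bound)
   also have "... <= expectation (%w. c^2)" using i b by (intro integral_mono) auto
   finally show "\<bar>expectation (%w. \<psi> i w * \<psi> j w)\<bar> <= c^2" by (simp add: prob_space)
  qed
  have S2: "(S w)^2 = (\<Sum>i\<in>A. \<Sum>j\<in>A. \<psi> i w * \<psi> j w)" for w by (simp add: S_def power2_eq_square sum_product)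
  have S2i: "integrable M (%w. (S w)^2)" unfolding S2 using pp by auto
  have "expectation (%w. (S w)^2) = (\<Sum>i\<in>A. \<Sum>j\<in>A. expectation (%w. \<psi> i w * \<psi> j w))" unfolding S2 using pp by simp
  also have "... <= (\<Sum>i\<in>A. \<Sum>j\<in>A. (if j = i then c\<^sup>2 else 0) + \<eta>)"
  proof (intro sum_mono)
   fix i j assume "i \<in> A" "j \<in> A"
   then show "expectation (%w. \<psi> i w * \<psi> j w) <= (if j = i then c\<^sup>2 else 0) + \<eta>"
    using A(4)[of i j] pp(2)[of i j] \<eta> by (cases "i = j") auto
  qed
  also have "... = real k * c^2 + (real k)^2 * \<eta>"
   using A by (simp add: sum.distrib power2_eq_square algebra_simps)
  finally have ES: "expectation (%w. (S w)^2) <= real k * c^2 + (real k)^2 * \<eta>" .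
  have Gi: "integrable M (%w. G w * \<psi> n w)" for n
  proof (rule integrable_const_bound[where B="(g + 1) * c"])
   show "AE x in M. norm (G x * \<psi> n x) <= (g + 1) * c"
    using g1 c c0 g0 by (intro AE_I2) (auto simp: abs_mult intro!: mult_mono)
  qed (use G \<psi> in auto)
  have "real k * eps = (\<Sum>n\<in>A. eps)" using A by simp
  also have "... <= (\<Sum>n\<in>A. expectation (%w. G w * \<psi> n w))" using A(2) by (intro sum_mono) auto
  also have "... = expectation (%w. G w * S w)" using Gi by (simp add: S_def sum_distrib_left)
  finally have low: "real k * eps <= expectation (%w. G w * S w)" .
  have GS: "(G w * S w)^2 <= (g + 1)^2 * (S w)^2" if "w \<in> space M" for w
   using power_mono[OF g1[OF that], of 2] by (simp add: power_mult_distrib mult_right_mono)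
  have GSi: "integrable M (%w. (G w * S w)^2)"
  proof (rule Bochner_Integration.integrable_bound)
   show "integrable M (%w. (g + 1)^2 * (S w)^2)" using S2i by simp
   show "(%w. (G w * S w)^2) \<in> borel_measurable M" by (intro borel_measurable_power borel_measurable_times G Sm)
   show "AE w in M. norm ((G w * S w)^2) <= norm ((g + 1)^2 * (S w)^2)"
   proof (rule AE_I2)
    fix w assume "w \<in> space M"
    from order_trans[OF GS[OF this] abs_ge_self] show "norm ((G w * S w)^2) <= norm ((g + 1)^2 * (S w)^2)" by simp
   qed
  qed
  have "(real k * eps)^2 <= (expectation (%w. G w * S w))^2" using low e by (intro power_mono) auto
  also have "... <= expectation (%w. (G w * S w)^2)" by (rule square_expectation_le(2)[OF borel_measurable_times[OF G Sm] GSi])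
  also have "... <= expectation (%w. (g + 1)^2 * (S w)^2)" using GSi S2i GS by (intro integral_mono) auto
  also have "... = (g + 1)^2 * expectation (%w. (S w)^2)" by simp
  also have "... <= (g + 1)^2 * (real k * c^2 + (real k)^2 * \<eta>)" using ES by (intro mult_left_mono) auto
  also have "... = real k * ((g + 1)^2 * c^2) + (real k * eps)^2 / 2"
  proof -
   have "(g + 1)^2 * \<eta> = eps^2 / 2" using g0 by (simp add: \<eta>_def)
   then have "(real k)^2 * ((g + 1)^2 * \<eta>) = (real k * eps)^2 / 2" by (simp add: power_mult_distrib)
   moreover have "(g + 1)^2 * (real k * c^2 + (real k)^2 * \<eta>) = real k * ((g + 1)^2 * c^2) + (real k)^2 * ((g + 1)^2 * \<eta>)"
    by (simp only: distrib_left mult_ac)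
   ultimately show ?thesis by simp
  qed
  finally have "(real k * eps)^2 / 2 <= real k * ((g + 1)^2 * c^2)" by simp
  then have "real k * (real k * eps^2) <= real k * (2 * (g + 1)^2 * c^2)" by (simp add: power2_eq_square mult_ac)
  then have "real k * eps^2 <= 2 * (g + 1)^2 * c^2" using k0 by (simp only: mult_le_cancel_left_pos)
  moreover have "2 * (g + 1)^2 * c^2 < real k * eps^2" using k e by (simp add: divide_less_eq)
  ultimately show False by simp
 qed
 show ?thesis
 proof (rule tendstoI)
  fix eps :: real assume e: "0 < eps"
  have "finite {n. eps <= expectation (%w. G w * \<psi> n w)}" by (rule one_sided[OF e G g])
  moreover have "finite {n. eps <= expectation (%w. - G w * \<psi> n w)}"
   using G g by (intro one_sided[OF e, of _ g]) auto
  ultimately have "finite ({n. eps <= expectation (%w. G w * \<psi> n w)} \<union> {n. eps <= expectation (%w. - G w * \<psi> n w)})" by simp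
  moreover have "{n. \<not> dist (expectation (%w. G w * \<psi> n w)) 0 < eps} \<subseteq>
   {n. eps <= expectation (%w. G w * \<psi> n w)} \<union> {n. eps <= expectation (%w. - G w * \<psi> n w)}"
   by (auto simp: abs_if split: if_splits)
  ultimately have "finite {n. \<not> dist (expectation (%w. G w * \<psi> n w)) 0 < eps}" using finite_subset by blast
  then show "\<forall>\<^sub>F n in sequentially. dist (expectation (%w. G w * \<psi> n w)) 0 < eps"
   by (simp add: eventually_cofinite flip: cofinite_eq_sequentially)
 qed
qed

text \<open>Independence makes the joint law of the two paths a product, so by Fubini the path of
  \<open>B\<close> may be held fixed; the sum is then Gaussian in \<open>B'\<close> with
  deterministic weights. \<open>h\<close> takes the whole restricted path, the form in which
  independence is stated.\<close>

lemma conditional_gaussian_cos: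
 fixes h :: "(real => real) => nat => real"
 assumes fsp: "filtered_prob_space M F" and B': "brownian_motion M F B'"
  and ind: "independent_processes M B B'" and p: "strict_mono p" "0 <= p (0::nat)"
  and h: "!!l. (%x. h x l) \<in> borel_measurable (Pi\<^sub>M {0..} (%_. borel))"
 shows "integral\<^sup>L M (%w. cos (\<Sum>l<L. h (\<lambda>t\<in>{0..}. B t w) l * (B' (p (Suc l)) w - B' (p l) w))) =
  integral\<^sup>L M (%w. exp (- ((\<Sum>l<L. (h (\<lambda>t\<in>{0..}. B t w) l)^2 * (p (Suc l) - p l)) / 2)))"
proof -
 interpret prob_space M by (rule filtered_prob_spaceD[OF fsp])
 let ?P = "Pi\<^sub>M {0..} (%_. borel) :: (real => real) measure"
 let ?b = "%w. \<lambda>t\<in>{0..}. B t w" and ?b' = "%w. \<lambda>t\<in>{0..}. B' t w"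
 have pp: "0 <= p j" for j using p(2) strict_mono_less_eq[OF p(1), of 0 j] by simp
 have bm[measurable]: "?b \<in> measurable M ?P" "?b' \<in> measurable M ?P"
  and pair: "distr M ?P ?b \<Otimes>\<^sub>M distr M ?P ?b' = distr M (?P \<Otimes>\<^sub>M ?P) (%w. (?b w, ?b' w))"
  using ind unfolding independent_processes_def indep_var_distribution_eq by auto
 have [measurable]: "(%x. x (p i)) \<in> borel_measurable ?P" for i
  using pp by (intro measurable_component_singleton) simp
 note h[measurable]
 interpret b: prob_space "distr M ?P ?b" by (rule prob_space_distr) (rule bm)
 interpret b': prob_space "distr M ?P ?b'" by (rule prob_space_distr) (rule bm)
 interpret bb: pair_prob_space "distr M ?P ?b" "distr M ?P ?b'" ..
 let ?f = "%x y. cos (\<Sum>l<L. h x l * (y (p (Suc l)) - y (p l)))"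
 have fm: "(%(x, y). ?f x y) \<in> borel_measurable (?P \<Otimes>\<^sub>M ?P)" by measurable
 have fi: "integrable (distr M ?P ?b \<Otimes>\<^sub>M distr M ?P ?b') (%(x, y). ?f x y)"
 proof (rule bb.P.integrable_const_bound[where B=1])
  show "(%(x, y). ?f x y) \<in> borel_measurable (distr M ?P ?b \<Otimes>\<^sub>M distr M ?P ?b')" using fm by simp
 qed auto
 have "expectation (%w. cos (\<Sum>l<L. h (?b w) l * (B' (p (Suc l)) w - B' (p l) w))) = expectation (%w. ?f (?b w) (?b' w))"
  using pp by simp
 also have "... = (\<integral>z. (%(x, y). ?f x y) z \<partial>distr M (?P \<Otimes>\<^sub>M ?P) (%w. (?b w, ?b' w)))"
  using fm by (subst integral_distr) auto
 also have "... = (\<integral>x. (\<integral>y. ?f x y \<partial>distr M ?P ?b') \<partial>distr M ?P ?b)"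
  unfolding pair[symmetric] using bb.integral_fst'[OF fi] by simp
 also have "... = (\<integral>x. exp (- ((\<Sum>l<L. (h x l)^2 * (p (Suc l) - p l)) / 2)) \<partial>distr M ?P ?b)"
 proof (intro Bochner_Integration.integral_cong refl)
  fix x
  have [measurable]: "B' (p l) \<in> borel_measurable M" for l
  proof -
   have "(%w. ?b' w (p l)) \<in> borel_measurable M" by measurable
   then show ?thesis using pp by simp
  qed
  let ?S = "%w. \<Sum>l<L. h x l * (B' (p (Suc l)) w - B' (p l) w)"
  have "(\<integral>y. ?f x y \<partial>distr M ?P ?b') = expectation (%w. cos (?S w))"
   using pp by (subst integral_distr) auto
  also have "... = Re (char (distr M borel ?S) 1)"
  proof -
   have i: "complex_integrable M (%w. iexp (?S w))" by (intro integrable_iexp) auto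
   have "char (distr M borel ?S) 1 = (CLINT w|M. iexp (?S w))" by (simp add: char_def integral_distr)
   then show ?thesis using integral_Re[OF i] by (simp add: Re_exp)
  qed
  also have "... = exp (- ((\<Sum>l<L. (h x l)^2 * (p (Suc l) - p l)) / 2))"
   unfolding bm_char[OF fsp B' p] by simp
  finally show "(\<integral>y. ?f x y \<partial>distr M ?P ?b') = exp (- ((\<Sum>l<L. (h x l)^2 * (p (Suc l) - p l)) / 2))" .
 qed
 also have "... = expectation (%w. exp (- ((\<Sum>l<L. (h (?b w) l)^2 * (p (Suc l) - p l)) / 2)))"
  by (subst integral_distr) auto
 finally show ?thesis .
qed

section \<open>Mixing of the covariation sums\<close>

locale bm_pair =
 fixes M :: "'a measure" and F :: "real => 'a measure" and B B' :: "real => 'a => real" and T :: real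
 assumes fsp: "filtered_prob_space M F" and B: "brownian_motion M F B" and B': "brownian_motion M F B'"
  and ind: "independent_processes M B B'" and T: "0 < T"

sublocale bm_pair \<subseteq> prob_space M
 by (rule filtered_prob_spaceD(1)[OF fsp])

context bm_pair
begin

abbreviation "\<beta> n i w \<equiv> inc T n (%t. B t w) i"
abbreviation "\<beta>' n i w \<equiv> inc T n (%t. B' t w) i"

text \<open>Since \<open>n / T\<close> is the inverse mesh, summand \<open>i\<close> has variance
  \<open>v i ^ 2 * (T / n)\<close>, and the variances form a Riemann sum.\<close>

definition R :: "(nat => real) => nat => 'a => real" where
 "R v n w = (\<Sum>i<n. v i * sqrt (n / T) * \<beta> n i w * \<beta>' n i w)"

lemma grid_mono: "0 < n ==> strict_mono (%j. real j * (T / real n))" "0 <= real 0 * (T / real n)"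
 "real (Suc j) * (T / real n) - real j * (T / real n) = T / real n"
proof -
 have 3: "real (Suc j) * (T / real n) - real j * (T / real n) = T / real n" for j
  by (simp only: of_nat_Suc distrib_right mult_1 add_diff_cancel_right')
 show "0 < n ==> strict_mono (%j. real j * (T / real n))"
 proof (rule strict_monoI_Suc)
  fix j assume "0 < n"
  then show "real j * (T / real n) < real (Suc j) * (T / real n)" using 3[of j] T divide_pos_pos[of T "real n"] by linarith
 qed
 show "real (Suc j) * (T / real n) - real j * (T / real n) = T / real n" by (rule 3)
qed simp

lemma pair_steps:
 assumes n: "0 < n"
 shows "gauss_pair M (%j. F (real j * (T / real n))) (%j w. \<beta> n j w) (%j w. \<beta>' n j w) (%_. T / real n)"
 using bm_gauss_pair[OF fsp B B' ind grid_mono(1)[OF n] grid_mono(2)] unfolding grid_mono(3) inc_def .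

lemma B_measurable: "0 <= s ==> B s \<in> borel_measurable M" "0 <= s ==> B' s \<in> borel_measurable M"
 using B B' measurable_from_subalg[OF filtered_prob_spaceD(2)[OF fsp, of s]]
 by (auto simp: brownian_motion_def adapted_process_def)

lemma \<beta>_measurable [measurable]: "(%w. \<beta> n i w) \<in> borel_measurable M" "(%w. \<beta>' n i w) \<in> borel_measurable M"
 unfolding inc_def using T by (intro borel_measurable_diff B_measurable; simp)+

lemma R_measurable [measurable]: "R v n \<in> borel_measurable M"
 unfolding R_def[abs_def] by measurable

lemma expectation_cos:
 fixes h :: "(real => real) => nat => real"
 assumes n: "0 < n" and h: "!!l. (%x. h x l) \<in> borel_measurable (Pi\<^sub>M {0..} (%_. borel))"
  and h': "!!w l. h (\<lambda>t\<in>{0..}. B t w) l = h' l w"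
 shows "expectation (%w. cos (\<Sum>l<L. h' l w * \<beta>' n l w)) = expectation (%w. exp (- ((\<Sum>l<L. (h' l w)^2 * (T / n)) / 2)))"
 using conditional_gaussian_cos[OF fsp B' ind grid_mono(1)[OF n] grid_mono(2) h, where L=L]
 unfolding grid_mono(3) h' inc_def .

lemma inc_path_measurable: "(%x. inc T n x i) \<in> borel_measurable (Pi\<^sub>M {0..} (%_. borel))"
proof -
 have "real j * (T / real n) \<in> {0..}" for j using T by simp
 then show ?thesis unfolding inc_def by (intro borel_measurable_diff measurable_component_singleton)
qed

lemma inc_restrict: "inc T n (\<lambda>t\<in>{0..}. B t w) i = \<beta> n i w"
 using T by (simp add: inc_def)

text \<open>The case \<open>r = 1\<close> of \<open>quadratic_variation_bound\<close>, with one
  point in each cell; the first moment is bounded by the root of the second.\<close>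

lemma \<beta>_square_sum:
 assumes n: "0 < n" and v: "!!i. i < n ==> \<bar>v i\<bar> <= C" and C: "0 <= C"
 shows "expectation (%w. \<bar>(\<Sum>i<n. (v i)^2 * (\<beta> n i w)^2) - (\<Sum>i<n. (v i)^2 * (T / n))\<bar>) <= sqrt (12 * C^4 * T^2 / n)"
  and "integrable M (%w. (\<Sum>i<n. (v i)^2 * (\<beta> n i w)^2))"
proof -
 interpret gp: gauss_pair M "%j. F (real j * (T / real n))" "%j w. \<beta> n j w" "%j w. \<beta>' n j w" "%_. T / real n"
  by (rule pair_steps[OF n])
 let ?Z = "%w. (\<Sum>i<n. (v i)^2 * (\<beta> n i w)^2) - (\<Sum>i<n. (v i)^2 * (T / n))"
 have Z: "?Z w = (\<Sum>i<n. (\<Sum>j\<in>{i*1..<i*1+1}. v j * \<beta> n j w)^2) - (\<Sum>j<n*1. T / n * (v j)^2)" for w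
  by (simp add: power_mult_distrib mult.commute)
 have vn: "\<bar>v j\<bar> <= C" if "j < n * 1" for j using v[of j] that by simp
 note qv = gp.B1.quadratic_variation_bound[of n 1 "%j _. v j" C "T / real n", OF _ vn, folded Z]
 have Zi: "integrable M (%w. (?Z w)^2)" using qv(1) by simp
 have ZE: "expectation (%w. (?Z w)^2) <= 12 * C^4 * T^2 / n" using qv(2) n by (simp add: power2_eq_square mult.assoc)
 have Zm: "?Z \<in> borel_measurable M" by measurable
 have Z1: "integrable M ?Z" by (rule square_expectation_le(1)[OF Zm Zi])
 have "integrable M (%w. ?Z w + (\<Sum>i<n. (v i)^2 * (T / n)))" by (intro Bochner_Integration.integrable_add Z1) auto
 then show "integrable M (%w. (\<Sum>i<n. (v i)^2 * (\<beta> n i w)^2))" by simp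
 have "(expectation (%w. \<bar>?Z w\<bar>))^2 <= expectation (%w. \<bar>?Z w\<bar>\<^sup>2)"
  using Zi Zm by (intro square_expectation_le(2)) auto
 also have "... <= 12 * C^4 * T^2 / n" using ZE by simp
 finally show "expectation (%w. \<bar>?Z w\<bar>) <= sqrt (12 * C^4 * T^2 / n)" by (rule real_le_rsqrt)
qed

text \<open>Given \<open>B\<close> the variance is random, but by \<open>\<beta>_square_sum\<close>
  it is close in mean to its expectation, and \<open>exp (- x)\<close> is 1-Lipschitz for
  nonnegative \<open>x\<close>.\<close>

lemma expectation_cos_R:
 assumes n: "0 < n" and v: "!!i. i < n ==> \<bar>v i\<bar> <= C" and C: "0 <= C"
 shows "expectation (%w. cos (R v n w)) = expectation (%w. exp (- ((\<Sum>i<n. (v i)^2 * (\<beta> n i w)^2) / 2)))"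
  and "\<bar>expectation (%w. cos (R v n w)) - exp (- ((\<Sum>i<n. (v i)^2 * (T / n)) / 2))\<bar> <= sqrt (12 * C^4 * T^2 / n)"
proof -
 define h where "h x l = v l * sqrt (n / T) * inc T n x l" for x l
 have hm: "(%x. h x l) \<in> borel_measurable (Pi\<^sub>M {0..} (%_. borel))" for l
  unfolding h_def using inc_path_measurable by (intro borel_measurable_times) auto
 have h': "h (\<lambda>t\<in>{0..}. B t w) l = v l * sqrt (n / T) * \<beta> n l w" for w l unfolding h_def inc_restrict ..
 have sq: "(v l * sqrt (n / T) * \<beta> n l w)^2 * (T / n) = (v l)^2 * (\<beta> n l w)^2" for l w
  using T n by (simp add: power_mult_distrib)
 show E: "expectation (%w. cos (R v n w)) = expectation (%w. exp (- ((\<Sum>i<n. (v i)^2 * (\<beta> n i w)^2) / 2)))"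
  using expectation_cos[OF n hm h', where L=n] unfolding sq R_def .
 note b = \<beta>_square_sum[where v=v and C=C, OF n v C]
 let ?X = "%w. (\<Sum>i<n. (v i)^2 * (\<beta> n i w)^2)" and ?s = "\<Sum>i<n. (v i)^2 * (T / n)"
 have X0: "0 <= ?X w" "0 <= ?s" for w using T by (auto intro!: sum_nonneg)
 have ei: "integrable M (%w. exp (- (?X w / 2)))"
  using X0 by (intro integrable_const_bound[where B=1]) auto
 have "\<bar>expectation (%w. exp (- (?X w / 2))) - exp (- (?s / 2))\<bar> = \<bar>expectation (%w. exp (- (?X w / 2)) - exp (- (?s / 2)))\<bar>"
  using ei by (simp add: prob_space)
 also have "... <= expectation (%w. \<bar>exp (- (?X w / 2)) - exp (- (?s / 2))\<bar>)" by (rule integral_abs_bound)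
 also have "... <= expectation (%w. \<bar>?X w - ?s\<bar>)"
 proof (intro integral_mono)
  show "integrable M (%w. \<bar>exp (- (?X w / 2)) - exp (- (?s / 2))\<bar>)" using ei by auto
  show "integrable M (%w. \<bar>?X w - ?s\<bar>)" using b(2) by auto
  show "\<bar>exp (- (?X w / 2)) - exp (- (?s / 2))\<bar> <= \<bar>?X w - ?s\<bar>" for w
  proof -
   have "\<bar>exp (- (?X w / 2)) - exp (- (?s / 2))\<bar> <= \<bar>?X w / 2 - ?s / 2\<bar>"
    using X0 by (intro exp_neg_lipschitz) simp_all
   also have "... <= \<bar>?X w - ?s\<bar>" unfolding diff_divide_distrib[symmetric] by simp
   finally show ?thesis .
  qed
 qed
 also have "... <= sqrt (12 * C^4 * T^2 / n)" by (rule b(1))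
 finally show "\<bar>expectation (%w. cos (R v n w)) - exp (- (?s / 2))\<bar> <= sqrt (12 * C^4 * T^2 / n)" unfolding E .
qed

text \<open>Sums over two grids are both written on the common refinement.\<close>

lemma R_refine:
 assumes m: "0 < m"
 shows "(\<Sum>i<n. a i * \<beta>' n i w) = (\<Sum>l<n*m. a (l div m) * \<beta>' (n*m) l w)"
 using sum_cells_const[OF m, where n=n and a=a and d="%l. \<beta>' (n*m) l w"] unfolding inc_refine[OF m] by simp

lemma sum_refine_const:
 assumes m: "0 < m" and n: "0 < n"
 shows "(\<Sum>l<n*m. a (l div m) * (T / real (n*m))) = (\<Sum>i<n. a i * (T / n))"
 unfolding sum_cells_const[OF m, where n=n and a=a and d="%_. T / real (n*m)"] using m by simp

text \<open>Given \<open>B\<close>, the combination is Gaussian with variance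
  \<open>V + W + 2 * s * X\<close>. Only the cross term \<open>X\<close> couples the grids; it
  averages increments of the \<open>n\<close>-grid over cells of the \<open>m\<close>-grid, which
  makes it small for \<open>m\<close> fixed and \<open>n\<close> large. Both signs \<open>s\<close>
  are wanted for the product formulas of cosine and sine.\<close>

lemma expectation_cos_R_sum:
 assumes n: "0 < n" and m: "0 < m" and v: "!!i. i < n ==> \<bar>v i\<bar> <= C" and ww: "!!i. i < m ==> \<bar>ww i\<bar> <= C" and C: "0 <= C"
  and s: "s \<in> {1, -1}"
 shows "\<bar>expectation (%w. cos (R v n w + s * R ww m w)) - exp (- ((\<Sum>i<n. (v i)^2 * (T / n)) / 2)) * expectation (%w. cos (R ww m w))\<bar>
  <= sqrt (12 * C^4 * T^2 / n) + real m * (C^2 * (1 + T^2)) / sqrt n"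
proof -
 define N where "N = n * m"
 have N: "0 < N" "N = n * m" "N = m * n" using n m by (auto simp: N_def)
 define a where "a i w = v i * sqrt (n / T) * \<beta> n i w" for i w
 define b where "b i w = ww i * sqrt (m / T) * \<beta> m i w" for i w
 define h where "h x l = v (l div m) * sqrt (n / T) * inc T n x (l div m) + s * (ww (l div n) * sqrt (m / T) * inc T m x (l div n))" for x l
 define h' where "h' l w = a (l div m) w + s * b (l div n) w" for l w
 have hm: "(%x. h x l) \<in> borel_measurable (Pi\<^sub>M {0..} (%_. borel))" for l
  unfolding h_def using inc_path_measurable by (intro borel_measurable_times borel_measurable_add) auto
 have hh: "h (\<lambda>t\<in>{0..}. B t w) l = h' l w" for w l unfolding h_def h'_def a_def b_def inc_restrict ..
 \<comment> \<open>On the grid with \<open>n * m\<close> cells, cell \<open>l\<close> lies in cell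
   \<open>l div m\<close> of the \<open>n\<close>-grid and in cell \<open>l div n\<close> of the
   \<open>m\<close>-grid.\<close>
 have R: "R v n w + s * R ww m w = (\<Sum>l<N. h' l w * \<beta>' N l w)" for w
 proof -
  have "R v n w = (\<Sum>l<N. a (l div m) w * \<beta>' N l w)"
   unfolding N(2) R_refine[OF m, where n=n and a="%i. a i w" and w=w, symmetric] by (simp add: R_def a_def)
  moreover have "R ww m w = (\<Sum>l<N. b (l div n) w * \<beta>' N l w)"
   unfolding N(3) R_refine[OF n, where n=m and a="%i. b i w" and w=w, symmetric] by (simp add: R_def b_def)
  ultimately show ?thesis by (simp add: h'_def sum.distrib sum_distrib_left algebra_simps)
 qed
 define X where "X w = (\<Sum>l<N. a (l div m) w * b (l div n) w * (T / N))" for w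
 define V where "V w = (\<Sum>i<n. (v i)^2 * (\<beta> n i w)^2)" for w
 define W where "W w = (\<Sum>i<m. (ww i)^2 * (\<beta> m i w)^2)" for w
 define c where "c = (\<Sum>i<n. (v i)^2 * (T / n))"
 have asq: "(a i w)^2 * (T / n) = (v i)^2 * (\<beta> n i w)^2" for i w using T n by (simp add: a_def power_mult_distrib)
 have bsq: "(b i w)^2 * (T / m) = (ww i)^2 * (\<beta> m i w)^2" for i w using T m by (simp add: b_def power_mult_distrib)
 have s2: "s * s = 1" using s by auto
 have H: "(\<Sum>l<N. (h' l w)^2 * (T / N)) = V w + W w + 2 * s * X w" for w
 proof -
  have "(\<Sum>l<N. (h' l w)^2 * (T / N)) = (\<Sum>l<N. (a (l div m) w)^2 * (T / N)) + (\<Sum>l<N. (b (l div n) w)^2 * (T / N)) + 2 * s * X w"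
  proof -
   have "(h' l w)^2 * (T / N) = (a (l div m) w)^2 * (T / N) + (b (l div n) w)^2 * (T / N) + 2 * s * (a (l div m) w * b (l div n) w * (T / N))" for l
   proof -
    have "(x + s * y)^2 * z = x^2 * z + (s * s) * (y^2 * z) + 2 * s * (x * y * z)" for x y z
     by (simp add: power2_eq_square algebra_simps)
    then have "(x + s * y)^2 * z = x^2 * z + y^2 * z + 2 * s * (x * y * z)" for x y z unfolding s2 by simp
    then show ?thesis unfolding h'_def .
   qed
   then show ?thesis by (simp add: X_def sum.distrib sum_distrib_left)
  qed
  also have "(\<Sum>l<N. (a (l div m) w)^2 * (T / N)) = V w"
   unfolding N(2) sum_refine_const[OF m n, of "%i. (a i w)^2"] V_def asq ..
  also have "(\<Sum>l<N. (b (l div n) w)^2 * (T / N)) = W w"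
   unfolding N(3) sum_refine_const[OF n m, of "%i. (b i w)^2"] W_def bsq ..
  finally show ?thesis .
 qed
 have VW0: "0 <= V w" "0 <= W w" "0 <= c" "0 <= V w + W w + 2 * s * X w" for w
  unfolding H[symmetric] using T by (auto simp: V_def W_def c_def intro!: sum_nonneg)
 have [measurable]: "a i \<in> borel_measurable M" "b i \<in> borel_measurable M" for i unfolding a_def[abs_def] b_def[abs_def] by measurable
 have [measurable]: "X \<in> borel_measurable M" "V \<in> borel_measurable M" "W \<in> borel_measurable M"
  unfolding X_def[abs_def] V_def[abs_def] W_def[abs_def] by measurable
 have E1: "expectation (%w. cos (R v n w + s * R ww m w)) = expectation (%w. exp (- ((V w + W w + 2 * s * X w) / 2)))"
  unfolding R by (rule expectation_cos[where h=h and h'=h' and n=N and L=N, OF N(1) hm hh, unfolded H])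
 have E2: "exp (- (c / 2)) * expectation (%w. cos (R ww m w)) = expectation (%w. exp (- ((c + W w) / 2)))"
 proof -
  have 1: "expectation (%w. cos (R ww m w)) = expectation (%w. exp (- (W w / 2)))"
   unfolding W_def by (rule expectation_cos_R(1)[OF m ww C])
  have 2: "exp (- ((c + W w) / 2)) = exp (- (c / 2)) * exp (- (W w / 2))" for w
   by (simp add: exp_add[symmetric] add_divide_distrib)
  show ?thesis unfolding 1 2 by simp
 qed

 interpret gp: gauss_pair M "%j. F (real j * (T / real n))" "%j w. \<beta> n j w" "%j w. \<beta>' n j w" "%_. T / real n"
  by (rule pair_steps[OF n])
 interpret gm: gauss_pair M "%j. F (real j * (T / real m))" "%j w. \<beta> m j w" "%j w. \<beta>' m j w" "%_. T / real m"
  by (rule pair_steps[OF m])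
 \<comment> \<open>The length of the overlap of cell \<open>j\<close> of the \<open>m\<close>-grid
   with cell \<open>i\<close> of the \<open>n\<close>-grid: at most \<open>T / n\<close> for each
   \<open>i\<close> and \<open>T / m\<close> in total, so the squares sum up to order
   \<open>1 / n\<close>.\<close>
 define lam where "lam j i = (\<Sum>l\<in>{j*n..<j*n+n}. (if l div m = i then T / N else 0))" for j i
 have lam0: "0 <= lam j i" for j i unfolding lam_def using T by (auto intro!: sum_nonneg)
 have lam_le: "lam j i <= T / n" for j i
 proof -
  have "lam j i = (\<Sum>l\<in>{j*n..<j*n+n} \<inter> {l. l div m = i}. T / N)" unfolding lam_def by (simp add: sum.If_cases)
  also have "... <= (\<Sum>l\<in>{i*m..<i*m+m}. T / N)"
  proof (rule sum_mono2)
   show "{j*n..<j*n+n} \<inter> {l. l div m = i} \<subseteq> {i*m..<i*m+m}"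
   proof
    fix l assume "l \<in> {j*n..<j*n+n} \<inter> {l. l div m = i}"
    then have "l div m = i" by simp
    then show "l \<in> {i*m..<i*m+m}" using div_mult_mod_eq[of l m] mod_less_divisor[OF m, of l] by auto
   qed
  qed (use T in auto)
  also have "... = T / n" using m by (simp add: N(2))
  finally show ?thesis .
 qed
 have lam_sum: "(\<Sum>i<n. lam j i) = T / m" if j: "j < m" for j
 proof -
  have "(\<Sum>i<n. lam j i) = (\<Sum>l\<in>{j*n..<j*n+n}. \<Sum>i<n. if l div m = i then T / N else 0)" unfolding lam_def by (rule sum.swap)
  also have "... = (\<Sum>l\<in>{j*n..<j*n+n}. T / N)"
  proof (intro sum.cong refl)
   fix l assume "l \<in> {j*n..<j*n+n}"
   then have "l < Suc j * n" by simp
   also have "... <= m * n" using j by (intro mult_le_mono1) simp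
   finally have "l div m < n" using m by (simp add: less_mult_imp_div_less mult.commute)
   then show "(\<Sum>i<n. if l div m = i then T / N else 0) = T / N" by simp
  qed
  also have "... = T / m" using n by (simp add: N(2))
  finally show ?thesis .
 qed
 \<comment> \<open>The part of \<open>X\<close> in cell \<open>j\<close> of the
   \<open>m\<close>-grid, where the weight \<open>b j\<close> is constant: a sum of fine increments
   with deterministic coefficients, open to the isometry.\<close>
 define Y where "Y j w = (\<Sum>i<n. (v i * sqrt (n / T) * lam j i) * \<beta> n i w)" for j w
 have X_eq: "X w = (\<Sum>j<m. b j w * Y j w)" for w
 proof -
  have "X w = (\<Sum>l<m*n. b (l div n) w * (a (l div m) w * (T / N)))" unfolding X_def N(3) by (simp add: mult_ac)
  also have "... = (\<Sum>j<m. b j w * (\<Sum>l\<in>{j*n..<j*n+n}. a (l div m) w * (T / N)))"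
   by (rule sum_cells_const[OF n, where a="%j. b j w" and d="%l. a (l div m) w * (T / N)"])
  also have "... = (\<Sum>j<m. b j w * Y j w)"
  proof (intro sum.cong refl arg_cong2[where f="(*)"])
   fix j assume j: "j \<in> {..<m}"
   have "(\<Sum>l\<in>{j*n..<j*n+n}. a (l div m) w * (T / N)) = (\<Sum>l\<in>{j*n..<j*n+n}. \<Sum>i<n. if l div m = i then a i w * (T / N) else 0)"
   proof (intro sum.cong refl)
    fix l assume "l \<in> {j*n..<j*n+n}"
    then have "l < Suc j * n" by simp
    also have "... <= m * n" using j by (intro mult_le_mono1) auto
    finally have "l div m < n" using m by (simp add: less_mult_imp_div_less mult.commute)
    then show "a (l div m) w * (T / N) = (\<Sum>i<n. if l div m = i then a i w * (T / N) else 0)" by simp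
   qed
   also have "... = (\<Sum>i<n. \<Sum>l\<in>{j*n..<j*n+n}. if l div m = i then a i w * (T / N) else 0)" by (rule sum.swap)
   also have "... = Y j w" unfolding Y_def lam_def sum_distrib_left sum_distrib_right
    by (intro sum.cong refl) (auto simp: a_def)
   finally show "(\<Sum>l\<in>{j*n..<j*n+n}. a (l div m) w * (T / N)) = Y j w" .
  qed
  finally show ?thesis .
 qed
 have Y2: "integrable M (%w. (Y j w)^2)" "expectation (%w. (Y j w)^2) <= C^2 * T^2 / n" if j: "j < m" for j
 proof -
  note iso = gp.B1.isometry[of n "%i _. v i * sqrt (n / T) * lam j i"]
  show "integrable M (%w. (Y j w)^2)" unfolding Y_def using iso by simp
  have "expectation (%w. (Y j w)^2) = (\<Sum>i<n. T / n * (v i * sqrt (n / T) * lam j i)^2)" unfolding Y_def using iso by (simp add: prob_space)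
  also have "... = (\<Sum>i<n. (v i)^2 * (lam j i)^2)" using T n by (intro sum.cong) (auto simp: power_mult_distrib)
  also have "... <= (\<Sum>i<n. C^2 * (T / n * lam j i))"
  proof (intro sum_mono mult_mono)
   fix i assume "i \<in> {..<n}"
   then show "(v i)^2 <= C^2" using power_mono[OF v[of i], of 2] by simp
   show "(lam j i)^2 <= T / n * lam j i" unfolding power2_eq_square using lam_le lam0 by (intro mult_right_mono) auto
  qed auto
  also have "... = C^2 * (T / n) * (T / m)" unfolding lam_sum[OF j, symmetric] by (simp add: sum_distrib_left mult.assoc)
  also have "... <= C^2 * (T / n) * T"
  proof (intro mult_left_mono)
   show "T / m <= T" using T m by (simp add: divide_le_eq)
  qed (use T in auto)
  also have "... = C^2 * T^2 / n" by (simp add: power2_eq_square)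
  finally show "expectation (%w. (Y j w)^2) <= C^2 * T^2 / n" .
 qed
 have b2: "integrable M (%w. (b j w)^2)" "expectation (%w. (b j w)^2) <= C^2" if j: "j < m" for j
 proof -
  have one: "(%_. ww j * sqrt (m / T)) \<in> borel_measurable (F (real j * (T / real m)))" by simp
  have eq: "b j w = (ww j * sqrt (m / T)) * \<beta> m j w" for w by (simp add: b_def)
  note iq = gm.B1.int_sq[where j=j, OF one]
  show "integrable M (%w. (b j w)^2)" unfolding eq using iq by simp
  have "expectation (%w. (b j w)^2) = (ww j)^2" unfolding eq using iq T m by (simp add: prob_space power_mult_distrib)
  then show "expectation (%w. (b j w)^2) <= C^2" using power_mono[OF ww[OF j], of 2] by simp
 qed
 have XE: "integrable M X" "expectation (%w. \<bar>X w\<bar>) <= real m * (C^2 * (1 + T^2)) / sqrt n"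
 proof -
  have Ym: "Y j \<in> borel_measurable M" for j unfolding Y_def[abs_def] by measurable
  have bY: "integrable M (%w. b j w * Y j w)" if "j < m" for j
   using Ym b2(1)[OF that] Y2(1)[OF that] by (intro integrable_mult_sq) auto
  have bYE: "expectation (%w. \<bar>b j w * Y j w\<bar>) <= C^2 * (1 + T^2) / sqrt n" if j: "j < m" for j
  proof -
   have rn: "0 < sqrt n" using n by simp
   \<comment> \<open>Young's inequality weighted by \<open>sqrt n\<close>, as \<open>b\<close> is of
     order 1 and \<open>Y\<close> of order \<open>1 / sqrt n\<close>.\<close>
   have pt: "\<bar>x * y\<bar> <= x^2 / sqrt n + sqrt n * y^2" for x y :: real
   proof -
    define q where "q = sqrt (sqrt n)"
    have q: "0 < q" "q^2 = sqrt n" using n by (auto simp: q_def)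
    have "2 * (\<bar>x\<bar> / q) * (\<bar>y\<bar> * q) <= (\<bar>x\<bar> / q)^2 + (\<bar>y\<bar> * q)^2" by (rule sum_squares_bound)
    then have "2 * (\<bar>x\<bar> * \<bar>y\<bar>) <= x^2 / sqrt n + sqrt n * y^2" using q by (simp add: power_mult_distrib power_divide mult_ac)
    moreover have "0 <= \<bar>x\<bar> * \<bar>y\<bar>" by (rule mult_nonneg_nonneg) auto
    ultimately show ?thesis unfolding abs_mult by linarith
   qed
   have "expectation (%w. \<bar>b j w * Y j w\<bar>) <= expectation (%w. (b j w)^2 / sqrt n + sqrt n * (Y j w)^2)"
    using bY[OF j] b2(1)[OF j] Y2(1)[OF j] pt by (intro integral_mono) auto
   also have "... = expectation (%w. (b j w)^2) / sqrt n + sqrt n * expectation (%w. (Y j w)^2)"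
    using b2(1)[OF j] Y2(1)[OF j] by simp
   also have "... <= C^2 / sqrt n + sqrt n * (C^2 * T^2 / n)"
    using b2(2)[OF j] Y2(2)[OF j] by (intro add_mono divide_right_mono mult_left_mono) auto
   also have "sqrt n * (C^2 * T^2 / n) = C^2 * T^2 / sqrt n"
    using n by (simp add: field_simps)
   also have "C^2 / sqrt n + C^2 * T^2 / sqrt n = C^2 * (1 + T^2) / sqrt n" by (simp add: add_divide_distrib distrib_left)
   finally show ?thesis .
  qed
  show Xi: "integrable M X" unfolding X_eq[abs_def] using bY by auto
  have "expectation (%w. \<bar>X w\<bar>) <= expectation (%w. \<Sum>j<m. \<bar>b j w * Y j w\<bar>)"
  proof (rule integral_mono)
   show "integrable M (%w. \<bar>X w\<bar>)" using Xi by (rule integrable_abs)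
   show "integrable M (%w. \<Sum>j<m. \<bar>b j w * Y j w\<bar>)" using bY by (intro Bochner_Integration.integrable_sum integrable_abs) auto
   show "\<bar>X w\<bar> <= (\<Sum>j<m. \<bar>b j w * Y j w\<bar>)" for w unfolding X_eq by (rule sum_abs)
  qed
  also have "... = (\<Sum>j<m. expectation (%w. \<bar>b j w * Y j w\<bar>))" using bY by (intro Bochner_Integration.integral_sum) auto
  also have "... <= (\<Sum>j<m. C^2 * (1 + T^2) / sqrt n)" using bYE by (intro sum_mono) auto
  finally show "expectation (%w. \<bar>X w\<bar>) <= real m * (C^2 * (1 + T^2)) / sqrt n" by simp
 qed
 have bV: "expectation (%w. \<bar>V w - c\<bar>) <= sqrt (12 * C^4 * T^2 / n)" "integrable M V"
  unfolding V_def[abs_def] c_def by (rule \<beta>_square_sum[where v=v and C=C, OF n v C]; assumption?)+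
 have ei: "integrable M (%w. exp (- ((V w + W w + 2 * s * X w) / 2)))" "integrable M (%w. exp (- ((c + W w) / 2)))"
  using VW0 by (auto intro!: integrable_const_bound[where B=1])
 have "\<bar>expectation (%w. exp (- ((V w + W w + 2 * s * X w) / 2))) - expectation (%w. exp (- ((c + W w) / 2)))\<bar>
  = \<bar>expectation (%w. exp (- ((V w + W w + 2 * s * X w) / 2)) - exp (- ((c + W w) / 2)))\<bar>" using ei by simp
 also have "... <= expectation (%w. \<bar>exp (- ((V w + W w + 2 * s * X w) / 2)) - exp (- ((c + W w) / 2))\<bar>)" by (rule integral_abs_bound)
 also have "... <= expectation (%w. \<bar>V w - c\<bar> + \<bar>X w\<bar>)"
 proof (intro integral_mono)
  show "\<bar>exp (- ((V w + W w + 2 * s * X w) / 2)) - exp (- ((c + W w) / 2))\<bar> <= \<bar>V w - c\<bar> + \<bar>X w\<bar>" for w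
  proof -
   have nn: "0 <= (V w + W w + 2 * s * X w) / 2" "0 <= (c + W w) / 2"
    using VW0(4)[of w] VW0(2)[of w] VW0(3) by auto
   have "\<bar>exp (- ((V w + W w + 2 * s * X w) / 2)) - exp (- ((c + W w) / 2))\<bar> <= \<bar>(V w + W w + 2 * s * X w) / 2 - (c + W w) / 2\<bar>"
    by (rule exp_neg_lipschitz[OF nn])
   also have "(V w + W w + 2 * s * X w) / 2 - (c + W w) / 2 = (V w - c) / 2 + s * X w" by (simp add: field_simps)
   also have "\<bar>...\<bar> <= \<bar>(V w - c) / 2\<bar> + \<bar>s * X w\<bar>" by (rule abs_triangle_ineq)
   also have "\<bar>s * X w\<bar> = \<bar>X w\<bar>" using s by auto
   also have "\<bar>(V w - c) / 2\<bar> + \<bar>X w\<bar> <= \<bar>V w - c\<bar> + \<bar>X w\<bar>" by simp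
   finally show ?thesis .
  qed
 qed (use ei bV(2) XE(1) in auto)
 also have "... = expectation (%w. \<bar>V w - c\<bar>) + expectation (%w. \<bar>X w\<bar>)" using bV(2) XE(1) by simp
 also have "... <= sqrt (12 * C^4 * T^2 / n) + real m * (C^2 * (1 + T^2)) / sqrt n" using bV(1) XE(2) by linarith
 finally show ?thesis unfolding E1 c_def[symmetric] E2 .
qed

end

context bm_pair
begin

lemma mixing_error_tendsto:
 "(%n. sqrt (12 * C^4 * T^2 / real n) + real m * (C^2 * (1 + T^2)) / sqrt (real n)) \<longlonglongrightarrow> 0"
 "(%n. sqrt (12 * C^4 * T^2 / real n)) \<longlonglongrightarrow> 0"
proof -
 have 1: "(%n. sqrt (12 * C^4 * T^2 / real n)) \<longlonglongrightarrow> sqrt 0"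
  by (intro tendsto_real_sqrt lim_const_over_n)
 then show "(%n. sqrt (12 * C^4 * T^2 / real n)) \<longlonglongrightarrow> 0" by simp
 have "filterlim (%n. sqrt (real n)) at_top sequentially"
  by (rule filterlim_compose[OF sqrt_at_top filterlim_real_sequentially])
 then have "(%n. real m * (C^2 * (1 + T^2)) / sqrt (real n)) \<longlonglongrightarrow> 0"
  by (intro tendsto_divide_0[OF tendsto_const] filterlim_at_top_imp_at_infinity)
 with 1 show "(%n. sqrt (12 * C^4 * T^2 / real n) + real m * (C^2 * (1 + T^2)) / sqrt (real n)) \<longlonglongrightarrow> 0"
  by (auto intro: tendsto_add_zero)
qed

text \<open>The covariation sums are asymptotically independent of every bounded random variable: two of
 them, on grids of which one gets ever finer, become uncorrelated.\<close>

lemma mixing: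
 assumes v: "!!n i. i < n ==> \<bar>v n i\<bar> <= C" and C: "0 <= C"
  and G: "G \<in> borel_measurable M" and g: "!!w. w \<in> space M ==> \<bar>G w\<bar> <= g"
 shows "(%n. expectation (%w. G w * (cos (R (v n) n w) - exp (- ((\<Sum>i<n. (v n i)^2 * (T / n)) / 2))))) \<longlonglongrightarrow> 0"
  and "(%n. expectation (%w. G w * sin (R (v n) n w))) \<longlonglongrightarrow> 0"
proof -
 define c where "c n = exp (- ((\<Sum>i<n. (v n i)^2 * (T / n)) / 2))" for n
 define X where "X n = R (v n) n" for n
 have Xm[measurable]: "X n \<in> borel_measurable M" for n unfolding X_def by measurable
 have c01: "0 <= c n" "c n <= 1" for n
  unfolding c_def using T by (auto intro!: sum_nonneg)
 have ci: "integrable M (%w. cos (X n w))" "integrable M (%w. sin (X n w))" "integrable M (%w. cos (X n w) * cos (X m w))"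
  "integrable M (%w. sin (X n w) * sin (X m w))" for n m
  by (auto intro!: integrable_const_bound[where B=1] simp: abs_mult mult_le_one)
 have ci5: "integrable M (%w. cos (X n w + s * X m w))" for n m s
  by (auto intro!: integrable_const_bound[where B=1])
 have e1: "(%n. expectation (%w. cos (X n w)) - c n) \<longlonglongrightarrow> 0"
 proof (rule Lim_null_comparison[OF _ mixing_error_tendsto(2)[of C]])
  show "\<forall>\<^sub>F n in sequentially. norm (expectation (%w. cos (X n w)) - c n) <= sqrt (12 * C ^ 4 * T^2 / real n)"
   using eventually_gt_at_top[of 0] by eventually_elim (use expectation_cos_R(2)[OF _ v C] in \<open>auto simp: X_def c_def\<close>)
 qed
 have e2: "(%n. expectation (%w. cos (X n w + s * X m w)) - c n * expectation (%w. cos (X m w))) \<longlonglongrightarrow> 0"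
  if s: "s \<in> {1, -1}" and m: "0 < m" for s m
 proof (rule Lim_null_comparison[OF _ mixing_error_tendsto(1)[of C m]])
  show "\<forall>\<^sub>F n in sequentially. norm (expectation (%w. cos (X n w + s * X m w)) - c n * expectation (%w. cos (X m w)))
   <= sqrt (12 * C ^ 4 * T^2 / real n) + real m * (C^2 * (1 + T^2)) / sqrt (real n)"
   using eventually_gt_at_top[of 0]
   by eventually_elim (use expectation_cos_R_sum[OF _ m v v C s] in \<open>auto simp: X_def c_def\<close>)
 qed
 \<comment> \<open>For \<open>m = 0\<close> the sum is empty and the centred cosine vanishes;
   \<open>e2\<close> asks for \<open>0 < m\<close>, so this index is treated apart.\<close>
 have X0: "X 0 w = 0" "c 0 = 1" for w by (simp_all add: X_def R_def c_def)
 have cc: "expectation (%w. cos (X n w) * cos (X m w)) = (expectation (%w. cos (X n w + (-1) * X m w)) + expectation (%w. cos (X n w + 1 * X m w))) / 2" for n m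
 proof -
  have "expectation (%w. cos (X n w) * cos (X m w)) = expectation (%w. (cos (X n w + (-1) * X m w) + cos (X n w + 1 * X m w)) / 2)"
   by (intro Bochner_Integration.integral_cong refl) (simp add: cos_times_cos)
  then show ?thesis using ci5[of n "-1" m] ci5[of n 1 m] by simp
 qed
 have ss: "expectation (%w. sin (X n w) * sin (X m w)) = (expectation (%w. cos (X n w + (-1) * X m w)) - expectation (%w. cos (X n w + 1 * X m w))) / 2" for n m
 proof -
  have "expectation (%w. sin (X n w) * sin (X m w)) = expectation (%w. (cos (X n w + (-1) * X m w) - cos (X n w + 1 * X m w)) / 2)"
   by (intro Bochner_Integration.integral_cong refl) (simp add: sin_times_sin)
  then show ?thesis using ci5[of n "-1" m] ci5[of n 1 m] by simp
 qed
 have "(%n. expectation (%w. G w * (cos (X n w) - c n))) \<longlonglongrightarrow> 0"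
 proof (rule renyi_weak_limit[where c=2 and g=g, OF _ _ G g])
  show "\<bar>cos (X n w) - c n\<bar> <= 2" for n w
   using c01[of n] abs_cos_le_one[of "X n w"] by linarith
  fix m
  have "(%n. expectation (%w. cos (X n w) * cos (X m w)) - c n * expectation (%w. cos (X m w)) - c m * (expectation (%w. cos (X n w)) - c n)) \<longlonglongrightarrow> 0 - c m * 0"
  proof (intro tendsto_diff tendsto_mult tendsto_const e1)
   show "(%n. expectation (%w. cos (X n w) * cos (X m w)) - c n * expectation (%w. cos (X m w))) \<longlonglongrightarrow> 0"
   proof (cases "m = 0")
    case True
    then show ?thesis using e1 by (simp add: X0 prob_space)
   next
    case False
    then have "(%n. ((expectation (%w. cos (X n w + (-1) * X m w)) - c n * expectation (%w. cos (X m w))) +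
     (expectation (%w. cos (X n w + 1 * X m w)) - c n * expectation (%w. cos (X m w)))) / 2) \<longlonglongrightarrow> (0 + 0) / 2"
     by (intro tendsto_divide tendsto_add tendsto_const e2) auto
    then show ?thesis unfolding cc by (simp add: field_simps)
   qed
  qed
  moreover have "expectation (%w. (cos (X n w) - c n) * (cos (X m w) - c m)) =
   expectation (%w. cos (X n w) * cos (X m w)) - c n * expectation (%w. cos (X m w)) - c m * (expectation (%w. cos (X n w)) - c n)" for n
  proof -
   have "(cos (X n w) - c n) * (cos (X m w) - c m) = cos (X n w) * cos (X m w) - c n * cos (X m w) - c m * cos (X n w) + c n * c m" for w
    by (simp add: algebra_simps)
   then show ?thesis using ci(1,3) by (simp add: prob_space algebra_simps)
  qed
  ultimately show "(%n. expectation (%w. (cos (X n w) - c n) * (cos (X m w) - c m))) \<longlonglongrightarrow> 0" by simp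
 qed measurable
 then show "(%n. expectation (%w. G w * (cos (R (v n) n w) - exp (- ((\<Sum>i<n. (v n i)^2 * (T / n)) / 2))))) \<longlonglongrightarrow> 0"
  by (simp add: X_def c_def)
 have "(%n. expectation (%w. G w * sin (X n w))) \<longlonglongrightarrow> 0"
 proof (rule renyi_weak_limit[where c=1 and g=g, OF _ _ G g])
  show "\<bar>sin (X n w)\<bar> <= 1" for n w by simp
  fix m
  show "(%n. expectation (%w. sin (X n w) * sin (X m w))) \<longlonglongrightarrow> 0"
  proof (cases "m = 0")
   case True
   then show ?thesis by (simp add: X0)
  next
   case False
   then have "(%n. ((expectation (%w. cos (X n w + (-1) * X m w)) - c n * expectation (%w. cos (X m w))) -
    (expectation (%w. cos (X n w + 1 * X m w)) - c n * expectation (%w. cos (X m w)))) / 2) \<longlonglongrightarrow> (0 - 0) / 2"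
    by (intro tendsto_divide tendsto_diff tendsto_const e2) auto
   then show ?thesis unfolding ss by simp
  qed
 qed measurable
 then show "(%n. expectation (%w. G w * sin (R (v n) n w))) \<longlonglongrightarrow> 0" by (simp add: X_def)
qed

section \<open>Random weights that are constant on coarse cells\<close>

text \<open>\<open>i * m div n\<close> is the index of the cell of the \<open>m\<close>-grid that
  contains point \<open>i\<close> of the \<open>n\<close>-grid, so the weights are constant on
  coarse cells even if \<open>m\<close> does not divide \<open>n\<close>.\<close>

definition RU :: "nat => (nat => 'a => real) => nat => 'a => real" where
 "RU m U n w = (\<Sum>i<n. U (i * m div n) w * sqrt (n / T) * \<beta> n i w * \<beta>' n i w)"

lemma block_lt: "i < n ==> 0 < m ==> i * m div n < (m::nat)"
 by (metis less_mult_imp_div_less mult.commute mult_less_cancel2)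

text \<open>The constant comes from \<open>product_bound\<close> with \<open>r = K = q = 1\<close>:
  \<open>3 * (T / n) * (4 * T + 2 * T)\<close>, times the normalisation \<open>n / T\<close>, is
  \<open>18 * T\<close>.\<close>

lemma block_sum_second_moment:
 fixes k m :: nat
 assumes n: "0 < n"
 defines "Z \<equiv> %w. \<Sum>i<n. (if i * m div n = k then 1 else 0) * sqrt (n / T) * \<beta> n i w * \<beta>' n i w"
 shows "integrable M (%w. \<bar>Z w\<bar>)" "expectation (%w. \<bar>Z w\<bar>) <= sqrt (18 * T)"
proof -
 interpret gp: gauss_pair M "%j. F (real j * (T / real n))" "%j w. \<beta> n j w" "%j w. \<beta>' n j w" "%_. T / real n"
  by (rule pair_steps[OF n])
 let ?y = "%j (_::'a). (if j * m div n = k then 1 else 0) :: real"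
 let ?A = "\<Sum>j<n*1. T / real n * expectation (%w. (?y j w)^2)"
 have A: "?A <= T"
 proof -
  have "?A <= (\<Sum>j<n*1. T / real n * 1)" using T by (intro sum_mono mult_left_mono) (auto simp: prob_space)
  then show ?thesis using n by simp
 qed
 have Z: "Z w = sqrt (n / T) * (\<Sum>i<n. (\<Sum>j\<in>{i*1..<i*1+1}. ?y j w * \<beta> n j w) * (\<Sum>j\<in>{i*1..<i*1+1}. 1 * \<beta>' n j w))" for w
  unfolding Z_def sum_distrib_left by (intro sum.cong refl) simp
 let ?Y = "%w. (\<Sum>i<n. (\<Sum>j\<in>{i*1..<i*1+1}. ?y j w * \<beta> n j w) * (\<Sum>j\<in>{i*1..<i*1+1}. 1 * \<beta>' n j w))"
 have pb: "integrable M (%w. (?Y w)^2)"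
  "expectation (%w. (?Y w)^2) <= 3 * (real 1 * (T / n)) * (4 * 1^2 * ?A + (3 * 1 * 1^4 * (real n * real 1 * (T / n)) + 1^2 * ?A / 1) / 2)"
  using gp.product_bound[where n=n and r=1 and y="?y" and y'="%_ _. 1" and K=1 and q=1 and h="T / n"] by simp_all
 have "expectation (%w. (?Y w)^2) <= 3 * (T / n) * (4 * T + (3 * T + T) / 2)"
 proof -
  have "3 * (real 1 * (T / n)) * (4 * 1^2 * a + (3 * 1 * 1^4 * (real n * real 1 * (T / n)) + 1^2 * a / 1) / 2)
   <= 3 * (T / n) * (4 * T + (3 * T + T) / 2)" if "a <= T" for a
  proof -
   have "4 * 1^2 * a + (3 * 1 * 1^4 * (real n * real 1 * (T / n)) + 1^2 * a / 1) / 2 <= 4 * T + (3 * T + T) / 2"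
    using that n by (simp add: field_simps)
   then show ?thesis using T n by (simp only: of_nat_1 mult_1) (intro mult_left_mono; simp)
  qed
  from order_trans[OF pb(2) this[OF A]] show ?thesis .
 qed
 then have Y: "expectation (%w. (?Y w)^2) <= 18 * T * (T / n)" by simp
 have Z2: "(Z w)^2 = n / T * (?Y w)^2" for w unfolding Z using T by (simp add: power_mult_distrib)
 have Zi: "integrable M (%w. (Z w)^2)" unfolding Z2 using pb(1) by simp
 have "expectation (%w. (Z w)^2) = n / T * expectation (%w. (?Y w)^2)" unfolding Z2 by simp
 also have "... <= n / T * (18 * T * (T / n))" using Y T by (intro mult_left_mono) auto
 also have "... = 18 * T" using n T by simp
 finally have ZE: "expectation (%w. (Z w)^2) <= 18 * T" .
 have Zm: "Z \<in> borel_measurable M" unfolding Z_def by measurable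
 have Zm': "(%w. \<bar>Z w\<bar>) \<in> borel_measurable M" using Zm by measurable
 have Zi': "integrable M (%w. \<bar>Z w\<bar>\<^sup>2)" using Zi by simp
 show "integrable M (%w. \<bar>Z w\<bar>)" by (rule square_expectation_le(1)[OF Zm' Zi'])
 have "(expectation (%w. \<bar>Z w\<bar>))^2 <= 18 * T" using square_expectation_le(2)[OF Zm' Zi'] ZE by simp
 then show "expectation (%w. \<bar>Z w\<bar>) <= sqrt (18 * T)" by (rule real_le_rsqrt)
qed

lemma RU_measurable [measurable]:
 assumes U: "!!k. U k \<in> borel_measurable M"
 shows "RU m U n \<in> borel_measurable M"
 unfolding RU_def[abs_def] using U by measurable

text \<open>Sorting the summands by coarse cell pulls the random weights out of the sums, at the
  price of a factor \<open>m\<close>; this is harmless as \<open>m\<close> stays fixed while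
  \<open>n\<close> grows.\<close>

lemma RU_diff_bound:
 assumes n: "0 < n" and m: "0 < m" and U: "!!k. U k \<in> borel_measurable M" and V: "!!k. V k \<in> borel_measurable M"
  and d: "!!k w. k < m ==> w \<in> space M ==> \<bar>U k w - V k w\<bar> <= \<eta>" and \<eta>: "0 <= \<eta>"
 shows "integrable M (%w. \<bar>RU m U n w - RU m V n w\<bar>)"
  "expectation (%w. \<bar>RU m U n w - RU m V n w\<bar>) <= real m * \<eta> * sqrt (18 * T)"
proof -
 define Z where "Z k w = (\<Sum>i<n. (if i * m div n = k then 1 else 0) * sqrt (n / T) * \<beta> n i w * \<beta>' n i w)" for k w
 have Zb: "integrable M (%w. \<bar>Z k w\<bar>)" "expectation (%w. \<bar>Z k w\<bar>) <= sqrt (18 * T)" for k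
  using block_sum_second_moment[OF n, of m k] unfolding Z_def by auto
 have eq: "RU m U n w - RU m V n w = (\<Sum>k<m. (U k w - V k w) * Z k w)" for w
 proof -
  have "(\<Sum>k<m. (U k w - V k w) * Z k w) =
   (\<Sum>k<m. \<Sum>i<n. if k = i * m div n then (U k w - V k w) * (sqrt (n / T) * \<beta> n i w * \<beta>' n i w) else 0)"
   unfolding Z_def sum_distrib_left by (intro sum.cong refl) auto
  also have "... = (\<Sum>i<n. \<Sum>k<m. if k = i * m div n then (U k w - V k w) * (sqrt (n / T) * \<beta> n i w * \<beta>' n i w) else 0)" by (rule sum.swap)
  also have "... = (\<Sum>i<n. (U (i * m div n) w - V (i * m div n) w) * (sqrt (n / T) * \<beta> n i w * \<beta>' n i w))"
   using block_lt[OF _ m] by (intro sum.cong refl) (simp add: sum.delta)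
  also have "... = RU m U n w - RU m V n w" unfolding RU_def sum_subtractf[symmetric] by (intro sum.cong refl) (simp add: algebra_simps)
  finally show ?thesis by simp
 qed
 have le: "\<bar>RU m U n w - RU m V n w\<bar> <= (\<Sum>k<m. \<eta> * \<bar>Z k w\<bar>)" if "w \<in> space M" for w
 proof -
  have "\<bar>RU m U n w - RU m V n w\<bar> <= (\<Sum>k<m. \<bar>(U k w - V k w) * Z k w\<bar>)" unfolding eq by (rule sum_abs)
  also have "... <= (\<Sum>k<m. \<eta> * \<bar>Z k w\<bar>)" unfolding abs_mult using d that by (intro sum_mono mult_right_mono) auto
  finally show ?thesis .
 qed
 have si: "integrable M (%w. \<Sum>k<m. \<eta> * \<bar>Z k w\<bar>)" using Zb(1) by auto
 have RM: "RU m U n \<in> borel_measurable M" "RU m V n \<in> borel_measurable M" using RU_measurable U V by auto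
 show i: "integrable M (%w. \<bar>RU m U n w - RU m V n w\<bar>)"
 proof (rule Bochner_Integration.integrable_bound[OF si])
  show "(%w. \<bar>RU m U n w - RU m V n w\<bar>) \<in> borel_measurable M" using RM by measurable
  show "AE x in M. norm \<bar>RU m U n x - RU m V n x\<bar> <= norm (\<Sum>k<m. \<eta> * \<bar>Z k x\<bar>)"
   using order_trans[OF le abs_ge_self] by (intro AE_I2) simp
 qed
 have "expectation (%w. \<bar>RU m U n w - RU m V n w\<bar>) <= expectation (%w. \<Sum>k<m. \<eta> * \<bar>Z k w\<bar>)"
  using i si le by (intro integral_mono) auto
 also have "... = (\<Sum>k<m. \<eta> * expectation (%w. \<bar>Z k w\<bar>))" using Zb(1) by simp
 also have "... <= (\<Sum>k<m. \<eta> * sqrt (18 * T))" using Zb(2) \<eta> by (intro sum_mono mult_left_mono) auto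
 finally show "expectation (%w. \<bar>RU m U n w - RU m V n w\<bar>) <= real m * \<eta> * sqrt (18 * T)" by (simp add: mult.assoc)
qed

text \<open>Random weights that do not vary with \<open>n\<close> are approximated by weights with finitely many values.\<close>

lemma random_weights:
 fixes f :: "real => real"
 assumes f: "!!x y. \<bar>f x - f y\<bar> <= \<bar>x - y\<bar>" "!!x. \<bar>f x\<bar> <= 1" "f \<in> borel_measurable borel" and \<kappa>: "0 <= \<kappa>" "\<kappa> <= 1"
  and mix: "!!v C G. (!!n i. i < n ==> \<bar>v n i\<bar> <= C) ==> 0 <= C ==> G \<in> borel_measurable M ==>
    (!!w. w \<in> space M ==> \<bar>G w\<bar> <= 1) ==>
    (%n. expectation (%w. G w * (f (R (v n) n w) - \<kappa> * exp (- ((\<Sum>i<n. (v n i)^2 * (T / n)) / 2))))) \<longlonglongrightarrow> 0"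
  and U: "!!k. U k \<in> borel_measurable M" and C: "!!k w. w \<in> space M ==> \<bar>U k w\<bar> <= C" and C0: "0 <= C" and m: "0 < m"
 shows "(%n. expectation (%w. f (RU m U n w)) - \<kappa> * expectation (%w. exp (- ((\<Sum>i<n. (U (i * m div n) w)^2 * (T / n)) / 2)))) \<longlonglongrightarrow> 0"
proof (rule tendstoI)
 fix eps :: real assume e: "0 < eps"
 \<comment> \<open>Collects both errors of rounding the weights: that of the sum, from
   \<open>RU_diff_bound\<close>, and that of the variance, where \<open>2 * C + 1\<close> bounds a
   weight plus its rounded value.\<close>
 define K where "K = real m * sqrt (18 * T) + (2 * C + 1) * T + 1"
 have K: "0 < K" unfolding K_def using T C0 by (intro add_nonneg_pos add_nonneg_nonneg mult_nonneg_nonneg) auto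
 define \<eta> where "\<eta> = min 1 (eps / (2 * K))"
 have \<eta>: "0 < \<eta>" "\<eta> <= 1" using e K by (auto simp: \<eta>_def)
 have "\<eta> * K <= eps / (2 * K) * K" unfolding \<eta>_def using K by (intro mult_right_mono) auto
 then have \<eta>K: "\<eta> * K <= eps / 2" using K by simp
 define V where "V k w = \<eta> * of_int \<lfloor>U k w / \<eta>\<rfloor>" for k w
 have Vm: "V k \<in> borel_measurable M" for k unfolding V_def[abs_def] using U[of k] by measurable
 have UV: "V k w <= U k w" "U k w <= V k w + \<eta>" for k w
 proof -
  have "of_int \<lfloor>U k w / \<eta>\<rfloor> <= U k w / \<eta>" "U k w / \<eta> <= of_int \<lfloor>U k w / \<eta>\<rfloor> + 1" by linarith+
  from this[THEN mult_left_mono, of \<eta>]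
  have "\<eta> * of_int \<lfloor>U k w / \<eta>\<rfloor> <= \<eta> * (U k w / \<eta>)" "\<eta> * (U k w / \<eta>) <= \<eta> * (of_int \<lfloor>U k w / \<eta>\<rfloor> + 1)" using \<eta> by simp_all
  then show "V k w <= U k w" "U k w <= V k w + \<eta>" using \<eta> unfolding V_def by (auto simp: distrib_left)
 qed
 have UV': "\<bar>U k w - V k w\<bar> <= \<eta>" for k w using UV[of k w] by linarith
 \<comment> \<open>All vectors of rounded values that can occur; bounded weights make them finitely
   many. On \<open>A z\<close> the weights are deterministic, so \<open>mix\<close> applies with the
   indicator of \<open>A z\<close> as \<open>G\<close>.\<close>
 define E where "E = PiE {..<m} (%_. {- (\<lceil>C / \<eta>\<rceil> + 1) .. \<lceil>C / \<eta>\<rceil> + 1})"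
 have Efin: "finite E" unfolding E_def by (intro finite_PiE) auto
 define A where "A z = {w \<in> space M. \<forall>k\<in>{..<m}. \<lfloor>U k w / \<eta>\<rfloor> = z k}" for z :: "nat => int"
 have Am: "A z \<in> events" for z unfolding A_def using U by measurable
 define ww where "ww z n i = \<eta> * of_int (z (i * m div n))" for z :: "nat => int" and n i :: nat
 define g where "g n w = exp (- ((\<Sum>i<n. (V (i * m div n) w)^2 * (T / n)) / 2))" for n w
 define h where "h z n w = f (R (ww z n) n w) - \<kappa> * exp (- ((\<Sum>i<n. (ww z n i)^2 * (T / n)) / 2))" for z n w
 have decomp: "f (RU m V n w) - \<kappa> * g n w = (\<Sum>z\<in>E. indicator (A z) w * h z n w)" if ww: "w \<in> space M" for n w
 proof -
  define z\<^sub>0 where "z\<^sub>0 = (\<lambda>k\<in>{..<m}. \<lfloor>U k w / \<eta>\<rfloor>)"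
  have z0: "z\<^sub>0 \<in> E" unfolding E_def z\<^sub>0_def
  proof (rule restrict_PiE_iff[THEN iffD2], rule ballI)
   fix k
   have "- C / \<eta> <= U k w / \<eta>" "U k w / \<eta> <= C / \<eta>" 
    using divide_right_mono[of "- C" "U k w" \<eta>] divide_right_mono[of "U k w" C \<eta>] C[OF ww, of k] \<eta> by (auto simp: abs_le_iff)
   then show "\<lfloor>U k w / \<eta>\<rfloor> \<in> {- (\<lceil>C / \<eta>\<rceil> + 1) .. \<lceil>C / \<eta>\<rceil> + 1}" by (simp; linarith)
  qed
  have iff: "w \<in> A z \<longleftrightarrow> z = z\<^sub>0" if "z \<in> E" for z
  proof
   assume a: "w \<in> A z"
   show "z = z\<^sub>0"
   proof (rule PiE_ext[OF that[unfolded E_def] z0[unfolded E_def]])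
    fix k assume "k \<in> {..<m}"
    then show "z k = z\<^sub>0 k" using a by (simp add: A_def z\<^sub>0_def)
   qed
  qed (use ww in \<open>simp add: A_def z\<^sub>0_def\<close>)
  have vz: "V (i * m div n) w = ww z\<^sub>0 n i" if "i < n" for i
   using block_lt[OF that m] by (simp add: V_def ww_def z\<^sub>0_def)
  have "(\<Sum>z\<in>E. indicator (A z) w * h z n w) = (\<Sum>z\<in>E. if z = z\<^sub>0 then h z\<^sub>0 n w else 0)"
   by (intro sum.cong refl) (simp add: indicator_def iff)
  also have "... = h z\<^sub>0 n w" using z0 Efin by simp
  also have "... = f (RU m V n w) - \<kappa> * g n w"
   unfolding h_def g_def RU_def R_def using vz by simp
  finally show ?thesis by simp
 qed
 define N where "N = \<lceil>C / \<eta>\<rceil> + 1"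
 have wb: "\<bar>ww z n i\<bar> <= \<eta> * N" if z: "z \<in> E" and i: "i < n" for z n i
 proof -
  have "z (i * m div n) \<in> {- N .. N}"
   unfolding N_def by (rule PiE_mem[OF z[unfolded E_def]]) (use block_lt[OF i m] in simp)
  then have "\<bar>z (i * m div n)\<bar> <= N" by (simp add: abs_le_iff)
  then have "real_of_int \<bar>z (i * m div n)\<bar> <= real_of_int N" by (simp only: of_int_le_iff)
  then show ?thesis unfolding ww_def using \<eta> by (simp add: abs_mult)
 qed
 have hm: "h z n \<in> borel_measurable M" for z n unfolding h_def[abs_def] using f(3) by measurable
 have hb: "\<bar>h z n w\<bar> <= 2" for z n w
 proof -
  have "exp (- ((\<Sum>i<n. (ww z n i)^2 * (T / n)) / 2)) <= 1" using T by (auto intro!: sum_nonneg)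
  then have "\<bar>\<kappa> * exp (- ((\<Sum>i<n. (ww z n i)^2 * (T / n)) / 2))\<bar> <= 1" using \<kappa> by (simp add: abs_mult mult_le_one)
  then show ?thesis unfolding h_def using f(2)[of "R (ww z n) n w"] by linarith
 qed
 have Ih: "integrable M (%w. indicator (A z) w * h z n w)" for z n
 proof (rule integrable_const_bound[where B=2])
  show "AE x in M. norm (indicator (A z) x * h z n x) <= 2" using hb by (intro AE_I2) (auto simp: indicator_def)
  show "(%w. indicator (A z) w * h z n w) \<in> borel_measurable M" using hm Am by (intro borel_measurable_times borel_measurable_indicator)
 qed
 have gm: "g n \<in> borel_measurable M" for n unfolding g_def[abs_def] using Vm by measurable
 have RUm: "RU m U n \<in> borel_measurable M" "RU m V n \<in> borel_measurable M" for n using RU_measurable[OF U] RU_measurable[OF Vm] by auto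
 have fi: "integrable M (%w. f (RU m U n w))" "integrable M (%w. f (RU m V n w))" for n
  using f(2) measurable_compose[OF RUm(1) f(3)] measurable_compose[OF RUm(2) f(3)] by (auto intro!: integrable_const_bound[where B=1])
 define gu where "gu n w = exp (- ((\<Sum>i<n. (U (i * m div n) w)^2 * (T / n)) / 2))" for n w
 have gum: "gu n \<in> borel_measurable M" for n unfolding gu_def[abs_def] using U by measurable
 have gi: "integrable M (g n)" "integrable M (gu n)" for n
 proof -
  have "\<bar>g n w\<bar> <= 1" "\<bar>gu n w\<bar> <= 1" for w unfolding g_def gu_def using T by (auto intro!: sum_nonneg)
  then show "integrable M (g n)" "integrable M (gu n)" using gm gum by (auto intro!: integrable_const_bound[where B=1])
 qed
 have "(%n. \<Sum>z\<in>E. expectation (%w. indicator (A z) w * h z n w)) \<longlonglongrightarrow> (\<Sum>z\<in>E. 0)"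
 proof (rule tendsto_sum)
  fix z assume z: "z \<in> E"
  have C0': "0 <= \<eta> * N"
  proof -
   have "0 <= C / \<eta>" using C0 \<eta> by simp
   then have "0 <= N" unfolding N_def by linarith
   then show ?thesis using \<eta> by simp
  qed
  show "(%n. expectation (%w. indicator (A z) w * h z n w)) \<longlonglongrightarrow> 0"
   unfolding h_def using Am by (intro mix[of "ww z" "\<eta> * N" "indicator (A z)", OF wb[OF z] C0']) (auto simp: indicator_def)
 qed
 then have "(%n. \<Sum>z\<in>E. expectation (%w. indicator (A z) w * h z n w)) \<longlonglongrightarrow> 0" by simp
 moreover have "(\<Sum>z\<in>E. expectation (%w. indicator (A z) w * h z n w)) = expectation (%w. f (RU m V n w)) - \<kappa> * expectation (g n)" for n
 proof -
  have "expectation (%w. f (RU m V n w)) - \<kappa> * expectation (g n) = expectation (%w. f (RU m V n w) - \<kappa> * g n w)" using fi gi by simp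
  also have "... = expectation (%w. \<Sum>z\<in>E. indicator (A z) w * h z n w)" by (intro Bochner_Integration.integral_cong refl decomp)
  also have "... = (\<Sum>z\<in>E. expectation (%w. indicator (A z) w * h z n w))" using Ih by (intro Bochner_Integration.integral_sum) auto
  finally show ?thesis by simp
 qed
 ultimately have "(%n. expectation (%w. f (RU m V n w)) - \<kappa> * expectation (g n)) \<longlonglongrightarrow> 0" by simp
 from tendstoD[OF this half_gt_zero[OF e]]
 have "\<forall>\<^sub>F n in sequentially. \<bar>expectation (%w. f (RU m V n w)) - \<kappa> * expectation (g n)\<bar> < eps / 2" by simp
 then have "\<forall>\<^sub>F n in sequentially. dist (expectation (%w. f (RU m U n w)) - \<kappa> * expectation (gu n)) 0 < eps"
  using eventually_gt_at_top[of 0]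
 proof eventually_elim
  case (elim n)
  have 1: "\<bar>expectation (%w. f (RU m U n w)) - expectation (%w. f (RU m V n w))\<bar> <= real m * \<eta> * sqrt (18 * T)"
  proof -
   note rb = RU_diff_bound[where U=U and V=V, OF elim(2) m U Vm UV' less_imp_le[OF \<eta>(1)]]
   have "\<bar>expectation (%w. f (RU m U n w)) - expectation (%w. f (RU m V n w))\<bar> = \<bar>expectation (%w. f (RU m U n w) - f (RU m V n w))\<bar>" using fi by simp
   also have "... <= expectation (%w. \<bar>f (RU m U n w) - f (RU m V n w)\<bar>)" by (rule integral_abs_bound)
   also have "... <= expectation (%w. \<bar>RU m U n w - RU m V n w\<bar>)"
    by (rule integral_mono[OF integrable_abs[OF Bochner_Integration.integrable_diff[OF fi]] rb(1) f(1)])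
   also have "... <= real m * \<eta> * sqrt (18 * T)" by (rule rb(2))
   finally show ?thesis .
  qed
  have 2: "\<bar>expectation (gu n) - expectation (g n)\<bar> <= \<eta> * ((2 * C + 1) * T)"
  proof -
   have "\<bar>gu n w - g n w\<bar> <= \<eta> * ((2 * C + 1) * T)" if ww: "w \<in> space M" for w
   proof -
    let ?a = "\<Sum>i<n. (U (i * m div n) w)^2 * (T / n)" and ?b = "\<Sum>i<n. (V (i * m div n) w)^2 * (T / n)"
    have "\<bar>gu n w - g n w\<bar> <= \<bar>?a / 2 - ?b / 2\<bar>"
     unfolding gu_def g_def using T by (intro exp_neg_lipschitz) (auto intro!: sum_nonneg)
    also have "... <= \<bar>?a - ?b\<bar>" unfolding diff_divide_distrib[symmetric] by simp
    also have "... <= (\<Sum>i<n. \<eta> * (2 * C + 1) * (T / n))"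
    proof -
     have "?a - ?b = (\<Sum>i<n. ((U (i * m div n) w)^2 - (V (i * m div n) w)^2) * (T / n))" by (simp only: sum_subtractf left_diff_distrib)
     also have "\<bar>...\<bar> <= (\<Sum>i<n. \<bar>((U (i * m div n) w)^2 - (V (i * m div n) w)^2) * (T / n)\<bar>)" by (rule sum_abs)
     also have "... <= (\<Sum>i<n. \<eta> * (2 * C + 1) * (T / n))"
     proof (intro sum_mono)
      fix i
      let ?u = "U (i * m div n) w" and ?v = "V (i * m div n) w"
      have "a^2 - b^2 = (a - b) * (a + b)" for a b :: real by (simp add: power2_eq_square algebra_simps)
      then have "\<bar>?u\<^sup>2 - ?v\<^sup>2\<bar> = \<bar>?u - ?v\<bar> * \<bar>?u + ?v\<bar>" by (simp only: abs_mult)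
      also have "... <= \<eta> * (2 * C + 1)"
      proof (intro mult_mono UV')
       show "\<bar>?u + ?v\<bar> <= 2 * C + 1" using C[OF ww, of "i * m div n"] UV'[of "i * m div n" w] \<eta>(2) by linarith
      qed (use \<eta> in auto)
      finally have "\<bar>?u\<^sup>2 - ?v\<^sup>2\<bar> * (T / n) <= \<eta> * (2 * C + 1) * (T / n)" using T by (intro mult_right_mono) auto
      moreover have "\<bar>T / n\<bar> = T / n" using T by simp
      ultimately show "\<bar>(?u\<^sup>2 - ?v\<^sup>2) * (T / n)\<bar> <= \<eta> * (2 * C + 1) * (T / n)" by (simp only: abs_mult)
     qed
     finally show ?thesis .
    qed
    also have "... = \<eta> * ((2 * C + 1) * T)" using elim(2) by simp
    finally show ?thesis .
   qed
   moreover have "\<bar>expectation (gu n) - expectation (g n)\<bar> <= expectation (%w. \<bar>gu n w - g n w\<bar>)"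
    using integral_abs_bound[of M "%w. gu n w - g n w"] gi by simp
   ultimately have "\<bar>expectation (gu n) - expectation (g n)\<bar> <= expectation (%w. \<eta> * ((2 * C + 1) * T))"
    using gi integral_mono[of M "%w. \<bar>gu n w - g n w\<bar>" "%w. \<eta> * ((2 * C + 1) * T)"] by auto
   then show ?thesis by (simp add: prob_space)
  qed
  have 3: "\<bar>\<kappa> * expectation (gu n) - \<kappa> * expectation (g n)\<bar> <= \<eta> * ((2 * C + 1) * T)"
  proof -
   have "\<bar>\<kappa> * expectation (gu n) - \<kappa> * expectation (g n)\<bar> = \<kappa> * \<bar>expectation (gu n) - expectation (g n)\<bar>"
    unfolding right_diff_distrib[symmetric] abs_mult using \<kappa> by simp
   also have "... <= 1 * \<bar>expectation (gu n) - expectation (g n)\<bar>" using \<kappa> by (intro mult_right_mono) auto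
   finally show ?thesis using 2 by simp
  qed
  have "real m * \<eta> * sqrt (18 * T) + \<eta> * ((2 * C + 1) * T) <= \<eta> * K" unfolding K_def using \<eta> by (simp add: algebra_simps)
  then show ?case using 1 3 elim(1) \<eta>K unfolding dist_real_def by linarith
 qed
 then show "\<forall>\<^sub>F n in sequentially. dist (expectation (%w. f (RU m U n w)) - \<kappa> * expectation (%w. exp (- ((\<Sum>i<n. (U (i * m div n) w)^2 * (T / n)) / 2)))) 0 < eps"
  unfolding gu_def .
qed

text \<open>Cosine with factor 1 and sine with factor 0 are the two cases of
  \<open>random_weights\<close>: a centred Gaussian law has a real characteristic function.\<close>

lemma random_mixing:
 assumes U: "!!k. U k \<in> borel_measurable M" and C: "!!k w. w \<in> space M ==> \<bar>U k w\<bar> <= C" and C0: "0 <= C" and m: "0 < m"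
 shows "(%n. expectation (%w. cos (RU m U n w)) - expectation (%w. exp (- ((\<Sum>i<n. (U (i * m div n) w)^2 * (T / n)) / 2)))) \<longlonglongrightarrow> 0"
  and "(%n. expectation (%w. sin (RU m U n w))) \<longlonglongrightarrow> 0"
proof -
 have "(%n. expectation (%w. cos (RU m U n w)) - 1 * expectation (%w. exp (- ((\<Sum>i<n. (U (i * m div n) w)^2 * (T / n)) / 2)))) \<longlonglongrightarrow> 0"
 proof (rule random_weights[where f=cos and \<kappa>=1, OF _ _ _ _ _ _ U C C0 m])
  fix v :: "nat => nat => real" and C :: real and G :: "'a => real" assume "!!n i. i < n ==> \<bar>v n i\<bar> <= C" "0 <= C" "G \<in> borel_measurable M" "!!w. w \<in> space M ==> \<bar>G w\<bar> <= 1"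
  from mixing(1)[of v, OF this]
  show "(%n. expectation (%w. G w * (cos (R (v n) n w) - 1 * exp (- ((\<Sum>i<n. (v n i)^2 * (T / n)) / 2))))) \<longlonglongrightarrow> 0" by simp
 qed (auto intro: cos_lipschitz)
 then show "(%n. expectation (%w. cos (RU m U n w)) - expectation (%w. exp (- ((\<Sum>i<n. (U (i * m div n) w)^2 * (T / n)) / 2)))) \<longlonglongrightarrow> 0" by simp
 have "(%n. expectation (%w. sin (RU m U n w)) - 0 * expectation (%w. exp (- ((\<Sum>i<n. (U (i * m div n) w)^2 * (T / n)) / 2)))) \<longlonglongrightarrow> 0"
 proof (rule random_weights[where f=sin and \<kappa>=0, OF _ _ _ _ _ _ U C C0 m])
  fix v :: "nat => nat => real" and C :: real and G :: "'a => real" assume "!!n i. i < n ==> \<bar>v n i\<bar> <= C" "0 <= C" "G \<in> borel_measurable M" "!!w. w \<in> space M ==> \<bar>G w\<bar> <= 1"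
  from mixing(2)[of v, OF this]
  show "(%n. expectation (%w. G w * (sin (R (v n) n w) - 0 * exp (- ((\<Sum>i<n. (v n i)^2 * (T / n)) / 2))))) \<longlonglongrightarrow> 0" by simp
 qed (auto intro: sin_lipschitz)
 then show "(%n. expectation (%w. sin (RU m U n w))) \<longlonglongrightarrow> 0" by simp
qed

end

section \<open>Covariation of two Ito integrals\<close>

text \<open>Uniformity over \<open>r\<close> follows from convergence along arbitrary sequences,
  since otherwise a bad triple could be chosen for every \<open>k\<close>. It is wanted because the
  refinement tends to infinity first, with \<open>n\<close> and \<open>m\<close> held fixed.\<close>

lemma joint_limit:
 fixes \<Phi> :: "nat => nat => nat => real"
 assumes lim: "!!n m r. filterlim n at_top sequentially ==> filterlim m at_top sequentially ==> (!!k. 0 < n k) ==> (!!k. 0 < m k) ==>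
   (!!k. 0 < r k) ==> (%k. \<Phi> (n k) (m k) (r k)) \<longlonglongrightarrow> 0"
  and e: "0 < eps"
 shows "\<exists>N>0. \<forall>n\<ge>N. \<forall>m\<ge>N. \<forall>r>0. \<bar>\<Phi> n m r\<bar> < eps"
proof (rule ccontr)
 assume "\<not> ?thesis"
 then have "\<forall>k. \<exists>n m r. Suc k <= n \<and> Suc k <= m \<and> 0 < r \<and> \<not> \<bar>\<Phi> n m r\<bar> < eps" by blast
 then obtain n m r where *: "!!k. Suc k <= n k" "!!k. Suc k <= m k" "!!k. 0 < r k" "!!k. \<not> \<bar>\<Phi> (n k) (m k) (r k)\<bar> < eps"
  by metis
 have "filterlim n at_top sequentially" "filterlim m at_top sequentially"
  using *(1,2) by (auto intro!: filterlim_at_top_mono[OF filterlim_Suc] always_eventually)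
 moreover have "0 < n k" "0 < m k" for k using *(1)[of k] *(2)[of k] by auto
 ultimately have "(%k. \<Phi> (n k) (m k) (r k)) \<longlonglongrightarrow> 0" using *(3) by (intro lim)
 from tendstoD[OF this e] show False using *(4) by (auto simp: eventually_sequentially)
qed

lemma filterlim_mult_Suc: "0 < i ==> filterlim (%r. i * Suc r) at_top sequentially"
proof (rule filterlim_at_top_mono[OF filterlim_Suc], rule always_eventually, rule allI)
 fix r :: nat assume "0 < i"
 then show "Suc r <= i * Suc r" using mult_le_mono1[of 1 i "Suc r"] by simp
qed

lemma (in prob_space) indep_var_commute:
 assumes "indep_var N X L Y" shows "indep_var L Y N X"
proof -
 have "indep_set P Q ==> indep_set Q P" for P Q
 proof -
  assume a: "indep_set P Q"
  then have "prob (q \<inter> p) = prob q * prob p" if "p \<in> P" "q \<in> Q" for p q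
   using that unfolding indep_sets2_eq Int_commute[of q p] mult.commute[of "prob q"] by blast
  then show ?thesis using a unfolding indep_sets2_eq by blast
 qed
 then show ?thesis using assms unfolding indep_var_eq by blast
qed

lemma gfl_grid:
 assumes "0 < T" "0 < n" "0 < N"
 shows "gfl T n (real j * (T / real N)) = real (j * n div N) * (T / real n)"
proof -
 have "real j * (T / real N) * real n / T = real (j * n) / real N" using assms by simp
 then have "\<lfloor>real j * (T / real N) * real n / T\<rfloor> = int (j * n div N)" by (simp only: floor_divide_of_nat_eq)
 then show ?thesis by (simp add: gfl_def)
qed

lemma grid_le: "0 < T ==> i <= n ==> real i * (T / real n) <= T"
proof -
 assume "0 < T" "i <= n"
 then have "real i * (T / real n) <= real n * (T / real n)" by (intro mult_right_mono) auto
 also have "... <= T" using \<open>0 < T\<close> by simp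
 finally show ?thesis .
qed

lemma gfl_range': "0 < T ==> s \<in> {0..T} ==> gfl T n s \<in> {0..T}"
 using gfl_range[of T n s] by (cases "n = 0") (auto simp: gfl_def)

lemma set_integral_bound:
 fixes h :: "real => real"
 assumes m: "set_borel_measurable lborel {0..T} h" and b: "!!s. s \<in> {0..T} ==> \<bar>h s\<bar> <= C" and T: "0 <= T"
 shows "\<bar>LINT s:{0..T}|lborel. h s\<bar> <= C * T" "set_integrable lborel {0..T} h"
proof -
 have dom: "integrable lborel (%s. indicat_real {0..T} s * C)"
  by (rule integrable_mult_left) (auto intro: integrable_real_indicator simp: emeasure_lborel_Icc_eq)
 show i: "set_integrable lborel {0..T} h"
  unfolding set_integrable_def
 proof (rule Bochner_Integration.integrable_bound[OF dom])
  show "(%x. indicat_real {0..T} x *\<^sub>R h x) \<in> borel_measurable lborel" using m by (simp add: set_borel_measurable_def)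
  show "AE x in lborel. norm (indicat_real {0..T} x *\<^sub>R h x) <= norm (indicat_real {0..T} x * C)"
   using b by (intro AE_I2) (auto simp: indicator_def intro: order_trans[OF _ abs_ge_self])
 qed
 have "\<bar>LINT s:{0..T}|lborel. h s\<bar> <= (LINT s|lborel. \<bar>indicat_real {0..T} s *\<^sub>R h s\<bar>)"
  unfolding set_lebesgue_integral_def by (rule integral_abs_bound)
 also have "... <= (LINT s|lborel. indicat_real {0..T} s * C)"
  using i b dom unfolding set_integrable_def by (intro integral_mono integrable_abs) (auto simp: indicator_def)
 also have "... = C * T" using T by simp
 finally show "\<bar>LINT s:{0..T}|lborel. h s\<bar> <= C * T" .
qed

lemma cadlag_step_integral:
 assumes f: "cadlag f" and T: "0 < T"
  and m: "!!k. \<phi> k \<in> borel_measurable borel" "!!k. \<psi> k \<in> borel_measurable borel"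
  and r: "!!k s. s \<in> {0..T} ==> \<phi> k s \<in> {0..T}" "!!k s. s \<in> {0..T} ==> \<psi> k s \<in> {0..T}"
  and l: "!!s. (%k. \<phi> k s) \<longlonglongrightarrow> s" "!!s. (%k. \<psi> k s) \<longlonglongrightarrow> s"
 shows "(%k. LINT s:{0..T}|lborel. (f (\<phi> k s) - f (\<psi> k s))^2) \<longlonglongrightarrow> 0"
proof -
 obtain C where C: "0 <= C" "!!t. t \<in> {0..T} ==> \<bar>f t\<bar> <= C" using cadlag_bounded[OF f less_imp_le[OF T]] by blast
 have "(%k. LINT s:{0..T}|lborel. (f (\<phi> k s) - f (\<psi> k s))^2) \<longlonglongrightarrow> (LINT s:{0..T}|lborel. 0)"
 proof (rule set_integral_bounded_convergence[where C="(2*C)^2"])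
  show "set_borel_measurable lborel {0..T} (%s. (f (\<phi> k s) - f (\<psi> k s))^2)" for k
  proof -
   have "set_borel_measurable lborel {0..T} (%s. f (\<phi> k s))" "set_borel_measurable lborel {0..T} (%s. f (\<psi> k s))"
    using cadlag_set_measurable[OF f m(1)] cadlag_set_measurable[OF f m(2)] r by auto
   then have "(%s. (indicat_real {0..T} s *\<^sub>R f (\<phi> k s) - indicat_real {0..T} s *\<^sub>R f (\<psi> k s))^2) \<in> borel_measurable lborel"
    unfolding set_borel_measurable_def by (intro borel_measurable_power borel_measurable_diff)
   moreover have "(%s. (indicat_real {0..T} s *\<^sub>R f (\<phi> k s) - indicat_real {0..T} s *\<^sub>R f (\<psi> k s))^2) =
    (%s. indicat_real {0..T} s *\<^sub>R (f (\<phi> k s) - f (\<psi> k s))\<^sup>2)" by (auto simp: indicator_def)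
   ultimately show ?thesis unfolding set_borel_measurable_def by simp
  qed
  show "set_borel_measurable lborel {0..T} (%s. 0::real)" by (simp add: set_borel_measurable_def)
  show "\<bar>(f (\<phi> k s) - f (\<psi> k s))\<^sup>2\<bar> <= (2*C)^2" if "s \<in> {0..T}" for k s
  proof -
   have "\<bar>f (\<phi> k s) - f (\<psi> k s)\<bar> <= 2*C" using C(2)[OF r(1)[OF that, of k]] C(2)[OF r(2)[OF that, of k]] by linarith
   from power_mono[OF this abs_ge_zero, of 2] show ?thesis by simp
  qed
  have "AE s in lborel. 0 < s --> (%k. f (\<phi> k s)) \<longlonglongrightarrow> f s" by (rule cadlag_AE_tendsto[OF f l(1)])
  moreover have "AE s in lborel. 0 < s --> (%k. f (\<psi> k s)) \<longlonglongrightarrow> f s" by (rule cadlag_AE_tendsto[OF f l(2)])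
  ultimately show "AE s in lborel. 0 < s --> s <= T --> (%k. (f (\<phi> k s) - f (\<psi> k s))^2) \<longlonglongrightarrow> 0"
  proof eventually_elim
   case (elim s)
   show ?case
   proof (intro impI)
    assume "0 < s"
    with elim have "(%k. (f (\<phi> k s) - f (\<psi> k s))^2) \<longlonglongrightarrow> (f s - f s)^2" by (intro tendsto_power tendsto_diff) auto
    then show "(%k. (f (\<phi> k s) - f (\<psi> k s))^2) \<longlonglongrightarrow> 0" by simp
   qed
  qed
 qed
 then show ?thesis by (simp add: set_lebesgue_integral_def)
qed

text \<open>Riemann sums use values up to time \<open>T\<close> only, so the integral is measurable
  for any \<sigma>-algebra with that information; it is applied to \<open>M\<close> and to
  \<open>F T\<close>.\<close>

lemma cadlag_adapted_integral_measurable: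
 assumes fsp: "filtered_prob_space M F" and f: "!!w. w \<in> space M ==> cadlag (%t. Y t w)"
  and T: "0 < T" and N: "space N = space M" "!!t. t \<in> {0..T} ==> Y t \<in> borel_measurable N"
 shows "(%w. LINT t:{0..T}|lborel. Y t w) \<in> borel_measurable N"
proof (rule borel_measurable_LIMSEQ_real)
 have k: "filterlim (%i. i) at_top (sequentially :: nat filter)" by (rule filterlim_ident)
 fix w assume "w \<in> space N"
 then show "(%i. \<Sum>j<i. T / i * Y (real j * (T / i)) w) \<longlonglongrightarrow> (LINT t:{0..T}|lborel. Y t w)"
  using cadlag_riemann[OF f T k] N by simp
next
 fix i :: nat
 show "(%w. \<Sum>j<i. T / i * Y (real j * (T / i)) w) \<in> borel_measurable N"
  using T grid_le[OF T] by (intro borel_measurable_sum borel_measurable_times borel_measurable_const N(2)) auto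
qed

text \<open>The integrals enter through the convergence of their Riemann sums, so a constant
  multiple of an Ito integral fits in directly.\<close>

locale ito_pair = bm_pair +
 fixes H H' I I' :: "real => 'a => real"
 assumes H: "cadlag_adapted M F H" and H': "cadlag_adapted M F H'"
  and I: "!!t. 0 <= t ==> tendsto_in_prob M (%r w. \<Sum>j<r. H (real j * (t / real r)) w *
   (B (real (Suc j) * (t / real r)) w - B (real j * (t / real r)) w)) (I t)"
  and I': "!!t. 0 <= t ==> tendsto_in_prob M (%r w. \<Sum>j<r. H' (real j * (t / real r)) w *
   (B' (real (Suc j) * (t / real r)) w - B' (real j * (t / real r)) w)) (I' t)"

lemma riemann_cell_tendsto:
 assumes M: "prob_space M" and T: "0 < T" and n: "0 < n"
  and I: "!!t. 0 <= t ==> tendsto_in_prob M (%r w. \<Sum>j<r. H (real j * (t / real r)) w *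
   (B (real (Suc j) * (t / real r)) w - B (real j * (t / real r)) w)) (I t)"
 shows "tendsto_in_prob M (%r w. \<Sum>j\<in>{i*Suc r..<i*Suc r+Suc r}. H (real j * (T / real (n*Suc r))) w * inc T (n*Suc r) (%t. B t w) j)
  (%w. inc T n (%t. I t w) i)"
proof -
 interpret prob_space M by (rule M)
 define x where "x r j w = H (real j * (T / real (n*Suc r))) w * inc T (n*Suc r) (%t. B t w) j" for r j w
 have S: "tendsto_in_prob M (%r w. \<Sum>j<i*Suc r. x r j w) (I (real i * (T / real n)))" for i :: nat
 \<comment> \<open>For \<open>i = 0\<close> the sum is empty and no rescaling of the mesh is
   possible; the assumption at time 0, where all increments vanish, gives the limit.\<close>
 proof (cases "i = 0")
  case True
  then show ?thesis using I[of 0] by simp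
 next
  case False
  have k: "filterlim (%r. i * Suc r) at_top sequentially"
   using False by (intro filterlim_mult_Suc) simp
  have eq: "real i * (T / real n) / real (i * Suc r) = T / real (n * Suc r)" for r
  proof -
   have "a * (t / b) / (a * c) = t / (b * c)" if "a ~= 0" for a b c t :: real using that by simp
   from this[of "real i" T "real n" "real (Suc r)"] False show ?thesis by (simp only: of_nat_mult of_nat_eq_0_iff) simp
  qed
  have "0 <= real i * (T / real n)" using T by simp
  from tendsto_in_prob_compose[OF I[OF this] k] show ?thesis unfolding eq x_def inc_def .
 qed
 have "tendsto_in_prob M (%r w. (\<Sum>j<Suc i*Suc r. x r j w) + (-1) * (\<Sum>j<i*Suc r. x r j w)) (%w. I (real (Suc i) * (T / real n)) w + (-1) * I (real i * (T / real n)) w)"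
  by (intro tendsto_in_prob_add tendsto_in_prob_mult S tendsto_in_prob_const borel_measurable_const)
 moreover have "(\<Sum>j<Suc i*Suc r. x r j w) + (-1) * (\<Sum>j<i*Suc r. x r j w) = (\<Sum>j\<in>{i*Suc r..<i*Suc r+Suc r}. x r j w)" for r w
 proof -
  have "(\<Sum>j<Suc i*Suc r. x r j w) = (\<Sum>j<i*Suc r. x r j w) + (\<Sum>j\<in>{i*Suc r..<i*Suc r+Suc r}. x r j w)"
   using sum.atLeastLessThan_concat[of 0 "i*Suc r" "i*Suc r+Suc r" "%j. x r j w"]
   by (simp only: lessThan_atLeast0 mult_Suc add.commute[of "Suc r"] zero_le le_add1 simp_thms)
  then show ?thesis by simp
 qed
 ultimately show ?thesis by (simp add: x_def inc_def)
qed

context ito_pair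
begin

lemma H_measurable: "0 <= t ==> H t \<in> borel_measurable (F t)" "0 <= t ==> H' t \<in> borel_measurable (F t)"
 "0 <= t ==> H t \<in> borel_measurable M" "0 <= t ==> H' t \<in> borel_measurable M"
proof -
 assume t: "0 <= t"
 then show "H t \<in> borel_measurable (F t)" "H' t \<in> borel_measurable (F t)" using H H' by (auto simp: cadlag_adapted_def adapted_process_def)
 then show "H t \<in> borel_measurable M" "H' t \<in> borel_measurable M" using measurable_from_subalg[OF filtered_prob_spaceD(2)[OF fsp, of t]] by auto
qed

lemma H_cadlag: "w \<in> space M ==> cadlag (%t. H t w)" "w \<in> space M ==> cadlag (%t. H' t w)"
 using H H' by (auto simp: cadlag_adapted_def)

lemma I_measurable: "0 <= t ==> I t \<in> borel_measurable M" "0 <= t ==> I' t \<in> borel_measurable M"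
 using I I' by (auto simp: tendsto_in_prob_def)

text \<open>The values at the points \<open>j * T / n\<close> of \<open>[0, T]\<close>, for all
  grids at once, as one countable family; a single event then serves every grid and every
  refinement.\<close>

definition Hgrid :: "nat \<times> nat => 'a => real" where
 "Hgrid q w = (if fst q <= snd q then \<bar>H (real (fst q) * (T / real (snd q))) w\<bar> + \<bar>H' (real (fst q) * (T / real (snd q))) w\<bar> else 0)"

definition good :: "real => 'a set" where
 "good K = {w \<in> space M. \<forall>q. \<bar>Hgrid q w\<bar> <= K}"

lemma goodD:
 assumes "w \<in> good K" "j <= n"
 shows "\<bar>H (real j * (T / real n)) w\<bar> <= K" "\<bar>H' (real j * (T / real n)) w\<bar> <= K"
proof -
 have "\<bar>Hgrid (j, n) w\<bar> <= K" using assms(1) unfolding good_def by blast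
 then show "\<bar>H (real j * (T / real n)) w\<bar> <= K" "\<bar>H' (real j * (T / real n)) w\<bar> <= K"
  using assms(2) by (auto simp: Hgrid_def)
qed

lemma good_prob:
 assumes e: "0 < e"
 shows "\<exists>K>0. \<forall>K'\<ge>K. good K' \<in> events \<and> prob (space M - good K') <= e"
proof -
 have m: "Hgrid q \<in> borel_measurable M" for q
 proof -
  have "0 <= real (fst q) * (T / real (snd q))" using T by simp
  note [measurable] = H_measurable(3,4)[OF this]
  show ?thesis unfolding Hgrid_def[abs_def] by measurable
 qed
 have b: "\<exists>C. \<forall>q. \<bar>Hgrid q w\<bar> <= C" if ww: "w \<in> space M" for w
 proof -
  obtain C where C: "0 <= C" "!!t. t \<in> {0..T} ==> \<bar>H t w\<bar> <= C" using cadlag_bounded[OF H_cadlag(1)[OF ww] less_imp_le[OF T]] by blast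
  obtain C' where C': "0 <= C'" "!!t. t \<in> {0..T} ==> \<bar>H' t w\<bar> <= C'" using cadlag_bounded[OF H_cadlag(2)[OF ww] less_imp_le[OF T]] by blast
  have "\<bar>Hgrid q w\<bar> <= C + C'" for q
  proof (cases "fst q <= snd q")
   case True
   then have "real (fst q) * (T / real (snd q)) \<in> {0..T}" using grid_le[OF T True] T by simp
   from C(2)[OF this] C'(2)[OF this] True show ?thesis by (simp add: Hgrid_def)
  qed (use C C' in \<open>simp add: Hgrid_def\<close>)
  then show ?thesis by blast
 qed
 obtain K where K: "0 < K" "!!K'. K <= K' ==> {w \<in> space M. \<forall>q. \<bar>Hgrid q w\<bar> <= K'} \<in> events \<and> prob {w \<in> space M. \<not> (\<forall>q. \<bar>Hgrid q w\<bar> <= K')} <= e"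
  using prob_good_event[OF prob_space_axioms m b e] by blast
 have "space M - good K' = {w \<in> space M. \<not> (\<forall>q. \<bar>Hgrid q w\<bar> <= K')}" for K' unfolding good_def by blast
 then show ?thesis using K unfolding good_def by (intro exI[of _ K]) simp
qed

text \<open>On the grid refined by \<open>Suc r\<close> the clipped sums obey a bound of order
  \<open>1 / n\<close> that does not depend on \<open>r\<close>. It passes to the integral for fixed
  \<open>n\<close> and then tends to 0.\<close>

lemma quadratic_variation_H:
 "vanishing M (%n w. (\<Sum>i<n. (inc T n (%t. I t w) i)^2) - (LINT t:{0..T}|lborel. (H t w)^2))"
proof (rule vanishingI)
 have incm: "(%w. inc T n (%t. I t w) i) \<in> borel_measurable M" for n i
  unfolding inc_def using T by (intro borel_measurable_diff I_measurable) auto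
 have Hm: "(%w. LINT t:{0..T}|lborel. (H t w)^2) \<in> borel_measurable M"
  using H_cadlag(1) H_measurable(3) by (intro cadlag_adapted_integral_measurable[OF fsp _ T]) auto
 let ?X = "%n w. (\<Sum>i<n. (inc T n (%t. I t w) i)^2) - (LINT t:{0..T}|lborel. (H t w)^2)"
 show Xm: "?X n \<in> borel_measurable M" for n
  using incm Hm by (intro borel_measurable_diff borel_measurable_sum borel_measurable_power)
 fix eps \<delta> :: real assume e: "0 < eps" "0 < \<delta>"
 obtain K where K: "0 < K" "good K \<in> events" "prob (space M - good K) <= \<delta> / 2" using good_prob[OF half_gt_zero[OF e(2)]] by blast
 have bound: "prob {w \<in> good K. eps < \<bar>?X n w\<bar>} <= 12 * K^4 * T * (T / n) / (eps / 2)^2" if n: "0 < n" for n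
 proof -
  define p where "p r j = real j * (T / real (n * Suc r))" for r j :: nat
  have pp: "0 <= p r j" for r j using T by (simp add: p_def)
  define b where "b r j w = inc T (n * Suc r) (%t. B t w) j" for r j w
  define x where "x r w = (\<Sum>i<n. (\<Sum>j\<in>{i*Suc r..<i*Suc r+Suc r}. H (p r j) w * b r j w)^2) - (\<Sum>j<n*Suc r. T / real (n*Suc r) * (H (p r j) w)^2)" for r w
  define z where "z r w = (\<Sum>i<n. (\<Sum>j\<in>{i*Suc r..<i*Suc r+Suc r}. clip K (H (p r j) w) * b r j w)^2) - (\<Sum>j<n*Suc r. T / real (n*Suc r) * (clip K (H (p r j) w))^2)" for r w
  have xlim: "tendsto_in_prob M x (?X n)"
  proof -
   have k: "filterlim (%r. n * Suc r) at_top sequentially"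
    by (rule filterlim_mult_Suc[OF n])
   have "vanishing M (%r w. (\<Sum>j<n*Suc r. T / real (n*Suc r) * (H (p r j) w)^2) - (LINT t:{0..T}|lborel. (H t w)^2))"
   proof (rule vanishing_AE)
    show "AE w in M. (%r. (\<Sum>j<n*Suc r. T / real (n*Suc r) * (H (p r j) w)^2) - (LINT t:{0..T}|lborel. (H t w)^2)) \<longlonglongrightarrow> 0"
    proof (rule AE_I2)
     fix w assume "w \<in> space M"
     then have "cadlag (%t. (H t w)^2)" by (intro cadlag_power H_cadlag)
     from cadlag_riemann[OF this T k]
     show "(%r. (\<Sum>j<n*Suc r. T / real (n*Suc r) * (H (p r j) w)^2) - (LINT t:{0..T}|lborel. (H t w)^2)) \<longlonglongrightarrow> 0"
      unfolding p_def by (rule LIM_zero)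
    qed
   qed (intro borel_measurable_diff borel_measurable_sum borel_measurable_times borel_measurable_power borel_measurable_const H_measurable pp Hm)
   then have 1: "tendsto_in_prob M (%r w. \<Sum>j<n*Suc r. T / real (n*Suc r) * (H (p r j) w)^2) (%w. LINT t:{0..T}|lborel. (H t w)^2)"
    unfolding tendsto_in_prob_iff_vanishing
    by (intro conjI allI Hm borel_measurable_sum borel_measurable_times borel_measurable_power borel_measurable_const H_measurable pp)
   have 2: "tendsto_in_prob M (%r w. \<Sum>j\<in>{i*Suc r..<i*Suc r+Suc r}. H (p r j) w * b r j w) (%w. inc T n (%t. I t w) i)" for i
    unfolding p_def b_def by (rule riemann_cell_tendsto[OF prob_space_axioms T n I])
   have "tendsto_in_prob M (%r w. (\<Sum>i<n. (\<Sum>j\<in>{i*Suc r..<i*Suc r+Suc r}. H (p r j) w * b r j w) * (\<Sum>j\<in>{i*Suc r..<i*Suc r+Suc r}. H (p r j) w * b r j w)) + (-1) * (\<Sum>j<n*Suc r. T / real (n*Suc r) * (H (p r j) w)^2))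
    (%w. (\<Sum>i<n. inc T n (%t. I t w) i * inc T n (%t. I t w) i) + (-1) * (LINT t:{0..T}|lborel. (H t w)^2))"
    by (intro tendsto_in_prob_add tendsto_in_prob_mult tendsto_in_prob_sum tendsto_in_prob_const 1 2 borel_measurable_const)
   then show ?thesis by (simp add: x_def[abs_def] power2_eq_square)
  qed
  have zb: "prob {w \<in> good K. eps / 2 < \<bar>x r w\<bar>} <= 12 * K^4 * T * (T / n) / (eps / 2)^2" for r
  proof -
   have nr: "0 < n * Suc r" using n by simp
   interpret gp: gauss_pair M "%j. F (p r j)" "b r" "%j w. \<beta>' (n * Suc r) j w" "%_. T / real (n * Suc r)"
    using pair_steps[OF nr] unfolding p_def b_def .
   have zz: "integrable M (%w. (z r w)^2)" "expectation (%w. (z r w)^2) <= 12 * K^4 * (real n * real (Suc r) * (T / real (n * Suc r))) * (real (Suc r) * (T / real (n * Suc r)))"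
   proof -
    have ym: "(%w. clip K (H (p r j) w)) \<in> borel_measurable (F (p r j))" for j
     by (rule measurable_compose[OF H_measurable(1)[OF pp] clip_measurable])
    have yb: "\<bar>clip K (H (p r j) w)\<bar> <= K" for j w by (rule clip_abs[OF less_imp_le[OF K(1)]])
    note q = gp.B1.quadratic_variation_bound[where n=n and r="Suc r" and y="%j w. clip K (H (p r j) w)" and K=K and h="T / real (n * Suc r)", OF ym yb refl zero_less_Suc]
    show "integrable M (%w. (z r w)^2)" unfolding z_def by (rule q(1))
    show "expectation (%w. (z r w)^2) <= 12 * K^4 * (real n * real (Suc r) * (T / real (n * Suc r))) * (real (Suc r) * (T / real (n * Suc r)))"
     unfolding z_def using q(2) by (simp only: of_nat_mult)
   qed
   have cancel: "a * b * (t / (a * b)) = t" "b * (t / (a * b)) = t / a" if "a ~= 0" "b ~= 0" for a b t :: real using that by simp_all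
   have "real n ~= 0" "real (Suc r) ~= 0" using n by simp_all
   note cancel = cancel[OF this, of T]
   have eqs: "real n * real (Suc r) * (T / real (n * Suc r)) = T" "real (Suc r) * (T / real (n * Suc r)) = T / n"
    unfolding of_nat_mult by (rule cancel)+
   have zm: "z r \<in> borel_measurable M"
    unfolding z_def[abs_def] b_def using measurable_compose[OF H_measurable(3)[OF pp] clip_measurable]
    by (intro borel_measurable_diff borel_measurable_sum borel_measurable_times borel_measurable_power borel_measurable_const \<beta>_measurable)
   have "{w \<in> good K. eps / 2 < \<bar>x r w\<bar>} \<subseteq> {w \<in> space M. eps / 2 < \<bar>z r w\<bar>}"
   proof
    fix w assume ww: "w \<in> {w \<in> good K. eps / 2 < \<bar>x r w\<bar>}"
    have "clip K (H (p r j) w) = H (p r j) w" if "j < n * Suc r" for j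
     using ww that goodD(1)[of w K j "n * Suc r"] by (intro clip_id) (auto simp: p_def simp del: of_nat_mult)
    moreover have "j < n * Suc r" if "i < n" "j < i * Suc r + Suc r" for i j
    proof -
     have "Suc i * Suc r <= n * Suc r" using that(1) by (intro mult_le_mono1) simp
     then show ?thesis using that(2) by simp
    qed
    ultimately have "z r w = x r w" unfolding z_def x_def by (intro arg_cong2[where f="(-)"] sum.cong refl arg_cong[where f="%x. x^2"] arg_cong2[where f="(*)"]) auto
    then show "w \<in> {w \<in> space M. eps / 2 < \<bar>z r w\<bar>}" using ww by (auto simp: good_def)
   qed
   then have "prob {w \<in> good K. eps / 2 < \<bar>x r w\<bar>} <= prob {w \<in> space M. eps / 2 < \<bar>z r w\<bar>}"
    using zm by (intro finite_measure_mono event_abs_gt)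
   also have "... <= expectation (%w. (z r w)^2) / (eps / 2)^2" using e by (intro prob_gt_le_second_moment zm zz) auto
   also have "... <= 12 * K^4 * T * (T / n) / (eps / 2)^2" using zz(2) unfolding eqs by (intro divide_right_mono) auto
   finally show ?thesis .
  qed
  show ?thesis
   by (rule tendsto_in_prob_tail[OF xlim K(2) _ always_eventually tendsto_const, of "eps / 2"]) (use e zb in auto)
 qed
 have "(%n. (12 * K^4 * T * T / (eps / 2)^2) / real n) \<longlonglongrightarrow> 0" by (rule lim_const_over_n)
 from order_tendstoD(2)[OF this half_gt_zero[OF e(2)]]
 show "\<forall>\<^sub>F n in sequentially. prob {w \<in> space M. eps < \<bar>?X n w\<bar>} <= \<delta>"
  using eventually_gt_at_top[of 0]
 proof eventually_elim
  case (elim n)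
  have "12 * K^4 * T * (T / n) / (eps / 2)^2 = (12 * K^4 * T * T / (eps / 2)^2) / real n" by simp
  then have b: "prob {w \<in> good K. eps < \<bar>?X n w\<bar>} <= \<delta> / 2" using bound[OF elim(2)] elim(1) by linarith
  have ev: "{w \<in> good K. eps < \<bar>?X n w\<bar>} \<in> events"
  proof -
   have "{w \<in> good K. eps < \<bar>?X n w\<bar>} = good K \<inter> {w \<in> space M. eps < \<bar>?X n w\<bar>}" by (auto simp: good_def)
   then show ?thesis using K(2) event_abs_gt[OF Xm] by simp
  qed
  have "prob {w \<in> space M. eps < \<bar>?X n w\<bar>} <= prob {w \<in> good K. eps < \<bar>?X n w\<bar>} + prob (space M - good K)"
   using K(2) ev by (intro prob_le_add) auto
  then show ?case using b K(3) by linarith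
 qed
qed

lemma swap: "ito_pair M F B' B T H' H I' I"
proof -
 have "independent_processes M B' B"
  using ind unfolding independent_processes_def by (rule indep_var_commute)
 then show ?thesis
  using fsp B B' T H H' I I' by unfold_locales auto
qed

lemma coarse_error:
 assumes K: "0 < K" and a: "0 < \<alpha>"
 shows "\<exists>N>0. \<forall>n\<ge>N. \<forall>m\<ge>N. \<forall>r>0. \<bar>\<Sum>j<n*r. T / real (n*r) *
  expectation (%w. (clip K (H (real j * (T / real (n*r))) w) - clip K (H (real ((j div r) * m div n) * (T / real m)) w))^2)\<bar> < \<alpha>"
proof (rule joint_limit[OF _ a])
 fix n m r :: "nat => nat"
 assume n: "filterlim n at_top sequentially" "!!k. 0 < n k" and m: "filterlim m at_top sequentially" "!!k. 0 < m k" and r: "!!k. 0 < r k"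
 have nr: "filterlim (%k. n k * r k) at_top sequentially"
  by (rule filterlim_at_top_mono[OF n(1) always_eventually]) (use r in \<open>simp add: Suc_leI\<close>)
 define f where "f t w = clip K (H t w)" for t w
 have fm: "f t \<in> borel_measurable M" if "0 <= t" for t
  using measurable_compose[OF H_measurable(3)[OF that] clip_measurable] by (simp add: f_def[abs_def])
 have fb: "\<bar>f t w\<bar> <= K" for t w unfolding f_def using K by (intro clip_abs) simp
 have fc: "cadlag (%t. f t w)" if "w \<in> space M" for w unfolding f_def by (rule cadlag_clip[OF H_cadlag(1)[OF that]])
 define \<phi> where "\<phi> k s = gfl T (m k) (gfl T (n k) s)" for k s
 define D where "D k w = (\<Sum>j<n k*r k. T / real (n k*r k) * (f (real j * (T / real (n k*r k))) w - f (real ((j div r k) * m k div n k) * (T / real (m k))) w)^2)" for k w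
 have sqb: "(f t w - f u w)^2 <= (2*K)^2" for t u w
 proof -
  have "\<bar>f t w - f u w\<bar> <= 2*K" using fb[of t w] fb[of u w] by linarith
  from power_mono[OF this abs_ge_zero, of 2] show ?thesis by simp
 qed
 have D_eq: "D k w = (LINT s:{0..T}|lborel. (f (gfl T (n k*r k) s) w - f (\<phi> k (gfl T (n k*r k) s)) w)^2)" for k w
 proof -
  have "\<phi> k (real j * (T / real (n k*r k))) = real ((j div r k) * m k div n k) * (T / real (m k))" for j
  proof -
   have "gfl T (n k) (real j * (T / real (n k*r k))) = real (j div r k) * (T / real (n k))"
    using gfl_grid[OF T n(2), of "n k * r k" k j] n(2)[of k] r[of k] by (simp add: mult.commute del: of_nat_mult)
   then show ?thesis unfolding \<phi>_def using gfl_grid[OF T m(2) n(2), of k "j div r k" k] by simp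
  qed
  then show ?thesis
   unfolding D_def using gfl_integral[OF T, of "n k*r k" "%s. (f s w - f (\<phi> k s) w)^2"] n(2)[of k] r[of k] by simp
 qed
 have Dlim: "(%k. D k w) \<longlonglongrightarrow> 0" if ww: "w \<in> space M" for w
 proof -
  let ?g1 = "%k s. gfl T (n k*r k) s" and ?g2 = "%k s. \<phi> k (gfl T (n k*r k) s)"
  have m1: "?g1 k \<in> borel_measurable borel" "?g2 k \<in> borel_measurable borel" for k unfolding \<phi>_def by measurable
  have l1: "(%k. ?g1 k s) \<longlonglongrightarrow> s" for s by (rule gfl_limit[OF T nr tendsto_const])
  have l2: "(%k. ?g2 k s) \<longlonglongrightarrow> s" for s unfolding \<phi>_def by (rule gfl_limit[OF T m(1) gfl_limit[OF T n(1) l1]])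
  have r1: "?g1 k s \<in> {0..T}" "?g2 k s \<in> {0..T}" if "s \<in> {0..T}" for k s
   using that gfl_range'[OF T] unfolding \<phi>_def by blast+
  show ?thesis unfolding D_eq by (rule cadlag_step_integral[OF fc[OF ww] T m1 r1 l1 l2])
 qed
 have i1: "integrable M (%w. (f t w - f u w)^2)" if "0 <= t" "0 <= u" for t u
  using sqb fm that by (intro integrable_const_bound[where B="(2*K)^2"]) (auto intro!: AE_I2 borel_measurable_power borel_measurable_diff)
 have pos: "0 <= real j * (T / real l)" for j l using T by simp
 have Dm: "D k \<in> borel_measurable M" for k
  unfolding D_def[abs_def] by (intro borel_measurable_sum borel_measurable_times borel_measurable_power borel_measurable_diff borel_measurable_const fm pos)
 have Db: "\<bar>D k w\<bar> <= T * (2*K)^2" for k w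
 proof -
  have D0: "0 <= D k w" unfolding D_def using T by (intro sum_nonneg mult_nonneg_nonneg) auto
  have "D k w <= (\<Sum>j<n k*r k. T / real (n k*r k) * (2*K)^2)" unfolding D_def using T sqb by (intro sum_mono mult_left_mono) auto
  also have "... = T * (2*K)^2" using n(2)[of k] r[of k] by simp
  finally show ?thesis using D0 by simp
 qed
 have "(%k. expectation (D k)) \<longlonglongrightarrow> expectation (%_. 0)"
  using Dlim Db Dm by (intro integral_dominated_convergence[where w="%_. T * (2*K)^2"]) auto
 moreover have "expectation (D k) = (\<Sum>j<n k*r k. T / real (n k*r k) *
  expectation (%w. (f (real j * (T / real (n k*r k))) w - f (real ((j div r k) * m k div n k) * (T / real (m k))) w)^2))" for k
  unfolding D_def integral_mult_right_zero[symmetric]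
  by (rule Bochner_Integration.integral_sum) (intro integrable_mult_right i1 pos)
 ultimately show "(%k. \<Sum>j<n k*r k. T / real (n k*r k) *
  expectation (%w. (clip K (H (real j * (T / real (n k*r k))) w) - clip K (H (real ((j div r k) * m k div n k) * (T / real (m k))) w))^2)) \<longlonglongrightarrow> 0"
  by (simp add: f_def)
qed

definition S :: "nat => 'a => real" where
 "S n w = sqrt (n / T) * (\<Sum>i<n. inc T n (%t. I t w) i * inc T n (%t. I' t w) i)"

definition HC :: "real => nat => nat => 'a => real" where
 "HC K m k w = clip K (H (real k * (T / real m)) w) * clip K (H' (real k * (T / real m)) w)"

lemma inc_I_measurable: "(%w. inc T n (%t. I t w) i) \<in> borel_measurable M" "(%w. inc T n (%t. I' t w) i) \<in> borel_measurable M"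
 unfolding inc_def using T by (intro borel_measurable_diff I_measurable; simp)+

lemma S_measurable: "S n \<in> borel_measurable M"
 unfolding S_def[abs_def] by (intro borel_measurable_times borel_measurable_sum borel_measurable_const inc_I_measurable)

lemma HC_measurable: "HC K m k \<in> borel_measurable M"
proof -
 have "0 <= real k * (T / real m)" using T by simp
 note H_measurable(3,4)[OF this, measurable]
 show ?thesis unfolding HC_def[abs_def] by measurable
qed

lemma pair_approx:
 assumes K: "0 < K" and good: "good K \<in> events" and e: "0 < eps" "0 < \<delta>"
 shows "\<exists>N>0. \<forall>n\<ge>N. \<forall>m\<ge>N. prob {w \<in> good K. eps < \<bar>S n w - RU m (HC K m) n w\<bar>} <= \<delta>"
proof -
 \<comment> \<open>This is \<open>6 / (eps / 2)^2\<close>, from Chebyshev's inequality. The constant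
   \<open>q\<close> of \<open>product_bound\<close> is fixed before the accuracy \<alpha> of
   freezing, as the latter is multiplied by \<open>1 / q\<close> in \<open>c\<close>; each
   contributes \<open>\<delta> / 2\<close>.\<close>
 define Q where "Q = 24 / eps^2"
 have Q: "0 < Q" using e by (simp add: Q_def)
 define q where "q = \<delta> / (2 * Q * (48 * K^4 * T))"
 have q: "0 < q" "Q * (48 * q * K^4 * T) = \<delta> / 2" using e Q K T by (auto simp: q_def)
 define c where "c = 16 * K^2 + 2 * K^2 / q"
 have c: "0 < c" using K q unfolding c_def by (intro add_pos_pos) auto
 define \<alpha> where "\<alpha> = \<delta> / (4 * Q * c)"
 have \<alpha>: "0 < \<alpha>" "Q * (c * (\<alpha> + \<alpha>)) = \<delta> / 2" using e Q c by (auto simp: \<alpha>_def field_simps)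
 interpret sw: ito_pair M F B' B T H' H I' I by (rule swap)
 obtain N1 where N1: "0 < N1" "!!n m r. N1 <= n ==> N1 <= m ==> 0 < r ==> \<bar>\<Sum>j<n*r. T / real (n*r) *
  expectation (%w. (clip K (H (real j * (T / real (n*r))) w) - clip K (H (real ((j div r) * m div n) * (T / real m)) w))^2)\<bar> < \<alpha>"
  using coarse_error[OF K \<alpha>(1)] by blast
 obtain N2 where N2: "0 < N2" "!!n m r. N2 <= n ==> N2 <= m ==> 0 < r ==> \<bar>\<Sum>j<n*r. T / real (n*r) *
  expectation (%w. (clip K (H' (real j * (T / real (n*r))) w) - clip K (H' (real ((j div r) * m div n) * (T / real m)) w))^2)\<bar> < \<alpha>"
  using sw.coarse_error[OF K \<alpha>(1)] by blast
 show ?thesis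
 proof (intro exI[of _ "max N1 N2"] conjI allI impI)
  show "0 < max N1 N2" using N1 by simp
  fix n m assume nm: "max N1 N2 <= n" "max N1 N2 <= m"
  then have n: "0 < n" and m: "0 < m" using N1 by auto
  define p where "p r j = real j * (T / real (n * Suc r))" for r j :: nat
  define u where "u r j = real ((j div Suc r) * m div n) * (T / real m)" for r j :: nat
  have pp: "0 <= p r j" "0 <= u r j" for r j using T by (auto simp: p_def u_def)
  have up: "u r j <= p r j" for r j
  proof -
   have "gfl T n (p r j) = real (j div Suc r) * (T / real n)"
    using gfl_grid[OF T n, of "n * Suc r" j] n unfolding p_def by (simp add: mult.commute del: of_nat_mult mult_Suc_right)
   then have "u r j = gfl T m (gfl T n (p r j))" unfolding u_def using gfl_grid[OF T m n, of "j div Suc r"] by simp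
   also have "... <= p r j" using gfl_le[OF T m, of "gfl T n (p r j)"] gfl_le[OF T n, of "p r j"] by linarith
   finally show ?thesis .
  qed
  define b where "b r j w = inc T (n * Suc r) (%t. B t w) j" for r j w
  define b' where "b' r j w = inc T (n * Suc r) (%t. B' t w) j" for r j w
  define y where "y r j w = clip K (H (p r j) w)" for r j w
  define y' where "y' r j w = clip K (H' (p r j) w)" for r j w
  define g where "g r j w = clip K (H (u r j) w)" for r j w
  define g' where "g' r j w = clip K (H' (u r j) w)" for r j w
  define C where "C r i = {i*Suc r..<i*Suc r+Suc r}" for r i :: nat
  define x where "x r w = sqrt (n / T) * (\<Sum>i<n. (\<Sum>j\<in>C r i. H (p r j) w * b r j w) * (\<Sum>j\<in>C r i. H' (p r j) w * b' r j w)) - RU m (HC K m) n w" for r w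
  define z1 where "z1 r w = (\<Sum>i<n. (\<Sum>j\<in>C r i. (y r j w - g r j w) * b r j w) * (\<Sum>j\<in>C r i. y' r j w * b' r j w))" for r w
  define z2 where "z2 r w = (\<Sum>i<n. (\<Sum>j\<in>C r i. (y' r j w - g' r j w) * b' r j w) * (\<Sum>j\<in>C r i. g r j w * b r j w))" for r w
  have RUm: "RU m (HC K m) n \<in> borel_measurable M" by (rule RU_measurable[OF HC_measurable])
  have xlim: "tendsto_in_prob M x (%w. S n w - RU m (HC K m) n w)"
  proof -
   have 1: "tendsto_in_prob M (%r w. \<Sum>j\<in>C r i. H (p r j) w * b r j w) (%w. inc T n (%t. I t w) i)" for i
    unfolding p_def b_def C_def by (rule riemann_cell_tendsto[OF prob_space_axioms T n I])
   have 2: "tendsto_in_prob M (%r w. \<Sum>j\<in>C r i. H' (p r j) w * b' r j w) (%w. inc T n (%t. I' t w) i)" for i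
    unfolding p_def b'_def C_def by (rule riemann_cell_tendsto[OF prob_space_axioms T n I'])
   have "tendsto_in_prob M (%r w. sqrt (n / T) * (\<Sum>i<n. (\<Sum>j\<in>C r i. H (p r j) w * b r j w) * (\<Sum>j\<in>C r i. H' (p r j) w * b' r j w)) + (-1) * RU m (HC K m) n w)
    (%w. sqrt (n / T) * (\<Sum>i<n. inc T n (%t. I t w) i * inc T n (%t. I' t w) i) + (-1) * RU m (HC K m) n w)"
    by (intro tendsto_in_prob_add tendsto_in_prob_mult tendsto_in_prob_sum tendsto_in_prob_const 1 2 borel_measurable_const RUm)
   then show ?thesis by (simp add: x_def[abs_def] S_def)
  qed
  have zb: "prob {w \<in> good K. eps / 2 < \<bar>x r w\<bar>} <= \<delta>" for r
  proof -
   have nr: "0 < n * Suc r" using n by simp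
   interpret gp: gauss_pair M "%j. F (p r j)" "b r" "b' r" "%_. T / real (n * Suc r)"
    using pair_steps[OF nr] unfolding p_def b_def b'_def .
   interpret gs: gauss_pair M "%j. F (p r j)" "b' r" "b r" "%_. T / real (n * Suc r)"
    by (rule gp.pair_swap)
   have meas: "y r j \<in> borel_measurable (F (p r j))" "y' r j \<in> borel_measurable (F (p r j))"
    "g r j \<in> borel_measurable (F (p r j))" "g' r j \<in> borel_measurable (F (p r j))" for j
   proof -
    show "y r j \<in> borel_measurable (F (p r j))" "y' r j \<in> borel_measurable (F (p r j))"
     unfolding y_def[abs_def] y'_def[abs_def] using measurable_compose[OF H_measurable(1)[OF pp(1)] clip_measurable] measurable_compose[OF H_measurable(2)[OF pp(1)] clip_measurable] by auto
    have sub: "subalgebra (F (p r j)) (F (u r j))"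
     using filtered_prob_spaceD(2)[OF fsp, of "p r j"] filtered_prob_spaceD(2)[OF fsp, of "u r j"] filtered_prob_spaceD(3)[OF fsp up]
     by (simp add: subalgebra_def)
    show "g r j \<in> borel_measurable (F (p r j))" "g' r j \<in> borel_measurable (F (p r j))"
     unfolding g_def[abs_def] g'_def[abs_def]
     using measurable_compose[OF measurable_from_subalg[OF sub H_measurable(1)[OF pp(2)]] clip_measurable]
      measurable_compose[OF measurable_from_subalg[OF sub H_measurable(2)[OF pp(2)]] clip_measurable] by auto
   qed
   have bnd: "\<bar>y r j w\<bar> <= K" "\<bar>y' r j w\<bar> <= K" "\<bar>g r j w\<bar> <= K" "\<bar>g' r j w\<bar> <= K" for j w
    unfolding y_def y'_def g_def g'_def by (rule clip_abs[OF less_imp_le[OF K]])+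
   \<comment> \<open>The differences need the bound \<open>2 * K\<close>; it is then used for both
     factors, since \<open>product_bound\<close> has a single constant.\<close>
   have bnd2: "\<bar>y r j w - g r j w\<bar> <= 2*K" "\<bar>y' r j w - g' r j w\<bar> <= 2*K" "\<bar>y' r j w\<bar> <= 2*K" "\<bar>g r j w\<bar> <= 2*K" for j w
    using bnd[of j w] K by linarith+
   let ?h = "T / real (n * Suc r)"
   define A where "A = (\<Sum>j<n*Suc r. ?h * expectation (%w. (y r j w - g r j w)^2))"
   define A' where "A' = (\<Sum>j<n*Suc r. ?h * expectation (%w. (y' r j w - g' r j w)^2))"
   have A: "A < \<alpha>" "A' < \<alpha>"
    using N1(2)[of n m "Suc r"] N2(2)[of n m "Suc r"] nm unfolding A_def A'_def y_def y'_def g_def g'_def p_def u_def by auto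
   have pb1: "integrable M (%w. (z1 r w)^2)" "expectation (%w. (z1 r w)^2) <= 3 * (real (Suc r) * ?h) * (4 * (2*K)^2 * A + (3 * q * (2*K)^4 * (real n * real (Suc r) * ?h) + (2*K)^2 * A / q) / 2)"
   proof -
    note q = gp.product_bound[where n=n and r="Suc r" and y="%j w. y r j w - g r j w" and y'="y' r" and K="2*K" and q=q and h="?h", OF borel_measurable_diff[OF meas(1) meas(3)] bnd2(1) meas(2) bnd2(3) refl zero_less_Suc q(1)]
    show "integrable M (%w. (z1 r w)^2)" unfolding z1_def C_def by (rule q(1))
    show "expectation (%w. (z1 r w)^2) <= 3 * (real (Suc r) * ?h) * (4 * (2*K)^2 * A + (3 * q * (2*K)^4 * (real n * real (Suc r) * ?h) + (2*K)^2 * A / q) / 2)"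
     unfolding z1_def C_def A_def using q(2) by (simp only: of_nat_mult)
   qed
   have pb2: "integrable M (%w. (z2 r w)^2)" "expectation (%w. (z2 r w)^2) <= 3 * (real (Suc r) * ?h) * (4 * (2*K)^2 * A' + (3 * q * (2*K)^4 * (real n * real (Suc r) * ?h) + (2*K)^2 * A' / q) / 2)"
   proof -
    note q = gs.product_bound[where n=n and r="Suc r" and y="%j w. y' r j w - g' r j w" and y'="g r" and K="2*K" and q=q and h="?h", OF borel_measurable_diff[OF meas(2) meas(4)] bnd2(2) meas(3) bnd2(4) refl zero_less_Suc q(1)]
    show "integrable M (%w. (z2 r w)^2)" unfolding z2_def C_def by (rule q(1))
    show "expectation (%w. (z2 r w)^2) <= 3 * (real (Suc r) * ?h) * (4 * (2*K)^2 * A' + (3 * q * (2*K)^4 * (real n * real (Suc r) * ?h) + (2*K)^2 * A' / q) / 2)"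
     unfolding z2_def C_def A'_def using q(2) by (simp only: of_nat_mult)
   qed
   have cancel: "a * b * (t / (a * b)) = t" "b * (t / (a * b)) = t / a" if "a ~= 0" "b ~= 0" for a b t :: real using that by simp_all
   have "real n ~= 0" "real (Suc r) ~= 0" using n by simp_all
   note cancel = cancel[OF this, of T]
   have eqs: "real n * real (Suc r) * ?h = T" "real (Suc r) * ?h = T / n"
    unfolding of_nat_mult by (rule cancel)+
   have zm: "z1 r \<in> borel_measurable M" "z2 r \<in> borel_measurable M"
   proof -
    have "y r j \<in> borel_measurable M" "y' r j \<in> borel_measurable M" "g r j \<in> borel_measurable M" "g' r j \<in> borel_measurable M" "b r j \<in> borel_measurable M" "b' r j \<in> borel_measurable M" for j
     using gp.B1.meas_M[OF meas(1)] gp.B1.meas_M[OF meas(2)] gp.B1.meas_M[OF meas(3)] gp.B1.meas_M[OF meas(4)] gp.B1.d_M gp.B2.d_M by auto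
    then show "z1 r \<in> borel_measurable M" "z2 r \<in> borel_measurable M"
     unfolding z1_def[abs_def] z2_def[abs_def] by (auto intro!: borel_measurable_sum borel_measurable_times borel_measurable_diff)
   qed
   define z where "z w = sqrt (n / T) * (z1 r w + z2 r w)" for w
   have zM: "z \<in> borel_measurable M" unfolding z_def[abs_def] using zm by (intro borel_measurable_times borel_measurable_add borel_measurable_const)
   have zsq: "(z w)^2 <= n / T * (2 * (z1 r w)^2 + 2 * (z2 r w)^2)" for w
   proof -
    have "2 * a^2 + 2 * b^2 - (a + b)^2 = (a - b)^2" for a b :: real by (simp add: power2_eq_square algebra_simps)
    then have "(a + b)^2 <= 2 * a^2 + 2 * b^2" for a b :: real by (metis diff_ge_0_iff_ge zero_le_power2)
    then have "n / T * (z1 r w + z2 r w)^2 <= n / T * (2 * (z1 r w)^2 + 2 * (z2 r w)^2)" using T by (intro mult_left_mono) auto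
    then show ?thesis unfolding z_def using T by (simp add: power_mult_distrib)
   qed
   have dom: "integrable M (%w. n / T * (2 * (z1 r w)^2 + 2 * (z2 r w)^2))" using pb1(1) pb2(1) by auto
   have zi: "integrable M (%w. (z w)^2)"
   proof (rule Bochner_Integration.integrable_bound[OF dom])
    show "(%w. (z w)^2) \<in> borel_measurable M" by (intro borel_measurable_power zM)
    show "AE w in M. norm ((z w)^2) <= norm (n / T * (2 * (z1 r w)^2 + 2 * (z2 r w)^2))"
     using order_trans[OF zsq abs_ge_self] by (intro AE_I2) simp
   qed
   have "expectation (%w. (z w)^2) <= expectation (%w. n / T * (2 * (z1 r w)^2 + 2 * (z2 r w)^2))"
    by (rule integral_mono[OF zi dom zsq])
   also have "... = n / T * (2 * expectation (%w. (z1 r w)^2) + 2 * expectation (%w. (z2 r w)^2))" using pb1(1) pb2(1) by simp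
   also have "... <= n / T * (2 * (3 * (T / n) * (4 * (2*K)^2 * A + (3 * q * (2*K)^4 * T + (2*K)^2 * A / q) / 2)) +
    2 * (3 * (T / n) * (4 * (2*K)^2 * A' + (3 * q * (2*K)^4 * T + (2*K)^2 * A' / q) / 2)))"
    using pb1(2) pb2(2) T unfolding eqs by (intro mult_left_mono add_mono) auto
   also have "... = 6 * (48 * q * K^4 * T + c * (A + A'))"
   proof -
    have ring: "N * (2 * (3 * M' * X) + 2 * (3 * M' * Y)) = 6 * (N * M') * (X + Y)" for N M' X Y :: real by (simp add: algebra_simps)
    have "n / T * (T / n) = 1" using n T by simp
    then show ?thesis unfolding ring c_def using q(1) by (simp add: power_mult_distrib field_simps)
   qed
   also have "... <= 6 * (48 * q * K^4 * T + c * (\<alpha> + \<alpha>))" using A c by (intro mult_left_mono add_left_mono add_mono) auto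
   finally have zE: "expectation (%w. (z w)^2) <= 6 * (48 * q * K^4 * T + c * (\<alpha> + \<alpha>))" .
   have "{w \<in> good K. eps / 2 < \<bar>x r w\<bar>} \<subseteq> {w \<in> space M. eps / 2 < \<bar>z w\<bar>}"
   proof
    fix w assume ww: "w \<in> {w \<in> good K. eps / 2 < \<bar>x r w\<bar>}"
    have jn: "j < n * Suc r" "j div Suc r = i" if "i < n" "j \<in> C r i" for i j
    proof -
     have "Suc i * Suc r <= n * Suc r" using that(1) by (intro mult_le_mono1) simp
     then show "j < n * Suc r" using that(2) by (simp add: C_def)
     show "j div Suc r = i" using that(2) div_nat_eqI[of "Suc r" i j] unfolding C_def by (simp add: mult.commute)
    qed
    have yH: "y r j w = H (p r j) w" "y' r j w = H' (p r j) w" if "i < n" "j \<in> C r i" for i j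
     using ww jn[OF that] goodD[of w K j "n * Suc r"] unfolding y_def y'_def p_def by (auto intro!: clip_id simp del: of_nat_mult)
    have gi: "(\<Sum>j\<in>C r i. g r j w * b r j w) = clip K (H (real (i * m div n) * (T / real m)) w) * \<beta> n i w"
     "(\<Sum>j\<in>C r i. g' r j w * b' r j w) = clip K (H' (real (i * m div n) * (T / real m)) w) * \<beta>' n i w" if "i < n" for i
    proof -
     have "(\<Sum>j\<in>C r i. g r j w * b r j w) = (\<Sum>j\<in>C r i. clip K (H (real (i * m div n) * (T / real m)) w) * b r j w)"
      using jn(2)[OF that] unfolding g_def u_def by (intro sum.cong refl) simp
     then show "(\<Sum>j\<in>C r i. g r j w * b r j w) = clip K (H (real (i * m div n) * (T / real m)) w) * \<beta> n i w"
      unfolding sum_distrib_left[symmetric] b_def C_def inc_refine[OF zero_less_Suc] .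
     have "(\<Sum>j\<in>C r i. g' r j w * b' r j w) = (\<Sum>j\<in>C r i. clip K (H' (real (i * m div n) * (T / real m)) w) * b' r j w)"
      using jn(2)[OF that] unfolding g'_def u_def by (intro sum.cong refl) simp
     then show "(\<Sum>j\<in>C r i. g' r j w * b' r j w) = clip K (H' (real (i * m div n) * (T / real m)) w) * \<beta>' n i w"
      unfolding sum_distrib_left[symmetric] b'_def C_def inc_refine[OF zero_less_Suc] .
    qed
    have RUe: "RU m (HC K m) n w = sqrt (n / T) * (\<Sum>i<n. (\<Sum>j\<in>C r i. g r j w * b r j w) * (\<Sum>j\<in>C r i. g' r j w * b' r j w))"
     unfolding RU_def HC_def sum_distrib_left[of "sqrt (n / T)"] by (intro sum.cong refl) (simp only: lessThan_iff gi, simp only: mult_ac)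
    have xe: "(\<Sum>i<n. (\<Sum>j\<in>C r i. H (p r j) w * b r j w) * (\<Sum>j\<in>C r i. H' (p r j) w * b' r j w)) =
     (\<Sum>i<n. (\<Sum>j\<in>C r i. y r j w * b r j w) * (\<Sum>j\<in>C r i. y' r j w * b' r j w))"
     by (intro sum.cong refl arg_cong2[where f="(*)"]) (auto simp: yH)
    have "z1 r w + z2 r w = (\<Sum>i<n. (\<Sum>j\<in>C r i. y r j w * b r j w) * (\<Sum>j\<in>C r i. y' r j w * b' r j w)) -
     (\<Sum>i<n. (\<Sum>j\<in>C r i. g r j w * b r j w) * (\<Sum>j\<in>C r i. g' r j w * b' r j w))"
     unfolding z1_def z2_def left_diff_distrib sum_subtractf right_diff_distrib by (simp add: mult.commute)
    then have "x r w = z w" unfolding x_def z_def RUe xe by (simp only: right_diff_distrib)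
    then show "w \<in> {w \<in> space M. eps / 2 < \<bar>z w\<bar>}" using ww by (auto simp: good_def)
   qed
   then have "prob {w \<in> good K. eps / 2 < \<bar>x r w\<bar>} <= prob {w \<in> space M. eps / 2 < \<bar>z w\<bar>}"
    using zM by (intro finite_measure_mono event_abs_gt)
   also have "... <= expectation (%w. (z w)^2) / (eps / 2)^2" using e by (intro prob_gt_le_second_moment zM zi) auto
   also have "... <= 6 * (48 * q * K^4 * T + c * (\<alpha> + \<alpha>)) / (eps / 2)^2" using zE by (intro divide_right_mono) auto
   also have "... = Q * (48 * q * K^4 * T) + Q * (c * (\<alpha> + \<alpha>))"
    unfolding Q_def by (simp add: power_divide distrib_left add_divide_distrib)
   also have "... = \<delta>" unfolding q(2) \<alpha>(2) by simp
   finally show ?thesis .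
  qed
  show "prob {w \<in> good K. eps < \<bar>S n w - RU m (HC K m) n w\<bar>} <= \<delta>"
   by (rule tendsto_in_prob_tail[OF xlim good _ always_eventually tendsto_const, of "eps / 2"]) (use e zb in auto)
 qed
qed

end

section \<open>The mixed central limit theorem for the covariation\<close>

text \<open>The Lipschitz bound is used where the variables are close; on the exceptional event two
  values of \<open>f\<close> differ by at most 2.\<close>

lemma (in prob_space) expectation_Lipschitz_diff:
 fixes f :: "real => real"
 assumes f: "!!x y. \<bar>f x - f y\<bar> <= \<bar>x - y\<bar>" "!!x. \<bar>f x\<bar> <= 1" "f \<in> borel_measurable borel"
  and X: "X \<in> borel_measurable M" and Y: "Y \<in> borel_measurable M" and \<eta>: "0 <= \<eta>"
 shows "\<bar>expectation (%w. f (X w)) - expectation (%w. f (Y w))\<bar> <= \<eta> + 2 * prob {w \<in> space M. \<eta> < \<bar>X w - Y w\<bar>}"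
proof -
 let ?A = "{w \<in> space M. \<eta> < \<bar>X w - Y w\<bar>}"
 have A: "?A \<in> events" by (rule event_abs_gt[OF borel_measurable_diff[OF X Y]])
 have i: "integrable M (%w. f (X w))" "integrable M (%w. f (Y w))"
  using f(2) measurable_compose[OF X f(3)] measurable_compose[OF Y f(3)]
  by (auto intro!: integrable_const_bound[where B=1] AE_I2)
 have ii: "integrable M (indicat_real ?A)" using A by (intro integrable_const_bound[where B=1]) auto
 have b: "\<bar>f (X w) - f (Y w)\<bar> <= \<eta> + 2 * indicator ?A w" if "w \<in> space M" for w
 proof (cases "w \<in> ?A")
  case True
  then show ?thesis using f(2)[of "X w"] f(2)[of "Y w"] \<eta> by simp
 next
  case False
  then show ?thesis using f(1)[of "X w" "Y w"] that by simp
 qed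
 have "\<bar>expectation (%w. f (X w)) - expectation (%w. f (Y w))\<bar> = \<bar>expectation (%w. f (X w) - f (Y w))\<bar>" using i by simp
 also have "... <= expectation (%w. \<bar>f (X w) - f (Y w)\<bar>)" by (rule integral_abs_bound)
 also have "... <= expectation (%w. \<eta> + 2 * indicator ?A w)"
  using i b by (intro integral_mono integrable_abs Bochner_Integration.integrable_diff Bochner_Integration.integrable_add integrable_mult_right ii) auto
 also have "... = \<eta> + 2 * prob ?A"
  by (subst Bochner_Integration.integral_add[OF _ integrable_mult_right[OF ii]]) (use A in \<open>simp_all add: prob_space\<close>)
 finally show ?thesis .
qed

lemma (in prob_space) vanishing_expectation:
 fixes f :: "real => real"
 assumes f: "!!x y. \<bar>f x - f y\<bar> <= \<bar>x - y\<bar>" "!!x. \<bar>f x\<bar> <= 1" "f \<in> borel_measurable borel"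
  and X: "!!n. X n \<in> borel_measurable M" and Y: "!!n. Y n \<in> borel_measurable M"
  and v: "vanishing M (%n w. X n w - Y n w)"
 shows "(%n. expectation (%w. f (X n w)) - expectation (%w. f (Y n w))) \<longlonglongrightarrow> 0"
proof (rule tendstoI)
 fix e :: real assume e: "0 < e"
 show "\<forall>\<^sub>F n in sequentially. dist (expectation (%w. f (X n w)) - expectation (%w. f (Y n w))) 0 < e"
  using vanishingD[OF v, of "e/4" "e/4", simplified, OF e]
 proof eventually_elim
  case (elim n)
  then show ?case using expectation_Lipschitz_diff[OF f X[of n] Y[of n], of "e/4"] e by (simp add: dist_real_def)
 qed
qed

context ito_pair
begin

text \<open>By \<open>pair_approx\<close> one fixed coarse grid \<open>N\<close> suffices, and there
  the sum is compared with zero weights by \<open>RU_diff_bound\<close>.\<close>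

lemma stoch_bounded_S: "stoch_bounded M S"
 unfolding stoch_bounded_def
proof (intro conjI allI impI S_measurable)
 fix eps :: real assume e: "0 < eps"
 obtain K where K: "0 < K" "good K \<in> events" "prob (space M - good K) <= eps / 3" using good_prob[of "eps / 3"] e by auto
 obtain N where N: "0 < N" "!!n m. N <= n ==> N <= m ==> prob {w \<in> good K. 1 < \<bar>S n w - RU m (HC K m) n w\<bar>} <= eps / 3"
  using pair_approx[OF K(1,2), of 1 "eps / 3"] e by auto
 define c where "c = real N * (K * K) * sqrt (18 * T) * (3 / eps)"
 have c: "0 < c" unfolding c_def using N K e T by (intro mult_pos_pos divide_pos_pos) auto
 have HCb: "\<bar>HC K N k w\<bar> <= K * K" for k w
  unfolding HC_def abs_mult using K by (intro mult_mono clip_abs) auto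
 have RUb: "prob {w \<in> space M. c < \<bar>RU N (HC K N) n w\<bar>} <= eps / 3" if n: "0 < n" for n
 proof -
  have z: "RU N (%_ _. 0) n w = 0" for w by (simp add: RU_def)
  have "\<bar>HC K N k w - 0\<bar> <= K * K" for k w using HCb by simp
  note r = RU_diff_bound[where V="%_ _. 0", OF n N(1) HC_measurable borel_measurable_const this mult_nonneg_nonneg[OF less_imp_le[OF K(1)] less_imp_le[OF K(1)]], unfolded z]
  have "prob {w \<in> space M. c < \<bar>RU N (HC K N) n w\<bar>} <= prob {w \<in> space M. c <= \<bar>RU N (HC K N) n w - 0\<bar>}"
   using RU_measurable[OF HC_measurable] by (intro finite_measure_mono) auto
  also have "... <= expectation (%w. \<bar>RU N (HC K N) n w - 0\<bar>) / c"
   by (rule integral_Markov_inequality_measure[OF r(1) _ _ c, of "{}"]) auto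
  also have "... <= real N * (K * K) * sqrt (18 * T) / c" using r(2) c by (intro divide_right_mono) auto
  also have "... = eps / 3" using N K e T by (simp add: c_def)
  finally show ?thesis .
 qed
 show "\<exists>C>0. \<forall>\<^sub>F n in sequentially. prob {w \<in> space M. C < \<bar>S n w\<bar>} <= eps"
 proof (intro exI[of _ "c + 1"] conjI)
  show "\<forall>\<^sub>F n in sequentially. prob {w \<in> space M. c + 1 < \<bar>S n w\<bar>} <= eps"
   using eventually_ge_at_top[of N]
  proof eventually_elim
   case (elim n)
   let ?A = "{w \<in> good K. 1 < \<bar>S n w - RU N (HC K N) n w\<bar>}" and ?B = "{w \<in> space M. c < \<bar>RU N (HC K N) n w\<bar>}"
   have ev: "?A \<in> events" "?B \<in> events"
   proof -
    have "?A = good K \<inter> {w \<in> space M. 1 < \<bar>S n w - RU N (HC K N) n w\<bar>}" by (auto simp: good_def)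
    then show "?A \<in> events" using K(2) event_abs_gt[OF borel_measurable_diff[OF S_measurable RU_measurable[OF HC_measurable]]] by simp
    show "?B \<in> events" by (rule event_abs_gt[OF RU_measurable[OF HC_measurable]])
   qed
   have "prob {w \<in> space M. c + 1 < \<bar>S n w\<bar>} <= prob (?A \<union> ?B) + prob (space M - good K)"
    using ev K(2) by (intro prob_le_add) auto
   also have "prob (?A \<union> ?B) <= prob ?A + prob ?B" using ev by (intro prob_le_add) auto
   finally show ?case using N(2)[OF elim order_refl] RUb[of n] K(3) elim N(1) by simp
  qed
 qed (use c in simp)
qed

definition V :: "'a => real" where
 "V w = (LINT t:{0..T}|lborel. (H t w * H' t w)^2)"

definition VK :: "real => 'a => real" where
 "VK K w = (LINT t:{0..T}|lborel. (clip K (H t w) * clip K (H' t w))^2)"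

lemma V_measurable: "V \<in> borel_measurable M" "VK K \<in> borel_measurable M"
proof -
 have "V \<in> borel_measurable M" unfolding V_def[abs_def]
  using H_measurable(3,4) by (intro cadlag_adapted_integral_measurable[OF fsp _ T] cadlag_power cadlag_mult H_cadlag borel_measurable_power borel_measurable_times) auto
 moreover have "VK K \<in> borel_measurable M" unfolding VK_def[abs_def]
  using H_measurable(3,4) by (intro cadlag_adapted_integral_measurable[OF fsp _ T] cadlag_power cadlag_mult cadlag_clip H_cadlag borel_measurable_power borel_measurable_times measurable_compose[OF _ clip_measurable]) auto
 ultimately show "V \<in> borel_measurable M" "VK K \<in> borel_measurable M" .
qed

lemma V_nonneg: "0 <= V w" "0 <= VK K w"
 unfolding V_def VK_def set_lebesgue_integral_def by (intro Bochner_Integration.integral_nonneg; simp)+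

lemma VK_limit: "w \<in> space M ==> (%k. VK (real k) w) \<longlonglongrightarrow> V w"
proof -
 assume ww: "w \<in> space M"
 obtain C where C: "0 <= C" "!!t. t \<in> {0..T} ==> \<bar>H t w\<bar> <= C" using cadlag_bounded[OF H_cadlag(1)[OF ww] less_imp_le[OF T]] by blast
 obtain C' where C': "0 <= C'" "!!t. t \<in> {0..T} ==> \<bar>H' t w\<bar> <= C'" using cadlag_bounded[OF H_cadlag(2)[OF ww] less_imp_le[OF T]] by blast
 obtain k0 :: nat where k0: "max C C' <= real k0" using real_arch_simple by blast
 have "\<forall>\<^sub>F k in sequentially. VK (real k) w = V w"
  using eventually_ge_at_top[of k0]
 proof eventually_elim
  case (elim k)
  have "clip (real k) (H t w) = H t w" "clip (real k) (H' t w) = H' t w" if "t \<in> {0..T}" for t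
   using C(2)[OF that] C'(2)[OF that] k0 elim by (auto intro!: clip_id)
  then show ?case unfolding VK_def V_def by (intro set_lebesgue_integral_cong) auto
 qed
 then show "(%k. VK (real k) w) \<longlonglongrightarrow> V w" by (rule tendsto_eventually)
qed

text \<open>The sum is \<open>W^2\<close> times the integral of the clipped integrand composed with
  two roundings, which converges along each path.\<close>

lemma block_variance_limit:
 assumes W: "W \<in> borel_measurable M" and n: "filterlim n at_top sequentially" "!!k. 0 < n k" and m: "filterlim m at_top sequentially" "!!k. 0 < m k"
 shows "(%k. expectation (%w. exp (- ((\<Sum>i<n k. (W w * HC K (m k) (i * m k div n k) w)^2 * (T / n k)) / 2)))) \<longlonglongrightarrow>
  expectation (%w. exp (- ((W w)^2 * VK K w / 2)))"
proof (rule integral_dominated_convergence[where w="%_. 1"])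
 show "(%w. exp (- ((\<Sum>i<n k. (W w * HC K (m k) (i * m k div n k) w)^2 * (T / n k)) / 2))) \<in> borel_measurable M" for k
  by (intro measurable_compose[OF _ borel_measurable_exp] borel_measurable_uminus borel_measurable_divide borel_measurable_sum borel_measurable_times borel_measurable_power borel_measurable_const W HC_measurable)
 show "(%w. exp (- ((W w)^2 * VK K w / 2))) \<in> borel_measurable M"
  by (intro measurable_compose[OF _ borel_measurable_exp] borel_measurable_uminus borel_measurable_divide borel_measurable_times borel_measurable_power borel_measurable_const W V_measurable)
 show "AE w in M. norm (exp (- ((\<Sum>i<n k. (W w * HC K (m k) (i * m k div n k) w)^2 * (T / n k)) / 2))) <= 1" for k
  using T by (intro AE_I2) (auto intro!: sum_nonneg)
 show "AE w in M. (%k. exp (- ((\<Sum>i<n k. (W w * HC K (m k) (i * m k div n k) w)^2 * (T / n k)) / 2))) \<longlonglongrightarrow> exp (- ((W w)^2 * VK K w / 2))"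
 proof (intro AE_I2 tendsto_intros)
  fix w assume ww: "w \<in> space M"
  define g where "g t = (clip K (H t w) * clip K (H' t w))^2" for t
  have gc: "cadlag g" unfolding g_def by (intro cadlag_power cadlag_mult cadlag_clip H_cadlag ww)
  obtain C where C: "0 <= C" "!!t. t \<in> {0..T} ==> \<bar>g t\<bar> <= C" using cadlag_bounded[OF gc less_imp_le[OF T]] by blast
  let ?\<phi> = "%k s. gfl T (m k) (gfl T (n k) s)"
  have r: "?\<phi> k s \<in> {0..T}" if "s \<in> {0..T}" for k s by (intro gfl_range'[OF T] that)
  have eq: "(\<Sum>i<n k. (W w * HC K (m k) (i * m k div n k) w)^2 * (T / n k)) = (W w)^2 * (LINT s:{0..T}|lborel. g (?\<phi> k s))" for k
   unfolding gfl_integral[of T "n k" "%s. g (gfl T (m k) s)"] gfl_integral[OF T n(2)[of k], of "%s. g (gfl T (m k) s)"] sum_distrib_left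
   using gfl_grid[OF T m(2)[of k] n(2)[of k]] by (intro sum.cong refl) (simp add: g_def HC_def power_mult_distrib)
  have "(%k. LINT s:{0..T}|lborel. g (?\<phi> k s)) \<longlonglongrightarrow> (LINT s:{0..T}|lborel. g s)"
  proof (rule set_integral_bounded_convergence[where C=C])
   show "set_borel_measurable lborel {0..T} (%s. g (?\<phi> k s))" for k
    using r by (intro cadlag_set_measurable[OF gc]) auto
   show "set_borel_measurable lborel {0..T} g"
    using cadlag_set_measurable[OF gc, of "%s. s" T] by simp
   show "\<bar>g (?\<phi> k s)\<bar> <= C" if "s \<in> {0..T}" for k s by (rule C(2)[OF r[OF that]])
   have "AE s in lborel. 0 < s --> (%k. g (?\<phi> k s)) \<longlonglongrightarrow> g s"
    by (rule cadlag_AE_tendsto[OF gc]) (intro gfl_limit[OF T m(1)] gfl_limit[OF T n(1)] tendsto_const)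
   then show "AE s in lborel. 0 < s --> s <= T --> (%k. g (?\<phi> k s)) \<longlonglongrightarrow> g s" by eventually_elim simp
  qed
  then show "(%k. \<Sum>i<n k. (W w * HC K (m k) (i * m k div n k) w)^2 * (T / n k)) \<longlonglongrightarrow> (W w)^2 * VK K w"
   unfolding eq VK_def g_def[symmetric] by (intro tendsto_mult_left)
 qed simp
qed simp

text \<open>The constants are chosen in the order \<open>K\<close>, coarse grid \<open>m\<close>,
  then \<open>n\<close>. The bounded random factor \<open>W\<close> inside \<open>f\<close> makes
  the limit usable after division by the random quadratic variation; it is absorbed into the
  weights.\<close>

lemma mixed_limit:
 fixes f :: "real => real"
 assumes f: "!!x y. \<bar>f x - f y\<bar> <= \<bar>x - y\<bar>" "!!x. \<bar>f x\<bar> <= 1" "f \<in> borel_measurable borel" and \<kappa>: "0 <= \<kappa>" "\<kappa> <= 1"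
  and mix: "!!U C m. (!!k. U k \<in> borel_measurable M) ==> (!!k w. w \<in> space M ==> \<bar>U k w\<bar> <= C) ==> 0 <= C ==> 0 < m ==>
   (%n. expectation (%w. f (RU m U n w)) - \<kappa> * expectation (%w. exp (- ((\<Sum>i<n. (U (i * m div n) w)^2 * (T / n)) / 2)))) \<longlonglongrightarrow> 0"
  and W: "W \<in> borel_measurable M" and ww: "!!w. w \<in> space M ==> \<bar>W w\<bar> <= ww" and w0: "0 <= ww"
 shows "(%n. expectation (%w. f (W w * S n w))) \<longlonglongrightarrow> \<kappa> * expectation (%w. exp (- ((W w)^2 * V w / 2)))"
proof (rule LIM_zero_cancel, rule tendstoI)
 fix eps :: real assume e: "0 < eps"
 \<comment> \<open>The errors are \<open>ww * \<eta> + 4 * \<eta>\<close> from freezing and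
   clipping, \<eta> from mixing and \<open>2 * \<eta>\<close> from the variance.\<close>
 define \<eta> where "\<eta> = eps / (ww + 8)"
 have \<eta>: "0 < \<eta>" "ww * \<eta> + 7 * \<eta> < eps"
 proof -
  show p: "0 < \<eta>" using e w0 by (simp add: \<eta>_def)
  have "(ww + 8) * \<eta> = eps" using w0 by (simp add: \<eta>_def)
  then show "ww * \<eta> + 7 * \<eta> < eps" using p by (simp add: distrib_right)
 qed
 obtain K0 where K0: "0 < K0" "!!K. K0 <= K ==> good K \<in> events \<and> prob (space M - good K) <= \<eta>" using good_prob[OF \<eta>(1)] by blast
 define E where "E X = expectation (%w. exp (- ((W w)^2 * X w / 2)))" for X
 have "(%k. E (VK (real k))) \<longlonglongrightarrow> E V"
  unfolding E_def
 proof (rule integral_dominated_convergence[where w="%_. 1"])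
  show "AE w in M. (%k. exp (- ((W w)^2 * VK (real k) w / 2))) \<longlonglongrightarrow> exp (- ((W w)^2 * V w / 2))"
   by (intro AE_I2 tendsto_intros VK_limit) auto
 qed (auto intro!: measurable_compose[OF _ borel_measurable_exp] borel_measurable_uminus borel_measurable_divide borel_measurable_times borel_measurable_power borel_measurable_const W V_measurable mult_nonneg_nonneg V_nonneg)
 from tendstoD[OF this \<eta>(1)] obtain k0 where k0: "!!k. k0 <= k ==> dist (E (VK (real k))) (E V) < \<eta>"
  unfolding eventually_sequentially by blast
 obtain k1 :: nat where k1: "K0 <= real k1" using real_arch_simple by blast
 define K where "K = real (max k0 k1)"
 have K: "0 < K" "good K \<in> events" "prob (space M - good K) <= \<eta>" "\<bar>E (VK K) - E V\<bar> < \<eta>"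
 proof -
  have "K0 <= K" using k1 by (simp add: K_def)
  with K0 show "0 < K" "good K \<in> events" "prob (space M - good K) <= \<eta>" by auto
  show "\<bar>E (VK K) - E V\<bar> < \<eta>" using k0[of "max k0 k1"] by (simp add: K_def dist_real_def)
 qed
 define U where "U m k w = W w * HC K m k w" for m k w
 define P where "P n m = expectation (%w. exp (- ((\<Sum>i<n. (U m (i * m div n) w)^2 * (T / n)) / 2)))" for n m
 have Um: "U m k \<in> borel_measurable M" for m k unfolding U_def[abs_def] by (intro borel_measurable_times W HC_measurable)
 have Ub: "\<bar>U m k w\<bar> <= ww * (K * K)" if "w \<in> space M" for m k w
  unfolding U_def HC_def abs_mult using K ww[OF that] w0 by (intro mult_mono clip_abs) auto
 have "\<exists>N>0. \<forall>n\<ge>N. \<forall>m\<ge>N. \<forall>r>0. \<bar>(%n m (r::nat). P n m - E (VK K)) n m r\<bar> < \<eta>"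
 proof (rule joint_limit[OF _ \<eta>(1)])
  fix n m r :: "nat => nat" assume "filterlim n at_top sequentially" "filterlim m at_top sequentially" "!!k. 0 < n k" "!!k. 0 < m k"
  from block_variance_limit[OF W this(1,3,2,4), of K]
  show "(%k. P (n k) (m k) - E (VK K)) \<longlonglongrightarrow> 0" unfolding P_def U_def E_def by (rule LIM_zero)
 qed
 then obtain N1 where N1: "0 < N1" "!!n m. N1 <= n ==> N1 <= m ==> \<bar>P n m - E (VK K)\<bar> < \<eta>" by (metis zero_less_one)
 obtain N2 where N2: "0 < N2" "!!n m. N2 <= n ==> N2 <= m ==> prob {w \<in> good K. \<eta> < \<bar>S n w - RU m (HC K m) n w\<bar>} <= \<eta>"
  using pair_approx[OF K(1,2) \<eta>(1) \<eta>(1)] by blast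
 define m where "m = max N1 N2"
 have m: "0 < m" "N1 <= m" "N2 <= m" using N1 by (auto simp: m_def)
 have c0: "0 <= ww * (K * K)" using w0 K by simp
 have RUW: "RU m (U m) n w = W w * RU m (HC K m) n w" for n w
  unfolding RU_def U_def sum_distrib_left by (intro sum.cong refl) (simp only: mult_ac)
 have RUm: "RU m (U m) n \<in> borel_measurable M" for n by (rule RU_measurable[OF Um])
 have mixl: "(%n. expectation (%w. f (RU m (U m) n w)) - \<kappa> * P n m) \<longlonglongrightarrow> 0"
  unfolding P_def by (rule mix[of "U m", OF Um Ub c0 m(1)])
 note mixm = tendstoD[OF mixl \<eta>(1)]
 show "\<forall>\<^sub>F n in sequentially. dist (expectation (%w. f (W w * S n w)) - \<kappa> * expectation (%w. exp (- ((W w)^2 * V w / 2)))) 0 < eps"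
  using mixm eventually_ge_at_top[of m]
 proof eventually_elim
  case (elim n)
  have n: "N1 <= n" "N2 <= n" using elim(2) m by auto
  let ?A = "{w \<in> good K. \<eta> < \<bar>S n w - RU m (HC K m) n w\<bar>}"
  have Aev: "?A \<in> events"
  proof -
   have "?A = good K \<inter> {w \<in> space M. \<eta> < \<bar>S n w - RU m (HC K m) n w\<bar>}" by (auto simp: good_def)
   then show ?thesis using K(2) event_abs_gt[OF borel_measurable_diff[OF S_measurable RU_measurable[OF HC_measurable]]] by simp
  qed
  have sub: "{w \<in> space M. ww * \<eta> < \<bar>W w * S n w - RU m (U m) n w\<bar>} \<subseteq> ?A \<union> (space M - good K)"
  proof
   fix w assume *: "w \<in> {w \<in> space M. ww * \<eta> < \<bar>W w * S n w - RU m (U m) n w\<bar>}"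
   have "\<eta> < \<bar>S n w - RU m (HC K m) n w\<bar>"
   proof (rule ccontr)
    assume "\<not> ?thesis"
    then have "\<bar>W w\<bar> * \<bar>S n w - RU m (HC K m) n w\<bar> <= ww * \<eta>" using * ww[of w] w0 by (intro mult_mono) auto
    then show False using * unfolding RUW by (simp add: abs_mult flip: right_diff_distrib)
   qed
   then show "w \<in> ?A \<union> (space M - good K)" using * by simp
  qed
  have "prob {w \<in> space M. ww * \<eta> < \<bar>W w * S n w - RU m (U m) n w\<bar>} <= prob ?A + prob (space M - good K)"
   using K(2) Aev by (intro prob_le_add sub) auto
  then have pr: "prob {w \<in> space M. ww * \<eta> < \<bar>W w * S n w - RU m (U m) n w\<bar>} <= 2 * \<eta>"
   using N2(2)[OF n(2) m(3)] K(3) by linarith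
  have a: "\<bar>expectation (%w. f (W w * S n w)) - expectation (%w. f (RU m (U m) n w))\<bar> <= ww * \<eta> + 4 * \<eta>"
   using expectation_Lipschitz_diff[OF f borel_measurable_times[OF W S_measurable[of n]] RUm[of n], of "ww * \<eta>"] pr w0 \<eta> by simp
  have b: "\<bar>expectation (%w. f (RU m (U m) n w)) - \<kappa> * P n m\<bar> < \<eta>" using elim(1) by (simp add: dist_real_def)
  have "\<bar>P n m - E V\<bar> <= 2 * \<eta>" using N1(2)[OF n(1) m(2)] K(4) by linarith
  then have "\<kappa> * \<bar>P n m - E V\<bar> <= 1 * (2 * \<eta>)" using \<kappa> \<eta> by (intro mult_mono) auto
  then have c: "\<bar>\<kappa> * P n m - \<kappa> * E V\<bar> <= 2 * \<eta>" using \<kappa> by (simp add: abs_mult flip: right_diff_distrib)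
  show ?case using a b c \<eta>(2) unfolding dist_real_def E_def by linarith
 qed
qed

lemma mixed_central_limit:
 assumes W: "W \<in> borel_measurable M" and ww: "!!w. w \<in> space M ==> \<bar>W w\<bar> <= ww" and w0: "0 <= ww"
 shows "(%n. expectation (%w. cos (W w * S n w))) \<longlonglongrightarrow> expectation (%w. exp (- ((W w)^2 * V w / 2)))"
  and "(%n. expectation (%w. sin (W w * S n w))) \<longlonglongrightarrow> 0"
proof -
 have "(%n. expectation (%w. cos (W w * S n w))) \<longlonglongrightarrow> 1 * expectation (%w. exp (- ((W w)^2 * V w / 2)))"
  using random_mixing(1) by (intro mixed_limit[OF cos_lipschitz _ _ _ _ _ W ww w0]) auto
 moreover have "(%n. expectation (%w. sin (W w * S n w))) \<longlonglongrightarrow> 0 * expectation (%w. exp (- ((W w)^2 * V w / 2)))"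
  using random_mixing(2) by (intro mixed_limit[OF sin_lipschitz _ _ _ _ _ W ww w0]) auto
 ultimately show "(%n. expectation (%w. cos (W w * S n w))) \<longlonglongrightarrow> expectation (%w. exp (- ((W w)^2 * V w / 2)))"
  "(%n. expectation (%w. sin (W w * S n w))) \<longlonglongrightarrow> 0" by simp_all
qed

end

section \<open>Drift terms and the delta method\<close>

lemma cadlag_set_integrable:
 assumes f: "cadlag f" and t: "0 <= t"
 shows "set_integrable lborel {0..t} f"
proof -
 obtain C where C: "!!s. s \<in> {0..t} ==> \<bar>f s\<bar> <= C" using cadlag_bounded[OF f t] by blast
 have "set_borel_measurable lborel {0..t} f" using cadlag_set_measurable[OF f, of "%s. s" t] by simp
 from set_integral_bound(2)[OF this C t] show ?thesis .
qed

lemma cadlag_set_integrable_cell: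
 assumes f: "cadlag f" and ab: "0 <= a" "a <= b"
 shows "set_integrable lborel {a<..b} f"
proof -
 have "0 <= b" using ab by simp
 from cadlag_set_integrable[OF f this] show ?thesis by (rule set_integrable_subset) (use ab in auto)
qed

lemma cadlag_integral_cell:
 assumes f: "cadlag f" and ab: "0 <= a" "a <= b"
 shows "(LINT s:{0..b}|lborel. f s) - (LINT s:{0..a}|lborel. f s) = (LINT s:{a<..b}|lborel. f s)"
proof -
 have "{0..b} = {0..a} \<union> {a<..b}" using ab by auto
 moreover have "{0..a} \<inter> {a<..b} = {}" by auto
 note set_integral_Un[OF this cadlag_set_integrable[OF f ab(1)] cadlag_set_integrable_cell[OF f ab]]
 ultimately show ?thesis by simp
qed

text \<open>An upward closed condition holds on a final segment, over which the differences
  telescope.\<close>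

lemma telescope_up_closed:
 fixes m :: "nat => real"
 assumes up: "!!i j. i <= j ==> j < n ==> P i ==> P j"
 shows "\<exists>l\<le>n. (\<Sum>i<n. if P i then m (Suc i) - m i else 0) = m n - m l"
 using up
proof (induction n)
 case (Suc n)
 show ?case
 proof (cases "P n")
  case True
  obtain l where "l <= n" "(\<Sum>i<n. if P i then m (Suc i) - m i else 0) = m n - m l" using Suc.IH Suc.prems by (meson less_SucI)
  with True show ?thesis by (intro exI[of _ l]) simp
 next
  case False
  then have "\<not> P i" if "i < n" for i using Suc.prems[of i n] that by auto
  then have "(\<Sum>i<n. if P i then m (Suc i) - m i else 0) = 0" by simp
  with False show ?thesis by (intro exI[of _ "Suc n"]) simp
 qed
qed simp

text \<open>Abel summation: a step function with at most \<open>k\<close> steps, summed against the increments of a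
 bounded sequence.\<close>

lemma step_sum_bound:
 fixes m x :: "nat => real" and b :: "nat => nat"
 assumes b: "mono b" "!!i. i < n ==> b i < k" and m: "!!i. i <= n ==> \<bar>m i\<bar> <= C" and x: "!!i. i <= k ==> \<bar>x i\<bar> <= D"
 shows "\<bar>\<Sum>i<n. x (b i) * (m (Suc i) - m i)\<bar> <= (4 * real k + 2) * (D * C)"
proof -
 define P where "P l i = (l < b i)" for l i
 have C: "0 <= C" using m[of 0] by simp
 have D: "0 <= D" using x[of 0] by simp
 \<comment> \<open>The value at step \<open>b i\<close> is the first value plus all jumps below
   \<open>b i\<close>. After exchanging the sums, each of the \<open>k\<close> jumps, at most
   \<open>2 * D\<close>, meets a telescoped final segment, at most \<open>2 * C\<close>; the first
   value adds \<open>2 * D * C\<close>.\<close>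
 have xb: "x (b i) = x 0 + (\<Sum>l<k. (x (Suc l) - x l) * (if P l i then 1 else 0))" if "i < n" for i
 proof -
  have "(\<Sum>l<k. (x (Suc l) - x l) * (if P l i then 1 else 0)) = (\<Sum>l\<in>{..<k} \<inter> {l. l < b i}. x (Suc l) - x l)"
   unfolding P_def by (subst sum.inter_restrict) (auto intro!: sum.cong)
  also have "{..<k} \<inter> {l. l < b i} = {..<b i}" using b(2)[OF that] by auto
  also have "(\<Sum>l<b i. x (Suc l) - x l) = x (b i) - x 0" by (rule sum_lessThan_telescope)
  finally show ?thesis by simp
 qed
 define s where "s l = (\<Sum>i<n. if P l i then m (Suc i) - m i else 0)" for l
 have s: "\<bar>s l\<bar> <= 2 * C" for l
 proof -
  have "P l i ==> i <= j ==> P l j" for i j using monoD[OF b(1), of i j] unfolding P_def by simp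
  then obtain q where "q <= n" "s l = m n - m q" unfolding s_def using telescope_up_closed[of n "P l" m] by blast
  then show ?thesis using m[of n] m[of q] by simp
 qed
 have t: "\<bar>(x (Suc l) - x l) * s l\<bar> <= 2 * D * (2 * C)" if "l < k" for l
  using x[of "Suc l"] x[of l] that s[of l] C D unfolding abs_mult by (intro mult_mono) auto
 have t0: "\<bar>x 0 * (m n - m 0)\<bar> <= D * (2 * C)"
  using x[of 0] m[of n] m[of 0] C D unfolding abs_mult by (intro mult_mono) auto
 have "(\<Sum>i<n. x (b i) * (m (Suc i) - m i)) = (\<Sum>i<n. (x 0 + (\<Sum>l<k. (x (Suc l) - x l) * (if P l i then 1 else 0))) * (m (Suc i) - m i))"
  by (intro sum.cong refl) (simp only: xb lessThan_iff)
 also have "... = x 0 * (\<Sum>i<n. m (Suc i) - m i) + (\<Sum>i<n. \<Sum>l<k. (x (Suc l) - x l) * (if P l i then m (Suc i) - m i else 0))"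
 proof -
  have *: "(u * (if p then 1 else 0)) * v = u * (if p then v else 0)" for u v :: real and p by simp
  show ?thesis by (simp only: distrib_right sum.distrib sum_distrib_right sum_distrib_left *)
 qed
 also have "... = x 0 * (m n - m 0) + (\<Sum>l<k. (x (Suc l) - x l) * s l)"
 proof -
  have 1: "(\<Sum>i<n. m (Suc i) - m i) = m n - m 0" by (rule sum_lessThan_telescope)
  have 2: "(\<Sum>i<n. \<Sum>l<k. (x (Suc l) - x l) * (if P l i then m (Suc i) - m i else 0)) = (\<Sum>l<k. (x (Suc l) - x l) * s l)"
   unfolding s_def sum_distrib_left by (rule sum.swap)
  show ?thesis unfolding 1 2 ..
 qed
 finally have "\<bar>\<Sum>i<n. x (b i) * (m (Suc i) - m i)\<bar> <= \<bar>x 0 * (m n - m 0)\<bar> + (\<Sum>l<k. \<bar>(x (Suc l) - x l) * s l\<bar>)"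
  using abs_triangle_ineq[of "x 0 * (m n - m 0)" "\<Sum>l<k. (x (Suc l) - x l) * s l"] sum_abs[of "%l. (x (Suc l) - x l) * s l" "{..<k}"] by linarith
 also have "... <= D * (2 * C) + (\<Sum>l<k. 2 * D * (2 * C))" using t t0 by (intro add_mono sum_mono) auto
 also have "... = (4 * real k + 2) * (D * C)" by (simp add: algebra_simps)
 finally show ?thesis .
qed

text \<open>On coarse blocks the drift is nearly constant, and there the increments of \<open>x\<close> telescope.\<close>

lemma drift_cross_limit:
 fixes p x :: "real => real"
 assumes p: "cadlag p" and x: "continuous_on {0..} x" and T: "0 < T"
 shows "(%n. sqrt (n / T) * (\<Sum>i<n. inc T n x i * inc T n (%t. LINT s:{0..t}|lborel. p s) i) / (1 + (\<Sum>i<n. (inc T n x i)^2))) \<longlonglongrightarrow> 0"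
proof (rule tendstoI)
 fix eps :: real assume e: "0 < eps"
 obtain D where D: "0 <= D" "!!t. t \<in> {0..T} ==> \<bar>p t\<bar> <= D" using cadlag_bounded[OF p less_imp_le[OF T]] by blast
 have "continuous_on {0..T} x" by (rule continuous_on_subset[OF x]) auto
 then have "compact (x ` {0..T})" by (rule compact_continuous_image) simp
 from compact_imp_bounded[OF this] obtain C where "\<forall>y\<in>x ` {0..T}. norm y <= C" unfolding bounded_iff by (rule exE)
 then have C: "\<bar>x t\<bar> <= C" if "t \<in> {0..T}" for t using that by auto
 define A where "A n m = (LINT s:{0..T}|lborel. (p s - p (gfl T m (gfl T n s)))^2)" for n m
 have "\<exists>N>0. \<forall>n\<ge>N. \<forall>m\<ge>N. \<forall>r>0. \<bar>(%n m (r::nat). A n m) n m r\<bar> < eps^2 / 2"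
 proof (rule joint_limit)
  fix n m r :: "nat => nat" assume n: "filterlim n at_top sequentially" and m: "filterlim m at_top sequentially"
  show "(%k. A (n k) (m k)) \<longlonglongrightarrow> 0" unfolding A_def
   by (rule cadlag_step_integral[where \<phi>="%_ s. s", OF p T])
    (auto intro!: gfl_range'[OF T] gfl_limit[OF T m] gfl_limit[OF T n] simp del: atLeastAtMost_iff)
 qed (use e in simp)
 \<comment> \<open>The coarse grid depends on \<open>eps\<close> only; as its number of steps stays
   fixed, the telescoped part is of order \<open>1 / sqrt n\<close>.\<close>
 then obtain m where m: "0 < m" "!!n. m <= n ==> \<bar>A n m\<bar> < eps^2 / 2" by (metis order_refl zero_less_one)
 define c where "c = (4 * real m + 2) * (D * C)"
 have "(%n. c * sqrt (T / n)) \<longlonglongrightarrow> c * sqrt 0" by (intro tendsto_intros lim_const_over_n)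
 then have "(%n. c * sqrt (T / n)) \<longlonglongrightarrow> 0" by simp
 from order_tendstoD(2)[OF this, of "eps / 8"] e have c: "\<forall>\<^sub>F n in sequentially. c * sqrt (T / n) < eps / 8" by simp
 show "\<forall>\<^sub>F n in sequentially. dist (sqrt (n / T) * (\<Sum>i<n. inc T n x i * inc T n (%t. LINT s:{0..t}|lborel. p s) i) / (1 + (\<Sum>i<n. (inc T n x i)^2))) 0 < eps"
  using c eventually_ge_at_top[of m]
 proof eventually_elim
  case (elim n)
  have n: "0 < n" using m elim by simp
  define a where "a i = real i * (T / real n)" for i
  have a0: "0 <= a i" "a i <= a (Suc i)" for i using T by (auto simp: a_def algebra_simps divide_right_mono)
  have aT: "a i \<in> {0..T}" if "i <= n" for i using grid_le[OF T that] a0(1) by (simp add: a_def)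
  define g where "g i = gfl T m (a i)" for i
  have g: "g i = real (i * m div n) * (T / real m)" for i unfolding g_def a_def by (rule gfl_grid[OF T m(1) n])
  define q where "q i s = p s + - p (g i)" for i s
  have qc: "cadlag (q i)" for i unfolding q_def by (intro cadlag_add p cadlag_const)
  define \<rho> where "\<rho> i = (LINT s:{a i<..a (Suc i)}|lborel. q i s)" for i
  define ww where "ww = sqrt (n / T)"
  have ww: "0 <= ww" "ww^2 = n / T" using T by (auto simp: ww_def)
  define d where "d i = inc T n x i" for i
  have split: "inc T n (%t. LINT s:{0..t}|lborel. p s) i = p (g i) * (T / n) + \<rho> i" for i
  proof -
   have "inc T n (%t. LINT s:{0..t}|lborel. p s) i = (LINT s:{a i<..a (Suc i)}|lborel. p s)"
    unfolding inc_def a_def[symmetric] by (rule cadlag_integral_cell[OF p a0])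
   also have "... = (LINT s:{a i<..a (Suc i)}|lborel. p (g i) + q i s)" by (simp add: q_def)
   also have "... = (LINT s:{a i<..a (Suc i)}|lborel. p (g i)) + \<rho> i"
    unfolding \<rho>_def by (intro set_integral_add cadlag_set_integrable_cell[OF cadlag_const a0] cadlag_set_integrable_cell[OF qc a0])
   also have "(LINT s:{a i<..a (Suc i)}|lborel. p (g i)) = p (g i) * (T / n)"
   proof -
    have "a (Suc i) - a i = T / n" by (simp add: a_def algebra_simps diff_divide_distrib[symmetric])
    then show ?thesis using a0(2)[of i] by (simp add: set_lebesgue_integral_def)
   qed
   finally show ?thesis .
  qed
  \<comment> \<open>Young's inequality splits off a small multiple of the squared increment, which
    the denominator \<open>1 + Q\<close> of the claim absorbs; the rest is the energy of the
    freezing error.\<close>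
  have cell: "\<bar>ww * d i * \<rho> i\<bar> <= eps / 4 * (d i)^2 + (LINT s:{a i<..a (Suc i)}|lborel. (q i s)^2) / eps" for i
  proof -
   let ?c = "{a i<..a (Suc i)}"
   have q1: "set_integrable lborel ?c (q i)" "set_integrable lborel ?c (%s. (q i s)^2)"
    by (intro cadlag_set_integrable_cell a0 qc cadlag_power)+
   have am: "\<bar>u * v\<bar> <= eps / 4 * u^2 + v^2 / eps" for u v :: real
   proof -
    have "0 <= (eps / 2 * \<bar>u\<bar> - \<bar>v\<bar>)^2" by simp
    also have "(eps / 2 * \<bar>u\<bar> - \<bar>v\<bar>)^2 = eps * (eps / 4 * \<bar>u\<bar>\<^sup>2) + \<bar>v\<bar>\<^sup>2 - eps * (\<bar>u\<bar> * \<bar>v\<bar>)"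
     by (simp only: power2_eq_square) (simp add: algebra_simps del: abs_mult_self_eq)
    finally have "eps * \<bar>u * v\<bar> <= eps * (eps / 4 * u^2) + v^2" by (simp add: abs_mult)
    then show ?thesis using e by (simp add: field_simps)
   qed
   have "\<bar>ww * d i * \<rho> i\<bar> = \<bar>LINT s:?c|lborel. ww * d i * q i s\<bar>" by (simp add: \<rho>_def)
   also have "... <= (LINT s:?c|lborel. \<bar>ww * d i * q i s\<bar>)"
    using set_integral_norm_bound[OF set_integrable_mult_right, of "ww * d i" lborel ?c "q i"] q1(1) by (simp add: real_norm_def)
   also have "... <= (LINT s:?c|lborel. eps / 4 * (ww * d i)^2 + (q i s)^2 / eps)"
    using q1 cadlag_set_integrable_cell[OF cadlag_const a0] am
    by (intro set_integral_mono set_integral_add set_integrable_abs set_integrable_mult_right set_integrable_divide) auto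
   also have "... = (LINT s:?c|lborel. eps / 4 * (ww * d i)^2) + (LINT s:?c|lborel. (q i s)^2 / eps)"
    using q1 by (intro set_integral_add cadlag_set_integrable_cell[OF cadlag_const a0] set_integrable_divide)
   also have "(LINT s:?c|lborel. eps / 4 * (ww * d i)^2) = eps / 4 * (d i)^2"
   proof -
    have "a (Suc i) - a i = T / n" by (simp add: a_def algebra_simps diff_divide_distrib[symmetric])
    then show ?thesis using a0(2)[of i] T n by (simp add: set_lebesgue_integral_def power_mult_distrib ww(2))
   qed
   finally show ?thesis by simp
  qed
  have Aeq: "(\<Sum>i<n. LINT s:{a i<..a (Suc i)}|lborel. (q i s)^2) = A n m"
  proof -
   define h where "h s = (p s - p (gfl T m (gfl T n s)))^2" for s
   have hi: "set_integrable lborel {0..T} h"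
   proof -
    have bm: "set_borel_measurable lborel {0..T} p" "set_borel_measurable lborel {0..T} (%s. p (gfl T m (gfl T n s)))"
     using cadlag_set_measurable[OF p, of "%s. s" T] cadlag_set_measurable[OF p, of "%s. gfl T m (gfl T n s)" T] gfl_range'[OF T] by auto
    have "set_borel_measurable lborel {0..T} h"
    proof -
     have "(%s. (indicat_real {0..T} s *\<^sub>R p s - indicat_real {0..T} s *\<^sub>R p (gfl T m (gfl T n s)))^2) \<in> borel_measurable lborel"
      using bm unfolding set_borel_measurable_def by (intro borel_measurable_power borel_measurable_diff)
     moreover have "(%s. (indicat_real {0..T} s *\<^sub>R p s - indicat_real {0..T} s *\<^sub>R p (gfl T m (gfl T n s)))^2) = (%s. indicat_real {0..T} s *\<^sub>R h s)"
      by (auto simp: indicator_def h_def)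
     ultimately show ?thesis unfolding set_borel_measurable_def by simp
    qed
    moreover have "\<bar>h s\<bar> <= (2*D)^2" if "s \<in> {0..T}" for s
    proof -
     have "\<bar>p s - p (gfl T m (gfl T n s))\<bar> <= 2*D" using D(2)[OF that] D(2)[OF gfl_range'[OF T gfl_range'[OF T that]], of m n] by linarith
     from power_mono[OF this abs_ge_zero, of 2] show ?thesis by (simp add: h_def)
    qed
    ultimately show ?thesis using T by (intro set_integral_bound(2)) auto
   qed
   have hsub: "set_integrable lborel {a i<..a j} h" if "i <= n" "j <= n" for i j
    by (rule set_integrable_subset[OF hi]) (use aT[OF that(1)] aT[OF that(2)] in auto)
   have ce: "(LINT s:{a i<..a (Suc i)}|lborel. (q i s)^2) = (LINT s:{a i<..a (Suc i)}|lborel. h s)" if "i < n" for i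
    unfolding set_lebesgue_integral_def
   proof (rule integral_cong_AE)
    have "set_integrable lborel {a i<..a (Suc i)} (%s. (q i s)^2)" by (intro cadlag_set_integrable_cell a0 qc cadlag_power)
    then show "(%s. indicat_real {a i<..a (Suc i)} s *\<^sub>R (q i s)\<^sup>2) \<in> borel_measurable lborel" unfolding set_integrable_def by auto
    have "i <= n" "Suc i <= n" using that by auto
    from hsub[OF this] show "(%s. indicat_real {a i<..a (Suc i)} s *\<^sub>R h s) \<in> borel_measurable lborel" unfolding set_integrable_def by auto
    show "AE s in lborel. indicat_real {a i<..a (Suc i)} s *\<^sub>R (q i s)\<^sup>2 = indicat_real {a i<..a (Suc i)} s *\<^sub>R h s"
     using AE_lborel_singleton[of "a (Suc i)"]
    proof eventually_elim
     case (elim s)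
     show ?case
     proof (cases "s \<in> {a i<..a (Suc i)}")
      case True
      then have "gfl T n s = a i" using elim T n unfolding a_def by (intro gfl_cell) (auto simp: algebra_simps)
      then show ?thesis by (simp add: q_def h_def g_def)
     qed simp
    qed
   qed
   have cum: "j <= n ==> (\<Sum>i<j. LINT s:{a i<..a (Suc i)}|lborel. h s) = (LINT s:{a 0<..a j}|lborel. h s)" for j
   proof (induction j)
    case (Suc j)
    have mono: "a 0 <= a j" using T by (simp add: a_def)
    have "{a 0<..a (Suc j)} = {a 0<..a j} \<union> {a j<..a (Suc j)}" using mono a0(2)[of j] by auto
    moreover have "{a 0<..a j} \<inter> {a j<..a (Suc j)} = {}" by auto
    note set_integral_Un[OF this hsub[of 0 j] hsub[of j "Suc j"]]
    ultimately show ?case using Suc by simp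
   qed (simp add: set_lebesgue_integral_def)
   have "(LINT s:{a 0<..a n}|lborel. h s) = (LINT s:{0..T}|lborel. h s)"
    unfolding set_lebesgue_integral_def
   proof (rule integral_cong_AE)
    show "(%s. indicat_real {a 0<..a n} s *\<^sub>R h s) \<in> borel_measurable lborel" using hsub[of 0 n] unfolding set_integrable_def by auto
    show "(%s. indicat_real {0..T} s *\<^sub>R h s) \<in> borel_measurable lborel" using hi unfolding set_integrable_def by auto
    have "a 0 = 0" "a n = T" using n by (auto simp: a_def)
    then show "AE s in lborel. indicat_real {a 0<..a n} s *\<^sub>R h s = indicat_real {0..T} s *\<^sub>R h s"
     using AE_lborel_singleton[of 0] by (auto simp: indicator_def elim!: eventually_mono)
   qed
   then show ?thesis using cum[OF order_refl] ce by (simp add: A_def h_def)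
  qed
  have main: "\<bar>ww * (\<Sum>i<n. d i * (p (g i) * (T / n)))\<bar> <= c * sqrt (T / n)"
  proof -
   have b: "mono (%i. i * m div n)" by (intro monoI div_le_mono mult_le_mono1)
   have h1: "\<bar>x (a i)\<bar> <= C" if "i <= n" for i by (rule C[OF aT[OF that]])
   have h2: "\<bar>p (real k * (T / real m))\<bar> <= D" if "k <= m" for k
    by (rule D(2)) (use grid_le[OF T that] T in \<open>simp del: times_divide_eq_right\<close>)
   have bk: "i * m div n < m" if "i < n" for i using that m(1) by (simp add: less_mult_imp_div_less mult.commute)
   have "\<bar>\<Sum>i<n. p (real (i * m div n) * (T / real m)) * (x (a (Suc i)) - x (a i))\<bar> <= (4 * real m + 2) * (D * C)"
    by (rule step_sum_bound[where x="%k. p (real k * (T / real m))" and m="%i. x (a i)", OF b bk h1 h2])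
   then have "\<bar>\<Sum>i<n. p (g i) * d i\<bar> <= c" unfolding c_def g d_def inc_def a_def[symmetric] .
   then have "ww * (T / n) * \<bar>\<Sum>i<n. p (g i) * d i\<bar> <= ww * (T / n) * c" using ww T by (intro mult_left_mono) auto
   moreover have "ww * (T / n) = sqrt (T / n)"
   proof -
    have "sqrt (T / n) * sqrt (T / n) = T / n" using T by simp
    then have "ww * (T / n) = (ww * sqrt (T / n)) * sqrt (T / n)" by (simp only: mult.assoc)
    moreover have "ww * sqrt (T / n) = 1" using n T unfolding ww_def real_sqrt_mult[symmetric] by simp
    ultimately show ?thesis by (simp only: mult_1)
   qed
   moreover have "\<bar>ww * (\<Sum>i<n. d i * (p (g i) * (T / n)))\<bar> = ww * (T / n) * \<bar>\<Sum>i<n. p (g i) * d i\<bar>"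
   proof -
    have "ww * (\<Sum>i<n. d i * (p (g i) * (T / n))) = ww * (T / n) * (\<Sum>i<n. p (g i) * d i)"
     unfolding sum_distrib_left by (intro sum.cong refl) (simp only: mult_ac)
    then show ?thesis using ww T by (simp add: abs_mult)
   qed
   ultimately show ?thesis by (simp only: mult.commute[of c])
  qed
  define Q where "Q = (\<Sum>i<n. (d i)^2)"
  have Q: "0 <= Q" unfolding Q_def by (intro sum_nonneg) auto
  have "\<bar>ww * (\<Sum>i<n. d i * inc T n (%t. LINT s:{0..t}|lborel. p s) i)\<bar> <= \<bar>ww * (\<Sum>i<n. d i * (p (g i) * (T / n)))\<bar> + (\<Sum>i<n. \<bar>ww * d i * \<rho> i\<bar>)"
  proof -
   have "ww * (\<Sum>i<n. d i * inc T n (%t. LINT s:{0..t}|lborel. p s) i) = ww * (\<Sum>i<n. d i * (p (g i) * (T / n))) + (\<Sum>i<n. ww * d i * \<rho> i)"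
    unfolding split distrib_left sum.distrib sum_distrib_left by (simp only: mult.assoc)
   then show ?thesis using abs_triangle_ineq[of "ww * (\<Sum>i<n. d i * (p (g i) * (T / n)))" "\<Sum>i<n. ww * d i * \<rho> i"] sum_abs[of "%i. ww * d i * \<rho> i" "{..<n}"] by linarith
  qed
  also have "(\<Sum>i<n. \<bar>ww * d i * \<rho> i\<bar>) <= (\<Sum>i<n. eps / 4 * (d i)^2 + (LINT s:{a i<..a (Suc i)}|lborel. (q i s)^2) / eps)" by (intro sum_mono cell)
  also have "... = eps / 4 * Q + A n m / eps" unfolding sum.distrib sum_distrib_left[symmetric] sum_divide_distrib[symmetric] Aeq Q_def ..
  also have "A n m / eps <= eps / 2"
  proof -
   have "A n m <= eps^2 / 2" using m(2)[OF elim(2)] by linarith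
   then show ?thesis using e by (simp add: divide_le_eq power2_eq_square)
  qed
  finally have le: "\<bar>ww * (\<Sum>i<n. d i * inc T n (%t. LINT s:{0..t}|lborel. p s) i)\<bar> <= eps / 8 + eps / 4 * Q + eps / 2" using main elim(1) by linarith
  also have "... < eps * (1 + Q)"
  proof -
   have "0 <= eps * Q" using e Q by simp
   then show ?thesis using e unfolding distrib_left by linarith
  qed
  finally have "\<bar>ww * (\<Sum>i<n. d i * inc T n (%t. LINT s:{0..t}|lborel. p s) i)\<bar> / (1 + Q) < eps" using Q by (simp add: pos_divide_less_eq)
  then show ?case using Q unfolding ww_def d_def Q_def dist_real_def by (simp add: abs_mult)
 qed
qed

lemma drift_increment_bound:
 assumes p: "cadlag p" and b: "!!t. t \<in> {0..T} ==> \<bar>p t\<bar> <= D" and T: "0 < T" and i: "i < n"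
 shows "\<bar>inc T n (%t. LINT s:{0..t}|lborel. p s) i\<bar> <= D * (T / n)"
proof -
 define a where "a i = real i * (T / real n)" for i
 have a0: "0 <= a i" "a i <= a (Suc i)" for i using T by (auto simp: a_def algebra_simps divide_right_mono)
 have "a (Suc i) <= T" using grid_le[OF T, of "Suc i" n] i by (simp add: a_def)
 have pi: "set_integrable lborel {a i<..a (Suc i)} p" by (rule cadlag_set_integrable_cell[OF p a0])
 have "\<bar>inc T n (%t. LINT s:{0..t}|lborel. p s) i\<bar> = \<bar>LINT s:{a i<..a (Suc i)}|lborel. p s\<bar>"
  unfolding inc_def a_def[symmetric] by (simp only: cadlag_integral_cell[OF p a0])
 also have "... <= (LINT s:{a i<..a (Suc i)}|lborel. \<bar>p s\<bar>)" using set_integral_norm_bound[OF pi] by (simp add: real_norm_def)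
 also have "... <= (LINT s:{a i<..a (Suc i)}|lborel. D)"
  using pi b a0(1)[of i] \<open>a (Suc i) <= T\<close> by (intro set_integral_mono set_integrable_abs cadlag_set_integrable_cell[OF cadlag_const a0]) auto
 also have "... = D * (T / n)"
 proof -
  have "a (Suc i) - a i = T / n" by (simp add: a_def algebra_simps diff_divide_distrib[symmetric])
  then show ?thesis using a0(2)[of i] by (simp add: set_lebesgue_integral_def)
 qed
 finally show ?thesis .
qed

text \<open>Each product is of order \<open>(T / n)^2\<close>, so the sum is of order
  \<open>1 / n\<close>, which outweighs the factor \<open>sqrt n\<close>.\<close>

lemma drift_drift_limit:
 assumes p: "cadlag p" and q: "cadlag q" and T: "0 < T"
 shows "(%n. sqrt (n / T) * (\<Sum>i<n. inc T n (%t. LINT s:{0..t}|lborel. p s) i * inc T n (%t. LINT s:{0..t}|lborel. q s) i)) \<longlonglongrightarrow> 0"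
proof -
 obtain C where C: "0 <= C" "!!t. t \<in> {0..T} ==> \<bar>p t\<bar> <= C" using cadlag_bounded[OF p less_imp_le[OF T]] by blast
 obtain D where D: "0 <= D" "!!t. t \<in> {0..T} ==> \<bar>q t\<bar> <= D" using cadlag_bounded[OF q less_imp_le[OF T]] by blast
 have "(%n. C * D * T * sqrt (T / n)) \<longlonglongrightarrow> C * D * T * sqrt 0" by (intro tendsto_intros lim_const_over_n)
 then have lim: "(%n. C * D * T * sqrt (T / n)) \<longlonglongrightarrow> 0" by simp
 show ?thesis
 proof (rule Lim_null_comparison[OF always_eventually lim], rule allI)
  fix n :: nat
  let ?a = "%i. inc T n (%t. LINT s:{0..t}|lborel. p s) i" and ?b = "%i. inc T n (%t. LINT s:{0..t}|lborel. q s) i"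
  show "norm (sqrt (n / T) * (\<Sum>i<n. ?a i * ?b i)) <= C * D * T * sqrt (T / n)"
  proof (cases "n = 0")
   case False
   have "\<bar>\<Sum>i<n. ?a i * ?b i\<bar> <= (\<Sum>i<n. \<bar>?a i * ?b i\<bar>)" by (rule sum_abs)
   also have "... <= (\<Sum>i<n. (C * (T / n)) * (D * (T / n)))" unfolding abs_mult
    using drift_increment_bound[OF p C(2) T] drift_increment_bound[OF q D(2) T] C(1) T by (intro sum_mono mult_mono) auto
   also have "... = C * D * T * (T / n)" using False by (simp add: field_simps)
   finally have "sqrt (n / T) * \<bar>\<Sum>i<n. ?a i * ?b i\<bar> <= sqrt (n / T) * (C * D * T * (T / n))" using T by (intro mult_left_mono) auto
   also have "... = C * D * T * (sqrt (n / T) * (T / n))" by (simp only: mult_ac)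
   also have "sqrt (n / T) * (T / n) = sqrt (T / n)"
   proof -
    have "sqrt (T / n) * sqrt (T / n) = T / n" using T by simp
    then have "sqrt (n / T) * (T / n) = (sqrt (n / T) * sqrt (T / n)) * sqrt (T / n)" by (simp only: mult.assoc)
    moreover have "sqrt (n / T) * sqrt (T / n) = 1" using False T unfolding real_sqrt_mult[symmetric] by simp
    ultimately show ?thesis by (simp only: mult_1)
   qed
   finally show ?thesis using T by (simp add: abs_mult)
  qed simp
 qed
qed

lemma (in prob_space) stoch_bounded_mult:
 assumes X: "stoch_bounded M X" and Y: "stoch_bounded M Y"
 shows "stoch_bounded M (%n w. X n w * Y n w)"
 unfolding stoch_bounded_def
proof (intro conjI allI impI)
 show "(%w. X n w * Y n w) \<in> borel_measurable M" for n
  using stoch_bounded_measurable[OF X] stoch_bounded_measurable[OF Y] by (rule borel_measurable_times)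
 fix eps :: real assume "0 < eps"
 then have e: "0 < eps / 2" by simp
 obtain C where C: "0 < C" "\<forall>\<^sub>F n in sequentially. prob {w \<in> space M. C < \<bar>X n w\<bar>} <= eps / 2"
  using X e unfolding stoch_bounded_def by blast
 obtain D where D: "0 < D" "\<forall>\<^sub>F n in sequentially. prob {w \<in> space M. D < \<bar>Y n w\<bar>} <= eps / 2"
  using Y e unfolding stoch_bounded_def by blast
 show "\<exists>K>0. \<forall>\<^sub>F n in sequentially. prob {w \<in> space M. K < \<bar>X n w * Y n w\<bar>} <= eps"
 proof (intro exI[of _ "C * D"] conjI)
  show "0 < C * D" using C D by simp
  show "\<forall>\<^sub>F n in sequentially. prob {w \<in> space M. C * D < \<bar>X n w * Y n w\<bar>} <= eps"
   using C(2) D(2)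
  proof eventually_elim
   case (elim n)
   have "{w \<in> space M. C * D < \<bar>X n w * Y n w\<bar>} \<subseteq> {w \<in> space M. C < \<bar>X n w\<bar>} \<union> {w \<in> space M. D < \<bar>Y n w\<bar>}"
   proof (rule subsetI, rule ccontr)
    fix w assume *: "w \<in> {w \<in> space M. C * D < \<bar>X n w * Y n w\<bar>}" "w \<notin> {w \<in> space M. C < \<bar>X n w\<bar>} \<union> {w \<in> space M. D < \<bar>Y n w\<bar>}"
    then have "\<bar>X n w\<bar> * \<bar>Y n w\<bar> <= C * D" using C(1) by (intro mult_mono) auto
    then show False using * by (simp add: abs_mult)
   qed
   from prob_le_add[OF this event_abs_gt[OF stoch_bounded_measurable[OF X]] event_abs_gt[OF stoch_bounded_measurable[OF Y]]]
   show ?case using elim by linarith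
  qed
 qed
qed

text \<open>However large \<open>X n\<close> may be, being nonzero confines it to an event of
  vanishing probability. Default values of the estimators are discarded in this way.\<close>

lemma (in prob_space) vanishing_support:
 assumes Y: "vanishing M Y" and c: "0 < c" and X: "!!n. X n \<in> borel_measurable M"
  and supp: "\<forall>\<^sub>F n in sequentially. AE w in M. X n w ~= 0 --> c < \<bar>Y n w\<bar>"
 shows "vanishing M X"
proof (rule vanishingI[OF X])
 fix eps \<delta> :: real assume e: "0 < eps" "0 < \<delta>"
 show "\<forall>\<^sub>F n in sequentially. prob {w \<in> space M. eps < \<bar>X n w\<bar>} <= \<delta>"
  using vanishingD[OF Y c e(2)] supp
 proof eventually_elim
  case (elim n)
  have "prob {w \<in> space M. eps < \<bar>X n w\<bar>} <= prob {w \<in> space M. c < \<bar>Y n w\<bar>}"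
  proof (rule finite_measure_mono_AE)
   show "AE w in M. w \<in> {w \<in> space M. eps < \<bar>X n w\<bar>} --> w \<in> {w \<in> space M. c < \<bar>Y n w\<bar>}"
    using elim(2) by eventually_elim (use e in auto)
  qed (rule event_abs_gt[OF vanishing_measurable[OF Y]])
  then show ?case using elim(1) by linarith
 qed
qed

lemma (in prob_space) vanishing_cmult: "vanishing M X ==> vanishing M (%n w. c * X n w)"
 using vanishing_mult[of X "%_ _. c"] stoch_bounded_const[of "%_. c"] by (simp add: mult.commute)

lemma (in prob_space) vanishing_null_seq:
 assumes r: "r \<longlonglongrightarrow> 0" and X: "stoch_bounded M X"
 shows "vanishing M (%n w. r n * X n w)"
proof -
 have "vanishing M (%n _. r n)" using r by (intro vanishing_AE) auto
 from vanishing_mult[OF this X] show ?thesis .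
qed

text \<open>The delta method for a ratio whose denominator may vanish and an estimator that agrees
  with \<open>g\<close> only near \<open>y0\<close>. Outside an event of small probability
  \<open>D n\<close> is near \<open>Q\<close>, so that \<open>R n * (\<Psi> n - y0)\<close> equals
  \<open>G n\<close>, which is bounded in probability; the exceptions are removed by
  \<open>vanishing_support\<close>.\<close>

lemma (in prob_space) ratio_delta_method:
 fixes R :: "nat => real"
 assumes S: "stoch_bounded M S" and v: "vanishing M v" and D: "vanishing M (%n w. D n w - Q w)"
  and Q: "Q \<in> borel_measurable M" "!!w. 0 < Q w"
  and R: "filterlim R at_top sequentially"
  and \<Psi>: "!!n. \<Psi> n \<in> borel_measurable M"
  and eq: "!!n. AE w in M. D n w ~= 0 --> R n * (\<Psi> n w - y0) * D n w = S n w + v n w"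
  and g: "(g has_real_derivative g') (at y0)" "g \<in> borel_measurable borel" and r: "0 < r"
  and est: "!!n. est n \<in> borel_measurable M" "!!n w. \<bar>\<Psi> n w - y0\<bar> <= r ==> est n w = g (\<Psi> n w)"
 shows "vanishing M (%n w. R n * (est n w - g y0) - g' * (S n w * inverse (Q w)))"
proof -
 have Qi: "stoch_bounded M (%_ w. inverse (Q w))" using Q(1) by (intro stoch_bounded_const borel_measurable_inverse)
 define \<delta> where "\<delta> n w = (D n w - Q w) * inverse (Q w)" for n w
 have \<delta>: "vanishing M \<delta>" unfolding \<delta>_def[abs_def] by (rule vanishing_mult[OF D Qi])
 define f where "f x = inverse (1 + x) - 1" for x :: real
 have f\<delta>: "vanishing M (%n w. f (\<delta> n w))"
 proof (rule vanishing_isCont[OF \<delta>])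
  show "isCont f 0" unfolding f_def by (intro continuous_intros) auto
  show "f \<in> borel_measurable borel" unfolding f_def[abs_def] by measurable
 qed (simp add: f_def)
 define P where "P n w = (S n w + v n w) * inverse (Q w)" for n w
 have P: "stoch_bounded M P" unfolding P_def[abs_def]
  by (intro stoch_bounded_mult stoch_bounded_add S vanishing_imp_stoch_bounded[OF v] Qi)
 define G where "G n w = P n w * (1 + f (\<delta> n w))" for n w
 have G: "stoch_bounded M G" unfolding G_def[abs_def]
  by (intro stoch_bounded_mult P stoch_bounded_add stoch_bounded_const borel_measurable_const vanishing_imp_stoch_bounded[OF f\<delta>])
 define u where "u n w = inverse (R n) * G n w" for n w
 have u: "vanishing M u" unfolding u_def[abs_def]
  by (intro vanishing_null_seq G filterlim_compose[OF tendsto_inverse_0_at_top filterlim_ident] tendsto_inverse_0_at_top R)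
 \<comment> \<open>The error of the difference quotient, continued by 0; its continuity at 0 is the
   differentiability of \<open>g\<close>.\<close>
 define h where "h x = (if x = 0 then 0 else (g (y0 + x) - g y0) / x - g')" for x
 have hu: "vanishing M (%n w. h (u n w))"
 proof (rule vanishing_isCont[OF u])
  have "((%x. (g (y0 + x) - g y0) / x) \<longlongrightarrow> g') (at 0)" by (rule DERIV_D[OF g(1)])
  then have "((%x. (g (y0 + x) - g y0) / x - g') \<longlongrightarrow> 0) (at 0)" by (rule LIM_zero)
  then have "(h \<longlongrightarrow> 0) (at 0)" by (rule Lim_transform_eventually) (simp add: h_def eventually_at_filter)
  then show "isCont h 0" unfolding isCont_def by (simp add: h_def)
  note g(2)[measurable]
  show "h \<in> borel_measurable borel" unfolding h_def[abs_def] by measurable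
 qed (simp add: h_def)
 have meas: "f \<in> borel_measurable borel" unfolding f_def[abs_def] by measurable
 \<comment> \<open>A nonzero \<open>Y1\<close> forces \<open>\<bar>\<delta>\<bar>\<close> above 1/2,
   where the denominator might vanish, or \<open>\<bar>u\<bar>\<close> above \<open>r\<close>, where
   nothing is known of \<open>est\<close>.\<close>
 define Y1 where "Y1 n w = R n * (est n w - g y0) - G n w * (g' + h (u n w))" for n w
 have Y1: "vanishing M Y1"
 proof (rule vanishing_support[of "%n w. \<bar>\<delta> n w\<bar> + \<bar>u n w\<bar>" "min (1/2) r"])
  have "vanishing M (%n w. \<bar>\<delta> n w\<bar>)" "vanishing M (%n w. \<bar>u n w\<bar>)"
   by (intro vanishing_isCont[OF \<delta>] vanishing_isCont[OF u] continuous_intros; simp)+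
  then show "vanishing M (%n w. \<bar>\<delta> n w\<bar> + \<bar>u n w\<bar>)" by (rule vanishing_add)
  show "0 < min (1/2) r" using r by simp
  show "Y1 n \<in> borel_measurable M" for n unfolding Y1_def[abs_def]
   by (intro borel_measurable_diff borel_measurable_times borel_measurable_add borel_measurable_const est(1) stoch_bounded_measurable[OF G] vanishing_measurable[OF hu])
  have "\<forall>\<^sub>F n in sequentially. 0 < R n" using R by (simp add: filterlim_at_top_dense)
  then show "\<forall>\<^sub>F n in sequentially. AE w in M. Y1 n w ~= 0 --> min (1/2) r < \<bar>\<bar>\<delta> n w\<bar> + \<bar>u n w\<bar>\<bar>"
  proof eventually_elim
   case (elim n)
   show ?case using eq[of n]
   proof eventually_elim
    case eq: (elim w)
    show ?case
    proof (rule impI, rule ccontr)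
     assume nz: "Y1 n w ~= 0" and "\<not> min (1/2) r < \<bar>\<bar>\<delta> n w\<bar> + \<bar>u n w\<bar>\<bar>"
     then have b: "\<bar>\<delta> n w\<bar> <= 1/2" "\<bar>u n w\<bar> <= r" by auto
     have d1: "1 + \<delta> n w ~= 0" using b(1) by linarith
     have Dq: "D n w = Q w * (1 + \<delta> n w)" using Q(2)[of w] by (simp add: \<delta>_def field_simps)
     then have D0: "D n w ~= 0" using Q(2)[of w] d1 by simp
     have "R n * (\<Psi> n w - y0) * D n w = S n w + v n w" using eq D0 by blast
     then have "R n * (\<Psi> n w - y0) = (S n w + v n w) * inverse (D n w)" using D0 by (simp add: field_simps)
     also have "... = G n w" unfolding Dq G_def P_def f_def by (simp add: mult.assoc)
     finally have RG: "R n * (\<Psi> n w - y0) = G n w" .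
     then have \<Psi>u: "\<Psi> n w - y0 = u n w" using elim unfolding u_def by (simp add: field_simps)
     then have "est n w = g (y0 + u n w)" using est(2)[of n w] b(2) by (simp add: algebra_simps)
     then have "est n w - g y0 = u n w * (g' + h (u n w))" by (simp add: h_def)
     then have "R n * (est n w - g y0) = G n w * (g' + h (u n w))" using RG \<Psi>u by (simp only: mult.assoc[symmetric])
     then show False using nz by (simp add: Y1_def)
    qed
   qed
  qed
 qed
 have "vanishing M (%n w. g' * (v n w * inverse (Q w)) + (g' * (f (\<delta> n w) * P n w) + h (u n w) * G n w))"
  by (intro vanishing_add vanishing_cmult vanishing_mult[OF v Qi] vanishing_mult[OF f\<delta> P] vanishing_mult[OF hu G])
 from vanishing_add[OF Y1 this] show ?thesis
  by (rule back_subst[of "vanishing M"]) (auto simp: Y1_def G_def P_def fun_eq_iff algebra_simps)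
qed

lemma (in bm_pair) drift_measurable:
 assumes p: "cadlag_adapted M F p" and t: "0 <= t"
 shows "(%w. LINT s:{0..t}|lborel. p s w) \<in> borel_measurable M"
proof -
 have pc: "!!w. w \<in> space M ==> cadlag (%t. p t w)" and pm: "p s \<in> borel_measurable M" if "0 <= s" for s
  using p that measurable_from_subalg[OF filtered_prob_spaceD(2)[OF fsp]] by (auto simp: cadlag_adapted_def adapted_process_def)
 show ?thesis
 proof (cases "t = 0")
  case True
  have "(LINT s:{0..t}|lborel. p s w) = 0" if "w \<in> space M" for w
   using set_integral_at_point[of lborel 0 "%s. p s w"] cadlag_set_integrable[OF pc[OF order_refl that], of 0] True by simp
  then show ?thesis by (subst measurable_cong[of _ _ "%_. 0"]) auto
 next
  case False
  with t show ?thesis by (intro cadlag_adapted_integral_measurable[OF fsp pc[OF order_refl] _ refl pm]) auto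
 qed
qed

context ito_pair
begin

abbreviation "\<iota> n i w \<equiv> inc T n (%t. I t w) i"
abbreviation "\<iota>' n i w \<equiv> inc T n (%t. I' t w) i"
abbreviation "dr p n i w \<equiv> inc T n (%t. LINT s:{0..t}|lborel. p s w) i"
abbreviation "QH w \<equiv> LINT t:{0..T}|lborel. (H t w)^2"

lemma dr_measurable: "cadlag_adapted M F p ==> (%w. dr p n i w) \<in> borel_measurable M"
 unfolding inc_def using T by (intro borel_measurable_diff drift_measurable) auto

lemma QH_measurable: "QH \<in> borel_measurable M"
 using H_cadlag(1) H_measurable(3) by (intro cadlag_adapted_integral_measurable[OF fsp _ T]) auto

lemma quadratic_variation_bounded: "stoch_bounded M (%n w. \<Sum>i<n. (\<iota> n i w)^2)"
proof -
 have "stoch_bounded M (%n w. ((\<Sum>i<n. (\<iota> n i w)^2) - QH w) + QH w)"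
  by (intro stoch_bounded_add vanishing_imp_stoch_bounded quadratic_variation_H stoch_bounded_const QH_measurable)
 then show ?thesis by simp
qed

text \<open>The limit along paths carries the denominator \<open>1 + Q\<close>; it can be multiplied
  back because the quadratic variation is bounded in probability.\<close>

lemma cross_drift_vanishing:
 assumes p: "cadlag_adapted M F p" and c: "AE w in M. continuous_on {0..} (%t. I t w)"
 shows "vanishing M (%n w. sqrt (n / T) * (\<Sum>i<n. \<iota> n i w * dr p n i w))"
proof -
 let ?Q = "%n w. \<Sum>i<n. (\<iota> n i w)^2"
 have Q0: "0 <= ?Q n w" for n w by (intro sum_nonneg) auto
 have "vanishing M (%n w. sqrt (n / T) * (\<Sum>i<n. \<iota> n i w * dr p n i w) / (1 + ?Q n w))"
 proof (rule vanishing_AE)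
  show "(%w. sqrt (n / T) * (\<Sum>i<n. \<iota> n i w * dr p n i w) / (1 + ?Q n w)) \<in> borel_measurable M" for n
   by (intro borel_measurable_divide borel_measurable_times borel_measurable_sum borel_measurable_add borel_measurable_power borel_measurable_const inc_I_measurable dr_measurable p)
  show "AE w in M. (%n. sqrt (n / T) * (\<Sum>i<n. \<iota> n i w * dr p n i w) / (1 + ?Q n w)) \<longlonglongrightarrow> 0"
   using c AE_space
  proof eventually_elim
   case (elim w)
   have "cadlag (%t. p t w)" using p elim(2) by (auto simp: cadlag_adapted_def)
   from drift_cross_limit[OF this elim(1) T] show ?case .
  qed
 qed
 from vanishing_mult[OF this, of "%n w. 1 + ?Q n w"]
 have "vanishing M (%n w. sqrt (n / T) * (\<Sum>i<n. \<iota> n i w * dr p n i w) / (1 + ?Q n w) * (1 + ?Q n w))"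
  using quadratic_variation_bounded by (simp add: stoch_bounded_add stoch_bounded_const)
 moreover have "1 + ?Q n w ~= 0" for n w using Q0[of n w] by linarith
 ultimately show ?thesis by simp
qed

lemma drift_drift_vanishing:
 assumes p: "cadlag_adapted M F p" and q: "cadlag_adapted M F q"
 shows "vanishing M (%n w. sqrt (n / T) * (\<Sum>i<n. dr p n i w * dr q n i w))"
proof (rule vanishing_AE)
 show "(%w. sqrt (n / T) * (\<Sum>i<n. dr p n i w * dr q n i w)) \<in> borel_measurable M" for n
  by (intro borel_measurable_times borel_measurable_sum borel_measurable_const dr_measurable p q)
 show "AE w in M. (%n. sqrt (n / T) * (\<Sum>i<n. dr p n i w * dr q n i w)) \<longlonglongrightarrow> 0"
  using p q T by (intro AE_I2 drift_drift_limit) (auto simp: cadlag_adapted_def)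
qed

text \<open>With \<open>x\<close> for the difference and \<open>y\<close> for the sum of two
  components, the integral against \<open>B'\<close> drops out of \<open>x\<close> and enters
  \<open>y\<close> twice. In \<open>e * x^2 - a * x * y\<close> the squares of
  \<open>\<iota>\<close> cancel and \<open>- 2 * a^2 * \<iota> * \<iota>'\<close> remains, up to
  products with drift increments.\<close>

lemma expansion:
 assumes c: "AE w in M. continuous_on {0..} (%t. I t w)" and c': "AE w in M. continuous_on {0..} (%t. I' t w)"
  and p: "cadlag_adapted M F p" and q: "cadlag_adapted M F q"
  and x: "!!n i. x n i \<in> borel_measurable M" "!!n i. AE w in M. x n i w = a * \<iota> n i w + dr p n i w"
  and y: "!!n i. y n i \<in> borel_measurable M" "!!n i. AE w in M. y n i w = e * \<iota> n i w + 2 * \<iota>' n i w + dr q n i w"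
 shows "vanishing M (%n w. (\<Sum>i<n. x n i w * y n i w) - a * e * QH w)"
  and "vanishing M (%n w. sqrt (n / T) * (e * (\<Sum>i<n. (x n i w)^2) - a * (\<Sum>i<n. x n i w * y n i w)) + 2 * a^2 * S n w)"
proof -
 interpret sw: ito_pair M F B' B T H' H I' I by (rule swap)
 define s2 where "s2 n w = sqrt (n / T) * (\<Sum>i<n. \<iota> n i w * dr q n i w)" for n w
 define s3 where "s3 n w = sqrt (n / T) * (\<Sum>i<n. \<iota> n i w * dr p n i w)" for n w
 define s4 where "s4 n w = sqrt (n / T) * (\<Sum>i<n. \<iota>' n i w * dr p n i w)" for n w
 define s5 where "s5 n w = sqrt (n / T) * (\<Sum>i<n. dr p n i w * dr q n i w)" for n w
 define s6 where "s6 n w = sqrt (n / T) * (\<Sum>i<n. dr p n i w * dr p n i w)" for n w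
 have s: "vanishing M s2" "vanishing M s3" "vanishing M s4" "vanishing M s5" "vanishing M s6"
  unfolding s2_def[abs_def] s3_def[abs_def] s4_def[abs_def] s5_def[abs_def] s6_def[abs_def]
  by (intro cross_drift_vanishing sw.cross_drift_vanishing drift_drift_vanishing p q c c')+
 have AE: "AE w in M. \<forall>n i. x n i w = a * \<iota> n i w + dr p n i w \<and> y n i w = e * \<iota> n i w + 2 * \<iota>' n i w + dr q n i w"
  using x(2) y(2) by (simp add: AE_all_countable)
 have xy: "(%w. \<Sum>i<n. x n i w * y n i w) \<in> borel_measurable M" "(%w. \<Sum>i<n. (x n i w)^2) \<in> borel_measurable M" for n
  by (intro borel_measurable_sum borel_measurable_times borel_measurable_power x y)+
 show "vanishing M (%n w. sqrt (n / T) * (e * (\<Sum>i<n. (x n i w)^2) - a * (\<Sum>i<n. x n i w * y n i w)) + 2 * a^2 * S n w)"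
 proof (rule vanishing_mono)
  show "vanishing M (%n w. (a * e) * s3 n w + ((- a\<^sup>2) * s2 n w + (e * s6 n w + ((- 2 * a) * s4 n w + (- a) * s5 n w))))"
   by (intro vanishing_add vanishing_cmult s)
  show "(%w. sqrt (n / T) * (e * (\<Sum>i<n. (x n i w)^2) - a * (\<Sum>i<n. x n i w * y n i w)) + 2 * a^2 * S n w) \<in> borel_measurable M" for n
   by (intro borel_measurable_add borel_measurable_diff borel_measurable_times borel_measurable_const xy S_measurable)
  show "\<forall>\<^sub>F n in sequentially. AE w in M. \<bar>sqrt (n / T) * (e * (\<Sum>i<n. (x n i w)^2) - a * (\<Sum>i<n. x n i w * y n i w)) + 2 * a^2 * S n w\<bar> \<le>
   \<bar>(a * e) * s3 n w + ((- a\<^sup>2) * s2 n w + (e * s6 n w + ((- 2 * a) * s4 n w + (- a) * s5 n w)))\<bar>"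
  proof (rule always_eventually, rule allI)
   fix n
   show "AE w in M. \<bar>sqrt (n / T) * (e * (\<Sum>i<n. (x n i w)^2) - a * (\<Sum>i<n. x n i w * y n i w)) + 2 * a^2 * S n w\<bar> \<le>
    \<bar>(a * e) * s3 n w + ((- a\<^sup>2) * s2 n w + (e * s6 n w + ((- 2 * a) * s4 n w + (- a) * s5 n w)))\<bar>"
    using AE
   proof eventually_elim
    case (elim w)
    have "e * (\<Sum>i<n. (x n i w)^2) - a * (\<Sum>i<n. x n i w * y n i w) + 2 * a^2 * (\<Sum>i<n. \<iota> n i w * \<iota>' n i w) =
     (a * e) * (\<Sum>i<n. \<iota> n i w * dr p n i w) + (- a\<^sup>2) * (\<Sum>i<n. \<iota> n i w * dr q n i w) + e * (\<Sum>i<n. dr p n i w * dr p n i w) +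
     (- 2 * a) * (\<Sum>i<n. \<iota>' n i w * dr p n i w) + (- a) * (\<Sum>i<n. dr p n i w * dr q n i w)"
     unfolding sum_distrib_left sum_subtractf[symmetric] sum.distrib[symmetric]
     by (intro sum.cong refl) (simp add: elim, simp add: power2_eq_square algebra_simps)
    then have "sqrt (n / T) * (e * (\<Sum>i<n. (x n i w)^2) - a * (\<Sum>i<n. x n i w * y n i w) + 2 * a^2 * (\<Sum>i<n. \<iota> n i w * \<iota>' n i w)) =
     sqrt (n / T) * ((a * e) * (\<Sum>i<n. \<iota> n i w * dr p n i w) + (- a\<^sup>2) * (\<Sum>i<n. \<iota> n i w * dr q n i w) + e * (\<Sum>i<n. dr p n i w * dr p n i w) +
     (- 2 * a) * (\<Sum>i<n. \<iota>' n i w * dr p n i w) + (- a) * (\<Sum>i<n. dr p n i w * dr q n i w))" by (rule arg_cong)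
    then show ?case unfolding S_def s2_def s3_def s4_def s5_def s6_def distrib_left
     by (intro eq_refl arg_cong[where f=abs]) (simp only: mult_ac add_ac)
   qed
  qed
 qed
 \<comment> \<open>Without the normalisation, every term except the quadratic variation carries this
   extra factor.\<close>
 have \<rho>: "(%n. sqrt (T / n)) \<longlonglongrightarrow> 0"
  using tendsto_real_sqrt[OF lim_const_over_n[of T]] by simp
 show "vanishing M (%n w. (\<Sum>i<n. x n i w * y n i w) - a * e * QH w)"
 proof (rule vanishing_mono)
  let ?Z = "%n w. (a * e) * ((\<Sum>i<n. (\<iota> n i w)^2) - QH w) + sqrt (T / n) * ((2 * a) * S n w + (a * s2 n w + (e * s3 n w + (2 * s4 n w + s5 n w))))"
  show "vanishing M ?Z"
   by (intro vanishing_add vanishing_cmult quadratic_variation_H vanishing_null_seq \<rho> stoch_bounded_add stoch_bounded_mult stoch_bounded_const borel_measurable_const stoch_bounded_S vanishing_imp_stoch_bounded s)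
  show "(%w. (\<Sum>i<n. x n i w * y n i w) - a * e * QH w) \<in> borel_measurable M" for n
   by (intro borel_measurable_diff borel_measurable_times borel_measurable_const xy QH_measurable)
  show "\<forall>\<^sub>F n in sequentially. AE w in M. \<bar>(\<Sum>i<n. x n i w * y n i w) - a * e * QH w\<bar> <= \<bar>?Z n w\<bar>"
   using eventually_gt_at_top[of 0]
  proof eventually_elim
   case n: (elim n)
   show ?case using AE
   proof eventually_elim
    case (elim w)
    have 1: "sqrt (T / n) * sqrt (n / T) = 1" using n T by (simp flip: real_sqrt_mult)
    have "(\<Sum>i<n. x n i w * y n i w) - a * e * (\<Sum>i<n. (\<iota> n i w)^2) = (2 * a) * (\<Sum>i<n. \<iota> n i w * \<iota>' n i w) +
     (a * (\<Sum>i<n. \<iota> n i w * dr q n i w) + (e * (\<Sum>i<n. \<iota> n i w * dr p n i w) + (2 * (\<Sum>i<n. \<iota>' n i w * dr p n i w) + (\<Sum>i<n. dr p n i w * dr q n i w))))"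
     unfolding sum_distrib_left sum_subtractf[symmetric] sum.distrib[symmetric]
     by (intro sum.cong refl) (simp add: elim, simp add: power2_eq_square algebra_simps)
    also have "... = (sqrt (T / n) * sqrt (n / T)) * ..." unfolding 1 by simp
    also have "... = sqrt (T / n) * ((2 * a) * S n w + (a * s2 n w + (e * s3 n w + (2 * s4 n w + s5 n w))))"
     unfolding S_def s2_def s3_def s4_def s5_def distrib_left by (simp only: mult_ac)
    finally show ?case by (intro eq_refl arg_cong[where f=abs]) (simp add: right_diff_distrib)
   qed
  qed
 qed
qed

text \<open>The argument \<open>t\<close> is absorbed into the bounded factor, so one mixed limit
  theorem gives all values of the characteristic function.\<close>

lemma limit_expectations:
 assumes W: "W \<in> borel_measurable M" and ww: "!!w. w \<in> space M ==> \<bar>W w\<bar> <= ww"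
  and Y: "!!n. Y n \<in> borel_measurable M" and v: "vanishing M (%n w. Y n w - W w * S n w)"
 shows "(%n. expectation (%w. cos (t * Y n w))) \<longlonglongrightarrow> expectation (%w. exp (- (t^2 * ((W w)^2 * V w) / 2)))"
  and "(%n. expectation (%w. sin (t * Y n w))) \<longlonglongrightarrow> 0"
proof -
 have w0: "0 <= ww" using not_empty ww by fastforce
 have W': "(%w. t * W w) \<in> borel_measurable M" using W by (intro borel_measurable_times borel_measurable_const)
 have b: "\<bar>t * W w\<bar> <= \<bar>t\<bar> * ww" if "w \<in> space M" for w using ww[OF that] unfolding abs_mult by (intro mult_left_mono) auto
 have m: "(%w. t * Y n w) \<in> borel_measurable M" "(%w. t * W w * S n w) \<in> borel_measurable M" for n
  by (intro borel_measurable_times borel_measurable_const Y W S_measurable)+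
 have v': "vanishing M (%n w. t * Y n w - t * W w * S n w)"
  using vanishing_cmult[OF v, of t] by (simp add: right_diff_distrib mult.assoc)
 have tw: "0 <= \<bar>t\<bar> * ww" using w0 by simp
 note lim = mixed_central_limit[OF W' b tw]
 have "(%n. expectation (%w. cos (t * Y n w)) - expectation (%w. cos (t * W w * S n w))) \<longlonglongrightarrow> 0"
  "(%n. expectation (%w. sin (t * Y n w)) - expectation (%w. sin (t * W w * S n w))) \<longlonglongrightarrow> 0"
  by (rule vanishing_expectation[OF cos_lipschitz _ _ m v'] vanishing_expectation[OF sin_lipschitz _ _ m v']; simp)+
 from tendsto_add[OF this(1) lim(1)] tendsto_add[OF this(2) lim(2)]
 show "(%n. expectation (%w. cos (t * Y n w))) \<longlonglongrightarrow> expectation (%w. exp (- (t^2 * ((W w)^2 * V w) / 2)))"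
  "(%n. expectation (%w. sin (t * Y n w))) \<longlonglongrightarrow> 0"
  by (simp_all add: power_mult_distrib mult.assoc)
qed

end

section \<open>The mixed Gaussian limit\<close>

text \<open>The extension is the product with an independent standard normal variable, scaled by the
  root of the variance. Sets of the lifted \<sigma>-algebra are cylinders, so the conditional law
  and the characteristic function both follow by integrating over the second factor first.\<close>

lemma gaussian_extension:
 fixes M :: "'a measure" and v :: "'a => real"
 assumes M: "prob_space M" and sub: "subalgebra M G" and v: "v \<in> borel_measurable G" and v0: "!!w. 0 <= v w"
 defines "N \<equiv> M \<Otimes>\<^sub>M std_normal_distribution" and "Z \<equiv> %x. sqrt (v (fst x)) * snd x"
 shows "prob_extension M N fst" "conditionally_gaussian N fst G v Z"
  "char (distr N borel Z) t = complex_of_real (integral\<^sup>L M (%w. exp (- (t^2 * v w / 2))))"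
proof -
 let ?K = "std_normal_distribution"
 interpret M: prob_space M by (rule M)
 interpret K: prob_space ?K by (rule prob_space_normal_density) simp
 interpret P: pair_prob_space M ?K ..
 have N: "prob_space N" unfolding N_def by (rule P.prob_space_axioms)
 interpret N: prob_space N by (rule N)
 have fstN: "fst \<in> measurable N M" unfolding N_def by (rule measurable_fst)
 show "prob_extension M N fst" unfolding prob_extension_def
  using N fstN K.distr_pair_fst[of M] by (simp add: N_def)
 have vM: "v \<in> borel_measurable M" by (rule measurable_from_subalg[OF sub v])
 have sK: "sets ?K = sets borel" by simp
 have snd: "snd \<in> borel_measurable (L \<Otimes>\<^sub>M ?K)" for L :: "'a measure"
  using measurable_snd[of L ?K] by (simp only: measurable_cong_sets[OF refl sK])
 have Zm': "Z \<in> borel_measurable (L \<Otimes>\<^sub>M ?K)" if "v \<in> borel_measurable L" for L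
  unfolding Z_def by (intro borel_measurable_times snd measurable_compose[OF measurable_compose[OF measurable_fst that] borel_measurable_sqrt])
 have Zm: "Z \<in> borel_measurable N" unfolding N_def by (rule Zm'[OF vM])
 have spG: "space G = space M" using sub by (simp add: subalgebra_def)
 have fstG: "fst \<in> space N \<rightarrow> space G"
 proof (rule funcsetI)
  fix x assume "x \<in> space N"
  from measurable_space[OF fstN this] show "fst x \<in> space G" unfolding spG .
 qed
 let ?F = "vimage_algebra (space N) fst G"
 have subF: "subalgebra N ?F"
  unfolding subalgebra_def sets_vimage_algebra2[OF fstG]
 proof (intro conjI subsetI)
  fix A assume "A \<in> {fst -` B \<inter> space N |B. B \<in> sets G}"
  then obtain B where "A = fst -` B \<inter> space N" "B \<in> sets M" using sub by (auto simp: subalgebra_def)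
  then show "A \<in> sets N" using measurable_sets[OF fstN] by blast
 qed simp
 interpret S: finite_measure_subalgebra N ?F by unfold_locales (rule subF)
 show "conditionally_gaussian N fst G v Z" unfolding conditionally_gaussian_def
 proof (intro conjI ballI Zm)
  fix C :: "real set" assume C: "C \<in> sets borel"
  define h where "h w = measure (centred_gaussian (v w)) C" for w
  have h: "h w = (LINT x|?K. indicator C (Z (w, x)))" for w
  proof -
   have m: "(%x. sqrt (v w) * x) \<in> measurable ?K borel" by simp
   have "h w = measure ?K ((%x. sqrt (v w) * x) -` C \<inter> space ?K)"
    unfolding h_def centred_gaussian_def by (rule measure_distr[OF m C])
   also have "... = (LINT x|?K. indicator ((%x. sqrt (v w) * x) -` C) x)" by simp
   finally show ?thesis by (simp add: Z_def indicator_def)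
  qed
  have CZ: "(%y. indicat_real C (Z y)) \<in> borel_measurable (L \<Otimes>\<^sub>M ?K)" if "v \<in> borel_measurable L" for L
   by (rule measurable_compose[OF Zm'[OF that] borel_measurable_indicator[OF C]])
  have hG: "h \<in> borel_measurable G"
  proof -
   have "(%(w, x). indicat_real C (Z (w, x))) = (%y. indicat_real C (Z y))" by (rule ext) (simp add: case_prod_beta)
   with CZ[OF v] have "(%(w, x). indicat_real C (Z (w, x))) \<in> borel_measurable (G \<Otimes>\<^sub>M ?K)" by (simp only:)
   then show ?thesis unfolding h[abs_def] by (rule K.borel_measurable_lebesgue_integral)
  qed
  have hM: "h \<in> borel_measurable M" by (rule measurable_from_subalg[OF sub hG])
  have hb: "\<bar>h w\<bar> <= 1" for w
  proof -
   have m: "(%x. sqrt (v w) * x) \<in> measurable ?K borel" by simp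
   interpret D: prob_space "centred_gaussian (v w)" unfolding centred_gaussian_def by (rule K.prob_space_distr[OF m])
   show ?thesis unfolding h_def using D.prob_le_1[of C] by (simp add: measure_nonneg)
  qed
  have "AE x in N. real_cond_exp N ?F (%y. indicator C (Z y)) x = h (fst x)"
  proof (rule S.real_cond_exp_charact)
   show i1: "integrable N (%y. indicat_real C (Z y))"
    by (rule N.integrable_const_bound[where B=1, OF AE_I2 CZ[OF vM, folded N_def]]) (simp add: indicator_def)
   show i2: "integrable N (%y. h (fst y))"
    by (rule N.integrable_const_bound[where B=1, OF AE_I2 measurable_compose[OF fstN hM]]) (simp add: hb)
   show "(%y. h (fst y)) \<in> borel_measurable ?F" by (rule measurable_compose[OF measurable_vimage_algebra1[OF fstG] hG])
   fix A assume "A \<in> sets ?F"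
   then obtain B where A: "A = fst -` B \<inter> space N" and B: "B \<in> sets G" unfolding sets_vimage_algebra2[OF fstG] by blast
   have BM: "B \<in> sets M" using B sub by (auto simp: subalgebra_def)
   have AN: "A \<in> sets N" unfolding A by (rule measurable_sets[OF fstN BM])
   have eq: "(\<integral>y\<in>A. f y \<partial>N) = (LINT w|M. indicator B w * (LINT x|?K. f (w, x)))" if f: "integrable N f" for f :: "'a \<times> real => real"
   proof -
    have "(\<integral>y\<in>A. f y \<partial>N) = (LINT w|M. LINT x|?K. indicator A (w, x) *\<^sub>R f (w, x))"
     unfolding set_lebesgue_integral_def
     using P.integral_fst'[of "%y. indicator A y *\<^sub>R f y"] integrable_mult_indicator[OF AN f] unfolding N_def by simp
    also have "... = (LINT w|M. indicator B w * (LINT x|?K. f (w, x)))"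
    proof (rule Bochner_Integration.integral_cong[OF refl])
     fix w assume "w \<in> space M"
     then have "indicat_real A (w, x) = indicator B w" for x by (simp add: A N_def space_pair_measure indicator_def)
     then show "(LINT x|?K. indicator A (w, x) *\<^sub>R f (w, x)) = indicator B w * (LINT x|?K. f (w, x))" by simp
    qed
    finally show ?thesis .
   qed
   show "(\<integral>y\<in>A. indicator C (Z y) \<partial>N) = (\<integral>y\<in>A. h (fst y) \<partial>N)"
    unfolding eq[OF i1] eq[OF i2] h[symmetric] using K.prob_space by simp
  qed
  then show "AE x in N. real_cond_exp N ?F (%y. indicator C (Z y)) x = measure (centred_gaussian (v (fst x))) C"
   by (simp add: h_def)
 qed
 have i: "integrable N (%y. iexp (t * Z y))"
 proof -
  have "(%z. iexp (t * z)) \<in> borel_measurable borel" by (intro borel_measurable_continuous_onI continuous_intros)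
  from measurable_compose[OF Zm this] show ?thesis by (rule N.integrable_const_bound[where B=1, OF AE_I2, rotated]) simp
 qed
 have "char (distr N borel Z) t = (CLINT y|N. iexp (t * Z y))"
  unfolding char_def by (rule integral_distr[OF Zm]) simp
 also have "... = (CLINT w|M. CLINT x|?K. iexp (t * Z (w, x)))"
  using P.integral_fst'[of "%y. iexp (t * Z y)"] i unfolding N_def by simp
 also have "... = (CLINT w|M. complex_of_real (exp (- (t^2 * v w / 2))))"
 proof (rule Bochner_Integration.integral_cong[OF refl])
  fix w
  have "(CLINT x|?K. iexp (t * Z (w, x))) = char ?K (t * sqrt (v w))" unfolding char_def Z_def by (simp add: mult.assoc)
  also have "... = complex_of_real (exp (- (t^2 * v w / 2)))"
   using v0[of w] by (simp add: char_std_normal_distribution power_mult_distrib)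
  finally show "(CLINT x|?K. iexp (t * Z (w, x))) = complex_of_real (exp (- (t^2 * v w / 2)))" .
 qed
 also have "... = complex_of_real (integral\<^sup>L M (%w. exp (- (t^2 * v w / 2))))" by (rule integral_complex_of_real)
 finally show "char (distr N borel Z) t = complex_of_real (integral\<^sup>L M (%w. exp (- (t^2 * v w / 2))))" .
qed

lemma (in prob_space) weak_conv_trigonometric:
 assumes Y: "!!n. Y n \<in> borel_measurable M" and N: "real_distribution N"
  and char: "!!t. char N t = complex_of_real (\<phi> t)"
  and lim: "!!t. (%n. expectation (%w. cos (t * Y n w))) \<longlonglongrightarrow> \<phi> t" "!!t. (%n. expectation (%w. sin (t * Y n w))) \<longlonglongrightarrow> 0"
 shows "weak_conv_m (%n. distr M borel (Y n)) N"
proof (rule levy_continuity[OF _ N])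
 show "real_distribution (distr M borel (Y n))" for n by (rule real_distribution_distr[OF Y])
 fix t
 have "char (distr M borel (Y n)) t = complex_of_real (expectation (%w. cos (t * Y n w))) + \<i> * complex_of_real (expectation (%w. sin (t * Y n w)))" for n
 proof -
  have m: "(%w. cos (t * Y n w)) \<in> borel_measurable M" "(%w. sin (t * Y n w)) \<in> borel_measurable M"
   by (rule measurable_compose[OF Y], intro borel_measurable_continuous_onI continuous_intros)+
  have i: "integrable M (%w. cos (t * Y n w))" "integrable M (%w. sin (t * Y n w))"
   by (rule integrable_const_bound[where B=1, OF AE_I2 m(1)], simp, rule integrable_const_bound[where B=1, OF AE_I2 m(2)], simp)
  have "char (distr M borel (Y n)) t = (CLINT w|M. iexp (t * Y n w))" unfolding char_def by (rule integral_distr[OF Y]) simp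
  also have "... = (CLINT w|M. complex_of_real (cos (t * Y n w)) + \<i> * complex_of_real (sin (t * Y n w)))"
   by (simp only: exp_Euler cos_of_real sin_of_real)
  also have "... = (CLINT w|M. complex_of_real (cos (t * Y n w))) + (CLINT w|M. \<i> * complex_of_real (sin (t * Y n w)))"
   using i by (intro Bochner_Integration.integral_add integrable_mult_right integrable_of_real)
  finally show ?thesis by (simp only: integral_mult_right_zero integral_complex_of_real)
 qed
 moreover have "(%n. complex_of_real (expectation (%w. cos (t * Y n w))) + \<i> * complex_of_real (expectation (%w. sin (t * Y n w)))) \<longlonglongrightarrow>
  complex_of_real (\<phi> t) + \<i> * complex_of_real 0"
  by (intro tendsto_intros lim)
 ultimately show "(%n. char (distr M borel (Y n)) t) \<longlonglongrightarrow> char N t" by (simp add: char)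
qed

text \<open>\<open>D\<close> is the mixed sum divided by \<open>a * e\<close>, whose limit is the
  quadratic variation. The maximum with \<open>q0\<close> makes the limiting denominator positive
  everywhere and its inverse bounded; almost surely it changes nothing.\<close>

lemma (in ito_pair) ratio_expansion:
 assumes c: "AE w in M. continuous_on {0..} (%t. I t w)" and c': "AE w in M. continuous_on {0..} (%t. I' t w)"
  and p: "cadlag_adapted M F p" and q: "cadlag_adapted M F q"
  and x: "!!n i. x n i \<in> borel_measurable M" "!!n i. AE w in M. x n i w = a * \<iota> n i w + dr p n i w"
  and y: "!!n i. y n i \<in> borel_measurable M" "!!n i. AE w in M. y n i w = e * \<iota> n i w + 2 * \<iota>' n i w + dr q n i w"
  and a: "a ~= 0" and e: "e ~= 0" and q0: "0 < q0" "AE w in M. q0 <= QH w"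
  and g: "(g has_real_derivative g') (at (a / e))" "g \<in> borel_measurable borel" and r: "0 < r"
  and est: "!!n. est n \<in> borel_measurable M"
   "!!n w. \<bar>(\<Sum>i<n. (x n i w)^2) / (\<Sum>i<n. x n i w * y n i w) - a / e\<bar> <= r ==>
    est n w = g ((\<Sum>i<n. (x n i w)^2) / (\<Sum>i<n. x n i w * y n i w))"
 shows "vanishing M (%n w. sqrt (n / T) * (est n w - g (a / e)) - (g' * (- 2 * a / e^2) * inverse (max q0 (QH w))) * S n w)"
proof -
 let ?X = "%n w. \<Sum>i<n. (x n i w)^2" and ?Y = "%n w. \<Sum>i<n. x n i w * y n i w"
 note ex = expansion[OF c c' p q x y]
 have Qm: "(%w. max q0 (QH w)) \<in> borel_measurable M" by (intro borel_measurable_max borel_measurable_const QH_measurable)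
 have XY: "?X n \<in> borel_measurable M" "?Y n \<in> borel_measurable M" for n
  by (intro borel_measurable_sum borel_measurable_times borel_measurable_power x y)+
 have "vanishing M (%n w. sqrt (n / T) * (est n w - g (a / e)) - g' * ((- 2 * a / e^2) * S n w * inverse (max q0 (QH w))))"
 proof (rule ratio_delta_method[where R="%n. sqrt (real n / T)" and g=g and g'=g' and ?y0.0="a / e" and S="%n w. (- 2 * a / e^2) * S n w" and Q="%w. max q0 (QH w)" and est=est and D="%n w. 1 / (a * e) * ?Y n w" and \<Psi>="%n w. ?X n w / ?Y n w" and r=r
   and v="%n w. 1 / (a * e^2) * (sqrt (n / T) * (e * ?X n w - a * ?Y n w) + 2 * a^2 * S n w)"])
  show "stoch_bounded M (%n w. - 2 * a / e^2 * S n w)" by (intro stoch_bounded_mult stoch_bounded_const borel_measurable_const stoch_bounded_S)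
  show "vanishing M (%n w. 1 / (a * e^2) * (sqrt (n / T) * (e * ?X n w - a * ?Y n w) + 2 * a^2 * S n w))" by (intro vanishing_cmult ex(2))
  show "vanishing M (%n w. 1 / (a * e) * ?Y n w - max q0 (QH w))"
  proof (rule vanishing_mono)
   show "vanishing M (%n w. 1 / (a * e) * (?Y n w - a * e * QH w))" by (intro vanishing_cmult ex(1))
   show "(%w. 1 / (a * e) * ?Y n w - max q0 (QH w)) \<in> borel_measurable M" for n
    by (intro borel_measurable_diff borel_measurable_times borel_measurable_const XY Qm)
   show "\<forall>\<^sub>F n in sequentially. AE w in M. \<bar>1 / (a * e) * ?Y n w - max q0 (QH w)\<bar> <= \<bar>1 / (a * e) * (?Y n w - a * e * QH w)\<bar>"
   proof (rule always_eventually, rule allI)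
    fix n
    show "AE w in M. \<bar>1 / (a * e) * ?Y n w - max q0 (QH w)\<bar> <= \<bar>1 / (a * e) * (?Y n w - a * e * QH w)\<bar>"
     using q0(2)
    proof eventually_elim
     case (elim w)
     have "1 / (a * e) * (?Y n w - a * e * QH w) = 1 / (a * e) * ?Y n w - QH w" using a e by (simp only: right_diff_distrib) simp
     then show ?case using elim by (simp only: max_absorb2)
    qed
   qed
  qed
  show "0 < max q0 (QH w)" for w using q0(1) by (rule less_max_iff_disj[THEN iffD2, OF disjI1])
  show "filterlim (%n. sqrt (real n / T)) at_top sequentially"
  proof -
   have "filterlim (%n. 1 / T * real n) at_top sequentially"
    using T by (intro filterlim_tendsto_pos_mult_at_top[OF tendsto_const] filterlim_real_sequentially) auto
   from filterlim_compose[OF sqrt_at_top this] show ?thesis by simp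
  qed
  show "(%w. ?X n w / ?Y n w) \<in> borel_measurable M" for n by (intro borel_measurable_divide XY)
  show "AE w in M. 1 / (a * e) * ?Y n w ~= 0 --> sqrt (n / T) * (?X n w / ?Y n w - a / e) * (1 / (a * e) * ?Y n w) =
   - 2 * a / e^2 * S n w + 1 / (a * e^2) * (sqrt (n / T) * (e * ?X n w - a * ?Y n w) + 2 * a^2 * S n w)" for n
  proof (intro AE_I2 impI)
   fix w assume "1 / (a * e) * ?Y n w ~= 0"
   then have Y: "?Y n w ~= 0" by simp
   have *: "ww * (X / Z - a / e) * (1 / (a * e) * Z) = - 2 * a / e^2 * s + 1 / (a * e^2) * (ww * (e * X - a * Z) + 2 * a^2 * s)" if "Z ~= 0" for ww X Z s :: real
    using that a e by (simp add: field_simps power2_eq_square)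
   show "sqrt (n / T) * (?X n w / ?Y n w - a / e) * (1 / (a * e) * ?Y n w) =
    - 2 * a / e^2 * S n w + 1 / (a * e^2) * (sqrt (n / T) * (e * ?X n w - a * ?Y n w) + 2 * a^2 * S n w)" by (rule *[OF Y])
  qed
 qed (use Qm g r est in auto)
 then show ?thesis by (simp only: mult_ac)
qed

lemma simple_integral_zero:
 assumes "simple_process_data M F m \<tau> \<xi>"
 shows "simple_integral_process m \<tau> \<xi> B 0 w = 0"
proof -
 have "0 <= \<tau> i" if "i <= m" for i using simple_process_data_weak[OF assms] that by (auto simp: weak_simple_data_def)
 then show ?thesis unfolding simple_integral_process_def by (intro sum.neutral ballI) (simp add: min_def)
qed

lemma ito_riemann_sums_closed:
 assumes fsp: "filtered_prob_space M F" and B: "brownian_motion M F B"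
  and H: "cadlag_adapted M F H" and I: "has_ito_integral M F B H I" and t: "0 <= t"
 shows "tendsto_in_prob M (%r w. \<Sum>j<r. H (real j * (t / real r)) w *
  (B (real (Suc j) * (t / real r)) w - B (real j * (t / real r)) w)) (I t)"
proof (cases "t = 0")
 case True
 from I obtain m :: "nat => nat" and \<tau> \<xi> where d: "!!k. simple_process_data M F (m k) (\<tau> k) (\<xi> k)"
  and l: "!!t. 0 <= t ==> tendsto_in_prob M (%k. simple_integral_process (m k) (\<tau> k) (\<xi> k) B t) (I t)"
  unfolding has_ito_integral_def by blast
 from l[OF order_refl] show ?thesis unfolding True simple_integral_zero[OF d, abs_def] by simp
next
 case False
 with t ito_riemann_sums[OF fsp B H I] show ?thesis by simp
qed

lemma (in prob_space) tendsto_in_prob_unique: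
 assumes X: "tendsto_in_prob M X Y" "tendsto_in_prob M X Z"
 shows "AE w in M. Y w = Z w"
proof -
 have "tendsto_in_prob M (%n w. X n w + (-1) * X n w) (%w. Y w + (-1) * Z w)"
  by (intro tendsto_in_prob_add tendsto_in_prob_mult tendsto_in_prob_const X borel_measurable_const)
 then have YZ: "(%w. Y w - Z w) \<in> borel_measurable M" and pr: "!!e. 0 < e ==> prob {w \<in> space M. e < \<bar>Y w - Z w\<bar>} = 0"
  unfolding tendsto_in_prob_def by (simp_all add: LIMSEQ_const_iff abs_minus_commute)
 have "AE w in M. \<not> inverse (real (Suc k)) < \<bar>Y w - Z w\<bar>" for k
 proof (rule AE_I')
  have "prob {w \<in> space M. inverse (real (Suc k)) < \<bar>Y w - Z w\<bar>} = 0" by (rule pr) simp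
  then show "{w \<in> space M. inverse (real (Suc k)) < \<bar>Y w - Z w\<bar>} \<in> null_sets M"
   using event_abs_gt[OF YZ] by (intro null_setsI) (simp_all add: emeasure_eq_measure)
 qed auto
 then have "AE w in M. \<forall>k. \<not> inverse (real (Suc k)) < \<bar>Y w - Z w\<bar>" by (simp add: AE_all_countable)
 then show ?thesis
 proof eventually_elim
  case (elim w)
  show ?case
  proof (rule ccontr)
   assume "Y w ~= Z w"
   then obtain k where "inverse (real (Suc k)) < \<bar>Y w - Z w\<bar>" using reals_Archimedean[of "\<bar>Y w - Z w\<bar>"] by auto
   with elim show False by blast
  qed
 qed
qed

lemma cadlag_adapted_exp_mult:
 assumes "cadlag_adapted M F Y"
 shows "cadlag_adapted M F (%u w. exp (r * u + s) * Y u w)"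
proof -
 have "cadlag (%u. exp (r * u + s))" by (rule cadlag_continuous) (intro continuous_intros)
 then show ?thesis using assms unfolding cadlag_adapted_def adapted_process_def
  by (simp add: borel_measurable_times cadlag_mult)
qed

lemma cadlag_adapted_lincomb:
 assumes "cadlag_adapted M F Y" "cadlag_adapted M F Z"
 shows "cadlag_adapted M F (%u w. r * Y u w + s * Z u w)"
 using assms unfolding cadlag_adapted_def adapted_process_def
 by (simp add: borel_measurable_times borel_measurable_add cadlag_add cadlag_mult cadlag_const)

text \<open>All driving integrals are multiples of one process, \<open>\<integral> exp(\<theta>u) \<sigma>\<^sub>u dB\<^sub>u\<close>.\<close>

lemma ito_integral_scale:
 assumes fsp: "filtered_prob_space M F" and B: "brownian_motion M F B" and \<sigma>: "cadlag_adapted M F \<sigma>"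
  and I: "has_ito_integral M F B (%u w. exp (- \<theta> * (c - u)) * \<sigma> u w) I" and t: "0 <= t"
 shows "tendsto_in_prob M (%r w. \<Sum>j<r. exp (\<theta> * (real j * (t / real r))) * \<sigma> (real j * (t / real r)) w *
  (B (real (Suc j) * (t / real r)) w - B (real j * (t / real r)) w)) (%w. exp (\<theta> * c) * I t w)"
proof -
 interpret prob_space M by (rule filtered_prob_spaceD(1)[OF fsp])
 have "cadlag_adapted M F (%u w. exp (- \<theta> * (c - u)) * \<sigma> u w)"
  using cadlag_adapted_exp_mult[OF \<sigma>, of \<theta> "- \<theta> * c"] by (simp add: algebra_simps)
 from tendsto_in_prob_mult[OF tendsto_in_prob_const[OF borel_measurable_const] ito_riemann_sums_closed[OF fsp B this I t], of "exp (\<theta> * c)"]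
 have "tendsto_in_prob M (%r w. exp (\<theta> * c) * (\<Sum>j<r. exp (- \<theta> * (c - real j * (t / real r))) * \<sigma> (real j * (t / real r)) w *
  (B (real (Suc j) * (t / real r)) w - B (real j * (t / real r)) w))) (%w. exp (\<theta> * c) * I t w)" .
 moreover have "exp (\<theta> * c) * (exp (- \<theta> * (c - u)) * s * b) = exp (\<theta> * u) * s * b" for u s b
 proof -
  have "exp (\<theta> * c) * exp (- \<theta> * (c - u)) = exp (\<theta> * u)" by (simp add: mult_exp_exp algebra_simps)
  then show ?thesis by (simp only: mult.assoc[symmetric])
 qed
 ultimately show ?thesis by (simp only: sum_distrib_left)
qed

lemma ito_integral_proportional:
 assumes fsp: "filtered_prob_space M F" and B: "brownian_motion M F B" and \<sigma>: "cadlag_adapted M F \<sigma>"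
  and I: "has_ito_integral M F B (%u w. exp (- \<theta> * (c - u)) * \<sigma> u w) I"
  and I': "has_ito_integral M F B (%u w. exp (- \<theta> * (c' - u)) * \<sigma> u w) I'" and t: "0 <= t"
 shows "AE w in M. I' t w = exp (- \<theta> * c') * (exp (\<theta> * c) * I t w)"
proof -
 interpret prob_space M by (rule filtered_prob_spaceD(1)[OF fsp])
 show ?thesis
  using tendsto_in_prob_unique[OF ito_integral_scale[OF fsp B \<sigma> I t] ito_integral_scale[OF fsp B \<sigma> I' t]]
 proof eventually_elim
  case (elim w)
  have "exp (- \<theta> * c') * exp (\<theta> * c') = 1" by (simp add: mult_exp_exp)
  then show ?case unfolding elim by (simp add: mult.assoc[symmetric])
 qed
qed

lemma ito_pair_model:
 assumes fsp: "filtered_prob_space M F" and B: "brownian_motion M F B" and B': "brownian_motion M F B'"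
  and ind: "independent_processes M B B'" and T: "0 < T"
  and \<sigma>: "cadlag_adapted M F \<sigma>" and \<sigma>': "cadlag_adapted M F \<sigma>'"
  and I: "has_ito_integral M F B (%u w. exp (- \<theta> * (c - u)) * \<sigma> u w) I" and J: "has_ito_integral M F B' \<sigma>' J"
 shows "ito_pair M F B B' T (%u w. exp (\<theta> * u) * \<sigma> u w) \<sigma>' (%t w. exp (\<theta> * c) * I t w) J"
 using fsp B B' ind T \<sigma>' cadlag_adapted_exp_mult[OF \<sigma>, of \<theta> 0] ito_integral_scale[OF fsp B \<sigma> I] ito_riemann_sums_closed[OF fsp B' \<sigma>' J]
 by unfold_locales simp_all

section \<open>The estimators\<close>

text \<open>After cancelling the common factor, \<psi>2 is minus the hyperbolic tangent of
  \<open>t * (Tm 2 - Tm 1) / 2\<close>, which explains its range.\<close>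

lemma \<psi>2_eq:
 assumes "0 < t" "Tm 1 < Tm 2"
 shows "\<psi>2 Tm t = (exp (- t * Tm 2) - exp (- t * Tm 1)) / (exp (- t * Tm 2) + exp (- t * Tm 1))"
proof -
 have sq: "exp (- 2 * t * u) = (exp (- t * u))^2" for u :: real by (simp add: power2_eq_square mult_exp_exp)
 have "exp (- t * Tm 2) ~= exp (- t * Tm 1)" using assms by simp
 then have n: "exp (- t * Tm 2) - exp (- t * Tm 1) ~= 0" by simp
 have "\<psi>2 Tm t = (exp (- t * Tm 2) - exp (- t * Tm 1)) * (exp (- t * Tm 2) - exp (- t * Tm 1)) / ((exp (- t * Tm 2) - exp (- t * Tm 1)) * (exp (- t * Tm 2) + exp (- t * Tm 1)))"
  unfolding \<psi>2_def sq by (simp only: power2_eq_square square_diff_square_factored mult.commute)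
 then show ?thesis by (simp only: mult_divide_mult_cancel_left[OF n])
qed

text \<open>Equals \<open>- 2 * artanh y / (Tm 2 - Tm 1)\<close> for
  \<open>\<bar>y\<bar> < 1\<close>. Measurability and derivative can be read off this formula, but
  not off \<open>inv_into\<close>.\<close>

definition \<psi>2_inv :: "(nat => real) => real => real" where
 "\<psi>2_inv Tm y = (ln (1 - y) - ln (1 + y)) / (Tm 2 - Tm 1)"

lemma \<psi>2_inv_\<psi>2:
 assumes t: "0 < t" and T: "Tm 1 < Tm 2"
 shows "\<psi>2_inv Tm (\<psi>2 Tm t) = t"
proof -
 define A1 A2 where "A1 = exp (- t * Tm 1)" and "A2 = exp (- t * Tm 2)"
 have p: "0 < A1" "0 < A2" "0 < A2 + A1" by (auto simp: A1_def A2_def add_pos_pos)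
 have y: "\<psi>2 Tm t = (A2 - A1) / (A2 + A1)" unfolding A1_def A2_def by (rule \<psi>2_eq[OF t T])
 have "1 - \<psi>2 Tm t = (2 * A1) / (A2 + A1)" "1 + \<psi>2 Tm t = (2 * A2) / (A2 + A1)" unfolding y using p by (simp_all add: field_simps)
 then have "ln (1 - \<psi>2 Tm t) - ln (1 + \<psi>2 Tm t) = ln A1 - ln A2" using p by (simp add: ln_div ln_mult)
 also have "... = t * (Tm 2 - Tm 1)" by (simp add: A1_def A2_def algebra_simps)
 finally show ?thesis using T by (simp add: \<psi>2_inv_def)
qed

lemma \<psi>2_\<psi>2_inv:
 assumes y: "y \<in> {-1<..<0}" and T: "Tm 1 < Tm 2"
 shows "0 < \<psi>2_inv Tm y" "\<psi>2 Tm (\<psi>2_inv Tm y) = y"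
proof -
 define t where "t = \<psi>2_inv Tm y"
 have "ln (1 + y) < ln (1 - y)" using y by (subst ln_less_cancel_iff) auto
 then show t: "0 < \<psi>2_inv Tm y" using T by (simp add: \<psi>2_inv_def)
 have "- t * Tm 2 = - t * Tm 1 + (ln (1 + y) - ln (1 - y))"
 proof -
  have "t * (Tm 2 - Tm 1) = ln (1 - y) - ln (1 + y)" using T by (simp add: t_def \<psi>2_inv_def)
  then show ?thesis by (simp add: algebra_simps)
 qed
 then have e: "exp (- t * Tm 2) = exp (- t * Tm 1) * ((1 + y) / (1 - y))" using y by (simp only: exp_add exp_diff) simp
 have "\<psi>2 Tm t = (exp (- t * Tm 1) * ((1 + y) / (1 - y)) - exp (- t * Tm 1)) / (exp (- t * Tm 1) * ((1 + y) / (1 - y)) + exp (- t * Tm 1))"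
  using \<psi>2_eq[OF t T] unfolding t_def[symmetric] e .
 also have "... = (exp (- t * Tm 1) * ((1 + y) / (1 - y) - 1)) / (exp (- t * Tm 1) * ((1 + y) / (1 - y) + 1))" by (simp add: algebra_simps)
 also have "... = ((1 + y) / (1 - y) - 1) / ((1 + y) / (1 - y) + 1)" by simp
 also have "... = y" using y by (simp add: field_simps)
 finally show "\<psi>2 Tm (\<psi>2_inv Tm y) = y" unfolding t_def .
qed

lemma inv_into_\<psi>2:
 assumes y: "y \<in> {-1<..<0}" and T: "Tm 1 < Tm 2"
 shows "inv_into {0<..} (\<psi>2 Tm) y = \<psi>2_inv Tm y"
proof (rule inv_into_f_eq)
 show "inj_on (\<psi>2 Tm) {0<..}" by (rule inj_on_inverseI[where g="\<psi>2_inv Tm"], rule \<psi>2_inv_\<psi>2[OF _ T], simp)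
qed (use \<psi>2_\<psi>2_inv[OF y T] in auto)

lemma \<psi>2_inv_derivative:
 assumes y: "y \<in> {-1<..<1}" and T: "Tm 1 < Tm 2"
 shows "(\<psi>2_inv Tm has_real_derivative - 2 / ((1 - y^2) * (Tm 2 - Tm 1))) (at y)"
proof -
 have "1 - y^2 = (1 - y) * (1 + y)" by (simp add: power2_eq_square algebra_simps)
 moreover have "0 < 1 - y" "0 < 1 + y" "0 < Tm 2 - Tm 1" using y T by auto
 moreover from this have "((%y. (ln (1 - y) - ln (1 + y)) / (Tm 2 - Tm 1)) has_real_derivative (- 1 / (1 - y) - 1 / (1 + y)) / (Tm 2 - Tm 1)) (at y)"
  by (auto intro!: derivative_eq_intros)
 moreover have "(- 1 / u - 1 / v) / ww = - (u + v) / ((u * v) * ww)" if "0 < u" "0 < v" "0 < ww" for u v ww :: real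
  using that by (simp add: field_simps)
 ultimately show ?thesis unfolding \<psi>2_inv_def[abs_def] by simp
qed

lemma \<psi>2_inv_measurable: "\<psi>2_inv Tm \<in> borel_measurable borel"
 unfolding \<psi>2_inv_def[abs_def] by measurable

section \<open>Strict convexity and the ratio for three maturities\<close>

lemma exp_strict_gt: "x ~= 0 ==> 1 + x < exp (x :: real)"
proof (cases "0 <= 1 + x / 2")
 case True
 assume x: "x ~= 0"
 have "1 + x < 1 + x + x^2 / 4" using x by simp
 also have "... = (1 + x / 2)^2" by (simp add: power2_eq_square algebra_simps)
 also have "... <= (exp (x / 2))^2" using True by (intro power_mono exp_ge_add_one_self) auto
 also have "... = exp x" by (simp add: power2_eq_square mult_exp_exp)
 finally show ?thesis .
next
 case False
 then have "1 + x < 0" by simp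
 then show ?thesis using exp_gt_zero[of x] by linarith
qed

text \<open>The tangent of \<open>exp\<close> at \<open>c * x\<close> lies strictly below the graph
  at \<open>x\<close> and weakly below at 0; averaging the two inequalities removes the
  slope.\<close>

lemma exp_strict_convex:
 fixes x c :: real
 assumes x: "x ~= 0" and c: "0 < c" "c < 1"
 shows "exp (c * x) < 1 - c + c * exp x"
proof -
 let ?z = "c * x"
 have "x - ?z ~= 0" using x c by simp
 from exp_strict_gt[OF this] have 1: "c * (exp ?z * (1 + (x - ?z))) < c * (exp ?z * exp (x - ?z))" using c by simp
 have 2: "(1 - c) * (exp ?z * (1 + (- ?z))) <= (1 - c) * (exp ?z * exp (- ?z))"
  using c exp_ge_add_one_self[of "- ?z"] by (intro mult_left_mono) auto
 have "exp ?z * exp (x - ?z) = exp x" "exp ?z * exp (- ?z) = 1" by (simp_all add: mult_exp_exp)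
 then have "c * (exp ?z * (1 + (x - ?z))) + (1 - c) * (exp ?z * (1 + (- ?z))) < c * exp x + (1 - c)" using 1 2 by simp
 moreover have "c * (e * (1 + (x - ?z))) + (1 - c) * (e * (1 + (- ?z))) = e" for e by (simp add: algebra_simps)
 ultimately show ?thesis by simp
qed

text \<open>With \<open>p = T\<^sub>2 - T\<^sub>1\<close> and \<open>q = T\<^sub>3 - T\<^sub>2\<close>, \<open>\<psi>\<^sub>3\<close> is the square of this ratio.\<close>

lemma exp_ratio_bounds:
 fixes p q t :: real
 assumes p: "0 < p" and q: "0 < q" and t: "0 < t"
 shows "0 < (1 - exp (- t * q)) / (exp (t * p) - 1)" "(1 - exp (- t * q)) / (exp (t * p) - 1) < q / p"
proof -
 have 1: "0 < 1 - exp (- t * q)" "0 < exp (t * p) - 1" using assms by simp_all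
 then show "0 < (1 - exp (- t * q)) / (exp (t * p) - 1)" by simp
 have 2: "1 - exp (- t * q) < t * q" "t * p < exp (t * p) - 1" using exp_strict_gt[of "- t * q"] exp_strict_gt[of "t * p"] assms by simp_all
 have "(1 - exp (- t * q)) / (exp (t * p) - 1) < (t * q) / (t * p)"
  using 1 2 assms by (intro frac_less) auto
 then show "(1 - exp (- t * q)) / (exp (t * p) - 1) < q / p" using t by simp
qed

text \<open>With \<open>s = c * t\<close>, the convex denominator and the concave numerator, both
  vanishing at time 0, are compared with \<open>c\<close> times their values at \<open>t\<close>, in
  opposite directions.\<close>

lemma exp_ratio_antimono:
 fixes p q s t :: real
 assumes p: "0 < p" and q: "0 < q" and s: "0 < s" "s < t"
 shows "(1 - exp (- t * q)) / (exp (t * p) - 1) < (1 - exp (- s * q)) / (exp (s * p) - 1)"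
proof -
 define c where "c = s / t"
 have c: "0 < c" "c < 1" using s by (auto simp: c_def)
 have st: "c * (t * p) = s * p" "c * (- t * q) = - s * q" using s by (auto simp: c_def)
 have "exp (s * p) - 1 < c * (exp (t * p) - 1)"
  using exp_strict_convex[OF _ c, of "t * p"] p s unfolding st by (simp add: algebra_simps)
 moreover have "c * (1 - exp (- t * q)) < 1 - exp (- s * q)"
  using exp_strict_convex[OF _ c, of "- t * q"] q s unfolding st by (simp add: algebra_simps)
 moreover have pos: "0 < 1 - exp (- t * q)" "0 < exp (t * p) - 1" "0 < exp (s * p) - 1" using assms by simp_all
 ultimately have "(1 - exp (- t * q)) * (exp (s * p) - 1) < (1 - exp (- t * q)) * (c * (exp (t * p) - 1))"
  "(c * (1 - exp (- t * q))) * (exp (t * p) - 1) < (1 - exp (- s * q)) * (exp (t * p) - 1)" by simp_all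
 then have "(1 - exp (- t * q)) * (exp (s * p) - 1) < (1 - exp (- s * q)) * (exp (t * p) - 1)" by (simp only: mult_ac)
 moreover have "u / v < ww / z" if "u * z < ww * v" "0 < v" "0 < z" for u v ww z :: real using that by (simp add: field_simps)
 ultimately show ?thesis using pos(2,3) by blast
qed

lemma \<psi>3_eq:
 assumes "0 < t" "Tm 1 < Tm 2"
 shows "\<psi>3 Tm t = ((1 - exp (- t * (Tm 3 - Tm 2))) / (exp (t * (Tm 2 - Tm 1)) - 1))^2"
proof -
 have "exp (- t * Tm 3) - exp (- t * Tm 2) = (- exp (- t * Tm 2)) * (1 - exp (- t * (Tm 3 - Tm 2)))"
  by (simp add: right_diff_distrib mult_exp_exp algebra_simps)
 moreover have "exp (- t * Tm 2) - exp (- t * Tm 1) = (- exp (- t * Tm 2)) * (exp (t * (Tm 2 - Tm 1)) - 1)"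
  by (simp add: right_diff_distrib mult_exp_exp algebra_simps)
 moreover have n: "- exp (- t * Tm 2) ~= 0" by simp
 ultimately show ?thesis unfolding \<psi>3_def by (simp only: mult_divide_mult_cancel_left[OF n])
qed

lemma \<psi>3_range:
 assumes t: "0 < t" and T: "Tm 1 < Tm 2" "Tm 2 < Tm 3"
 shows "\<psi>3 Tm t \<in> {0<..<((Tm 3 - Tm 2) / (Tm 2 - Tm 1))^2}"
proof -
 have pq: "0 < Tm 2 - Tm 1" "0 < Tm 3 - Tm 2" using T by auto
 note b = exp_ratio_bounds[OF pq t]
 have "0 < (2::nat)" by simp
 from zero_less_power[OF b(1), of 2] power_strict_mono[OF b(2) less_imp_le[OF b(1)] this]
 show ?thesis unfolding \<psi>3_eq[OF t T(1)] greaterThanLessThan_iff by (rule conjI)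
qed

lemma \<psi>3_antimono:
 assumes s: "0 < s" "s < t" and T: "Tm 1 < Tm 2" "Tm 2 < Tm 3"
 shows "\<psi>3 Tm t < \<psi>3 Tm s"
proof -
 have pq: "0 < Tm 2 - Tm 1" "0 < Tm 3 - Tm 2" using T by auto
 have t: "0 < t" using s by simp
 show ?thesis unfolding \<psi>3_eq[OF t T(1)] \<psi>3_eq[OF s(1) T(1)]
  by (intro power_strict_mono exp_ratio_antimono pq s less_imp_le[OF exp_ratio_bounds(1)[OF pq t]]) simp
qed

lemma \<psi>3_inj:
 assumes T: "Tm 1 < Tm 2" "Tm 2 < Tm 3"
 shows "inj_on (\<psi>3 Tm) {0<..}"
proof (rule inj_onI)
 fix s t :: real assume "s \<in> {0<..}" "t \<in> {0<..}" and e: "\<psi>3 Tm s = \<psi>3 Tm t"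
 then show "s = t" using \<psi>3_antimono[OF _ _ T, of s t] \<psi>3_antimono[OF _ _ T, of t s] by (cases s t rule: linorder_cases) auto
qed

text \<open>Off its image the inverse takes the constant junk value of \<open>inv_into\<close>; on the image, the
 preimages of rays are images of rays under the continuous \<open>\<psi>\<^sub>3\<close>, hence \<open>\<sigma>\<close>-compact.\<close>

lemma inv_into_\<psi>3_measurable:
 assumes T: "Tm 1 < Tm 2" "Tm 2 < Tm 3"
 shows "inv_into {0<..} (\<psi>3 Tm) \<in> borel_measurable borel"
proof -
 have cont: "continuous_on {0<..} (\<psi>3 Tm)"
 proof -
  have "exp (- t * Tm 2) - exp (- t * Tm 1) ~= 0" if "t \<in> {0<..}" for t using that T by simp
  then show ?thesis unfolding \<psi>3_def[abs_def] by (intro continuous_intros) blast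
 qed
 have B: "\<psi>3 Tm ` {c<..} \<in> sets borel" if c: "0 <= c" for c
 proof -
  have "{c<..} = (\<Union>k::nat. {c + inverse (real (Suc k))..c + real (Suc k)})"
  proof (rule set_eqI, rule iffI)
   fix t assume "t \<in> {c<..}"
   then obtain k l :: nat where "inverse (real (Suc k)) < t - c" "t - c <= real l" using reals_Archimedean[of "t - c"] real_arch_simple[of "t - c"] by auto
   moreover have "inverse (real (Suc (max k l))) <= inverse (real (Suc k))" by (intro le_imp_inverse_le) auto
   moreover have "real l <= real (Suc (max k l))" by simp
   ultimately have "t \<in> {c + inverse (real (Suc (max k l)))..c + real (Suc (max k l))}" unfolding atLeastAtMost_iff by linarith
   then show "t \<in> (\<Union>k::nat. {c + inverse (real (Suc k))..c + real (Suc k)})" by (rule UN_I[OF UNIV_I])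
  next
   fix t assume "t \<in> (\<Union>k::nat. {c + inverse (real (Suc k))..c + real (Suc k)})"
   then obtain k :: nat where "c + inverse (real (Suc k)) <= t" by auto
   moreover have "0 < inverse (real (Suc k))" by simp
   ultimately show "t \<in> {c<..}" unfolding greaterThan_iff by linarith
  qed
  then have eq: "\<psi>3 Tm ` {c<..} = (\<Union>k::nat. \<psi>3 Tm ` {c + inverse (real (Suc k))..c + real (Suc k)})" by (simp only: image_UN)
  have "\<psi>3 Tm ` {c + inverse (real (Suc k))..c + real (Suc k)} \<in> sets borel" for k
  proof (intro borel_compact compact_continuous_image continuous_on_subset[OF cont])
   have "0 < inverse (real (Suc k))" by simp
   then show "{c + inverse (real (Suc k))..c + real (Suc k)} \<subseteq> {0<..}" using c unfolding subset_iff atLeastAtMost_iff greaterThan_iff by (intro allI impI) linarith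
  qed simp
  then show ?thesis unfolding eq by (intro sets.countable_UN) auto
 qed
 let ?P = "\<psi>3 Tm ` {0<..}"
 \<comment> \<open>The junk value is first replaced by 0: above a level \<open>c\<close> lies then
   the image of the ray from \<open>max 0 c\<close>, together with the complement of the image when
   \<open>c < 0\<close>.\<close>
 define k where "k y = (if y \<in> ?P then inv_into {0<..} (\<psi>3 Tm) y else 0)" for y
 have k: "k \<in> borel_measurable borel"
 proof (rule borel_measurableI_greater)
  fix c :: real
  have "{y \<in> space borel. c < k y} = \<psi>3 Tm ` {max 0 c<..} \<union> (if c < 0 then - ?P else {})"
  proof (rule set_eqI)
   fix y
   show "y \<in> {y \<in> space borel. c < k y} \<longleftrightarrow> y \<in> \<psi>3 Tm ` {max 0 c<..} \<union> (if c < 0 then - ?P else {})"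
   proof (cases "y \<in> ?P")
    case True
    then obtain t where t: "0 < t" "y = \<psi>3 Tm t" by auto
    have ky: "k y = t" unfolding k_def using True t inv_into_f_f[OF \<psi>3_inj[OF T], of t] by simp
    have "y \<in> \<psi>3 Tm ` {max 0 c<..} \<longleftrightarrow> c < t"
    proof
     assume "y \<in> \<psi>3 Tm ` {max 0 c<..}"
     then obtain u where u: "max 0 c < u" "\<psi>3 Tm t = \<psi>3 Tm u" using t by auto
     then have "t = u" using inj_onD[OF \<psi>3_inj[OF T] u(2)] t by simp
     then show "c < t" using u by simp
    qed (use t in auto)
    then show ?thesis using ky True by simp
   next
    case False
    then have "y \<notin> \<psi>3 Tm ` {max 0 c<..}" by auto
    then show ?thesis using False by (simp add: k_def)
   qed
  qed
  also have "... \<in> sets borel" using B[of "max 0 c"] B[of 0] by (auto intro: borel_comp)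
  finally show "{y \<in> space borel. c < k y} \<in> sets borel" .
 qed
 have "inv_into {0<..} (\<psi>3 Tm) y = (if y \<in> ?P then k y else (SOME x. False))" for y
  by (auto simp: k_def inv_into_def image_iff intro!: arg_cong[where f=Eps])
 then have "inv_into {0<..} (\<psi>3 Tm) = (%y. if y \<in> ?P then k y else (SOME x. False))" by (rule ext)
 also have "... \<in> borel_measurable borel"
  using B[of 0] by (intro measurable_If k measurable_const) auto
 finally show ?thesis .
qed

section \<open>The observed components and the estimator from two maturities\<close>

text \<open>Shared by both claims: \<open>2 <= d\<close> is asked here, and \<open>3 <= d\<close> is
  added where a third component occurs.\<close>

locale bond_model =
 fixes M :: "'a measure" and F :: "real => 'a measure"
  and B B' \<sigma> \<sigma>' J :: "real => 'a => real"
  and X b I :: "nat => real => 'a => real"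
  and d :: nat and x0 Tm :: "nat => real" and T \<theta> c_min :: real
 assumes space: "filtered_prob_space M F"
  and d: "2 <= d"
  and B: "brownian_motion M F B"
  and B': "brownian_motion M F B'"
  and indep: "independent_processes M B B'"
  and \<sigma>: "cadlag_adapted M F \<sigma>"
  and \<sigma>': "cadlag_adapted M F \<sigma>'"
  and b: "!!j. j \<in> {1..d} ==> cadlag_adapted M F (b j)"
  and \<theta>: "0 < \<theta>"
  and T: "0 < T"
  and Tm: "strict_mono_on {1..d} Tm"
  and I: "!!j. j \<in> {1..d} ==>
    has_ito_integral M F B (%u w. exp (- \<theta> * (Tm j - u)) * \<sigma> u w) (I j)"
  and J: "has_ito_integral M F B' \<sigma>' J"
  and X_meas: "!!j t. j \<in> {1..d} ==> 0 <= t ==> X j t \<in> borel_measurable M"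
  and X: "!!j. j \<in> {1..d} ==> AE w in M. \<forall>t\<ge>0.
    X j t w = x0 j + (LINT u:{0..t}|lborel. b j u w) + I j t w + J t w"
  and c_min: "0 < c_min"
  and lower: "AE w in M. \<forall>t\<in>{0..T}. c_min <= min (\<sigma> t w) (\<sigma>' t w)"
begin

abbreviation "H u w \<equiv> exp (\<theta> * u) * \<sigma> u w"
abbreviation "m t w \<equiv> exp (\<theta> * Tm 1) * I 1 t w"
abbreviation "A j \<equiv> exp (- \<theta> * Tm j)"

lemma one_in: "1 \<in> {1..d}" "2 \<in> {1..d}"
 using d by auto

sublocale ip: ito_pair M F B B' T H \<sigma>' m J
 by (rule ito_pair_model[OF space B B' indep T \<sigma> \<sigma>' I[OF one_in(1)] J])

lemma Tm_less: "1 <= i ==> i < j ==> j <= d ==> Tm i < Tm j"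
 using strict_mono_onD[OF Tm, of i j] by simp

lemma paths_continuous: "AE w in M. continuous_on {0..} (%t. m t w)" "AE w in M. continuous_on {0..} (%t. J t w)"
proof -
 have "AE w in M. continuous_on {0..} (%t. I 1 t w)" using I[OF one_in(1)] unfolding has_ito_integral_def by blast
 then show "AE w in M. continuous_on {0..} (%t. m t w)" by eventually_elim (intro continuous_intros)
 show "AE w in M. continuous_on {0..} (%t. J t w)" using J unfolding has_ito_integral_def by blast
qed

lemma incr_measurable: "j \<in> {1..d} ==> incr X T n (Suc i) j \<in> borel_measurable M"
proof -
 assume j: "j \<in> {1..d}"
 have "0 <= real (Suc i) * mesh T n" "0 <= (real (Suc i) - 1) * mesh T n" using T by (simp_all add: mesh_def)
 then show ?thesis unfolding incr_def[abs_def] by (intro borel_measurable_diff X_meas[OF j])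
qed

text \<open>All integrals against \<open>B\<close> are multiples of the one for the first maturity,
  almost surely at each fixed time, so every component is built from the same two increments with
  coefficients \<open>A j\<close> and 1.\<close>

lemma incr_decomposition:
 assumes j: "j \<in> {1..d}"
 shows "AE w in M. incr X T n (Suc i) j w = A j * ip.\<iota> n i w + ip.\<iota>' n i w + ip.dr (b j) n i w"
proof -
 let ?u = "real i * (T / real n)" and ?v = "real (Suc i) * (T / real n)"
 have t: "0 <= ?u" "0 <= ?v" using T by simp_all
 note p = ito_integral_proportional[OF space B \<sigma> I[OF one_in(1)] I[OF j]]
 show ?thesis using X[OF j] p[OF t(1)] p[OF t(2)]
 proof eventually_elim
  case (elim w)
  have "X j ?u w = x0 j + (LINT u:{0..?u}|lborel. b j u w) + I j ?u w + J ?u w"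
   "X j ?v w = x0 j + (LINT u:{0..?v}|lborel. b j u w) + I j ?v w + J ?v w" using elim(1) t by blast+
  moreover have "incr X T n (Suc i) j w = X j ?v w - X j ?u w" by (simp add: incr_def mesh_def)
  ultimately show ?case unfolding inc_def elim(2,3) by (simp add: algebra_simps)
 qed
qed

lemma dr_lincomb:
 assumes "cadlag_adapted M F Y" "cadlag_adapted M F Z" "w \<in> space M"
 shows "ip.dr (%u w. r * Y u w + s * Z u w) n i w = r * ip.dr Y n i w + s * ip.dr Z n i w"
proof -
 have c: "cadlag (%t. Y t w)" "cadlag (%t. Z t w)" using assms by (auto simp: cadlag_adapted_def)
 have "(LINT u:{0..t}|lborel. r * Y u w + s * Z u w) = r * (LINT u:{0..t}|lborel. Y u w) + s * (LINT u:{0..t}|lborel. Z u w)" if "0 <= t" for t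
  using cadlag_set_integrable[OF c(1) that] cadlag_set_integrable[OF c(2) that] by simp
 then show ?thesis unfolding inc_def using T by (simp add: algebra_simps)
qed

text \<open>\<open>exp (\<theta> * t)\<close> is at least 1 on \<open>[0, T]\<close>, so the lower
  bound for \<sigma> passes to \<open>H\<close>.\<close>

lemma QH_lower: "AE w in M. c_min^2 * T <= ip.QH w"
 using lower AE_space
proof eventually_elim
 case (elim w)
 have c: "cadlag (%t. H t w)" by (rule ip.H_cadlag(1)[OF elim(2)])
 have le: "c_min^2 <= (H t w)^2" if "t \<in> {0..T}" for t
 proof (rule power_mono)
  have "c_min <= \<sigma> t w" using elim(1) that by auto
  moreover have "1 <= exp (\<theta> * t)" using \<theta> that by simp
  ultimately have "1 * c_min <= H t w" using c_min by (intro mult_mono) auto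
  then show "c_min <= H t w" by simp
 qed (use c_min in simp)
 have "c_min^2 * T = (LINT t:{0..T}|lborel. c_min^2)" using T by (simp add: set_lebesgue_integral_def)
 also have "... <= ip.QH w"
  using T le by (intro set_integral_mono cadlag_set_integrable cadlag_power cadlag_const c) auto
 finally show ?case .
qed

lemma q0: "0 < c_min^2 * T"
 using c_min T by simp

lemma square_integrals:
 "(H t w)^2 = exp (2 * \<theta> * t) * (\<sigma> t w)^2" "(H t w * \<sigma>' t w)^2 = exp (2 * \<theta> * t) * (\<sigma> t w)^2 * (\<sigma>' t w)^2"
proof -
 have "(exp (\<theta> * t))^2 = exp (2 * \<theta> * t)" by (simp add: power2_eq_square mult_exp_exp)
 then show "(H t w)^2 = exp (2 * \<theta> * t) * (\<sigma> t w)^2" "(H t w * \<sigma>' t w)^2 = exp (2 * \<theta> * t) * (\<sigma> t w)^2 * (\<sigma>' t w)^2"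
  by (simp_all only: power_mult_distrib)
qed

lemma limit_variance_eq:
 "limit_variance \<theta> Tm T \<sigma> \<sigma>' w = ((exp (\<theta> * Tm 1) - exp (\<theta> * Tm 2)) / (Tm 2 - Tm 1))^2 * (ip.V w / (ip.QH w)^2)"
 unfolding limit_variance_def ip.V_def square_integrals by (simp add: power_divide power2_commute)

lemma limit_variance_nonneg: "0 <= limit_variance \<theta> Tm T \<sigma> \<sigma>' w"
 unfolding limit_variance_eq by (intro mult_nonneg_nonneg divide_nonneg_nonneg ip.V_nonneg zero_le_power2)

text \<open>Measurability for \<open>F T\<close>, and not merely for \<open>M\<close>, is what
  admits this variance in the conditional law given \<open>F T\<close>.\<close>

lemma limit_variance_measurable: "limit_variance \<theta> Tm T \<sigma> \<sigma>' \<in> borel_measurable (F T)"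
proof -
 have sp: "space (F T) = space M" using filtered_prob_spaceD(2)[OF space, of T] by (simp add: subalgebra_def)
 have sub: "subalgebra (F T) (F t)" if "t \<in> {0..T}" for t
  using filtered_prob_spaceD(2)[OF space, of t] sp filtered_prob_spaceD(3)[OF space, of t T] that by (simp add: subalgebra_def)
 have m: "H t \<in> borel_measurable (F T)" "\<sigma>' t \<in> borel_measurable (F T)" if "t \<in> {0..T}" for t
  using measurable_from_subalg[OF sub[OF that]] ip.H_measurable(1,2)[of t] that by auto
 have "ip.V \<in> borel_measurable (F T)" unfolding ip.V_def[abs_def]
  by (intro cadlag_adapted_integral_measurable[OF space _ T sp] cadlag_power cadlag_mult[of "%t. H t _"] ip.H_cadlag borel_measurable_power borel_measurable_times[of "H _"] m)
 moreover have "ip.QH \<in> borel_measurable (F T)"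
  by (intro cadlag_adapted_integral_measurable[OF space _ T sp] cadlag_power ip.H_cadlag borel_measurable_power m)
 ultimately show ?thesis unfolding limit_variance_eq[abs_def]
  by (intro borel_measurable_times borel_measurable_divide borel_measurable_power borel_measurable_const)
qed

text \<open>Factoring the difference of squares gives the denominator the form difference times sum,
  the shape of \<open>ratio_expansion\<close>.\<close>

lemma \<Psi>2_sums:
 "\<Psi>2 X T n w = (\<Sum>i<n. (incr X T n (Suc i) 2 w - incr X T n (Suc i) 1 w)^2) /
  (\<Sum>i<n. (incr X T n (Suc i) 2 w - incr X T n (Suc i) 1 w) * (incr X T n (Suc i) 2 w + incr X T n (Suc i) 1 w))"
 unfolding \<Psi>2_def One_nat_def sum.atLeast1_atMost_eq by (simp add: power2_eq_square algebra_simps)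

lemma \<Psi>2_measurable: "\<Psi>2 X T n \<in> borel_measurable M"
 unfolding \<Psi>2_sums[abs_def]
 by (intro borel_measurable_divide borel_measurable_sum borel_measurable_power borel_measurable_times borel_measurable_diff borel_measurable_add incr_measurable one_in)

lemma estimator2_eq: "estimator2 Tm X T n w = (if \<Psi>2 X T n w \<in> {-1<..<0} then \<psi>2_inv Tm (\<Psi>2 X T n w) else 0)"
 unfolding estimator2_def using inv_into_\<psi>2[OF _ Tm_less[of 1 2]] d by simp

lemma estimator2_measurable: "estimator2 Tm X T n \<in> borel_measurable M"
proof -
 have "(%y. if y \<in> {-1<..<0} then \<psi>2_inv Tm y else 0) \<in> borel_measurable borel"
  by (intro measurable_If_set \<psi>2_inv_measurable measurable_const) auto
 from measurable_compose[OF \<Psi>2_measurable this] show ?thesis unfolding estimator2_eq[abs_def] .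
qed

text \<open>For \<open>n = 0\<close> both sides are 0 by the conventions for division and
  powers.\<close>

lemma rate: "mesh T n powr (- 1 / 2) = sqrt (real n / T)"
proof (cases "n = 0")
 case False
 then have "0 < T / n" using T by simp
 then have "mesh T n powr (- 1 / 2) = inverse (sqrt (T / n))" by (simp add: mesh_def powr_minus powr_half_sqrt)
 then show ?thesis by (simp add: real_sqrt_divide)
qed (simp add: mesh_def)

theorem estimator2_limit:
 "\<exists>(N :: ('a \<times> real) measure) \<pi> Z. prob_extension M N \<pi> \<and>
  conditionally_gaussian N \<pi> (F T) (limit_variance \<theta> Tm T \<sigma> \<sigma>') Z \<and>
  tendsto_in_distribution M (%n w. mesh T n powr (- 1 / 2) * (estimator2 Tm X T n w - \<theta>)) N Z"
proof -
 define a where "a = A 2 - A 1"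
 define e where "e = A 2 + A 1"
 have T12: "Tm 1 < Tm 2" using Tm_less[of 1 2] d by simp
 have ae: "a < 0" "0 < e" "- e < a" using T12 \<theta> by (auto simp: a_def e_def add_pos_pos)
 have y0: "a / e \<in> {-1<..<0}" using ae by (simp add: field_simps)
 have \<psi>y: "\<psi>2 Tm \<theta> = a / e" unfolding a_def e_def by (rule \<psi>2_eq[OF \<theta> T12])
 have gy: "\<psi>2_inv Tm (a / e) = \<theta>" unfolding \<psi>y[symmetric] by (rule \<psi>2_inv_\<psi>2[OF \<theta> T12])
 define g' where "g' = - 2 / ((1 - (a / e)^2) * (Tm 2 - Tm 1))"
 have g': "(\<psi>2_inv Tm has_real_derivative g') (at (a / e))" unfolding g'_def using y0 by (intro \<psi>2_inv_derivative T12) auto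
 \<comment> \<open>Half the distance from the limit to the nearer end of the interval from -1 to 0:
   within it the estimator is given by the inverse formula and the default 0 does not occur.\<close>
 define r where "r = min (a / e + 1) (- (a / e)) / 2"
 have r: "0 < r" using y0 by (simp add: r_def)
 \<comment> \<open>The derivative of the inverse times the coefficient of the covariation in the
   ratio; its square is the deterministic factor of the limit variance.\<close>
 define \<kappa> where "\<kappa> = g' * (- 2 * a / e^2)"
 have \<kappa>: "\<kappa> = (exp (\<theta> * Tm 1) - exp (\<theta> * Tm 2)) / (Tm 2 - Tm 1)"
 proof -
  have "e^2 - a^2 = 4 * (A 1 * A 2)" by (simp add: a_def e_def power2_eq_square algebra_simps)
  moreover have "1 - (a / e)^2 = (e^2 - a^2) / e^2" using ae by (simp add: power_divide diff_divide_distrib)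
  ultimately have 1: "1 - (a / e)^2 = 4 * (A 1 * A 2) / e^2" by (simp only:)
  have "- 2 / (4 * P / E * D) * (- 2 * a / E) = a / P / D" if "P ~= 0" "E ~= 0" "D ~= 0" for P E D :: real
   using that by (simp add: field_simps)
  then have "\<kappa> = a / (A 1 * A 2) / (Tm 2 - Tm 1)" using ae T12 unfolding \<kappa>_def g'_def 1 by simp
  also have "a / (A 1 * A 2) = inverse (A 1) - inverse (A 2)" unfolding a_def by (simp add: field_simps)
  also have "... = exp (\<theta> * Tm 1) - exp (\<theta> * Tm 2)" by (simp add: exp_minus)
  finally show ?thesis .
 qed
 define p where "p u w = 1 * b 2 u w + (-1) * b 1 u w" for u w
 define q where "q u w = 1 * b 2 u w + 1 * b 1 u w" for u w
 note b12 = b[OF one_in(2)] b[OF one_in(1)]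
 have pq: "cadlag_adapted M F p" "cadlag_adapted M F q" unfolding p_def[abs_def] q_def[abs_def] by (intro cadlag_adapted_lincomb b12)+
 define x where "x n i w = incr X T n (Suc i) 2 w - incr X T n (Suc i) 1 w" for n i w
 define y where "y n i w = incr X T n (Suc i) 2 w + incr X T n (Suc i) 1 w" for n i w
 have xm: "x n i \<in> borel_measurable M" "y n i \<in> borel_measurable M" for n i
  unfolding x_def[abs_def] y_def[abs_def] by (intro borel_measurable_diff borel_measurable_add incr_measurable one_in)+
 have xe: "AE w in M. x n i w = a * ip.\<iota> n i w + ip.dr p n i w" for n i
  using incr_decomposition[OF one_in(1), of n i] incr_decomposition[OF one_in(2), of n i] AE_space
 proof eventually_elim
  case (elim w)
  show ?case unfolding x_def elim p_def dr_lincomb[OF b12 elim(3)] a_def by (simp add: algebra_simps)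
 qed
 have ye: "AE w in M. y n i w = e * ip.\<iota> n i w + 2 * ip.\<iota>' n i w + ip.dr q n i w" for n i
  using incr_decomposition[OF one_in(1), of n i] incr_decomposition[OF one_in(2), of n i] AE_space
 proof eventually_elim
  case (elim w)
  show ?case unfolding y_def elim q_def dr_lincomb[OF b12 elim(3)] e_def by (simp add: algebra_simps)
 qed
 have \<Psi>: "(\<Sum>i<n. (x n i w)^2) / (\<Sum>i<n. x n i w * y n i w) = \<Psi>2 X T n w" for n w
  unfolding \<Psi>2_sums x_def y_def ..
 have est: "estimator2 Tm X T n w = \<psi>2_inv Tm (\<Psi>2 X T n w)" if "\<bar>\<Psi>2 X T n w - a / e\<bar> <= r" for n w
 proof -
  have "r <= (a / e + 1) / 2" "r <= - (a / e) / 2" by (auto simp: r_def)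
  moreover have "0 < a / e + 1" "0 < - (a / e)" using y0 by auto
  moreover have "- 1 < P \<and> P < 0" if "\<bar>P - y\<bar> <= r" "r <= (y + 1) / 2" "r <= - y / 2" "0 < y + 1" "0 < - y" for P y r :: real
  proof
   have "P - y <= r" "y - P <= r" using that(1) by (simp_all add: abs_le_iff)
   then show "- 1 < P" "P < 0" using that(2-5) by (simp_all add: field_simps)
  qed
  ultimately have "- 1 < \<Psi>2 X T n w \<and> \<Psi>2 X T n w < 0" using that by blast
  then show ?thesis by (simp add: estimator2_eq)
 qed
 have ne: "a ~= 0" "e ~= 0" using ae by auto
 \<comment> \<open>The maximum keeps \<open>W\<close> bounded, as the mixed limit theorem requires;
   almost surely \<open>W^2 * V\<close> is the limit variance.\<close>
 define W where "W w = \<kappa> * inverse (max (c_min^2 * T) (ip.QH w))" for w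
 define Y where "Y n w = mesh T n powr (- 1 / 2) * (estimator2 Tm X T n w - \<theta>)" for n w
 have v: "vanishing M (%n w. Y n w - W w * ip.S n w)"
  using ip.ratio_expansion[where est="%n. estimator2 Tm X T n" and r=r, OF paths_continuous pq xm(1) xe xm(2) ye ne q0 QH_lower g' \<psi>2_inv_measurable r estimator2_measurable, unfolded \<Psi>, OF est]
  unfolding Y_def W_def rate \<kappa>_def gy .
 have Wm: "W \<in> borel_measurable M" unfolding W_def[abs_def]
  by (intro borel_measurable_times borel_measurable_inverse borel_measurable_max borel_measurable_const ip.QH_measurable)
 have Wb: "\<bar>W w\<bar> <= \<bar>\<kappa>\<bar> * inverse (c_min^2 * T)" for w
 proof -
  have "inverse (max (c_min^2 * T) (ip.QH w)) <= inverse (c_min^2 * T)" using q0 by (intro le_imp_inverse_le) auto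
  moreover have "0 <= inverse (max (c_min^2 * T) (ip.QH w))" using q0 by (simp add: le_max_iff_disj)
  ultimately show ?thesis unfolding W_def abs_mult by (intro mult_left_mono) auto
 qed
 have Ym: "Y n \<in> borel_measurable M" for n
  unfolding Y_def[abs_def] by (intro borel_measurable_times borel_measurable_diff borel_measurable_const estimator2_measurable)
 let ?v = "limit_variance \<theta> Tm T \<sigma> \<sigma>'"
 have WV: "AE w in M. (W w)^2 * ip.V w = ?v w"
  using QH_lower
 proof eventually_elim
  case (elim w)
  then have "max (c_min^2 * T) (ip.QH w) = ip.QH w" by (rule max_absorb2)
  then show ?case unfolding W_def limit_variance_eq \<kappa>[symmetric] by (simp add: power_mult_distrib power_inverse divide_inverse)
 qed
 have vM: "?v \<in> borel_measurable M" by (rule measurable_from_subalg[OF filtered_prob_spaceD(2)[OF space] limit_variance_measurable])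
 have E: "ip.expectation (%w. exp (- (t^2 * ((W w)^2 * ip.V w) / 2))) = ip.expectation (%w. exp (- (t^2 * ?v w / 2)))" for t
 proof (rule integral_cong_AE)
  show "(%w. exp (- (t^2 * ((W w)^2 * ip.V w) / 2))) \<in> borel_measurable M" "(%w. exp (- (t^2 * ?v w / 2))) \<in> borel_measurable M"
   by (intro measurable_compose[OF _ borel_measurable_exp] borel_measurable_uminus borel_measurable_divide borel_measurable_times borel_measurable_power borel_measurable_const Wm ip.V_measurable vM)+
  show "AE w in M. exp (- (t^2 * ((W w)^2 * ip.V w) / 2)) = exp (- (t^2 * ?v w / 2))"
   using WV by eventually_elim simp
 qed
 let ?N = "M \<Otimes>\<^sub>M std_normal_distribution" and ?Z = "%x. sqrt (?v (fst x)) * snd x"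
 note ext = gaussian_extension[OF ip.prob_space_axioms filtered_prob_spaceD(2)[OF space, of T] limit_variance_measurable limit_variance_nonneg]
 have Zm: "?Z \<in> borel_measurable ?N" using ext(2) unfolding conditionally_gaussian_def by blast
 interpret N: prob_space ?N using ext(1) by (simp add: prob_extension_def)
 have "weak_conv_m (%n. distr M borel (Y n)) (distr ?N borel ?Z)"
  by (rule ip.weak_conv_trigonometric[where \<phi>="%t. ip.expectation (%w. exp (- (t^2 * ?v w / 2)))", OF Ym N.real_distribution_distr[OF Zm] ext(3)
   ip.limit_expectations(1)[OF Wm Wb Ym v, unfolded E] ip.limit_expectations(2)[OF Wm Wb Ym v]])
 then have "tendsto_in_distribution M Y ?N ?Z" unfolding tendsto_in_distribution_def using Ym Zm by blast
 then show ?thesis using ext(1,2) unfolding Y_def[abs_def] by blast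
qed

end

section \<open>Three components without drift\<close>

lemma cadlag_adapted_mult:
 assumes "cadlag_adapted M F Y" "cadlag_adapted M F Z"
 shows "cadlag_adapted M F (%u w. Y u w * Z u w)"
 using assms unfolding cadlag_adapted_def adapted_process_def
 by (simp add: borel_measurable_times cadlag_mult)

context bond_model
begin

lemma incr_driftless:
 assumes d3: "3 <= d" and zero: "AE w in M. \<forall>j\<in>{1..3}. \<forall>t\<in>{0..T}. b j t w = 0"
 shows "AE w in M. \<forall>j\<in>{1..3}. \<forall>i<n. incr X T n (Suc i) j w = A j * ip.\<iota> n i w + ip.\<iota>' n i w"
proof -
 have "AE w in M. \<forall>i. incr X T n (Suc i) j w = A j * ip.\<iota> n i w + ip.\<iota>' n i w + ip.dr (b j) n i w" if "j \<in> {1..3}" for j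
  using incr_decomposition[of j n] that d3 by (simp add: AE_all_countable)
 then have "AE w in M. \<forall>j\<in>{1..3}. \<forall>i. incr X T n (Suc i) j w = A j * ip.\<iota> n i w + ip.\<iota>' n i w + ip.dr (b j) n i w"
  by (intro AE_finite_allI) auto
 then show ?thesis using zero
 proof eventually_elim
  case (elim w)
  have "ip.dr (b j) n i w = 0" if "j \<in> {1..3}" "i < n" for j i
  proof -
   have z: "(LINT s:{0..t}|lborel. b j s w) = 0" if t: "t <= T" for t
   proof -
    have "(LINT s:{0..t}|lborel. b j s w) = (LINT s:{0..t}|lborel. 0)"
     using elim(2) t \<open>j \<in> {1..3}\<close> by (intro set_lebesgue_integral_cong) auto
    then show ?thesis by (simp add: set_lebesgue_integral_def)
   qed
   have "real (Suc i) * (T / real n) <= T" "real i * (T / real n) <= T" using that by (intro grid_le[OF T]; simp)+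
   from z[OF this(1)] z[OF this(2)] show ?thesis unfolding inc_def by (simp only: diff_self)
  qed
  with elim(1) show ?case by simp
 qed
qed

text \<open>Differences of components contain no increment of \<open>J\<close>. Numerator and
  denominator are then the same sum of squares, each times a squared difference of the
  \<open>A j\<close>, and their quotient is free of randomness.\<close>

lemma estimator3_exact:
 assumes d3: "3 <= d" and zero: "AE w in M. \<forall>j\<in>{1..3}. \<forall>t\<in>{0..T}. b j t w = 0"
 shows "AE w in M. (\<Sum>i<n. (ip.\<iota> n i w)^2) ~= 0 --> estimator3 Tm X T n w = \<theta>"
 using incr_driftless[OF assms, of n]
proof eventually_elim
 case (elim w)
 have T12: "Tm 1 < Tm 2" "Tm 2 < Tm 3" using Tm_less[of 1 2] Tm_less[of 2 3] d3 by auto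
 let ?Q = "\<Sum>i<n. (ip.\<iota> n i w)^2"
 have s: "(\<Sum>i=1..n. (incr X T n i j w - incr X T n i k w)^2) = (A j - A k)^2 * ?Q" if "j \<in> {1..3}" "k \<in> {1..3}" for j k
 proof -
  have "(\<Sum>i=1..n. (incr X T n i j w - incr X T n i k w)^2) = (\<Sum>i<n. (incr X T n (Suc i) j w - incr X T n (Suc i) k w)^2)"
   unfolding One_nat_def sum.atLeast1_atMost_eq ..
  also have "... = (\<Sum>i<n. (A j - A k)^2 * (ip.\<iota> n i w)^2)"
  proof (rule sum.cong[OF refl])
   fix i assume "i \<in> {..<n}"
   then have "incr X T n (Suc i) j w - incr X T n (Suc i) k w = (A j - A k) * ip.\<iota> n i w" using elim that by (simp add: left_diff_distrib)
   then show "(incr X T n (Suc i) j w - incr X T n (Suc i) k w)^2 = (A j - A k)^2 * (ip.\<iota> n i w)^2" by (simp only: power_mult_distrib)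
  qed
  finally show ?thesis by (simp only: sum_distrib_left)
 qed
 show ?case
 proof
  assume "?Q ~= 0"
  then have "\<Psi>3 X T n w = \<psi>3 Tm \<theta>" unfolding \<Psi>3_def \<psi>3_def using s[of 3 2] s[of 2 1] by (simp add: power_divide)
  then show "estimator3 Tm X T n w = \<theta>"
   unfolding estimator3_def using \<psi>3_range[OF \<theta> T12] inv_into_f_f[OF \<psi>3_inj[OF T12], of \<theta>] \<theta> by simp
 qed
qed

lemma estimator3_measurable:
 assumes d3: "3 <= d"
 shows "estimator3 Tm X T n \<in> borel_measurable M"
proof -
 have T12: "Tm 1 < Tm 2" "Tm 2 < Tm 3" using Tm_less[of 1 2] Tm_less[of 2 3] d3 by auto
 let ?R = "((Tm 3 - Tm 2) / (Tm 2 - Tm 1))^2"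
 have m1: "(%y. if y \<in> {0<..<?R} then inv_into {0<..} (\<psi>3 Tm) y else 0) \<in> borel_measurable borel"
  by (intro measurable_If_set inv_into_\<psi>3_measurable[OF T12] measurable_const) auto
 have m2: "\<Psi>3 X T n \<in> borel_measurable M"
  unfolding \<Psi>3_def[abs_def] One_nat_def sum.atLeast1_atMost_eq using d3
  by (intro borel_measurable_divide borel_measurable_sum borel_measurable_power borel_measurable_diff incr_measurable) auto
 from measurable_compose[OF m2 m1] show ?thesis unfolding estimator3_def[abs_def] .
qed

text \<open>Without drift, \<open>\<Psi>\<^sub>3 = \<psi>\<^sub>3(\<theta>)\<close> exactly as soon as the quadratic variation does not vanish, and the
 limit variable is 0.\<close>

theorem estimator3_limit:
 assumes d3: "3 <= d" and zero: "AE w in M. \<forall>j\<in>{1..3}. \<forall>t\<in>{0..T}. b j t w = 0"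
  and L: "has_ito_integral M F B (%t w. b_bar \<theta> Tm b t w * exp (\<theta> * t) * \<sigma> t w) L"
 shows "tendsto_in_prob M (%n w. inverse (mesh T n) * (estimator3 Tm X T n w - \<theta>))
  (%w. (b_tilde \<theta> Tm b T w + L T w) / (2 * (exp (- \<theta> * Tm 2) - exp (- \<theta> * Tm 1)) * D3 \<theta> Tm *
   (LINT t:{0..T}|lborel. exp (2 * \<theta> * t) * (\<sigma> t w)^2)))"
proof -
 have b3: "cadlag_adapted M F (b 1)" "cadlag_adapted M F (b 2)" "cadlag_adapted M F (b 3)" using b d3 by auto
 let ?d32 = "%t w. 1 * b 3 t w + (-1) * b 2 t w" and ?d21 = "%t w. 1 * b 2 t w + (-1) * b 1 t w"
 have dd: "cadlag_adapted M F ?d32" "cadlag_adapted M F ?d21" by (intro cadlag_adapted_lincomb b3)+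
 define G where "G t w = b_bar \<theta> Tm b t w * exp (\<theta> * t) * \<sigma> t w" for t w
 \<comment> \<open>\<open>b_bar\<close> is a fixed linear combination of the two drift differences,
   so adaptedness and cadlag paths are inherited; they are wanted for the Riemann sum description of
   \<open>L T\<close>.\<close>
 have Gc: "cadlag_adapted M F G"
 proof -
  let ?r = "2 * (A 2 - A 1) * (A 3 - A 2)"
  have "cadlag_adapted M F (%t w. ((?r * (A 2 - A 1)) * ?d32 t w + (- (?r * (A 3 - A 2))) * ?d21 t w) * (exp (\<theta> * t + 0) * \<sigma> t w))"
   by (intro cadlag_adapted_mult cadlag_adapted_lincomb cadlag_adapted_exp_mult \<sigma> dd)
  moreover have "G = (%t w. ((?r * (A 2 - A 1)) * ?d32 t w + (- (?r * (A 3 - A 2))) * ?d21 t w) * (exp (\<theta> * t + 0) * \<sigma> t w))"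
  proof (intro ext)
   fix t w
   have *: "2 * c * f * (c * (z - y) - f * (y - x)) * E * v = ((2 * c * f * c) * (1 * z + (-1) * y) + (- (2 * c * f * f)) * (1 * y + (-1) * x)) * (E * v)"
    for c f x y z E v :: real by (simp add: algebra_simps)
   show "G t w = ((?r * (A 2 - A 1)) * ?d32 t w + (- (?r * (A 3 - A 2))) * ?d21 t w) * (exp (\<theta> * t + 0) * \<sigma> t w)"
    unfolding G_def b_bar_def add_0_right by (rule *)
  qed
  ultimately show ?thesis by (simp only:)
 qed
 have G0: "AE w in M. \<forall>t\<in>{0..T}. G t w = 0"
  using zero by eventually_elim (simp add: G_def b_bar_def)
 let ?R = "%r w. \<Sum>j<r. G (real j * (T / real r)) w * (B (real (Suc j) * (T / real r)) w - B (real j * (T / real r)) w)"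
 have LR: "tendsto_in_prob M ?R (L T)" by (rule ito_riemann_sums[OF space B Gc L[folded G_def] T])
 then have Rm: "?R r \<in> borel_measurable M" and Lm: "L T \<in> borel_measurable M" for r by (auto simp: tendsto_in_prob_def)
 \<comment> \<open>The integrand is zero on \<open>[0, T]\<close> almost surely, hence so are its
   Riemann sums, and uniqueness of limits in probability yields \<open>L T = 0\<close>.\<close>
 have "vanishing M ?R"
 proof (rule ip.vanishing_mono[OF ip.vanishing_AE[of "%_ _. 0"] Rm])
  show "\<forall>\<^sub>F r in sequentially. AE w in M. \<bar>?R r w\<bar> <= \<bar>0\<bar>"
  proof (rule always_eventually, rule allI)
   fix r
   show "AE w in M. \<bar>?R r w\<bar> <= \<bar>0\<bar>" using G0
   proof eventually_elim
    case (elim w)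
    have "G (real j * (T / real r)) w = 0" if "j < r" for j
     using elim grid_le[OF T, of j r] that T by (simp del: times_divide_eq_right)
    then show ?case by simp
   qed
  qed
 qed auto
 then have "tendsto_in_prob M ?R (%_. 0)" unfolding tendsto_in_prob_iff_vanishing using Rm by simp
 from ip.tendsto_in_prob_unique[OF LR this] have L0: "AE w in M. L T w = 0" .
 have bt0: "AE w in M. b_tilde \<theta> Tm b T w = 0"
  using zero
 proof eventually_elim
  case (elim w)
  have "(LINT t:{0..T}|lborel. (b 3 t w - b 2 t w)^2) = (LINT t:{0..T}|lborel. 0)" "(LINT t:{0..T}|lborel. (b 2 t w - b 1 t w)^2) = (LINT t:{0..T}|lborel. 0)"
   using elim by (intro set_lebesgue_integral_cong; simp)+
  then show ?case unfolding b_tilde_def by (simp add: set_lebesgue_integral_def)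
 qed
 have btm: "b_tilde \<theta> Tm b T \<in> borel_measurable M"
 proof -
  have "(%w. LINT t:{0..T}|lborel. ?d32 t w * ?d32 t w) \<in> borel_measurable M" "(%w. LINT t:{0..T}|lborel. ?d21 t w * ?d21 t w) \<in> borel_measurable M"
   using T by (intro ip.drift_measurable cadlag_adapted_mult dd; simp)+
  moreover have "(b 3 t w - b 2 t w)^2 = ?d32 t w * ?d32 t w" "(b 2 t w - b 1 t w)^2 = ?d21 t w * ?d21 t w" for t w
   by (simp_all add: power2_eq_square)
  ultimately show ?thesis unfolding b_tilde_def[abs_def] by (simp only: borel_measurable_diff borel_measurable_times borel_measurable_const)
 qed
 define Z where "Z w = (b_tilde \<theta> Tm b T w + L T w) / (2 * (exp (- \<theta> * Tm 2) - exp (- \<theta> * Tm 1)) * D3 \<theta> Tm * ip.QH w)" for w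
 have Zm: "Z \<in> borel_measurable M" unfolding Z_def[abs_def]
  by (intro borel_measurable_divide borel_measurable_add borel_measurable_times borel_measurable_const btm Lm ip.QH_measurable)
 have Z0: "AE w in M. Z w = 0" using L0 bt0 by eventually_elim (simp add: Z_def)
 define Y where "Y n w = inverse (mesh T n) * (estimator3 Tm X T n w - \<theta>)" for n w
 have Ym: "Y n \<in> borel_measurable M" for n unfolding Y_def[abs_def]
  by (intro borel_measurable_times borel_measurable_diff borel_measurable_const estimator3_measurable d3)
 \<comment> \<open>If the estimator misses \<theta>, the observed quadratic variation is 0 and
   differs from its limit by at least \<open>c_min^2 * T\<close>; half of this is the threshold, to
   have a strict inequality.\<close>
 have "vanishing M (%n w. Y n w - Z w)"
 proof (rule ip.vanishing_support[OF ip.quadratic_variation_H half_gt_zero[OF q0]])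
  show "(%w. Y n w - Z w) \<in> borel_measurable M" for n by (intro borel_measurable_diff Ym Zm)
  show "\<forall>\<^sub>F n in sequentially. AE w in M. Y n w - Z w ~= 0 --> c_min^2 * T / 2 < \<bar>(\<Sum>i<n. (ip.\<iota> n i w)^2) - ip.QH w\<bar>"
  proof (rule always_eventually, rule allI)
   fix n
   show "AE w in M. Y n w - Z w ~= 0 --> c_min^2 * T / 2 < \<bar>(\<Sum>i<n. (ip.\<iota> n i w)^2) - ip.QH w\<bar>"
    using estimator3_exact[OF d3 zero, of n] Z0 QH_lower
   proof eventually_elim
    case (elim w)
    show ?case
    proof
     assume "Y n w - Z w ~= 0"
     then have "(\<Sum>i<n. (ip.\<iota> n i w)^2) = 0" using elim(1,2) by (auto simp: Y_def)
     then show "c_min^2 * T / 2 < \<bar>(\<Sum>i<n. (ip.\<iota> n i w)^2) - ip.QH w\<bar>" using elim(3) q0 by linarith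
    qed
   qed
  qed
 qed
 then have "tendsto_in_prob M Y Z" unfolding tendsto_in_prob_iff_vanishing using Ym Zm by blast
 then show ?thesis unfolding Y_def[abs_def] Z_def[abs_def] square_integrals .
qed

end

theorem theorem1:
  fixes M :: "'a measure" and F :: "real \<Rightarrow> 'a measure"
    and B B' \<sigma> \<sigma>' J :: "real \<Rightarrow> 'a \<Rightarrow> real"
    and X b I :: "nat \<Rightarrow> real \<Rightarrow> 'a \<Rightarrow> real"
    and d :: nat and x0 Tm :: "nat \<Rightarrow> real" and T \<theta> c_min s :: real
  assumes space: "filtered_prob_space M F"
    and d: "d \<in> {2, 3}"
    and B: "brownian_motion M F B"
    and B': "brownian_motion M F B'"
    and indep: "independent_processes M B B'"
    and \<sigma>: "cadlag_adapted M F \<sigma>"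
    and \<sigma>': "cadlag_adapted M F \<sigma>'"
    and b: "\<And>j. j \<in> {1..d} \<Longrightarrow> cadlag_adapted M F (b j)"
    and \<theta>: "0 < \<theta>"
    and T: "0 < T"
    and T_le: "T \<le> Tm 1"
    and Tm: "strict_mono_on {1..d} Tm"
    and I: "\<And>j. j \<in> {1..d} \<Longrightarrow>
        has_ito_integral M F B (\<lambda>u \<omega>. exp (- \<theta> * (Tm j - u)) * \<sigma> u \<omega>) (I j)"
    and J: "has_ito_integral M F B' \<sigma>' J"
    and X_meas: "\<And>j t. j \<in> {1..d} \<Longrightarrow> 0 \<le> t \<Longrightarrow> X j t \<in> borel_measurable M"
    and X: "\<And>j. j \<in> {1..d} \<Longrightarrow> AE \<omega> in M. \<forall>t\<ge>0.
        X j t \<omega> = x0 j + (LINT u:{0..t}|lborel. b j u \<omega>) + I j t \<omega> + J t \<omega>"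
    and c_min: "0 < c_min"
    and lower: "AE \<omega> in M. \<forall>t\<in>{0..T}. c_min \<le> min (\<sigma> t \<omega>) (\<sigma>' t \<omega>)"
    and s: "1 / 2 < s"
    and drift: "\<And>j. j \<in> {1..d} \<Longrightarrow>
        (SUP t\<in>{0<..T}. ennreal (t powr (- s)) * mod_cont M T (b j) t) < \<top>"
  shows "(d = 2 \<longrightarrow>
      (\<exists>(N :: ('a \<times> real) measure) \<pi> Z.
         prob_extension M N \<pi> \<and>
         conditionally_gaussian N \<pi> (F T) (limit_variance \<theta> Tm T \<sigma> \<sigma>') Z \<and>
         tendsto_in_distribution M
           (\<lambda>n \<omega>. mesh T n powr (- 1 / 2) * (estimator2 Tm X T n \<omega> - \<theta>)) N Z)) \<and>
    (d = 3 \<and> (AE \<omega> in M. \<forall>j\<in>{1..3}. \<forall>t\<in>{0..T}. b j t \<omega> = 0) \<longrightarrow>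
      (\<forall>L. has_ito_integral M F B (\<lambda>t \<omega>. b_bar \<theta> Tm b t \<omega> * exp (\<theta> * t) * \<sigma> t \<omega>) L \<longrightarrow>
         tendsto_in_prob M
           (\<lambda>n \<omega>. inverse (mesh T n) * (estimator3 Tm X T n \<omega> - \<theta>))
           (\<lambda>\<omega>. (b_tilde \<theta> Tm b T \<omega> + L T \<omega>) /
              (2 * (exp (- \<theta> * Tm 2) - exp (- \<theta> * Tm 1)) * D3 \<theta> Tm *
               (LINT t:{0..T}|lborel. exp (2 * \<theta> * t) * (\<sigma> t \<omega>)\<^sup>2)))))"
proof (intro conjI impI)
  assume d2: "d = 2"
  interpret bond_model M F B B' \<sigma> \<sigma>' J X b I d x0 Tm T \<theta> c_min
    by (rule bond_model.intro[OF space _ B B' indep \<sigma> \<sigma>' b \<theta> T Tm I J X_meas X c_min lower]) (use d2 in simp)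
  show "\<exists>(N :: ('a \<times> real) measure) \<pi> Z. prob_extension M N \<pi> \<and>
      conditionally_gaussian N \<pi> (F T) (limit_variance \<theta> Tm T \<sigma> \<sigma>') Z \<and>
      tendsto_in_distribution M (\<lambda>n \<omega>. mesh T n powr (- 1 / 2) * (estimator2 Tm X T n \<omega> - \<theta>)) N Z"
    by (rule estimator2_limit)
next
  assume d3: "d = 3 \<and> (AE \<omega> in M. \<forall>j\<in>{1..3}. \<forall>t\<in>{0..T}. b j t \<omega> = 0)"
  interpret bond_model M F B B' \<sigma> \<sigma>' J X b I d x0 Tm T \<theta> c_min
    by (rule bond_model.intro[OF space _ B B' indep \<sigma> \<sigma>' b \<theta> T Tm I J X_meas X c_min lower]) (use d3 in simp)
  show "\<forall>L. has_ito_integral M F B (\<lambda>t \<omega>. b_bar \<theta> Tm b t \<omega> * exp (\<theta> * t) * \<sigma> t \<omega>) L \<longrightarrow>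
      tendsto_in_prob M (\<lambda>n \<omega>. inverse (mesh T n) * (estimator3 Tm X T n \<omega> - \<theta>))
        (\<lambda>\<omega>. (b_tilde \<theta> Tm b T \<omega> + L T \<omega>) / (2 * (exp (- \<theta> * Tm 2) - exp (- \<theta> * Tm 1)) * D3 \<theta> Tm *
          (LINT t:{0..T}|lborel. exp (2 * \<theta> * t) * (\<sigma> t \<omega>)\<^sup>2)))"
  proof (intro allI impI)
    fix L assume L: "has_ito_integral M F B (\<lambda>t \<omega>. b_bar \<theta> Tm b t \<omega> * exp (\<theta> * t) * \<sigma> t \<omega>) L"
    have "3 \<le> d" using d3 by simp
    from estimator3_limit[OF this conjunct2[OF d3] L]
    show "tendsto_in_prob M (\<lambda>n \<omega>. inverse (mesh T n) * (estimator3 Tm X T n \<omega> - \<theta>))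
        (\<lambda>\<omega>. (b_tilde \<theta> Tm b T \<omega> + L T \<omega>) / (2 * (exp (- \<theta> * Tm 2) - exp (- \<theta> * Tm 1)) * D3 \<theta> Tm *
          (LINT t:{0..T}|lborel. exp (2 * \<theta> * t) * (\<sigma> t \<omega>)\<^sup>2)))" .
  qed
qed

end
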